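(* Let $\Lambda$ be a locally convex row-finite $k$-graph. Then $C^*(\Lambda)$ is $n$-decomposable for some $n\ge1$ if and only if $n=\max\{|\mathcal{C}|:\mathcal{C}\text{ is a chain in }\mathcal{H}_\Lambda\}$. Moreover, if this is the case, then there is a unique decomposition (up to permutation) $C^*(\Lambda)\cong C^*(\Lambda_1)\oplus\cdots\oplus C^*(\Lambda_n)$, where the $\Lambda_i$ are $k$-subgraphs of $\Lambda$ and each $C^*(\Lambda_i)$ is indecomposable.
   Context: Fix an integer $k\ge 1$. $\mathbb{N}^k$ carries the coordinatewise order, with standard generators $e_1,\dots,e_k$. A $k$-graph is a countable small category $\Lambda$ with range and source maps $r,s$ and a degree functor $d:\Lambda\to\mathbb{N}^k$ such that whenever $d(\lambda)=m+n$ there are unique $\mu,\nu\in\Lambda$ with $d(\mu)=m$, $d(\nu)=n$, $\lambda=\mu\nu$ (the product $\mu\nu$ makes sense only if $s(\mu)=r(\nu)$). $\Lambda^n:=d^{-1}(n)$, and $\Lambda^0$ is the set of vertices. For $v\in\Lambda^0$, $E\subseteq\Lambda$: $vE=\{\mu\in E:r(\mu)=v\}$. $\Lambda$ is row-finite if every $v\Lambda^n$ is finite; locally convex if for all $v\in\Lambda^0$, $i\ne j$, $\lambda\in v\Lambda^{e_i}$, $\mu\in v\Lambda^{e_j}$ we have $s(\lambda)\Lambda^{e_j}\neq\emptyset$ and $s(\mu)\Lambda^{e_i}\ne\emptyset$. $\Lambda^{\le n}:=\{\lambda\in\Lambda: d(\lambda)\le n,\text{ and } d(\lambda)_i<n_i\Rightarrow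 s(\lambda)\Lambda^{e_i}=\emptyset\}$. A $k$-subgraph of $\Lambda$ is a subcategory which is a $k$-graph under the restricted degree functor. All $k$-graphs considered, including the $\Lambda_i$, are locally convex and row-finite. For a locally convex row-finite $k$-graph $\Lambda$, $C^*(\Lambda)$ is the universal $C^*$-algebra generated by partial isometries $\{s_\lambda:\lambda\in\Lambda\}$ with: $s_vs_w=\delta_{v,w}s_v$ ($v,w\in\Lambda^0$); $s_\lambda s_{\lambda'}=s_{\lambda\lambda'}$ if $s(\lambda)=r(\lambda')$; $s_\lambda^*s_\lambda=s_{s(\lambda)}$; $s_v=\sum_{\lambda\in v\Lambda^{\le n}}s_\lambda s_\lambda^*$ for all $v\in\Lambda^0$, $n\in\mathbb{N}^k$. A $C^*$-algebra is decomposable if it equals $A\oplus B$ for two nonzero $C^*$-algebras $A,B$, and indecomposable otherwise. $C^*(\Lambda)$ is $n$-decomposable ($n\ge1$) if there exists an $n$-term decomposition $C^*(\Lambda)=A_1\oplus\cdots\oplus A_n$ such that each direct summand $A_i$ is indecomposable (so $1$-decomposable means indecomposable). $H\subseteq\Lambda^0$ is hereditary if $r(\lambda)\in H$ implies $s(\lambda)\in H$; saturated if $v\in\Lambda^0$ and $s(v\Lambda^{\le n})\subseteq H$ for some $n\in\mathbb{N}^k$ imply $v\in H$. $\mathcal{H}_\Lambda$ is the collection of saturated hereditary subsets of $\Lambda^0$. For $v\in\Lambda^0$, $T(v):=\{s(\mu):\mu\in v\Lambda\}$. For $H_1\supseteq H_2$ in $\mathcal{H}_\Lambda$: $\Delta(H_1,H_2):=\{v\in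 H_1:T(v)\cap H_2=\emptyset\}$ and $\Omega(H_1,H_2):=\{v\in H_1\setminus H_2:T(v)\cap H_2\neq\emptyset\}$. We write $H_1\succ H_2$ iff $H_1\supseteq H_2$, $\Delta(H_1,H_2)\ne\emptyset$, and for every $v\in\Omega(H_1,H_2)$ there is $n\in\mathbb{N}^k$ with $s(v\Lambda^{\le n})\subseteq H_2\cup\Delta(H_1,H_2)$. A chain in $\mathcal{H}_\Lambda$ is a sequence $\mathcal{C}=\{H_i\}_{i=1}^n$, $n\in\mathbb{N}\cup\{\infty\}$, of saturated hereditary subsets of $\Lambda^0$ with $H_1=\Lambda^0$ and $H_i\succ H_{i+1}$ for all $1\le i<n$; its length is $|\mathcal{C}|=n$.
   Formalization: In a chain the terms H_i with i≥2 are required nonempty, since H≻∅ holds for every nonempty H and would make the maximum one too large; in decompositions with n≥2 terms the summands are required nonzero, since the zero algebra is indecomposable and could be added freely. *)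

theory Defs
  imports "HOL-Analysis.Analysis" "HOL-Library.Poly_Mapping" "HOL-Library.Extended_Nat"
begin

section \<open>Higher-rank graphs\<close>

text \<open>
  A small category is given by its set of morphisms; objects are identified with their identity
  morphisms, and \<open>cmp \<Lambda> \<mu> \<nu>\<close> is the product \<open>\<mu>\<nu>\<close>, meaningful only if \<open>src \<Lambda> \<mu> = rng \<Lambda> \<nu>\<close>.
  The monoid \<open>\<nat>\<^sup>k\<close> is \<^typ>\<open>nat ^ 'k\<close> with \<open>k = CARD('k)\<close>, whose order is coordinatewise;
  the generator \<open>e\<^sub>i\<close> is \<open>axis i 1\<close>.
\<close>

record ('a, 'k::finite) kgraph =
  mor :: "'a set"
  rng :: "'a \<Rightarrow> 'a"
  src :: "'a \<Rightarrow> 'a"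
  cmp :: "'a \<Rightarrow> 'a \<Rightarrow> 'a"
  deg :: "'a \<Rightarrow> nat ^ 'k"

locale k_graph =
  fixes \<Lambda> :: "('a, 'k::finite) kgraph"
  assumes countable_mor: "countable (mor \<Lambda>)"
    and rng_closed: "x \<in> mor \<Lambda> \<Longrightarrow> rng \<Lambda> x \<in> mor \<Lambda>"
    and src_closed: "x \<in> mor \<Lambda> \<Longrightarrow> src \<Lambda> x \<in> mor \<Lambda>"
    and rng_rng: "x \<in> mor \<Lambda> \<Longrightarrow> rng \<Lambda> (rng \<Lambda> x) = rng \<Lambda> x"
    and src_rng: "x \<in> mor \<Lambda> \<Longrightarrow> src \<Lambda> (rng \<Lambda> x) = rng \<Lambda> x"
    and rng_src: "x \<in> mor \<Lambda> \<Longrightarrow> rng \<Lambda> (src \<Lambda> x) = src \<Lambda> x"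
    and src_src: "x \<in> mor \<Lambda> \<Longrightarrow> src \<Lambda> (src \<Lambda> x) = src \<Lambda> x"
    and cmp_closed: "\<lbrakk>x \<in> mor \<Lambda>; y \<in> mor \<Lambda>; src \<Lambda> x = rng \<Lambda> y\<rbrakk> \<Longrightarrow> cmp \<Lambda> x y \<in> mor \<Lambda>"
    and rng_cmp: "\<lbrakk>x \<in> mor \<Lambda>; y \<in> mor \<Lambda>; src \<Lambda> x = rng \<Lambda> y\<rbrakk> \<Longrightarrow> rng \<Lambda> (cmp \<Lambda> x y) = rng \<Lambda> x"
    and src_cmp: "\<lbrakk>x \<in> mor \<Lambda>; y \<in> mor \<Lambda>; src \<Lambda> x = rng \<Lambda> y\<rbrakk> \<Longrightarrow> src \<Lambda> (cmp \<Lambda> x y) = src \<Lambda> y"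
    and cmp_assoc: "\<lbrakk>x \<in> mor \<Lambda>; y \<in> mor \<Lambda>; z \<in> mor \<Lambda>; src \<Lambda> x = rng \<Lambda> y; src \<Lambda> y = rng \<Lambda> z\<rbrakk>
      \<Longrightarrow> cmp \<Lambda> (cmp \<Lambda> x y) z = cmp \<Lambda> x (cmp \<Lambda> y z)"
    and cmp_rng: "x \<in> mor \<Lambda> \<Longrightarrow> cmp \<Lambda> (rng \<Lambda> x) x = x"
    and cmp_src: "x \<in> mor \<Lambda> \<Longrightarrow> cmp \<Lambda> x (src \<Lambda> x) = x"
    and deg_rng: "x \<in> mor \<Lambda> \<Longrightarrow> deg \<Lambda> (rng \<Lambda> x) = 0"
    and deg_src: "x \<in> mor \<Lambda> \<Longrightarrow> deg \<Lambda> (src \<Lambda> x) = 0"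
    and deg_cmp: "\<lbrakk>x \<in> mor \<Lambda>; y \<in> mor \<Lambda>; src \<Lambda> x = rng \<Lambda> y\<rbrakk>
      \<Longrightarrow> deg \<Lambda> (cmp \<Lambda> x y) = deg \<Lambda> x + deg \<Lambda> y"
    and factorisation: "\<lbrakk>x \<in> mor \<Lambda>; deg \<Lambda> x = m + n\<rbrakk>
      \<Longrightarrow> \<exists>!(\<mu>, \<nu>). \<mu> \<in> mor \<Lambda> \<and> \<nu> \<in> mor \<Lambda> \<and> src \<Lambda> \<mu> = rng \<Lambda> \<nu>
            \<and> deg \<Lambda> \<mu> = m \<and> deg \<Lambda> \<nu> = n \<and> x = cmp \<Lambda> \<mu> \<nu>"

text \<open>As \<open>k_graph\<close> includes closure under the structure maps, a subset of the morphisms that is a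
  \<open>k\<close>-graph under the restricted structure is in particular a subcategory.\<close>

definition k_subgraph :: "('a, 'k::finite) kgraph \<Rightarrow> ('a, 'k::finite) kgraph \<Rightarrow> bool" where
  "k_subgraph \<Gamma> \<Lambda> \<longleftrightarrow> mor \<Gamma> \<subseteq> mor \<Lambda> \<and> \<Gamma> = \<Lambda>\<lparr>mor := mor \<Gamma>\<rparr> \<and> k_graph \<Gamma>"

definition paths :: "('a, 'k::finite) kgraph \<Rightarrow> nat ^ 'k \<Rightarrow> 'a set" where
  "paths \<Lambda> n = {x \<in> mor \<Lambda>. deg \<Lambda> x = n}"

definition verts :: "('a, 'k::finite) kgraph \<Rightarrow> 'a set" where
  "verts \<Lambda> = paths \<Lambda> 0"

text \<open>\<open>from_vertex \<Lambda> v E\<close> is \<open>vE\<close>.\<close>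

definition from_vertex :: "('a, 'k::finite) kgraph \<Rightarrow> 'a \<Rightarrow> 'a set \<Rightarrow> 'a set" where
  "from_vertex \<Lambda> v E = {x \<in> E. rng \<Lambda> x = v}"

definition paths_le :: "('a, 'k::finite) kgraph \<Rightarrow> nat ^ 'k \<Rightarrow> 'a set" where
  "paths_le \<Lambda> n = {x \<in> mor \<Lambda>. deg \<Lambda> x \<le> n \<and>
     (\<forall>i. deg \<Lambda> x $ i < n $ i \<longrightarrow> from_vertex \<Lambda> (src \<Lambda> x) (paths \<Lambda> (axis i 1)) = {})}"

definition row_finite :: "('a, 'k::finite) kgraph \<Rightarrow> bool" where
  "row_finite \<Lambda> \<longleftrightarrow> (\<forall>v \<in> verts \<Lambda>. \<forall>n. finite (from_vertex \<Lambda> v (paths \<Lambda> n)))"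

definition locally_convex :: "('a, 'k::finite) kgraph \<Rightarrow> bool" where
  "locally_convex \<Lambda> \<longleftrightarrow> (\<forall>v \<in> verts \<Lambda>. \<forall>i j. i \<noteq> j \<longrightarrow>
     (\<forall>x \<in> from_vertex \<Lambda> v (paths \<Lambda> (axis i 1)). \<forall>y \<in> from_vertex \<Lambda> v (paths \<Lambda> (axis j 1)).
        from_vertex \<Lambda> (src \<Lambda> x) (paths \<Lambda> (axis j 1)) \<noteq> {} \<and>
        from_vertex \<Lambda> (src \<Lambda> y) (paths \<Lambda> (axis i 1)) \<noteq> {}))"

section \<open>Saturated hereditary sets and chains\<close>

definition hereditary :: "('a, 'k::finite) kgraph \<Rightarrow> 'a set \<Rightarrow> bool" where
  "hereditary \<Lambda> H \<longleftrightarrow> (\<forall>x \<in> mor \<Lambda>. rng \<Lambda> x \<in> H \<longrightarrow> src \<Lambda> x \<in> H)"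

definition saturated :: "('a, 'k::finite) kgraph \<Rightarrow> 'a set \<Rightarrow> bool" where
  "saturated \<Lambda> H \<longleftrightarrow>
     (\<forall>v \<in> verts \<Lambda>. (\<exists>n. src \<Lambda> ` from_vertex \<Lambda> v (paths_le \<Lambda> n) \<subseteq> H) \<longrightarrow> v \<in> H)"

definition sat_her :: "('a, 'k::finite) kgraph \<Rightarrow> 'a set set" where
  "sat_her \<Lambda> = {H. H \<subseteq> verts \<Lambda> \<and> hereditary \<Lambda> H \<and> saturated \<Lambda> H}"

definition tree :: "('a, 'k::finite) kgraph \<Rightarrow> 'a \<Rightarrow> 'a set" where
  "tree \<Lambda> v = src \<Lambda> ` from_vertex \<Lambda> v (mor \<Lambda>)"

definition Delta :: "('a, 'k::finite) kgraph \<Rightarrow> 'a set \<Rightarrow> 'a set \<Rightarrow> 'a set" where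
  "Delta \<Lambda> H1 H2 = {v \<in> H1. tree \<Lambda> v \<inter> H2 = {}}"

definition Omega :: "('a, 'k::finite) kgraph \<Rightarrow> 'a set \<Rightarrow> 'a set \<Rightarrow> 'a set" where
  "Omega \<Lambda> H1 H2 = {v \<in> H1 - H2. tree \<Lambda> v \<inter> H2 \<noteq> {}}"

definition chain_step :: "('a, 'k::finite) kgraph \<Rightarrow> 'a set \<Rightarrow> 'a set \<Rightarrow> bool" where
  "chain_step \<Lambda> H1 H2 \<longleftrightarrow> H2 \<subseteq> H1 \<and> Delta \<Lambda> H1 H2 \<noteq> {} \<and>
     (\<forall>v \<in> Omega \<Lambda> H1 H2. \<exists>n. src \<Lambda> ` from_vertex \<Lambda> v (paths_le \<Lambda> n) \<subseteq> H2 \<union> Delta \<Lambda> H1 H2)"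

text \<open>
  \<open>is_chain \<Lambda> N H\<close>: the sequence \<open>H\<^sub>1, H\<^sub>2, \<dots>\<close> of length \<open>N \<in> {1, 2, \<dots>, \<infinity>}\<close> is a chain (the values
  of \<open>H\<close> at other indices are irrelevant). The terms after \<open>H\<^sub>1\<close> are required to be nonempty: since
  \<open>chain_step \<Lambda> H {}\<close> holds for every nonempty \<open>H\<close>, every finite chain ending in a nonempty set
  could otherwise be prolonged by \<open>{}\<close>, which contributes no direct summand. \<open>H\<^sub>1\<close> is empty only
  if \<open>\<Lambda>\<close> is.
\<close>

definition is_chain :: "('a, 'k::finite) kgraph \<Rightarrow> enat \<Rightarrow> (nat \<Rightarrow> 'a set) \<Rightarrow> bool" where
  "is_chain \<Lambda> N H \<longleftrightarrow> 1 \<le> N \<and> H 1 = verts \<Lambda> \<and>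
     (\<forall>i\<ge>1. enat i \<le> N \<longrightarrow> H i \<in> sat_her \<Lambda>) \<and>
     (\<forall>i\<ge>2. enat i \<le> N \<longrightarrow> H i \<noteq> {}) \<and>
     (\<forall>i\<ge>1. enat i < N \<longrightarrow> chain_step \<Lambda> (H i) (H (Suc i)))"

definition chain_lengths :: "('a, 'k::finite) kgraph \<Rightarrow> enat set" where
  "chain_lengths \<Lambda> = {N. \<exists>H. is_chain \<Lambda> N H}"

section \<open>C*-algebras\<close>

record 'x star_alg =
  carr :: "'x set"
  zer :: 'x
  pls :: "'x \<Rightarrow> 'x \<Rightarrow> 'x"
  smul :: "complex \<Rightarrow> 'x \<Rightarrow> 'x"
  tim :: "'x \<Rightarrow> 'x \<Rightarrow> 'x"
  adj :: "'x \<Rightarrow> 'x"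
  nrm :: "'x \<Rightarrow> real"

definition sub :: "'x star_alg \<Rightarrow> 'x \<Rightarrow> 'x \<Rightarrow> 'x" where
  "sub A x y = pls A x (smul A (-1) y)"

locale star_algebra =
  fixes A :: "'x star_alg"
  assumes zer_closed: "zer A \<in> carr A"
    and pls_closed: "\<lbrakk>x \<in> carr A; y \<in> carr A\<rbrakk> \<Longrightarrow> pls A x y \<in> carr A"
    and smul_closed: "x \<in> carr A \<Longrightarrow> smul A c x \<in> carr A"
    and tim_closed: "\<lbrakk>x \<in> carr A; y \<in> carr A\<rbrakk> \<Longrightarrow> tim A x y \<in> carr A"
    and adj_closed: "x \<in> carr A \<Longrightarrow> adj A x \<in> carr A"
    and pls_assoc: "\<lbrakk>x \<in> carr A; y \<in> carr A; z \<in> carr A\<rbrakk> \<Longrightarrow> pls A (pls A x y) z = pls A x (pls A y z)"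
    and pls_commute: "\<lbrakk>x \<in> carr A; y \<in> carr A\<rbrakk> \<Longrightarrow> pls A x y = pls A y x"
    and pls_zer: "x \<in> carr A \<Longrightarrow> pls A x (zer A) = x"
    and sub_self: "x \<in> carr A \<Longrightarrow> sub A x x = zer A"
    and smul_one: "x \<in> carr A \<Longrightarrow> smul A 1 x = x"
    and smul_smul: "x \<in> carr A \<Longrightarrow> smul A c (smul A d x) = smul A (c * d) x"
    and smul_pls: "\<lbrakk>x \<in> carr A; y \<in> carr A\<rbrakk> \<Longrightarrow> smul A c (pls A x y) = pls A (smul A c x) (smul A c y)"
    and add_smul: "x \<in> carr A \<Longrightarrow> smul A (c + d) x = pls A (smul A c x) (smul A d x)"
    and tim_assoc: "\<lbrakk>x \<in> carr A; y \<in> carr A; z \<in> carr A\<rbrakk> \<Longrightarrow> tim A (tim A x y) z = tim A x (tim A y z)"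
    and tim_pls: "\<lbrakk>x \<in> carr A; y \<in> carr A; z \<in> carr A\<rbrakk> \<Longrightarrow> tim A x (pls A y z) = pls A (tim A x y) (tim A x z)"
    and pls_tim: "\<lbrakk>x \<in> carr A; y \<in> carr A; z \<in> carr A\<rbrakk> \<Longrightarrow> tim A (pls A x y) z = pls A (tim A x z) (tim A y z)"
    and smul_tim: "\<lbrakk>x \<in> carr A; y \<in> carr A\<rbrakk> \<Longrightarrow> tim A (smul A c x) y = smul A c (tim A x y)"
    and tim_smul: "\<lbrakk>x \<in> carr A; y \<in> carr A\<rbrakk> \<Longrightarrow> tim A x (smul A c y) = smul A c (tim A x y)"
    and adj_adj: "x \<in> carr A \<Longrightarrow> adj A (adj A x) = x"
    and adj_pls: "\<lbrakk>x \<in> carr A; y \<in> carr A\<rbrakk> \<Longrightarrow> adj A (pls A x y) = pls A (adj A x) (adj A y)"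
    and adj_smul: "x \<in> carr A \<Longrightarrow> adj A (smul A c x) = smul A (cnj c) (adj A x)"
    and adj_tim: "\<lbrakk>x \<in> carr A; y \<in> carr A\<rbrakk> \<Longrightarrow> adj A (tim A x y) = tim A (adj A y) (adj A x)"

text \<open>A *-algebra whose \<open>nrm\<close> is a C*-seminorm.\<close>

locale cstar_seminormed = star_algebra +
  assumes nrm_nonneg: "x \<in> carr A \<Longrightarrow> 0 \<le> nrm A x"
    and nrm_triangle: "\<lbrakk>x \<in> carr A; y \<in> carr A\<rbrakk> \<Longrightarrow> nrm A (pls A x y) \<le> nrm A x + nrm A y"
    and nrm_smul: "x \<in> carr A \<Longrightarrow> nrm A (smul A c x) = cmod c * nrm A x"
    and nrm_tim: "\<lbrakk>x \<in> carr A; y \<in> carr A\<rbrakk> \<Longrightarrow> nrm A (tim A x y) \<le> nrm A x * nrm A y"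
    and nrm_cstar: "x \<in> carr A \<Longrightarrow> nrm A (tim A (adj A x) x) = (nrm A x)\<^sup>2"

definition cauchy_seqs :: "'x star_alg \<Rightarrow> (nat \<Rightarrow> 'x) set" where
  "cauchy_seqs A = {X. (\<forall>n. X n \<in> carr A) \<and>
     (\<forall>e>0. \<exists>N. \<forall>m\<ge>N. \<forall>n\<ge>N. nrm A (sub A (X m) (X n)) < e)}"

locale cstar_algebra = cstar_seminormed +
  assumes nrm_definite: "\<lbrakk>x \<in> carr A; nrm A x = 0\<rbrakk> \<Longrightarrow> x = zer A"
    and complete: "X \<in> cauchy_seqs A \<Longrightarrow>
      \<exists>x \<in> carr A. (\<lambda>n. nrm A (sub A (X n) x)) \<longlonglongrightarrow> 0"

definition star_iso :: "('x \<Rightarrow> 'y) \<Rightarrow> 'x star_alg \<Rightarrow> 'y star_alg \<Rightarrow> bool" where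
  "star_iso \<phi> A B \<longleftrightarrow> bij_betw \<phi> (carr A) (carr B) \<and>
     (\<forall>x \<in> carr A. \<forall>y \<in> carr A. \<phi> (pls A x y) = pls B (\<phi> x) (\<phi> y) \<and> \<phi> (tim A x y) = tim B (\<phi> x) (\<phi> y)) \<and>
     (\<forall>x \<in> carr A. \<phi> (adj A x) = adj B (\<phi> x) \<and> (\<forall>c. \<phi> (smul A c x) = smul B c (\<phi> x)))"

definition star_isomorphic :: "'x star_alg \<Rightarrow> 'y star_alg \<Rightarrow> bool" where
  "star_isomorphic A B \<longleftrightarrow> (\<exists>\<phi>. star_iso \<phi> A B)"

definition nonzero_alg :: "'x star_alg \<Rightarrow> bool" where
  "nonzero_alg A \<longleftrightarrow> carr A \<noteq> {zer A}"

text \<open>The C*-direct sum of a finite family (maximum norm).\<close>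

definition direct_sum :: "'i set \<Rightarrow> ('i \<Rightarrow> 'x star_alg) \<Rightarrow> ('i \<Rightarrow> 'x) star_alg" where
  "direct_sum I B =
     \<lparr>carr = (\<Pi>\<^sub>E i\<in>I. carr (B i)),
      zer = (\<lambda>i\<in>I. zer (B i)),
      pls = (\<lambda>x y. \<lambda>i\<in>I. pls (B i) (x i) (y i)),
      smul = (\<lambda>c x. \<lambda>i\<in>I. smul (B i) c (x i)),
      tim = (\<lambda>x y. \<lambda>i\<in>I. tim (B i) (x i) (y i)),
      adj = (\<lambda>x. \<lambda>i\<in>I. adj (B i) (x i)),
      nrm = (\<lambda>x. Max (insert 0 ((\<lambda>i. nrm (B i) (x i)) ` I)))\<rparr>"

text \<open>
  Direct summands of \<open>A\<close> embed in \<open>A\<close>, so letting the summands range over C*-algebras with elements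
  of the same type as \<open>A\<close> is no restriction.
\<close>

definition decomposable :: "'x star_alg \<Rightarrow> bool" where
  "decomposable A \<longleftrightarrow> (\<exists>B :: nat \<Rightarrow> 'x star_alg.
     (\<forall>i<2. cstar_algebra (B i) \<and> nonzero_alg (B i)) \<and> star_isomorphic A (direct_sum {..<2} B))"

definition indecomposable :: "'x star_alg \<Rightarrow> bool" where
  "indecomposable A \<longleftrightarrow> \<not> decomposable A"

text \<open>
  As in the definition of decomposability, the summands of a decomposition into at least two terms
  are nonzero; without this every algebra with an \<open>n\<close>-term decomposition into indecomposables would
  have longer ones, the zero algebra being indecomposable. A one-term decomposition of the zero
  algebra is admitted, so that 1-decomposable means indecomposable.
\<close>

definition n_decomposable :: "'x star_alg \<Rightarrow> nat \<Rightarrow> bool" where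
  "n_decomposable A n \<longleftrightarrow> n \<ge> 1 \<and> (\<exists>B :: nat \<Rightarrow> 'x star_alg.
     (\<forall>i<n. cstar_algebra (B i) \<and> indecomposable (B i) \<and> (n \<ge> 2 \<longrightarrow> nonzero_alg (B i))) \<and>
     star_isomorphic A (direct_sum {..<n} B))"

text \<open>
  The Hausdorff completion of a *-algebra with respect to a C*-seminorm: Cauchy sequences modulo
  sequences at distance tending to zero.
\<close>

definition cauchy_class :: "'x star_alg \<Rightarrow> (nat \<Rightarrow> 'x) \<Rightarrow> (nat \<Rightarrow> 'x) set" where
  "cauchy_class A X = {Y \<in> cauchy_seqs A. (\<lambda>n. nrm A (sub A (X n) (Y n))) \<longlonglongrightarrow> 0}"

definition representative :: "(nat \<Rightarrow> 'x) set \<Rightarrow> nat \<Rightarrow> 'x" where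
  "representative C = (SOME X. X \<in> C)"

definition completion :: "'x star_alg \<Rightarrow> (nat \<Rightarrow> 'x) set star_alg" where
  "completion A =
     \<lparr>carr = cauchy_class A ` cauchy_seqs A,
      zer = cauchy_class A (\<lambda>n. zer A),
      pls = (\<lambda>C D. cauchy_class A (\<lambda>n. pls A (representative C n) (representative D n))),
      smul = (\<lambda>c C. cauchy_class A (\<lambda>n. smul A c (representative C n))),
      tim = (\<lambda>C D. cauchy_class A (\<lambda>n. tim A (representative C n) (representative D n))),
      adj = (\<lambda>C. cauchy_class A (\<lambda>n. adj A (representative C n))),
      nrm = (\<lambda>C. lim (\<lambda>n. nrm A (representative C n)))\<rparr>"

section \<open>The C*-algebra of a higher-rank graph\<close>

text \<open>
  The universal C*-algebra of generators and relations is the Hausdorff completion of the free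
  *-algebra on the generators in the largest C*-seminorm that vanishes on the relations. The free
  (unital) *-algebra on \<^typ>\<open>'a\<close> is the monoid algebra of the words in \<open>s\<^sub>\<lambda>\<close>, \<open>s\<^sub>\<lambda>\<^sup>*\<close>, the letters
  being encoded as \<open>(\<lambda>, False)\<close> and \<open>(\<lambda>, True)\<close>. It is the type
  \<open>'a star_word \<Rightarrow>\<^sub>0 complex\<close> with the convolution product.
\<close>

datatype 'a star_word = Star_Word (letters: "('a \<times> bool) list")

instantiation star_word :: (type) monoid_add
begin

definition zero_star_word :: "'a star_word" where
  "0 = Star_Word []"

definition plus_star_word :: "'a star_word \<Rightarrow> 'a star_word \<Rightarrow> 'a star_word" where
  "u + v = Star_Word (letters u @ letters v)"

instance
  by standard (simp_all add: zero_star_word_def plus_star_word_def)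

end

definition word_adj :: "'a star_word \<Rightarrow> 'a star_word" where
  "word_adj w = Star_Word (rev (map (\<lambda>(x, b). (x, \<not> b)) (letters w)))"

definition free_adj :: "('a star_word \<Rightarrow>\<^sub>0 complex) \<Rightarrow> 'a star_word \<Rightarrow>\<^sub>0 complex" where
  "free_adj f = Poly_Mapping.map cnj (Poly_Mapping.map_key word_adj f)"

definition gen :: "'a \<Rightarrow> 'a star_word \<Rightarrow>\<^sub>0 complex" where
  "gen x = Poly_Mapping.single (Star_Word [(x, False)]) 1"

text \<open>The nonunital free *-algebra on the morphisms of \<open>\<Lambda>\<close>, with seminorm \<open>p\<close>.\<close>

definition free_star_algebra ::
    "('a, 'k::finite) kgraph \<Rightarrow> (('a star_word \<Rightarrow>\<^sub>0 complex) \<Rightarrow> real) \<Rightarrow> ('a star_word \<Rightarrow>\<^sub>0 complex) star_alg" where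
  "free_star_algebra \<Lambda> p =
     \<lparr>carr = {f. \<forall>w \<in> Poly_Mapping.keys f. w \<noteq> 0 \<and> fst ` set (letters w) \<subseteq> mor \<Lambda>},
      zer = 0, pls = (+), smul = (\<lambda>c f. Poly_Mapping.map ((*) c) f), tim = (*),
      adj = free_adj, nrm = p\<rparr>"

inductive_set ck_relators :: "('a, 'k::finite) kgraph \<Rightarrow> ('a star_word \<Rightarrow>\<^sub>0 complex) set"
  for \<Lambda> :: "('a, 'k::finite) kgraph" where
  partial_isometry: "x \<in> mor \<Lambda> \<Longrightarrow> gen x * free_adj (gen x) * gen x - gen x \<in> ck_relators \<Lambda>"
| vertices: "v \<in> verts \<Lambda> \<Longrightarrow> w \<in> verts \<Lambda> \<Longrightarrow>
    gen v * gen w - (if v = w then gen v else 0) \<in> ck_relators \<Lambda>"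
| product: "x \<in> mor \<Lambda> \<Longrightarrow> y \<in> mor \<Lambda> \<Longrightarrow> src \<Lambda> x = rng \<Lambda> y \<Longrightarrow>
    gen x * gen y - gen (cmp \<Lambda> x y) \<in> ck_relators \<Lambda>"
| source_projection: "x \<in> mor \<Lambda> \<Longrightarrow> free_adj (gen x) * gen x - gen (src \<Lambda> x) \<in> ck_relators \<Lambda>"
| cuntz_krieger: "v \<in> verts \<Lambda> \<Longrightarrow>
    gen v - (\<Sum>x \<in> from_vertex \<Lambda> v (paths_le \<Lambda> n). gen x * free_adj (gen x)) \<in> ck_relators \<Lambda>"

definition ck_seminorm :: "('a, 'k::finite) kgraph \<Rightarrow> (('a star_word \<Rightarrow>\<^sub>0 complex) \<Rightarrow> real) \<Rightarrow> bool" where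
  "ck_seminorm \<Lambda> p \<longleftrightarrow> cstar_seminormed (free_star_algebra \<Lambda> p) \<and> (\<forall>r \<in> ck_relators \<Lambda>. p r = 0)"

text \<open>
  On the carrier the supremum ranges over a nonempty bounded set: modulo the relations each \<open>s\<^sub>\<lambda>\<^sup>* s\<^sub>\<lambda>\<close>
  is a projection, hence \<open>p (s\<^sub>\<lambda>) \<le> 1\<close> for every such \<open>p\<close>.
\<close>

definition universal_seminorm :: "('a, 'k::finite) kgraph \<Rightarrow> ('a star_word \<Rightarrow>\<^sub>0 complex) \<Rightarrow> real" where
  "universal_seminorm \<Lambda> f = (SUP p \<in> {p. ck_seminorm \<Lambda> p}. p f)"

definition graph_cstar :: "('a, 'k::finite) kgraph \<Rightarrow> (nat \<Rightarrow> 'a star_word \<Rightarrow>\<^sub>0 complex) set star_alg" where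
  "graph_cstar \<Lambda> = completion (free_star_algebra \<Lambda> (universal_seminorm \<Lambda>))"

section \<open>Decompositions by subgraphs\<close>

text \<open>\<open>\<phi>\<close> realises a decomposition of \<open>C\<^sup>*(\<Lambda>)\<close> as the direct sum of the indecomposable algebras
  \<open>C\<^sup>*(\<Gamma> 0), \<dots>, C\<^sup>*(\<Gamma> (n - 1))\<close>, with the convention on zero summands used above.\<close>

definition subgraph_decomposition ::
    "('a, 'k::finite) kgraph \<Rightarrow> nat \<Rightarrow> (nat \<Rightarrow> ('a, 'k::finite) kgraph) \<Rightarrow>
     ((nat \<Rightarrow> 'a star_word \<Rightarrow>\<^sub>0 complex) set \<Rightarrow> nat \<Rightarrow> (nat \<Rightarrow> 'a star_word \<Rightarrow>\<^sub>0 complex) set) \<Rightarrow> bool" where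
  "subgraph_decomposition \<Lambda> n \<Gamma> \<phi> \<longleftrightarrow>
     (\<forall>i<n. k_subgraph (\<Gamma> i) \<Lambda> \<and> row_finite (\<Gamma> i) \<and> locally_convex (\<Gamma> i) \<and>
        indecomposable (graph_cstar (\<Gamma> i)) \<and> (n \<ge> 2 \<longrightarrow> nonzero_alg (graph_cstar (\<Gamma> i)))) \<and>
     star_iso \<phi> (graph_cstar \<Lambda>) (direct_sum {..<n} (\<lambda>i. graph_cstar (\<Gamma> i)))"

text \<open>The ideal of \<open>A\<close> that \<open>\<phi>: A \<rightarrow> \<Oplus>\<^sub>i B i\<close> identifies with the summand \<open>B i\<close>.\<close>

definition summand :: "'x star_alg \<Rightarrow> 'i set \<Rightarrow> ('i \<Rightarrow> 'y star_alg) \<Rightarrow> ('x \<Rightarrow> 'i \<Rightarrow> 'y) \<Rightarrow> 'i \<Rightarrow> 'x set" where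
  "summand A I B \<phi> i = {a \<in> carr A. \<forall>j \<in> I - {i}. \<phi> a j = zer (B j)}"

end

theory Submission
  imports Defs
begin

text \<open>
  A direct summand of \<open>C\<^sup>*(\<Lambda>)\<close> is the range of a central projection \<open>P\<close> of the multiplier algebra, and \<open>P\<close> is
  determined by its support \<open>H = {v. P s\<^sub>v = s\<^sub>v}\<close>. Averaging over the gauge action approximates \<open>P s\<^sub>v\<close> by an
  element of degree \<open>0\<close>, whose compression by \<open>s\<^sub>m\<close> is a multiple of the projection \<open>s\<^sub>w\<close>, \<open>w = s(m)\<close>, as
  soon as \<open>m \<in> \<Lambda>\<^sup>\<le>\<^sup>N\<close> for large \<open>N\<close>; so \<open>P s\<^sub>w\<close> is \<open>0\<close> or \<open>s\<^sub>w\<close>. Hence from every vertex all paths in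
  \<open>\<Lambda>\<^sup>\<le>\<^sup>N\<close> end in \<open>H\<close> or in \<open>\<Delta>(\<Lambda>\<^sup>0, H)\<close>, which for \<open>H \<noteq> \<Lambda>\<^sup>0\<close> is the condition \<open>\<Lambda>\<^sup>0 \<succ> H\<close>.

  Conversely, let disjoint hereditary sets \<open>H\<^sub>i\<close> be reached by all of \<open>v \<Lambda>\<^sup>\<le>\<^sup>N\<close>, with \<open>N\<close> depending on \<open>v\<close>.
  The sums of the \<open>s\<^sub>m s\<^sub>m\<^sup>*\<close> over the \<open>m \<in> v \<Lambda>\<^sup>\<le>\<^sup>N\<close> that end in \<open>H\<^sub>i\<close> define a central projection with
  support the saturation of \<open>H\<^sub>i\<close>, and the corresponding summand is \<open>C\<^sup>*\<close> of the subgraph obtained by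
  deleting \<open>\<Delta>(\<Lambda>\<^sup>0, H\<^sub>i)\<close>. Thus decompositions into indecomposables are the atoms of the Boolean algebra
  of supports, and the differences of the terms of a chain partition \<open>\<Lambda>\<^sup>0\<close>, up to such covers, into
  members of this algebra.
\<close>

text \<open>The estimates are made with C*-seminorms on the free *-algebra, without positivity or
  spectral theory, and this shapes three steps. The relations only prescribe sums of the s_x s_x^*,
  so their orthogonality, usually read off from positivity, is derived from the unit being an
  extreme point of the unit ball. That no s_v vanishes, without which a support would say nothing,
  is usually seen on boundary paths; here finite paths are used, and operator norms give way to
  their limits on longer and longer paths. Averages are taken over finite groups of roots of unity,
  one coordinate of the degree at a time; they stay near P s_v because a gauge automorphism close to
  the identity fixes P s_v. As C*(\<Lambda>) may lack a unit, a central multiplier P is a map with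
  P(xy) = (Px)y = x(Py). No bound on P is part of this, so limits are tested through products: only
  0 annihilates a C*-algebra.\<close>

declare One_nat_def [simp del]

section \<open>Combinatorics of paths, saturated hereditary sets and chains\<close>

subsection \<open>Paths of bounded degree\<close>

context k_graph
begin

abbreviation edges_at :: "'a \<Rightarrow> 'k \<Rightarrow> 'a set" where
  "edges_at v i \<equiv> from_vertex \<Lambda> v (paths \<Lambda> (axis i 1))"

abbreviation le_paths :: "'a \<Rightarrow> nat ^ 'k \<Rightarrow> 'a set" where
  "le_paths v n \<equiv> from_vertex \<Lambda> v (paths_le \<Lambda> n)"

lemma factor:
  assumes "x \<in> mor \<Lambda>" "deg \<Lambda> x = m + n"
  obtains y z where "y \<in> mor \<Lambda>" "z \<in> mor \<Lambda>" "src \<Lambda> y = rng \<Lambda> z" "deg \<Lambda> y = m" "deg \<Lambda> z = n" "x = cmp \<Lambda> y z"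
  using factorisation[OF assms] by blast

lemma factor_unique:
  assumes "a \<in> mor \<Lambda>" "b \<in> mor \<Lambda>" "src \<Lambda> a = rng \<Lambda> b" "c \<in> mor \<Lambda>" "d \<in> mor \<Lambda>" "src \<Lambda> c = rng \<Lambda> d"
    "deg \<Lambda> a = deg \<Lambda> c" "cmp \<Lambda> a b = cmp \<Lambda> c d"
  shows "a = c" "b = d"
proof -
  have x: "cmp \<Lambda> a b \<in> mor \<Lambda>" and dx: "deg \<Lambda> (cmp \<Lambda> a b) = deg \<Lambda> a + deg \<Lambda> b"
    using assms(1-3) by (auto simp: cmp_closed deg_cmp)
  have "deg \<Lambda> a + deg \<Lambda> b = deg \<Lambda> c + deg \<Lambda> d"
    using assms dx deg_cmp[of c d] by simp
  then have "deg \<Lambda> b = deg \<Lambda> d" using assms(7) by (simp add: vec_eq_iff)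
  define Q where "Q = (\<lambda>(\<mu>, \<nu>). \<mu> \<in> mor \<Lambda> \<and> \<nu> \<in> mor \<Lambda> \<and> src \<Lambda> \<mu> = rng \<Lambda> \<nu>
            \<and> deg \<Lambda> \<mu> = deg \<Lambda> a \<and> deg \<Lambda> \<nu> = deg \<Lambda> b \<and> cmp \<Lambda> a b = cmp \<Lambda> \<mu> \<nu>)"
  have "\<exists>!q. Q q" unfolding Q_def by (rule factorisation[OF x dx])
  moreover have "Q (a, b)" "Q (c, d)"
    unfolding Q_def using assms \<open>deg \<Lambda> b = deg \<Lambda> d\<close> by simp_all
  ultimately have "(a, b) = (c, d)" by blast
  then show "a = c" "b = d" by simp_all
qed

lemma verts_iff: "v \<in> verts \<Lambda> \<longleftrightarrow> v \<in> mor \<Lambda> \<and> deg \<Lambda> v = 0"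
  by (auto simp: verts_def paths_def)

lemma rng_verts: "x \<in> mor \<Lambda> \<Longrightarrow> rng \<Lambda> x \<in> verts \<Lambda>"
  by (simp add: verts_iff rng_closed deg_rng)

lemma src_verts: "x \<in> mor \<Lambda> \<Longrightarrow> src \<Lambda> x \<in> verts \<Lambda>"
  by (simp add: verts_iff src_closed deg_src)

text \<open>Both r(v) v and v s(v) factor v into two paths of degree 0; uniqueness of the
  factorisation gives r(v) = v.\<close>

lemma vert_rng [simp]: assumes "v \<in> verts \<Lambda>" shows "rng \<Lambda> v = v"
  using factor_unique(1)[of "rng \<Lambda> v" v v "src \<Lambda> v"] assms
  by (simp add: verts_iff rng_closed src_closed src_rng rng_src deg_rng cmp_rng cmp_src)

lemma vert_src [simp]: assumes "v \<in> verts \<Lambda>" shows "src \<Lambda> v = v"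
  using src_rng[of v] vert_rng[OF assms] assms by (simp add: verts_iff)

lemma vert_mor: "v \<in> verts \<Lambda> \<Longrightarrow> v \<in> mor \<Lambda>"
  by (simp add: verts_iff)

lemma cancel_left:
  assumes "a \<in> mor \<Lambda>" "b \<in> mor \<Lambda>" "src \<Lambda> a = rng \<Lambda> b" "d \<in> mor \<Lambda>" "src \<Lambda> a = rng \<Lambda> d"
    "cmp \<Lambda> a b = cmp \<Lambda> a d"
  shows "b = d"
  using factor_unique(2)[of a b a d] assms by simp

lemma edges_at_iff: "f \<in> edges_at v i \<longleftrightarrow> f \<in> mor \<Lambda> \<and> rng \<Lambda> f = v \<and> deg \<Lambda> f = axis i 1"
  by (auto simp: from_vertex_def paths_def)

lemma le_paths_iff: "x \<in> le_paths v n \<longleftrightarrow> x \<in> paths_le \<Lambda> n \<and> rng \<Lambda> x = v"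
  by (auto simp: from_vertex_def)

lemma paths_le_mor: "x \<in> paths_le \<Lambda> n \<Longrightarrow> x \<in> mor \<Lambda>"
  by (simp add: paths_le_def)

lemma paths_le_deg: "x \<in> paths_le \<Lambda> n \<Longrightarrow> deg \<Lambda> x \<le> n"
  by (simp add: paths_le_def)

lemma paths_le_edges: "x \<in> paths_le \<Lambda> n \<Longrightarrow> deg \<Lambda> x $ i < n $ i \<Longrightarrow> edges_at (src \<Lambda> x) i = {}"
  by (simp add: paths_le_def)

lemma paths_leI:
  "x \<in> mor \<Lambda> \<Longrightarrow> (\<And>i. deg \<Lambda> x $ i \<le> n $ i) \<Longrightarrow>
   (\<And>i. deg \<Lambda> x $ i < n $ i \<Longrightarrow> edges_at (src \<Lambda> x) i = {}) \<Longrightarrow> x \<in> paths_le \<Lambda> n"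
  by (simp add: paths_le_def less_eq_vec_def)

lemma self_paths_le: "x \<in> mor \<Lambda> \<Longrightarrow> x \<in> paths_le \<Lambda> (deg \<Lambda> x)"
  by (auto intro: paths_leI)

lemma tree_iff: "u \<in> tree \<Lambda> v \<longleftrightarrow> (\<exists>x\<in>mor \<Lambda>. rng \<Lambda> x = v \<and> src \<Lambda> x = u)"
  by (auto simp: tree_def from_vertex_def)

lemma tree_self: "v \<in> verts \<Lambda> \<Longrightarrow> v \<in> tree \<Lambda> v"
  unfolding tree_iff by (rule bexI[of _ v]) (auto simp: vert_mor)

lemma tree_trans: "x \<in> mor \<Lambda> \<Longrightarrow> tree \<Lambda> (src \<Lambda> x) \<subseteq> tree \<Lambda> (rng \<Lambda> x)"
proof
  fix u assume x: "x \<in> mor \<Lambda>" and "u \<in> tree \<Lambda> (src \<Lambda> x)"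
  then obtain y where "y \<in> mor \<Lambda>" "rng \<Lambda> y = src \<Lambda> x" "src \<Lambda> y = u" by (auto simp: tree_iff)
  then show "u \<in> tree \<Lambda> (rng \<Lambda> x)"
    unfolding tree_iff using x by (intro bexI[of _ "cmp \<Lambda> x y"]) (auto simp: rng_cmp src_cmp cmp_closed)
qed

lemma first_edge:
  assumes "x \<in> mor \<Lambda>" "deg \<Lambda> x $ i > 0"
  obtains e y where "e \<in> edges_at (rng \<Lambda> x) i" "y \<in> mor \<Lambda>" "src \<Lambda> e = rng \<Lambda> y" "x = cmp \<Lambda> e y"
proof -
  have "deg \<Lambda> x = axis i 1 + (deg \<Lambda> x - axis i 1)"
    using assms by (auto simp: vec_eq_iff axis_def)
  from factor[OF assms(1) this] obtain e y where
    "e \<in> mor \<Lambda>" "y \<in> mor \<Lambda>" "src \<Lambda> e = rng \<Lambda> y" "deg \<Lambda> e = axis i 1" "x = cmp \<Lambda> e y" by metis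
  then show ?thesis using that[of e y] by (auto simp: edges_at_iff rng_cmp)
qed

text \<open>The factorisation property brings the last edge to the front: x followed by an edge of
  degree e_i has positive i-th degree, so it begins with such an edge.\<close>

lemma edges_at_src_imp:
  assumes "x \<in> mor \<Lambda>" "edges_at (src \<Lambda> x) i \<noteq> {}"
  shows "edges_at (rng \<Lambda> x) i \<noteq> {}"
proof -
  obtain f where f: "f \<in> mor \<Lambda>" "rng \<Lambda> f = src \<Lambda> x" "deg \<Lambda> f = axis i 1"
    using assms by (auto simp: edges_at_iff)
  have xf: "cmp \<Lambda> x f \<in> mor \<Lambda>" "rng \<Lambda> (cmp \<Lambda> x f) = rng \<Lambda> x"
    using f assms by (simp_all add: cmp_closed rng_cmp)
  have "deg \<Lambda> (cmp \<Lambda> x f) $ i > 0" using f assms by (simp add: deg_cmp)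
  with xf(1) show ?thesis by (rule first_edge) (use xf(2) in auto)
qed

text \<open>A path of maximal total degree among those from v of degree at most n cannot be
  prolonged within n, which is the condition in \<open>paths_le\<close>.\<close>

lemma le_paths_nonempty: assumes "v \<in> verts \<Lambda>" shows "le_paths v n \<noteq> {}"
proof -
  let ?S = "{x\<in>mor \<Lambda>. rng \<Lambda> x = v \<and> (\<forall>i. deg \<Lambda> x $ i \<le> n $ i)}"
  let ?f = "\<lambda>x. (\<Sum>i\<in>UNIV. deg \<Lambda> x $ i)"
  have v: "v \<in> ?S" using assms vert_rng[OF assms] by (simp add: verts_iff)
  have "\<forall>x. x \<in> ?S \<longrightarrow> ?f x < Suc (\<Sum>i\<in>UNIV. n $ i)"
    unfolding less_Suc_eq_le by (blast intro: sum_mono)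
  from ex_has_greatest_nat[of "\<lambda>x. x \<in> ?S", OF v this]
  obtain x where x: "x \<in> ?S" and mx: "\<And>y. y \<in> ?S \<Longrightarrow> ?f y \<le> ?f x"
    by blast
  have "x \<in> paths_le \<Lambda> n"
  proof (rule paths_leI)
    fix i assume i: "deg \<Lambda> x $ i < n $ i"
    show "edges_at (src \<Lambda> x) i = {}"
    proof (rule ccontr)
      assume "edges_at (src \<Lambda> x) i \<noteq> {}"
      then obtain f where f: "f \<in> mor \<Lambda>" "rng \<Lambda> f = src \<Lambda> x" "deg \<Lambda> f = axis i 1"
        by (auto simp: edges_at_iff)
      have "cmp \<Lambda> x f \<in> ?S"
        using x f i by (auto simp: cmp_closed rng_cmp deg_cmp axis_def)
      from mx[OF this] show False using x f by (simp add: deg_cmp sum.distrib axis_def)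
    qed
  qed (use x in auto)
  then show ?thesis using x by (auto simp: le_paths_iff)
qed

text \<open>If x stops short of m in direction i, there is no edge of degree e_i at s(x), and by
  \<open>edges_at_src_imp\<close> none at s(y) either.\<close>

lemma cmp_paths_le:
  assumes x: "x \<in> paths_le \<Lambda> m" and y: "y \<in> paths_le \<Lambda> n" and xy: "src \<Lambda> x = rng \<Lambda> y"
  shows "cmp \<Lambda> x y \<in> paths_le \<Lambda> (m + n)"
proof (rule paths_leI)
  note c = paths_le_mor[OF x] paths_le_mor[OF y] xy
  have dx: "deg \<Lambda> x $ i \<le> m $ i" and dy: "deg \<Lambda> y $ i \<le> n $ i" for i
    using paths_le_deg[OF x] paths_le_deg[OF y] by (simp_all add: less_eq_vec_def)
  show "cmp \<Lambda> x y \<in> mor \<Lambda>" using c by (simp add: cmp_closed)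
  fix i
  show "deg \<Lambda> (cmp \<Lambda> x y) $ i \<le> (m + n) $ i"
    using c dx dy by (simp add: deg_cmp add_mono)
  assume "deg \<Lambda> (cmp \<Lambda> x y) $ i < (m + n) $ i"
  then consider "deg \<Lambda> x $ i < m $ i" | "deg \<Lambda> y $ i < n $ i"
    using c by (fastforce simp: deg_cmp)
  then show "edges_at (src \<Lambda> (cmp \<Lambda> x y)) i = {}"
  proof cases
    case 1
    then show ?thesis
      using paths_le_edges[OF x 1] edges_at_src_imp[OF c(2), of i] c by (auto simp: src_cmp)
  next
    case 2
    then show ?thesis using paths_le_edges[OF y 2] c by (simp add: src_cmp)
  qed
qed

text \<open>Where x stops short of m, y cannot go on in that direction. So the degree of an initial
  segment in \<open>paths_le \<Lambda> m\<close> depends only on the whole path, which makes such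
  segments unique although their degrees are not prescribed.\<close>

lemma cmp_paths_le_deg:
  assumes x: "x \<in> paths_le \<Lambda> m" and y: "y \<in> mor \<Lambda>" and xy: "src \<Lambda> x = rng \<Lambda> y"
  shows "deg \<Lambda> x $ i = min (deg \<Lambda> (cmp \<Lambda> x y) $ i) (m $ i)"
proof (cases "deg \<Lambda> x $ i < m $ i")
  case True
  then have "edges_at (rng \<Lambda> y) i = {}" using paths_le_edges[OF x] xy by simp
  then have "deg \<Lambda> y $ i = 0" by (metis first_edge[OF y] empty_iff gr0I)
  then show ?thesis using True paths_le_mor[OF x] y xy by (simp add: deg_cmp)
next
  case False
  then have "deg \<Lambda> x $ i = m $ i" using paths_le_deg[OF x] by (simp add: less_eq_vec_def le_antisym)
  then show ?thesis using paths_le_mor[OF x] y xy by (simp add: deg_cmp)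
qed

lemma paths_le_factor_unique:
  assumes "x \<in> paths_le \<Lambda> m" "y \<in> mor \<Lambda>" "src \<Lambda> x = rng \<Lambda> y"
    "x' \<in> paths_le \<Lambda> m" "y' \<in> mor \<Lambda>" "src \<Lambda> x' = rng \<Lambda> y'" "cmp \<Lambda> x y = cmp \<Lambda> x' y'"
  shows "x = x'" "y = y'"
proof -
  have "deg \<Lambda> x = deg \<Lambda> x'"
    unfolding vec_eq_iff using assms by (metis cmp_paths_le_deg)
  then show "x = x'" "y = y'" using factor_unique[of x y x' y'] assms by (auto simp: paths_le_mor)
qed

end

locale lc_kgraph = k_graph \<Lambda> for \<Lambda> :: "('a, 'k::finite) kgraph" +
  assumes rf: "row_finite \<Lambda>" and lc: "locally_convex \<Lambda>"
begin

text \<open>Local convexity carries an edge of degree e_i past one edge of another direction;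
  induction on the length of y carries it past all of y.\<close>

lemma edges_at_push:
  assumes "y \<in> mor \<Lambda>" "deg \<Lambda> y $ i = 0" "edges_at (rng \<Lambda> y) i \<noteq> {}"
  shows "edges_at (src \<Lambda> y) i \<noteq> {}"
  using assms
proof (induction "\<Sum>j\<in>UNIV. deg \<Lambda> y $ j" arbitrary: y rule: less_induct)
  case less
  show ?case
  proof (cases "deg \<Lambda> y = 0")
    case True
    then show ?thesis using less.prems by (metis verts_iff vert_rng vert_src)
  next
    case False
    then obtain j where j: "deg \<Lambda> y $ j > 0" by (auto simp: vec_eq_iff)
    from first_edge[OF less.prems(1) j] obtain e z where
      e: "e \<in> edges_at (rng \<Lambda> y) j" and z: "z \<in> mor \<Lambda>" "src \<Lambda> e = rng \<Lambda> z" and y: "y = cmp \<Lambda> e z" .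
    have ij: "i \<noteq> j" using j less.prems by auto
    have em: "e \<in> mor \<Lambda>" "deg \<Lambda> e = axis j 1" using e by (auto simp: edges_at_iff)
    have dy: "deg \<Lambda> y = axis j 1 + deg \<Lambda> z" using z em y by (simp add: deg_cmp)
    have "edges_at (src \<Lambda> e) i \<noteq> {}"
      using lc ij e less.prems(3) rng_verts[OF less.prems(1)] unfolding locally_convex_def by blast
    then have "edges_at (src \<Lambda> z) i \<noteq> {}"
      using less.hyps[of z] z dy less.prems(2) by (auto simp: sum.distrib axis_def)
    then show ?thesis using y z em by (simp add: src_cmp)
  qed
qed

lemma paths_le_factor:
  assumes z: "z \<in> paths_le \<Lambda> (m + n)"
  obtains x y where "x \<in> paths_le \<Lambda> m" "y \<in> paths_le \<Lambda> n" "src \<Lambda> x = rng \<Lambda> y" "z = cmp \<Lambda> x y"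
proof -
  \<comment> \<open>The cut is made at the coordinatewise minimum of d(z) and m, the only possible
    degree by \<open>cmp_paths_le_deg\<close>.\<close>
  let ?a = "\<chi> i. min (deg \<Lambda> z $ i) (m $ i)"
  have zm: "z \<in> mor \<Lambda>" using z by (rule paths_le_mor)
  have dz: "deg \<Lambda> z $ i \<le> m $ i + n $ i" for i using paths_le_deg[OF z] by (simp add: less_eq_vec_def)
  have "deg \<Lambda> z = ?a + (deg \<Lambda> z - ?a)" by (simp add: vec_eq_iff)
  from factor[OF zm this] obtain x y where xy: "x \<in> mor \<Lambda>" "y \<in> mor \<Lambda>" "src \<Lambda> x = rng \<Lambda> y"
    "deg \<Lambda> x = ?a" "deg \<Lambda> y = deg \<Lambda> z - ?a" "z = cmp \<Lambda> x y" .
  have sz: "src \<Lambda> z = src \<Lambda> y" using xy by (simp add: src_cmp)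
  show ?thesis
  proof
    show "y \<in> paths_le \<Lambda> n"
    proof (rule paths_leI)
      fix i
      show "deg \<Lambda> y $ i \<le> n $ i" using xy dz[of i] by auto
      assume "deg \<Lambda> y $ i < n $ i"
      then have "deg \<Lambda> z $ i < (m + n) $ i" using xy(5) by (simp add: min_def split: if_splits)
      then show "edges_at (src \<Lambda> y) i = {}" using paths_le_edges[OF z] sz by simp
    qed (rule xy)
    show "x \<in> paths_le \<Lambda> m"
    proof (rule paths_leI)
      fix i
      show "deg \<Lambda> x $ i \<le> m $ i" using xy by simp
      \<comment> \<open>If x falls short of m, the whole i-th degree of z lies in x; an edge of
        degree e_i at s(x) could then be pushed along y to s(z), where there is none.\<close>
      assume i: "deg \<Lambda> x $ i < m $ i"
      then have "deg \<Lambda> z $ i < (m + n) $ i" "deg \<Lambda> y $ i = 0"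
        using xy(4,5) by (simp_all add: min_def split: if_splits)
      then show "edges_at (src \<Lambda> x) i = {}"
        using paths_le_edges[OF z] sz edges_at_push[OF xy(2), of i] xy(3) by auto
    qed (rule xy)
  qed (use xy in \<open>simp_all only:\<close>)
qed

lemma finite_le_paths: assumes "v \<in> verts \<Lambda>" shows "finite (le_paths v n)"
proof -
  have "finite {m :: nat ^ 'k. m \<le> n}"
  proof (rule finite_imageD[of vec_nth])
    have "vec_nth ` {m. m \<le> n} \<subseteq> Pi\<^sub>E UNIV (\<lambda>i. {..n $ i})" by (auto simp: less_eq_vec_def)
    then show "finite (vec_nth ` {m. m \<le> n})" by (rule finite_subset) (auto intro: finite_PiE)
    show "inj_on vec_nth {m. m \<le> n}" by (auto simp: inj_on_def vec_nth_inject)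
  qed
  moreover have "le_paths v n \<subseteq> (\<Union>m\<in>{m. m \<le> n}. from_vertex \<Lambda> v (paths \<Lambda> m))"
    by (auto simp: from_vertex_def paths_def paths_le_def)
  moreover have "finite (from_vertex \<Lambda> v (paths \<Lambda> m))" for m
    using rf assms by (auto simp: row_finite_def)
  ultimately show ?thesis by (simp add: finite_subset)
qed

text \<open>Cuntz-Krieger sums of different levels are compared through this bijection.\<close>

lemma bij_betw_le_paths_add:
  assumes "v \<in> verts \<Lambda>"
  shows "bij_betw (\<lambda>(x, y). cmp \<Lambda> x y) (SIGMA x:le_paths v m. le_paths (src \<Lambda> x) n) (le_paths v (m + n))"
  unfolding bij_betw_def
proof
  show "inj_on (\<lambda>(x, y). cmp \<Lambda> x y) (SIGMA x:le_paths v m. le_paths (src \<Lambda> x) n)"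
  proof (rule inj_onI, clarify)
    fix x y x' y'
    assume a: "x \<in> le_paths v m" "y \<in> le_paths (src \<Lambda> x) n" "x' \<in> le_paths v m" "y' \<in> le_paths (src \<Lambda> x') n"
      and eq: "cmp \<Lambda> x y = cmp \<Lambda> x' y'"
    have b: "x \<in> paths_le \<Lambda> m" "y \<in> mor \<Lambda>" "src \<Lambda> x = rng \<Lambda> y" "x' \<in> paths_le \<Lambda> m" "y' \<in> mor \<Lambda>" "src
      \<Lambda> x' = rng \<Lambda> y'"
      using a by (auto simp: le_paths_iff dest: paths_le_mor)
    show "x = x' \<and> y = y'"
      using paths_le_factor_unique[OF b eq] by simp
  qed
  show "(\<lambda>(x, y). cmp \<Lambda> x y) ` (SIGMA x:le_paths v m. le_paths (src \<Lambda> x) n) = le_paths v (m + n)"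
  proof (intro equalityI subsetI)
    fix z assume z: "z \<in> le_paths v (m + n)"
    then have "z \<in> paths_le \<Lambda> (m + n)" by (simp add: le_paths_iff)
    then obtain x y where xy: "x \<in> paths_le \<Lambda> m" "y \<in> paths_le \<Lambda> n" "src \<Lambda> x = rng \<Lambda> y" "z = cmp \<Lambda> x y"
      by (rule paths_le_factor)
    have "rng \<Lambda> x = v" using z xy rng_cmp[of x y] by (simp add: le_paths_iff paths_le_mor)
    then have "(x, y) \<in> (SIGMA x:le_paths v m. le_paths (src \<Lambda> x) n)" using xy by (simp add: le_paths_iff)
    then show "z \<in> (\<lambda>(x, y). cmp \<Lambda> x y) ` (SIGMA x:le_paths v m. le_paths (src \<Lambda> x) n)"
      using xy(4) by (auto simp: image_iff)
  next
    fix z assume "z \<in> (\<lambda>(x, y). cmp \<Lambda> x y) ` (SIGMA x:le_paths v m. le_paths (src \<Lambda> x) n)"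
    then obtain x y where xy: "x \<in> paths_le \<Lambda> m" "y \<in> paths_le \<Lambda> n" "src \<Lambda> x = rng \<Lambda> y" "rng \<Lambda> x
      = v" "z = cmp \<Lambda> x y"
      by (auto simp: le_paths_iff)
    then show "z \<in> le_paths v (m + n)"
      using cmp_paths_le[OF xy(1-3)] rng_cmp[of x y] paths_le_mor by (simp add: le_paths_iff)
  qed
qed

end


subsection \<open>Quotient graphs\<close>

text \<open>Testing the source is enough: for hereditary K, a path that ends outside K also starts
  outside K. The algebras of these graphs become the direct summands.\<close>

definition quotient_graph :: "('a, 'k::finite) kgraph \<Rightarrow> 'a set \<Rightarrow> ('a, 'k) kgraph" where
  "quotient_graph \<Lambda> K = \<Lambda>\<lparr>mor := {x \<in> mor \<Lambda>. src \<Lambda> x \<notin> K}\<rparr>"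

lemma quotient_graph_sel [simp]:
  "mor (quotient_graph \<Lambda> K) = {x \<in> mor \<Lambda>. src \<Lambda> x \<notin> K}"
  "rng (quotient_graph \<Lambda> K) = rng \<Lambda>" "src (quotient_graph \<Lambda> K) = src \<Lambda>"
  "cmp (quotient_graph \<Lambda> K) = cmp \<Lambda>" "deg (quotient_graph \<Lambda> K) = deg \<Lambda>"
  by (simp_all add: quotient_graph_def)

lemma from_vertex_quotient_graph [simp]: "from_vertex (quotient_graph \<Lambda> K) v E = from_vertex \<Lambda> v E"
  by (simp add: from_vertex_def)

lemma hereditaryD: "hereditary \<Lambda> H \<Longrightarrow> x \<in> mor \<Lambda> \<Longrightarrow> rng \<Lambda> x \<in> H \<Longrightarrow> src \<Lambda> x \<in> H"
  by (simp add: hereditary_def)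

context lc_kgraph
begin

lemma le_paths_mor: "x \<in> le_paths v n \<Longrightarrow> x \<in> mor \<Lambda> \<and> rng \<Lambda> x = v"
  by (auto simp: le_paths_iff dest: paths_le_mor)

lemma saturatedD:
  "saturated \<Lambda> H \<Longrightarrow> v \<in> verts \<Lambda> \<Longrightarrow> src \<Lambda> ` le_paths v n \<subseteq> H \<Longrightarrow> v \<in> H"
  by (auto simp: saturated_def)

context
  fixes K assumes K: "K \<in> sat_her \<Lambda>"
begin

lemma K_her: "x \<in> mor \<Lambda> \<Longrightarrow> src \<Lambda> x \<notin> K \<Longrightarrow> rng \<Lambda> x \<notin> K"
  using K by (auto simp: sat_her_def hereditary_def)

lemma quotient_k_graph: "k_graph (quotient_graph \<Lambda> K)"
proof (unfold_locales, goal_cases)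
  case 1
  show ?case using countable_mor by (auto intro: countable_subset)
next
  case (17 x m n)
  then have x: "x \<in> mor \<Lambda>" "deg \<Lambda> x = m + n" and sx: "src \<Lambda> x \<notin> K" by auto
  \<comment> \<open>The second factor has the source of x; its range, which is the source of the
    first factor, is outside K by heredity. So both factors of x survive.\<close>
  have eq: "\<mu> \<in> mor \<Lambda> \<and> src \<Lambda> \<mu> \<notin> K \<and> \<nu> \<in> mor \<Lambda> \<and> src \<Lambda> \<nu> \<notin> K \<and> src \<Lambda> \<mu> = rng \<Lambda> \<nu>
            \<and> deg \<Lambda> \<mu> = m \<and> deg \<Lambda> \<nu> = n \<and> x = cmp \<Lambda> \<mu> \<nu> \<longleftrightarrow>
        \<mu> \<in> mor \<Lambda> \<and> \<nu> \<in> mor \<Lambda> \<and> src \<Lambda> \<mu> = rng \<Lambda> \<nu>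
            \<and> deg \<Lambda> \<mu> = m \<and> deg \<Lambda> \<nu> = n \<and> x = cmp \<Lambda> \<mu> \<nu>" for \<mu> \<nu>
    using sx K_her[of \<nu>] src_cmp[of \<mu> \<nu>] by metis
  show ?case using factorisation[OF x] by (simp add: eq)
next
  case (2 x) then show ?case using K_her by (auto simp: rng_closed src_rng)
qed (auto simp: src_closed rng_rng src_rng rng_src src_src cmp_closed rng_cmp src_cmp cmp_assoc
    cmp_rng cmp_src deg_rng deg_src deg_cmp)

lemma quotient_verts: "verts (quotient_graph \<Lambda> K) = verts \<Lambda> - K"
  by (auto simp: verts_def paths_def)

lemma quotient_paths: "paths (quotient_graph \<Lambda> K) n = paths \<Lambda> n \<inter> {x \<in> mor \<Lambda>. src \<Lambda> x \<notin> K}"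
  by (auto simp: paths_def)

text \<open>If there is an edge of degree e_i at v, then \<open>le_paths v (axis i 1)\<close>
  consists of such edges alone, and saturation forbids all of them to end in K. Hence deleting K
  creates no new dead ends, and \<open>paths_le\<close> is merely restricted.\<close>

lemma edges_at_outside:
  assumes v: "v \<in> verts \<Lambda>" "v \<notin> K" and e: "edges_at v i \<noteq> {}"
  shows "\<exists>x\<in>edges_at v i. src \<Lambda> x \<notin> K"
proof (rule ccontr)
  assume c: "\<not> ?thesis"
  have "src \<Lambda> x \<in> K" if x: "x \<in> le_paths v (axis i 1)" for x
  proof -
    have xm: "x \<in> mor \<Lambda>" "rng \<Lambda> x = v" using le_paths_mor[OF x] by auto
    have xl: "x \<in> paths_le \<Lambda> (axis i 1)" using x by (simp add: le_paths_iff)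
    have d: "deg \<Lambda> x $ j \<le> axis i 1 $ j" for j using paths_le_deg[OF xl] by (simp add: less_eq_vec_def)
    have "deg \<Lambda> x = axis i 1"
    proof (rule ccontr)
      assume "deg \<Lambda> x \<noteq> axis i 1"
      then obtain j where j: "deg \<Lambda> x $ j \<noteq> (axis i 1 :: nat^'k) $ j" by (auto simp: vec_eq_iff)
      then have ji: "j = i" "deg \<Lambda> x $ i = 0" using d[of j] by (auto simp: axis_def split: if_splits)
      have "deg \<Lambda> x $ l = 0" for l using d[of l] ji by (cases "l = i") (auto simp: axis_def)
      then have "x \<in> verts \<Lambda>" using xm by (simp add: verts_iff vec_eq_iff)
      then have "src \<Lambda> x = v" using xm by simp
      then show False using paths_le_edges[OF xl, of i] ji e by simp
    qed
    then show ?thesis using c xm by (auto simp: edges_at_iff)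
  qed
  then have "v \<in> K" using saturatedD[of K v "axis i 1"] K v by (auto simp: sat_her_def)
  then show False using v by simp
qed

lemma quotient_paths_le: "paths_le (quotient_graph \<Lambda> K) n = paths_le \<Lambda> n \<inter> {x \<in> mor \<Lambda>. src \<Lambda> x \<notin> K}"
proof -
  have "from_vertex \<Lambda> (src \<Lambda> x) (paths \<Lambda> (axis i 1) \<inter> {x \<in> mor \<Lambda>. src \<Lambda> x \<notin> K}) = {} \<longleftrightarrow>
    edges_at (src \<Lambda> x) i = {}" if "x \<in> mor \<Lambda>" "src \<Lambda> x \<notin> K" for x i
    using edges_at_outside[of "src \<Lambda> x" i] that src_verts[of x] by (auto simp: from_vertex_def paths_def)
  then show ?thesis by (auto simp: paths_le_def quotient_paths)
qed

lemma quotient_row_finite: "row_finite (quotient_graph \<Lambda> K)"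
  unfolding row_finite_def
proof (intro ballI allI)
  fix v n assume "v \<in> verts (quotient_graph \<Lambda> K)"
  then have "finite (from_vertex \<Lambda> v (paths \<Lambda> n))" using rf by (auto simp: row_finite_def quotient_verts)
  then show "finite (from_vertex (quotient_graph \<Lambda> K) v (paths (quotient_graph \<Lambda> K) n))"
    by (rule finite_subset[rotated]) (auto simp: from_vertex_def quotient_paths)
qed

lemma quotient_locally_convex: "locally_convex (quotient_graph \<Lambda> K)"
  unfolding locally_convex_def
proof (intro ballI allI impI)
  fix v i j x y
  assume v: "v \<in> verts (quotient_graph \<Lambda> K)" and ij: "i \<noteq> j"
    and "x \<in> from_vertex (quotient_graph \<Lambda> K) v (paths (quotient_graph \<Lambda> K) (axis i 1))"
    and "y \<in> from_vertex (quotient_graph \<Lambda> K) v (paths (quotient_graph \<Lambda> K) (axis j 1))"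
  then have x: "x \<in> edges_at v i" "src \<Lambda> x \<notin> K" and y: "y \<in> edges_at v j" "src \<Lambda> y \<notin> K"
    by (auto simp: from_vertex_def quotient_paths)
  have m: "src \<Lambda> x \<in> verts \<Lambda>" "src \<Lambda> y \<in> verts \<Lambda>" using x y by (auto simp: edges_at_iff src_verts)
  have "edges_at (src \<Lambda> x) j \<noteq> {}" "edges_at (src \<Lambda> y) i \<noteq> {}"
    using lc v ij x y unfolding locally_convex_def quotient_verts by blast+
  then show "from_vertex (quotient_graph \<Lambda> K) (src (quotient_graph \<Lambda> K) x) (paths (quotient_graph \<Lambda>
    K) (axis j 1)) \<noteq> {} \<and>
        from_vertex (quotient_graph \<Lambda> K) (src (quotient_graph \<Lambda> K) y) (paths (quotient_graph \<Lambda> K)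
          (axis i 1)) \<noteq> {}"
    using edges_at_outside[OF m(1) x(2)] edges_at_outside[OF m(2) y(2)]
    by (fastforce simp: from_vertex_def quotient_paths paths_def)
qed

lemma quotient_lc_kgraph: "lc_kgraph (quotient_graph \<Lambda> K)"
  using quotient_k_graph quotient_row_finite quotient_locally_convex
  by (simp add: lc_kgraph_def lc_kgraph_axioms_def)

lemma quotient_k_subgraph: "k_subgraph (quotient_graph \<Lambda> K) \<Lambda>"
  using quotient_k_graph by (auto simp: k_subgraph_def quotient_graph_def)

end

section \<open>Covers by hereditary sets and the Boolean algebra \<open>clopens\<close>\<close>

abbreviation cpl :: "'a set \<Rightarrow> 'a set" where
  "cpl H \<equiv> Delta \<Lambda> (verts \<Lambda>) H"

lemma cpl_iff: "v \<in> cpl H \<longleftrightarrow> v \<in> verts \<Lambda> \<and> tree \<Lambda> v \<inter> H = {}"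
  by (simp add: Delta_def)

lemma cpl_disjoint: "cpl H \<inter> H = {}"
  using tree_self cpl_iff by blast

lemma hereditary_tree: "hereditary \<Lambda> H \<Longrightarrow> v \<in> H \<Longrightarrow> tree \<Lambda> v \<subseteq> H"
  by (auto simp: tree_iff hereditary_def)

lemma src_le_paths_tree: "src \<Lambda> ` le_paths v n \<subseteq> tree \<Lambda> v"
  using le_paths_mor by (force simp: tree_iff)

lemma src_le_paths_hereditary: "hereditary \<Lambda> H \<Longrightarrow> v \<in> H \<Longrightarrow> src \<Lambda> ` le_paths v n \<subseteq> H"
  using src_le_paths_tree hereditary_tree by blast

lemma cpl_hereditary: "hereditary \<Lambda> (cpl H)"
  unfolding hereditary_def cpl_iff using tree_trans src_verts by blast

lemma hereditary_Un: "hereditary \<Lambda> H \<Longrightarrow> hereditary \<Lambda> H' \<Longrightarrow> hereditary \<Lambda> (H \<union> H')"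
  by (auto simp: hereditary_def)

lemma hereditary_Int: "hereditary \<Lambda> H \<Longrightarrow> hereditary \<Lambda> H' \<Longrightarrow> hereditary \<Lambda> (H \<inter> H')"
  by (auto simp: hereditary_def)

lemma hereditary_Union: "(\<And>H. H \<in> \<A> \<Longrightarrow> hereditary \<Lambda> H) \<Longrightarrow> hereditary \<Lambda> (\<Union>\<A>)"
  by (auto simp: hereditary_def)

text \<open>A path of level n + m begins with one of level n, and hereditary sets are never left.
  Thus several covers can be brought to a common level.\<close>

lemma src_le_paths_mono:
  assumes "hereditary \<Lambda> U" "src \<Lambda> ` le_paths v n \<subseteq> U"
  shows "src \<Lambda> ` le_paths v (n + m) \<subseteq> U"
proof
  fix u assume "u \<in> src \<Lambda> ` le_paths v (n + m)"
  then obtain z where z: "z \<in> paths_le \<Lambda> (n + m)" "rng \<Lambda> z = v" "u = src \<Lambda> z" by (auto simp: le_paths_iff)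
  from paths_le_factor[OF z(1)] obtain x y where xy: "x \<in> paths_le \<Lambda> n" "y \<in> paths_le \<Lambda> m"
    "src \<Lambda> x = rng \<Lambda> y" "z = cmp \<Lambda> x y" by blast
  note c = paths_le_mor[OF xy(1)] paths_le_mor[OF xy(2)] xy(3)
  have "x \<in> le_paths v n" using xy z rng_cmp[OF c] by (simp add: le_paths_iff)
  then have "src \<Lambda> x \<in> U" using assms by auto
  then show "u \<in> U" using hereditaryD[OF assms(1) c(2)] c z xy src_cmp[OF c] by simp
qed

text \<open>Only finitely many paths have level n at v, so the sum of the levels that their ends
  require serves all of them at once.\<close>

lemma cover_compose:
  assumes v: "v \<in> verts \<Lambda>" and U: "hereditary \<Lambda> U"
    and x: "\<And>x. x \<in> le_paths v n \<Longrightarrow> \<exists>m. src \<Lambda> ` le_paths (src \<Lambda> x) m \<subseteq> U"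
  shows "\<exists>N. src \<Lambda> ` le_paths v N \<subseteq> U"
proof -
  from x obtain m where m: "\<And>x. x \<in> le_paths v n \<Longrightarrow> src \<Lambda> ` le_paths (src \<Lambda> x) (m x) \<subseteq> U" by metis
  let ?M = "\<Sum>x\<in>le_paths v n. m x"
  have "src \<Lambda> z \<in> U" if "z \<in> le_paths v (n + ?M)" for z
  proof -
    have z: "z \<in> paths_le \<Lambda> (n + ?M)" "rng \<Lambda> z = v" using that by (auto simp: le_paths_iff)
    from paths_le_factor[OF z(1)] obtain x y where xy: "x \<in> paths_le \<Lambda> n" "y \<in> paths_le \<Lambda> ?M"
      "src \<Lambda> x = rng \<Lambda> y" "z = cmp \<Lambda> x y" by blast
    note c = paths_le_mor[OF xy(1)] paths_le_mor[OF xy(2)] xy(3)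
    have xv: "x \<in> le_paths v n" using xy z rng_cmp[OF c] by (simp add: le_paths_iff)
    have "?M = m x + (\<Sum>x\<in>le_paths v n - {x}. m x)"
      using xv finite_le_paths[OF v] by (rule sum.remove[rotated])
    then have "src \<Lambda> ` le_paths (src \<Lambda> x) ?M \<subseteq> U" using src_le_paths_mono[OF U m[OF xv]] by simp
    then show ?thesis using xy src_cmp[OF c] by (auto simp: le_paths_iff)
  qed
  then show ?thesis by blast
qed

text \<open>If v could reach some u in H by a path x, then x followed by a path of level n from u
  would end in H by heredity, and in \<open>cpl H\<close> because the cover of v at level n persists
  at level n + d(x).\<close>

lemma cpl_sat_her: assumes "hereditary \<Lambda> H" shows "cpl H \<in> sat_her \<Lambda>"
proof -
  have "saturated \<Lambda> (cpl H)"
    unfolding saturated_def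
  proof (intro ballI impI)
    fix v assume v: "v \<in> verts \<Lambda>" and "\<exists>n. src \<Lambda> ` le_paths v n \<subseteq> cpl H"
    then obtain n where n: "src \<Lambda> ` le_paths v n \<subseteq> cpl H" by blast
    have False if u: "u \<in> tree \<Lambda> v" "u \<in> H" for u
    proof -
      obtain x where x: "x \<in> mor \<Lambda>" "rng \<Lambda> x = v" "src \<Lambda> x = u" using u by (auto simp: tree_iff)
      obtain y where y: "y \<in> le_paths u n" using le_paths_nonempty[OF src_verts[OF x(1)]] x by auto
      have ym: "y \<in> mor \<Lambda>" "rng \<Lambda> y = u" using le_paths_mor[OF y] by auto
      have "cmp \<Lambda> x y \<in> paths_le \<Lambda> (deg \<Lambda> x + n)"
        using cmp_paths_le[OF self_paths_le[OF x(1)], of y n] y ym x by (simp add: le_paths_iff)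
      then have "cmp \<Lambda> x y \<in> le_paths v (n + deg \<Lambda> x)"
        using rng_cmp[of x y] x ym by (simp add: le_paths_iff add.commute)
      then have "src \<Lambda> (cmp \<Lambda> x y) \<in> cpl H"
        using src_le_paths_mono[OF cpl_hereditary n, of "deg \<Lambda> x"] by blast
      then have "src \<Lambda> y \<in> cpl H" using src_cmp[of x y] x ym by simp
      moreover have "src \<Lambda> y \<in> H" using hereditaryD[OF assms, of y] ym u by simp
      ultimately show False using cpl_disjoint by blast
    qed
    then show "v \<in> cpl H" using v by (auto simp: cpl_iff)
  qed
  then show ?thesis using cpl_hereditary by (auto simp: sat_her_def cpl_iff)
qed

text \<open>These sets turn out to be the supports of the central projections of the multiplier algebra of
  \<open>C\<^sup>*(\<Lambda>)\<close>; they form a Boolean algebra with complement \<open>cpl\<close>.\<close>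

definition clopens :: "'a set set" where
  "clopens = {H \<in> sat_her \<Lambda>. \<forall>v\<in>verts \<Lambda>. \<exists>n. src \<Lambda> ` le_paths v n \<subseteq> H \<union> cpl H}"

lemma clopens_hereditary: "H \<in> clopens \<Longrightarrow> hereditary \<Lambda> H"
  by (simp add: clopens_def sat_her_def)

lemma clopens_verts: "H \<in> clopens \<Longrightarrow> H \<subseteq> verts \<Lambda>"
  by (simp add: clopens_def sat_her_def)

lemma clopens_saturated: "H \<in> clopens \<Longrightarrow> saturated \<Lambda> H"
  by (simp add: clopens_def sat_her_def)

lemma clopens_cover: "H \<in> clopens \<Longrightarrow> v \<in> verts \<Lambda> \<Longrightarrow> \<exists>n. src \<Lambda> ` le_paths v n \<subseteq> H \<union> cpl H"
  by (simp add: clopens_def)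

lemma subset_cpl: "hereditary \<Lambda> H \<Longrightarrow> H \<subseteq> verts \<Lambda> \<Longrightarrow> H \<inter> H' = {} \<Longrightarrow> H \<subseteq> cpl H'"
  using hereditary_tree by (fastforce simp: cpl_iff)

text \<open>A vertex of \<open>cpl (cpl H)\<close> never reaches \<open>cpl H\<close>, so its cover
  by H and \<open>cpl H\<close> lies in H, and saturation applies.\<close>

lemma cpl_cpl: assumes "H \<in> clopens" shows "cpl (cpl H) = H"
proof
  show "H \<subseteq> cpl (cpl H)"
    using assms cpl_disjoint by (intro subset_cpl) (auto dest: clopens_hereditary clopens_verts)
  show "cpl (cpl H) \<subseteq> H"
  proof
    fix v assume v: "v \<in> cpl (cpl H)"
    then have vv: "v \<in> verts \<Lambda>" by (simp add: cpl_iff)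
    obtain n where "src \<Lambda> ` le_paths v n \<subseteq> H \<union> cpl H" using clopens_cover[OF assms vv] by blast
    moreover have "src \<Lambda> ` le_paths v n \<inter> cpl H = {}"
      using v src_le_paths_tree unfolding cpl_iff[of v "cpl H"] by blast
    ultimately have "src \<Lambda> ` le_paths v n \<subseteq> H" by blast
    then show "v \<in> H" using saturatedD[OF clopens_saturated[OF assms] vv] by blast
  qed
qed

lemma cpl_clopens: assumes "H \<in> clopens" shows "cpl H \<in> clopens"
  using cpl_sat_her[OF clopens_hereditary[OF assms]] cpl_cpl[OF assms] clopens_cover[OF assms]
  by (simp add: clopens_def Un_commute)

lemma verts_clopens: "verts \<Lambda> \<in> clopens"
proof -
  have "src \<Lambda> ` le_paths v n \<subseteq> verts \<Lambda>" for v n using le_paths_mor src_verts by blast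
  then have "\<exists>n. src \<Lambda> ` le_paths v n \<subseteq> verts \<Lambda> \<union> U" for v U by blast
  moreover have "hereditary \<Lambda> (verts \<Lambda>)" using src_verts by (simp add: hereditary_def)
  moreover have "saturated \<Lambda> (verts \<Lambda>)" by (simp add: saturated_def)
  ultimately show ?thesis by (simp add: clopens_def sat_her_def)
qed

lemma Int_clopens: assumes "H \<in> clopens" "H' \<in> clopens" shows "H \<inter> H' \<in> clopens"
proof -
  have "saturated \<Lambda> (H \<inter> H')"
    unfolding saturated_def
  proof (intro ballI impI)
    fix v assume v: "v \<in> verts \<Lambda>" and "\<exists>n. src \<Lambda> ` le_paths v n \<subseteq> H \<inter> H'"
    then obtain n where "src \<Lambda> ` le_paths v n \<subseteq> H" "src \<Lambda> ` le_paths v n \<subseteq> H'" by auto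
    then show "v \<in> H \<inter> H'" using saturatedD[OF clopens_saturated v] assms by simp
  qed
  moreover have "hereditary \<Lambda> (H \<inter> H')"
    using assms[THEN clopens_hereditary] by (simp add: hereditary_def)
  ultimately have "H \<inter> H' \<in> sat_her \<Lambda>"
    using clopens_verts[OF assms(1)] by (auto simp: sat_her_def)
  moreover have "\<exists>n. src \<Lambda> ` le_paths v n \<subseteq> H \<inter> H' \<union> cpl (H \<inter> H')" if v: "v \<in> verts \<Lambda>" for v
  proof -
    obtain n n' where n: "src \<Lambda> ` le_paths v n \<subseteq> H \<union> cpl H" and n': "src \<Lambda> ` le_paths v n' \<subseteq> H' \<union> cpl H'"
      using clopens_cover v assms by meson
    \<comment> \<open>Both covers hold at the common level n + n'. An end outside the intersection
      lies in \<open>cpl H\<close> or \<open>cpl H'\<close>, and both are contained in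
      \<open>cpl (H \<inter> H')\<close>.\<close>
    have "src \<Lambda> ` le_paths v (n + n') \<subseteq> H \<union> cpl H"
      using n by (rule src_le_paths_mono[rotated]) (simp add: hereditary_Un clopens_hereditary assms
        cpl_hereditary)
    moreover have "src \<Lambda> ` le_paths v (n' + n) \<subseteq> H' \<union> cpl H'"
      using n' by (rule src_le_paths_mono[rotated]) (simp add: hereditary_Un clopens_hereditary
        assms cpl_hereditary)
    ultimately have "src \<Lambda> ` le_paths v (n + n') \<subseteq> H \<inter> H' \<union> cpl (H \<inter> H')"
      unfolding add.commute[of n'] by (fastforce simp: cpl_iff)
    then show ?thesis by blast
  qed
  ultimately show ?thesis by (simp add: clopens_def)
qed

lemma clopens_cover_within:
  assumes "H1 \<in> clopens" "H2 \<in> clopens" "v \<in> H1"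
  shows "\<exists>n. src \<Lambda> ` le_paths v n \<subseteq> (H1 \<inter> H2) \<union> (H1 \<inter> cpl H2)"
proof -
  have "v \<in> verts \<Lambda>" using clopens_verts assms by blast
  then obtain n where "src \<Lambda> ` le_paths v n \<subseteq> H2 \<union> cpl H2" using clopens_cover assms by blast
  moreover have "src \<Lambda> ` le_paths v n \<subseteq> H1" using src_le_paths_hereditary clopens_hereditary assms by blast
  ultimately show ?thesis by blast
qed

text \<open>The relation of a chain speaks about vertices of H1 only. The others are first led into
  H1 or \<open>cpl H1\<close> by the cover belonging to H1, and \<open>cpl H1\<close> is contained
  in \<open>cpl H2\<close>.\<close>

lemma chain_step_clopens:
  assumes H1: "H1 \<in> clopens" and H2: "H2 \<in> sat_her \<Lambda>" and step: "chain_step \<Lambda> H1 H2"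
  shows "H2 \<in> clopens"
proof -
  have her2: "hereditary \<Lambda> H2" using H2 by (simp add: sat_her_def)
  have D: "Delta \<Lambda> H1 H2 \<subseteq> cpl H2" using clopens_verts[OF H1] by (auto simp: Delta_def)
  have U: "hereditary \<Lambda> (H2 \<union> cpl H2)" using her2 cpl_hereditary by (rule hereditary_Un)
  have in1: "\<exists>m. src \<Lambda> ` le_paths u m \<subseteq> H2 \<union> cpl H2" if u: "u \<in> H1 \<or> u \<in> cpl H1" "u \<in> verts \<Lambda>" for u
  proof (cases "u \<in> H2 \<union> cpl H2")
    case True
    then show ?thesis using src_le_paths_hereditary[OF U] by blast
  next
    case False
    have "H2 \<subseteq> H1" using step by (simp add: chain_step_def)
    then have "cpl H1 \<subseteq> cpl H2" unfolding Delta_def by blast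
    then have "u \<in> H1" "u \<notin> H2" "tree \<Lambda> u \<inter> H2 \<noteq> {}" using False u by (auto simp: Delta_def)
    then have "u \<in> Omega \<Lambda> H1 H2" by (simp add: Omega_def)
    then have "\<exists>n. src \<Lambda> ` le_paths u n \<subseteq> H2 \<union> Delta \<Lambda> H1 H2" using step by (simp add: chain_step_def)
    then obtain n where "src \<Lambda> ` le_paths u n \<subseteq> H2 \<union> Delta \<Lambda> H1 H2" ..
    then show ?thesis using D by (intro exI[of _ n]) blast
  qed
  have "\<exists>N. src \<Lambda> ` le_paths v N \<subseteq> H2 \<union> cpl H2" if v: "v \<in> verts \<Lambda>" for v
  proof -
    obtain n where n: "src \<Lambda> ` le_paths v n \<subseteq> H1 \<union> cpl H1" using clopens_cover[OF H1 v] by blast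
    show ?thesis
      by (rule cover_compose[OF v U, of n], rule in1) (use n in \<open>auto dest: le_paths_mor simp: src_verts\<close>)
  qed
  then show ?thesis using H2 by (simp add: clopens_def)
qed

subsection \<open>Chains and partitions\<close>

text \<open>A partition of unity in \<open>clopens\<close>. A union of clopen sets need not be
  saturated, so the members exhaust the vertices only eventually along paths.\<close>

definition clopen_partition :: "'a set set \<Rightarrow> bool" where
  "clopen_partition \<A> \<longleftrightarrow> finite \<A> \<and> \<A> \<subseteq> clopens \<and> {} \<notin> \<A> \<and> disjoint \<A> \<and>
     (\<forall>v\<in>verts \<Lambda>. \<exists>n. src \<Lambda> ` le_paths v n \<subseteq> \<Union>\<A>)"

text \<open>This serves two purposes: the next term of a chain splits the current one, and a clopen
  set cutting a member of a partition of maximal size would give a larger partition.\<close>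

lemma clopen_partition_split:
  assumes \<A>: "clopen_partition \<A>" and A: "A \<in> \<A>" and H: "H \<in> clopens" and ne: "A \<inter> H \<noteq> {}" "A \<inter> cpl H \<noteq> {}"
  defines "\<B> \<equiv> insert (A \<inter> H) (insert (A \<inter> cpl H) (\<A> - {A}))"
  shows "clopen_partition \<B>" and "card \<B> = Suc (card \<A>)"
proof -
  have Ac: "A \<in> clopens" and sub: "\<A> \<subseteq> clopens" using \<A> A by (auto simp: clopen_partition_def)
  have her: "hereditary \<Lambda> (\<Union>\<B>)"
  proof (rule hereditary_Union)
    fix B assume "B \<in> \<B>"
    then consider "B = A \<inter> H" | "B = A \<inter> cpl H" | "B \<in> \<A>" by (auto simp: \<B>_def)
    then show "hereditary \<Lambda> B"
      using hereditary_Int clopens_hereditary Ac H sub cpl_hereditary by cases auto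
  qed
  have dis: "A \<inter> B = {}" if "B \<in> \<A> - {A}" for B
    using that A disjointD[of \<A> A B] \<A> by (metis DiffE clopen_partition_def insertI1)
  have cov: "\<exists>N. src \<Lambda> ` le_paths v N \<subseteq> \<Union>\<B>" if v: "v \<in> verts \<Lambda>" for v
  proof -
    obtain n where n: "src \<Lambda> ` le_paths v n \<subseteq> \<Union>\<A>" using \<A> v by (auto simp: clopen_partition_def)
    show ?thesis
    proof (rule cover_compose[OF v her, of n])
      fix x assume "x \<in> le_paths v n"
      then obtain B where "B \<in> \<A>" "src \<Lambda> x \<in> B" using n by blast
      then consider "src \<Lambda> x \<in> A" | "src \<Lambda> x \<in> \<Union>\<B>" by (cases "B = A") (auto simp: \<B>_def)
      then show "\<exists>m. src \<Lambda> ` le_paths (src \<Lambda> x) m \<subseteq> \<Union>\<B>"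
      proof cases
        case 1
        then obtain m where "src \<Lambda> ` le_paths (src \<Lambda> x) m \<subseteq> (A \<inter> H) \<union> (A \<inter> cpl H)"
          using clopens_cover_within[OF Ac H] by blast
        then show ?thesis unfolding \<B>_def by (intro exI[of _ m]) auto
      next
        case 2
        then show ?thesis using src_le_paths_hereditary[OF her] by blast
      qed
    qed
  qed
  have disj: "(A \<inter> H) \<inter> (A \<inter> cpl H) = {}" using cpl_disjoint by blast
  have "disjoint \<B>"
  proof -
    have "disjoint (\<A> - {A})" using \<A> by (auto simp: clopen_partition_def disjoint_def)
    moreover have "(A \<inter> U) \<inter> B = {}" "B \<inter> (A \<inter> U) = {}" if "B \<in> \<A> - {A}" for B U
      using dis[OF that] by blast+
    moreover have "(A \<inter> cpl H) \<inter> (A \<inter> H) = {}" using disj by blast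
    ultimately show ?thesis unfolding \<B>_def disjoint_def using disj by auto
  qed
  then show "clopen_partition \<B>"
    using \<A> Ac H ne cov cpl_clopens Int_clopens unfolding clopen_partition_def by (auto simp: \<B>_def)
  have "A \<inter> H \<notin> \<A> - {A}" "A \<inter> cpl H \<notin> \<A> - {A}" "A \<inter> H \<noteq> A \<inter> cpl H" using dis ne disj by blast+
  moreover have "finite \<A>" using \<A> by (simp add: clopen_partition_def)
  moreover have "card \<A> > 0" using A calculation by (auto simp: card_gt_0_iff)
  ultimately show "card \<B> = Suc (card \<A>)" using A by (simp add: \<B>_def card_insert_if)
qed

text \<open>The invariant that the current term is itself a member lets the next step split exactly
  this member, into the new term and the part that cannot reach it.\<close>

lemma is_chain_partition:
  assumes ch: "is_chain \<Lambda> N H" and ne: "verts \<Lambda> \<noteq> {}" and i: "1 \<le> i" "enat i \<le> N"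
  shows "H i \<in> clopens \<and> (\<exists>\<A>. clopen_partition \<A> \<and> card \<A> = i \<and> H i \<in> \<A>)"
  using i
proof (induction i rule: nat_induct_at_least)
  case base
  have "clopen_partition {verts \<Lambda>}"
    unfolding clopen_partition_def
    using verts_clopens ne src_le_paths_hereditary[OF clopens_hereditary[OF verts_clopens]] by auto
  then show ?case using ch verts_clopens by (intro conjI exI[of _ "{verts \<Lambda>}"]) (auto simp: is_chain_def)
next
  case (Suc i)
  have iN: "enat i < N" using Suc.prems by (metis Suc_ile_eq)
  then have IH: "H i \<in> clopens" "\<exists>\<A>. clopen_partition \<A> \<and> card \<A> = i \<and> H i \<in> \<A>"
    using Suc.IH by simp_all
  then obtain \<A> where \<A>: "clopen_partition \<A>" "card \<A> = i" "H i \<in> \<A>" and Hi: "H i \<in> clopens"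
    by blast
  have step: "chain_step \<Lambda> (H i) (H (Suc i))" and sh: "H (Suc i) \<in> sat_her \<Lambda>" and ne': "H (Suc i) \<noteq> {}"
    using ch iN Suc by (auto simp: is_chain_def)
  have Hs: "H (Suc i) \<in> clopens" using chain_step_clopens[OF Hi sh step] .
  have sub: "H (Suc i) \<subseteq> H i" and "Delta \<Lambda> (H i) (H (Suc i)) \<noteq> {}" using step by (auto simp: chain_step_def)
  then have "H i \<inter> cpl (H (Suc i)) \<noteq> {}" using clopens_verts[OF Hi] by (auto simp: Delta_def)
  moreover have I: "H i \<inter> H (Suc i) = H (Suc i)" using sub by blast
  ultimately have "clopen_partition (insert (H i \<inter> H (Suc i)) (insert (H i \<inter> cpl (H (Suc i))) (\<A> - {H i})))
    \<and> card (insert (H i \<inter> H (Suc i)) (insert (H i \<inter> cpl (H (Suc i))) (\<A> - {H i}))) = Suc i"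
    using clopen_partition_split[OF \<A>(1,3) Hs] ne' \<A>(2) by simp
  then show ?case using Hs I by blast
qed

text \<open>The members are given up one after another: \<open>G j\<close> is the meet of the
  complements of the first j members and still contains all later ones.\<close>

lemma partition_chain:
  assumes \<A>: "clopen_partition \<A>" and card: "card \<A> = m" and m: "m \<ge> 1"
  shows "enat m \<in> chain_lengths \<Lambda>"
proof -
  have fin: "finite \<A>" using \<A> by (simp add: clopen_partition_def)
  from ex_bij_betw_nat_finite[OF fin] obtain A where A: "bij_betw A {0..<m} \<A>" using card by auto
  have Ac: "A j \<in> clopens" "A j \<noteq> {}" if "j < m" for j
    using A \<A> that by (auto simp: clopen_partition_def bij_betw_def image_subset_iff)
  have dis: "A j \<inter> A k = {}" if "j < m" "k < m" "j \<noteq> k" for j k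
  proof -
    have "A j \<in> \<A>" "A k \<in> \<A>" "A j \<noteq> A k" using A that by (auto simp: bij_betw_def inj_on_eq_iff)
    then show ?thesis using \<A> by (auto simp: clopen_partition_def disjoint_def)
  qed
  define G where "G j = {v\<in>verts \<Lambda>. \<forall>k<j. v \<in> cpl (A k)}" for j
  have GS: "G (Suc j) = G j \<inter> cpl (A j)" for j by (auto simp: G_def less_Suc_eq cpl_iff)
  have Gc: "G j \<in> clopens" if "j \<le> m" for j
    using that
  proof (induction j)
    case 0 show ?case using verts_clopens by (simp add: G_def)
  next
    case (Suc j) then show ?case unfolding GS by (simp add: Int_clopens cpl_clopens Ac)
  qed
  have AG: "A k \<subseteq> G j" if "j \<le> k" "k < m" for j k
  proof -
    have "A k \<subseteq> cpl (A l)" if "l < j" for l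
      using subset_cpl[of "A k" "A l"] Ac[of k] dis[of k l] \<open>j \<le> k\<close> \<open>k < m\<close> that
      by (simp add: clopens_hereditary clopens_verts)
    then show ?thesis using clopens_verts[OF Ac(1)[of k]] that by (auto simp: G_def)
  qed
  \<comment> \<open>The member \<open>A j\<close> makes the Delta set nonempty: it lies in
    \<open>G j\<close> and, being disjoint from \<open>G (Suc j)\<close> and hereditary, cannot
    reach it.\<close>
  have step: "chain_step \<Lambda> (G j) (G (Suc j))" if j: "j < m" for j
  proof -
    have D: "Delta \<Lambda> (G j) (G (Suc j)) = G j \<inter> cpl (G (Suc j))" by (auto simp: Delta_def G_def)
    have "A j \<inter> G (Suc j) = {}" using GS cpl_disjoint by blast
    then have "A j \<subseteq> cpl (G (Suc j))"
      using subset_cpl[of "A j" "G (Suc j)"] Ac[OF j] clopens_hereditary clopens_verts by blast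
    then have "Delta \<Lambda> (G j) (G (Suc j)) \<noteq> {}" using D AG[of j j] Ac[OF j] j by auto
    moreover have "\<exists>n. src \<Lambda> ` le_paths v n \<subseteq> G (Suc j) \<union> Delta \<Lambda> (G j) (G (Suc j))"
      if "v \<in> Omega \<Lambda> (G j) (G (Suc j))" for v
      using clopens_cover_within[OF Gc[of j] Gc[of "Suc j"], of v] j that GS[of j] D
      by (fastforce simp: Omega_def)
    moreover have "G (Suc j) \<subseteq> G j" using GS by blast
    ultimately show ?thesis by (simp add: chain_step_def)
  qed
  \<comment> \<open>Chains are indexed from 1. The last term is \<open>G (m - 1)\<close>, which
    contains the nonempty \<open>A (m - 1)\<close>; \<open>G m\<close> is left out.\<close>
  have "is_chain \<Lambda> (enat m) (\<lambda>i. G (i - 1))"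
    unfolding is_chain_def
  proof (intro conjI allI impI)
    show "1 \<le> enat m" using m by (simp add: one_enat_def)
    show "G (1 - 1) = verts \<Lambda>" by (simp add: G_def)
    fix i :: nat
    { assume "1 \<le> i" "enat i \<le> enat m"
      then show "G (i - 1) \<in> sat_her \<Lambda>" using Gc[of "i - 1"] by (simp add: clopens_def) }
    { assume i: "2 \<le> i" "enat i \<le> enat m"
      then have "A (i - 1) \<subseteq> G (i - 1)" "A (i - 1) \<noteq> {}" using AG[of "i - 1" "i - 1"] Ac[of "i - 1"] by simp_all
      then show "G (i - 1) \<noteq> {}" by blast }
    { assume i: "1 \<le> i" "enat i < enat m"
      then show "chain_step \<Lambda> (G (i - 1)) (G (Suc i - 1))" using step[of "i - 1"] by simp }
  qed
  then show ?thesis by (auto simp: chain_lengths_def)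
qed

text \<open>The atoms of \<open>clopens\<close>, numbered from 0. As for decompositions, empty
  members are excluded only from n = 2 on, so that the empty graph has a family with n = 1.\<close>

definition atomic_family :: "nat \<Rightarrow> (nat \<Rightarrow> 'a set) \<Rightarrow> bool" where
  "atomic_family n A \<longleftrightarrow> (\<forall>i<n. A i \<in> clopens) \<and> (\<forall>i<n. \<forall>j<n. i \<noteq> j \<longrightarrow> A i \<inter> A j = {}) \<and>
     (\<forall>v\<in>verts \<Lambda>. \<exists>m. src \<Lambda> ` le_paths v m \<subseteq> (\<Union>i<n. A i)) \<and>
     (\<forall>i<n. \<forall>H\<in>clopens. A i \<inter> H = {} \<or> A i \<subseteq> H) \<and> (n \<ge> 2 \<longrightarrow> (\<forall>i<n. A i \<noteq> {}))"

lemma atomic_familyD: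
  assumes "atomic_family n A"
  shows "i < n \<Longrightarrow> A i \<in> clopens" "i < n \<Longrightarrow> j < n \<Longrightarrow> i \<noteq> j \<Longrightarrow> A i \<inter> A j = {}"
    "v \<in> verts \<Lambda> \<Longrightarrow> \<exists>m. src \<Lambda> ` le_paths v m \<subseteq> (\<Union>i<n. A i)"
    "i < n \<Longrightarrow> H \<in> clopens \<Longrightarrow> A i \<inter> H \<noteq> {} \<Longrightarrow> A i \<subseteq> H" "n \<ge> 2 \<Longrightarrow> i < n \<Longrightarrow> A i \<noteq> {}"
  using assms unfolding atomic_family_def by meson+

lemma atomic_family_1: assumes "atomic_family 1 A" shows "A 0 = verts \<Lambda>"
proof
  show "A 0 \<subseteq> verts \<Lambda>" using assms by (auto simp: atomic_family_def dest: clopens_verts)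
  show "verts \<Lambda> \<subseteq> A 0"
  proof
    fix v assume v: "v \<in> verts \<Lambda>"
    then obtain m where "src \<Lambda> ` le_paths v m \<subseteq> A 0"
      using assms by (force simp: atomic_family_def lessThan_Suc One_nat_def)
    then show "v \<in> A 0" using saturatedD[OF clopens_saturated v] assms by (auto simp: atomic_family_def)
  qed
qed

lemma empty_verts_chain: assumes "verts \<Lambda> = {}" "enat m \<in> chain_lengths \<Lambda>" "m \<ge> 1" shows "m = 1"
proof (rule ccontr)
  assume "m \<noteq> 1"
  then have m: "m \<ge> 2" using assms by simp
  obtain H where H: "is_chain \<Lambda> (enat m) H" using assms by (auto simp: chain_lengths_def)
  have "H 2 \<in> sat_her \<Lambda>" "H 2 \<noteq> {}" using H m by (auto simp: is_chain_def)
  then show False using assms by (auto simp: sat_her_def)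
qed

lemma max_chain_atomic_family:
  assumes n: "n \<ge> 1" "enat n \<in> chain_lengths \<Lambda>" and max: "\<forall>l\<in>chain_lengths \<Lambda>. l \<le> enat n"
  shows "\<exists>A. atomic_family n A"
proof (cases "verts \<Lambda> = {}")
  case True
  then have n1: "n = 1" using empty_verts_chain n by blast
  have "{} \<in> clopens" using verts_clopens True by simp
  then have "atomic_family 1 (\<lambda>_. {})" using True by (auto simp: atomic_family_def)
  then show ?thesis using n1 by blast
next
  case False
  obtain H where H: "is_chain \<Lambda> (enat n) H" using n by (auto simp: chain_lengths_def)
  obtain \<A> where \<A>: "clopen_partition \<A>" "card \<A> = n"
    using is_chain_partition[OF H False n(1)] by auto
  have fin: "finite \<A>" using \<A> by (simp add: clopen_partition_def)
  from ex_bij_betw_nat_finite[OF fin] obtain A where A: "bij_betw A {..<n} \<A>"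
    using \<A>(2) by (auto simp: atLeast0LessThan)
  have mem: "A i \<in> \<A>" if "i < n" for i using A that by (auto simp: bij_betw_def)
  \<comment> \<open>A clopen set that properly cuts \<open>A i\<close> would refine the partition to
    n + 1 members and so produce a chain longer than the maximum.\<close>
  have atom: "A i \<inter> H = {} \<or> A i \<subseteq> H" if i: "i < n" and H: "H \<in> clopens" for i H
  proof (rule ccontr)
    assume c: "\<not> ?thesis"
    then obtain v where v: "v \<in> A i" "v \<notin> H" by blast
    have Ai: "A i \<in> clopens" using mem[OF i] \<A> by (auto simp: clopen_partition_def)
    \<comment> \<open>Since \<open>cpl\<close> is an involution on \<open>clopens\<close>, a vertex
      outside H reaches \<open>cpl H\<close>, and heredity keeps the point reached in
      \<open>A i\<close>.\<close>
    have "v \<notin> cpl (cpl H)" using cpl_cpl[OF H] v by simp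
    then have "tree \<Lambda> v \<inter> cpl H \<noteq> {}" using v clopens_verts[OF Ai] by (auto simp: cpl_iff)
    then have "A i \<inter> cpl H \<noteq> {}" using hereditary_tree[OF clopens_hereditary[OF Ai] v(1)] by blast
    from clopen_partition_split[OF \<A>(1) mem[OF i] H _ this] c
    have "enat (Suc n) \<in> chain_lengths \<Lambda>" using \<A>(2) by (intro partition_chain) auto
    then show False using max by force
  qed
  have "A i \<inter> A j = {}" if "i < n" "j < n" "i \<noteq> j" for i j
  proof -
    have "A i \<noteq> A j" using A that by (auto simp: bij_betw_def inj_on_eq_iff)
    then show ?thesis using \<A> mem[OF that(1)] mem[OF that(2)] by (auto simp: clopen_partition_def disjoint_def)
  qed
  moreover have "\<Union>\<A> = (\<Union>i<n. A i)" using A by (auto simp: bij_betw_def)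
  moreover have "A i \<noteq> {}" "A i \<in> clopens" if "i < n" for i
    using mem[OF that] \<A> by (auto simp: clopen_partition_def)
  ultimately have "atomic_family n A"
    using \<A>(1) atom unfolding atomic_family_def clopen_partition_def by simp
  then show ?thesis by blast
qed

lemma atomic_family_chain_length:
  assumes A: "atomic_family n A" and n: "n \<ge> 1"
  shows "enat n \<in> chain_lengths \<Lambda>"
proof (cases "verts \<Lambda> = {}")
  case True
  have "n = 1"
  proof (rule ccontr)
    assume "n \<noteq> 1"
    then have "A 0 \<in> clopens" "A 0 \<noteq> {}" using A n by (auto simp: atomic_family_def)
    then show False using True clopens_verts by blast
  qed
  moreover have "is_chain \<Lambda> 1 (\<lambda>_. verts \<Lambda>)"
    using verts_clopens True by (auto simp: is_chain_def clopens_def one_enat_def)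
  ultimately show ?thesis by (auto simp: chain_lengths_def one_enat_def)
next
  case False
  have ne: "A i \<noteq> {}" if "i < n" for i
  proof (cases "n = 1")
    case True then show ?thesis using atomic_family_1 A False that by auto
  next
    case n1: False then show ?thesis using A n that by (auto simp: atomic_family_def)
  qed
  have inj: "inj_on A {..<n}"
  proof (rule inj_onI)
    fix i j assume "i \<in> {..<n}" "j \<in> {..<n}" "A i = A j"
    then show "i = j" using atomic_familyD(2)[OF A, of i j] ne[of i] by auto
  qed
  have "clopen_partition (A ` {..<n})"
    unfolding clopen_partition_def
  proof (intro conjI)
    show "disjoint (A ` {..<n})"
      by (rule disjointI) (use atomic_familyD(2)[OF A] in blast)
    show "{} \<notin> A ` {..<n}" using ne by (metis imageE lessThan_iff)
  qed (use atomic_familyD(1,3)[OF A] in auto)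
  moreover have "card (A ` {..<n}) = n" using card_image[OF inj] by simp
  ultimately show ?thesis using partition_chain n by blast
qed

text \<open>Each step of a chain loses an atom: a vertex of the Delta set reaches some atom, which
  then lies in the larger term but not in the smaller one. A nonempty clopen set contains an atom,
  so n + 1 nonempty terms are too many.\<close>

lemma atomic_family_chain_bound:
  assumes A: "atomic_family n A" and n: "n \<ge> 1" and l: "l \<in> chain_lengths \<Lambda>"
  shows "l \<le> enat n"
proof (rule ccontr)
  assume "\<not> l \<le> enat n"
  then have nl: "enat (Suc n) \<le> l" by (simp add: Suc_ile_eq)
  obtain H where H: "is_chain \<Lambda> l H" using l by (auto simp: chain_lengths_def)
  have H2: "H i \<in> sat_her \<Lambda>" "H i \<noteq> {}" if "2 \<le> i" "i \<le> Suc n" for i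
  proof -
    have "enat i \<le> l" using that nl by (meson enat_ord_simps(1) order_trans)
    then show "H i \<in> sat_her \<Lambda>" "H i \<noteq> {}" using H that by (auto simp: is_chain_def)
  qed
  have ne: "verts \<Lambda> \<noteq> {}" using H2[of 2] n by (auto simp: sat_her_def)
  have Hc: "H i \<in> clopens" if "1 \<le> i" "i \<le> Suc n" for i
  proof -
    have "enat i \<le> l" using that nl by (meson enat_ord_simps(1) order_trans)
    then show ?thesis using is_chain_partition[OF H ne that(1)] by blast
  qed
  have meet: "\<exists>j<n. tree \<Lambda> v \<inter> A j \<noteq> {}" if v: "v \<in> verts \<Lambda>" for v
  proof -
    obtain m where m: "src \<Lambda> ` le_paths v m \<subseteq> (\<Union>i<n. A i)" using A v by (auto simp: atomic_family_def)
    obtain x where "x \<in> le_paths v m" using le_paths_nonempty[OF v] by blast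
    then show ?thesis using m src_le_paths_tree[of v m] by blast
  qed
  define S where "S i = {j. j < n \<and> A j \<subseteq> H i}" for i
  have fS: "finite (S i)" for i by (simp add: S_def)
  have less: "card (S (Suc i)) < card (S i)" if i: "1 \<le> i" "i \<le> n" for i
  proof (rule psubset_card_mono[OF fS])
    have "enat i < l" using i nl by (meson Suc_ile_eq Suc_le_mono enat_ord_simps(1) order_trans)
    then have step: "chain_step \<Lambda> (H i) (H (Suc i))" using H i by (auto simp: is_chain_def)
    then have sub: "H (Suc i) \<subseteq> H i" by (simp add: chain_step_def)
    obtain v where v: "v \<in> H i" "tree \<Lambda> v \<inter> H (Suc i) = {}" using step by (auto simp: chain_step_def Delta_def)
    have Hi: "H i \<in> clopens" using Hc i by simp
    have "v \<in> verts \<Lambda>" using clopens_verts[OF Hi] v(1) by blast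
    then obtain j u where j: "j < n" and u: "u \<in> tree \<Lambda> v" "u \<in> A j" using meet by blast
    have "u \<in> H i" using hereditary_tree[OF clopens_hereditary[OF Hi] v(1)] u by blast
    then have "A j \<subseteq> H i" using atomic_familyD(4)[OF A j Hi] u by blast
    moreover have "\<not> A j \<subseteq> H (Suc i)" using u v by blast
    ultimately show "S (Suc i) \<subset> S i" using sub j unfolding S_def by blast
  qed
  \<comment> \<open>Terms are indexed from 1, so the term reached after i steps is
    \<open>H (Suc i)\<close>.\<close>
  have "i \<le> n \<Longrightarrow> i + card (S (Suc i)) \<le> n" for i
  proof (induction i)
    case 0
    have "card (S (Suc 0)) \<le> card {..<n}" by (rule card_mono) (auto simp: S_def)
    then show ?case by simp
  next
    case (Suc i) then show ?case using less[of "Suc i"] by simp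
  qed
  from this[of n] have "card (S (Suc n)) = 0" by simp
  then have S0: "S (Suc n) = {}" using fS by simp
  obtain v where v: "v \<in> H (Suc n)" using H2[of "Suc n"] n by auto
  have c: "H (Suc n) \<in> clopens" using Hc by simp
  then obtain j where "j < n" "tree \<Lambda> v \<inter> A j \<noteq> {}" using meet v clopens_verts by blast
  then have "A j \<inter> H (Suc n) \<noteq> {}" using hereditary_tree[OF clopens_hereditary[OF c] v] by blast
  then have "j \<in> S (Suc n)" using atomic_familyD(4)[OF A \<open>j < n\<close> c] \<open>j < n\<close> by (simp add: S_def)
  then show False using S0 by simp
qed

text \<open>Any vertex of \<open>B i\<close> reaches some \<open>A j\<close>; the two atoms meet and
  hence contain each other. For n = 1 both families consist of the whole vertex set, which may be
  empty.\<close>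

lemma atomic_family_unique:
  assumes A: "atomic_family n A" and B: "atomic_family n B" and n: "n \<ge> 1"
  shows "\<exists>\<sigma>. \<sigma> permutes {..<n} \<and> (\<forall>i<n. B i = A (\<sigma> i))"
proof (cases "n = 1")
  case True
  then show ?thesis using A B atomic_family_1 by (intro exI[of _ id]) (auto simp: permutes_id)
next
  case False
  then have ne: "\<forall>i<n. A i \<noteq> {}" "\<forall>i<n. B i \<noteq> {}" using A B n by (auto simp: atomic_family_def)
  have "\<exists>j<n. B i = A j" if i: "i < n" for i
  proof -
    obtain v where v: "v \<in> B i" using ne i by blast
    have Bi: "B i \<in> clopens" using B i by (auto simp: atomic_family_def)
    then have vv: "v \<in> verts \<Lambda>" using clopens_verts v by blast
    obtain m where m: "src \<Lambda> ` le_paths v m \<subseteq> (\<Union>i<n. A i)" using atomic_familyD(3)[OF A vv] by blast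
    obtain x where "x \<in> le_paths v m" using le_paths_nonempty[OF vv] by blast
    then obtain j where j: "j < n" "src \<Lambda> x \<in> A j" "src \<Lambda> x \<in> B i"
      using m src_le_paths_hereditary[OF clopens_hereditary[OF Bi] v, of m] by blast
    then have "A j \<subseteq> B i" "B i \<subseteq> A j"
      using atomic_familyD(4)[OF A j(1) Bi] atomic_familyD(4)[OF B i atomic_familyD(1)[OF A j(1)]] by blast+
    then show ?thesis using j by blast
  qed
  then obtain \<sigma> where \<sigma>: "\<And>i. i < n \<Longrightarrow> \<sigma> i < n \<and> B i = A (\<sigma> i)" by metis
  have "inj_on \<sigma> {..<n}"
  proof (rule inj_onI)
    fix i j assume ij: "i \<in> {..<n}" "j \<in> {..<n}" "\<sigma> i = \<sigma> j"
    then have "B i = B j" using \<sigma> by simp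
    then show "i = j" using atomic_familyD(2)[OF B, of i j] ne ij by auto
  qed
  then have "bij_betw \<sigma> {..<n} {..<n}"
    using \<sigma> by (intro bij_betw_imageI endo_inj_surj) auto
  then have "(\<lambda>i. if i \<in> {..<n} then \<sigma> i else i) permutes {..<n}"
    by (intro bij_imp_permutes) (auto simp: bij_betw_def inj_on_def image_iff)
  then show ?thesis using \<sigma> by (intro exI[of _ "\<lambda>i. if i \<in> {..<n} then \<sigma> i else i"]) auto
qed

end


section \<open>The free *-algebra and its Cuntz-Krieger seminorms\<close>

subsection \<open>The free star algebra\<close>

type_synonym 'a falg = "'a star_word \<Rightarrow>\<^sub>0 complex"

abbreviation lookup :: "('a \<Rightarrow>\<^sub>0 'b::zero) \<Rightarrow> 'a \<Rightarrow> 'b" where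
  "lookup \<equiv> Poly_Mapping.lookup"

abbreviation keys :: "('a \<Rightarrow>\<^sub>0 'b::zero) \<Rightarrow> 'a set" where
  "keys \<equiv> Poly_Mapping.keys"

text \<open>Scalars are multiples of the empty word, which turns scalar multiplication into a
  product with a central element. Nonzero ones lie outside the nonunital carrier.\<close>

abbreviation scal :: "complex \<Rightarrow> 'a falg" where
  "scal c \<equiv> Poly_Mapping.single 0 c"

lemma letters_zero [simp]: "letters 0 = []"
  by (simp add: zero_star_word_def)

lemma letters_plus [simp]: "letters (u + v) = letters u @ letters v"
  by (simp add: plus_star_word_def)

lemma star_word_eq_iff: "u = v \<longleftrightarrow> letters u = letters v"
  by (cases u; cases v) simp

lemma word_adj_plus: "word_adj (u + v) = word_adj v + word_adj u"
  by (simp add: word_adj_def star_word_eq_iff)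

lemma word_adj_word_adj [simp]: "word_adj (word_adj w) = w"
  by (simp add: word_adj_def star_word_eq_iff rev_map comp_def case_prod_unfold)

lemma word_adj_zero [simp]: "word_adj 0 = 0"
  by (simp add: word_adj_def star_word_eq_iff)

lemma inj_word_adj [simp]: "inj word_adj"
  by (metis injI word_adj_word_adj)

lemma bij_word_adj: "bij word_adj"
  by (rule o_bij[of word_adj]) (simp_all add: fun_eq_iff)

lemma inv_word_adj: "inv word_adj = word_adj"
  by (rule inv_equality) simp_all

lemma lookup_free_adj: "lookup (free_adj f) w = cnj (lookup f (word_adj w))"
  by (simp add: free_adj_def Poly_Mapping.map.rep_eq map_key.rep_eq when_def)

lemma poly_mapping_sum_single: "(f :: 'a \<Rightarrow>\<^sub>0 'b::comm_monoid_add)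
  = (\<Sum>w\<in>keys f. Poly_Mapping.single w (lookup f w))"
  by (rule poly_mapping_eqI) (simp add: lookup_sum lookup_single when_def in_keys_iff)

lemma falg_induct [case_names single add]:
  fixes f :: "'a falg"
  assumes single: "\<And>w c. P (Poly_Mapping.single w c)" and add: "\<And>f g. P f \<Longrightarrow> P g \<Longrightarrow> P (f + g)"
  shows "P f"
proof -
  have "P (\<Sum>w\<in>S. Poly_Mapping.single w (lookup f w))" if "finite S" for S
    using that
  proof (induction S)
    case empty show ?case using single[of 0 0] by simp
  next
    case (insert w S) then show ?case using single add by simp
  qed
  from this[of "keys f"] show ?thesis by (simp flip: poly_mapping_sum_single)
qed

lemma free_adj_zero [simp]: "free_adj 0 = 0"
  by (rule poly_mapping_eqI) (simp add: lookup_free_adj)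

lemma free_adj_add: "free_adj (f + g) = free_adj f + free_adj g"
  by (rule poly_mapping_eqI) (simp add: lookup_free_adj lookup_add)

lemma free_adj_diff: "free_adj (f - g) = free_adj f - free_adj g"
  by (rule poly_mapping_eqI) (simp add: lookup_free_adj lookup_minus)

lemma free_adj_sum: "free_adj (sum f S) = (\<Sum>x\<in>S. free_adj (f x))"
  by (induction S rule: infinite_finite_induct) (simp_all add: free_adj_add)

lemma free_adj_single: "free_adj (Poly_Mapping.single w c) = Poly_Mapping.single (word_adj w) (cnj c)"
  by (rule poly_mapping_eqI) (auto simp: lookup_free_adj lookup_single when_def)

lemma free_adj_free_adj [simp]: "free_adj (free_adj f) = f"
  by (rule poly_mapping_eqI) (simp add: lookup_free_adj)

lemma free_adj_mult: "free_adj (f * g) = free_adj g * free_adj f"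
proof (induction f rule: falg_induct)
  case (single w c)
  show ?case
    by (induction g rule: falg_induct) (simp_all add: mult_single free_adj_single word_adj_plus
      distrib_left distrib_right free_adj_add mult.commute)
next
  case (add f f') then show ?case by (simp add: distrib_left distrib_right free_adj_add)
qed

lemma scal_commute: "f * scal c = scal c * f"
  by (induction f rule: falg_induct) (simp_all add: mult_single distrib_left distrib_right mult.commute)

lemma mult_scal: "f * (scal c * g) = scal c * (f * g)"
  by (metis mult.assoc scal_commute)

lemma scal_scal: "scal c * (scal d * f) = scal (c * d) * f"
  by (simp add: mult_single flip: mult.assoc)

lemma free_adj_scal: "free_adj (scal c * f) = scal (cnj c) * free_adj f"
  by (simp add: free_adj_mult free_adj_single scal_commute)

lemma keys_free_adj: "keys (free_adj f) = word_adj ` keys f"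
proof -
  have "w \<in> keys (free_adj f) \<longleftrightarrow> word_adj w \<in> keys f" for w by (simp add: in_keys_iff lookup_free_adj)
  then have "keys (free_adj f) = word_adj -` keys f" by blast
  then show ?thesis by (simp add: bij_vimage_eq_inv_image[OF bij_word_adj] inv_word_adj)
qed

text \<open>The carrier of \<open>free_star_algebra\<close>, stated without reference to a
  seminorm.\<close>

definition fcarr :: "('a, 'k::finite) kgraph \<Rightarrow> 'a falg set" where
  "fcarr \<Lambda> = {f. \<forall>w \<in> keys f. w \<noteq> 0 \<and> fst ` set (letters w) \<subseteq> mor \<Lambda>}"

lemma fcarr_zero [simp, intro]: "0 \<in> fcarr \<Lambda>"
  by (simp add: fcarr_def)

lemma fcarr_add [intro]: "f \<in> fcarr \<Lambda> \<Longrightarrow> g \<in> fcarr \<Lambda> \<Longrightarrow> f + g \<in> fcarr \<Lambda>"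
  using Poly_Mapping.keys_add[of f g] by (auto simp: fcarr_def)

lemma fcarr_uminus [intro]: "f \<in> fcarr \<Lambda> \<Longrightarrow> - f \<in> fcarr \<Lambda>"
  by (simp add: fcarr_def in_keys_iff)

lemma fcarr_diff [intro]: "f \<in> fcarr \<Lambda> \<Longrightarrow> g \<in> fcarr \<Lambda> \<Longrightarrow> f - g \<in> fcarr \<Lambda>"
  using fcarr_add[of f \<Lambda> "- g"] fcarr_uminus[of g \<Lambda>] by simp

lemma fcarr_sum [intro]: "(\<And>x. x \<in> S \<Longrightarrow> f x \<in> fcarr \<Lambda>) \<Longrightarrow> sum f S \<in> fcarr \<Lambda>"
  by (induction S rule: infinite_finite_induct) auto

lemma fcarr_mult [intro]: "f \<in> fcarr \<Lambda> \<Longrightarrow> g \<in> fcarr \<Lambda> \<Longrightarrow> f * g \<in> fcarr \<Lambda>"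
  using Poly_Mapping.keys_mult[of f g] by (fastforce simp: fcarr_def star_word_eq_iff)

lemma fcarr_scal [intro]: "f \<in> fcarr \<Lambda> \<Longrightarrow> scal c * f \<in> fcarr \<Lambda>"
  using Poly_Mapping.keys_mult[of "scal c" f] by (fastforce simp: fcarr_def split: if_splits)

lemma fcarr_free_adj [intro]: "f \<in> fcarr \<Lambda> \<Longrightarrow> free_adj f \<in> fcarr \<Lambda>"
  by (fastforce simp: fcarr_def keys_free_adj word_adj_def star_word_eq_iff)

lemma fcarr_gen [intro]: "x \<in> mor \<Lambda> \<Longrightarrow> gen x \<in> fcarr \<Lambda>"
  by (simp add: fcarr_def gen_def star_word_eq_iff)

lemma free_star_algebra_sel [simp]:
  "carr (free_star_algebra \<Lambda> p) = fcarr \<Lambda>" "zer (free_star_algebra \<Lambda> p) = 0"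
  "pls (free_star_algebra \<Lambda> p) = (+)" "smul (free_star_algebra \<Lambda> p) c f = scal c * f"
  "tim (free_star_algebra \<Lambda> p) = (*)" "adj (free_star_algebra \<Lambda> p) = free_adj"
  "nrm (free_star_algebra \<Lambda> p) = p"
  by (simp_all add: free_star_algebra_def fcarr_def mult_map_scale_conv_mult)

lemma sub_free_star_algebra [simp]: "sub (free_star_algebra \<Lambda> p) f g = f - g"
  by (simp add: sub_def single_uminus)

lemma star_algebra_free: "star_algebra (free_star_algebra \<Lambda> p)"
proof (unfold_locales, goal_cases)
  case (18 x y c)
  show ?case by (simp add: mult_scal)
next
  case (21 x c)
  show ?case by (simp add: free_adj_scal)
qed (auto simp: free_adj_add free_adj_mult free_adj_scal single_add scal_scal algebra_simps)

subsection \<open>Homomorphisms given on generators\<close>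

definition letter_hom :: "('a \<Rightarrow> 'b falg) \<Rightarrow> 'a \<times> bool \<Rightarrow> 'b falg" where
  "letter_hom b l = (if snd l then free_adj (b (fst l)) else b (fst l))"

definition word_hom :: "('a \<Rightarrow> 'b falg) \<Rightarrow> ('a \<times> bool) list \<Rightarrow> 'b falg" where
  "word_hom b w = prod_list (map (letter_hom b) w)"

text \<open>The extension of an assignment on generators to the free *-algebra. Gauge automorphisms,
  quotient maps and the cutting by central projections all have this form.\<close>

definition free_hom :: "('a \<Rightarrow> 'b falg) \<Rightarrow> 'a falg \<Rightarrow> 'b falg" where
  "free_hom b f = (\<Sum>w\<in>keys f. scal (lookup f w) * word_hom b (letters w))"

lemma word_hom_append: "word_hom b (u @ v) = word_hom b u * word_hom b v"
  by (simp add: word_hom_def)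

lemma word_hom_word_adj: "word_hom b (letters (word_adj w)) = free_adj (word_hom b (letters w))"
proof -
  have "word_hom b (rev (map (\<lambda>(x, t). (x, \<not> t)) l)) = free_adj (word_hom b l)" for l
  proof (induction l)
    case Nil show ?case by (simp add: word_hom_def free_adj_single flip: single_one)
  next
    case (Cons a l)
    have "letter_hom b (case a of (x, t) \<Rightarrow> (x, \<not> t)) = free_adj (letter_hom b a)"
      by (simp add: letter_hom_def case_prod_unfold)
    then show ?case using Cons by (simp add: word_hom_def free_adj_mult)
  qed
  then show ?thesis by (simp add: word_adj_def)
qed

lemma free_hom_single: "free_hom b (Poly_Mapping.single w c) = scal c * word_hom b (letters w)"
  by (simp add: free_hom_def)

lemma free_hom_add: "free_hom b (f + g) = free_hom b f + free_hom b g"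
  unfolding free_hom_def by (rule setsum_keys_plus_distrib) (simp_all add: single_add distrib_right)

lemma free_hom_zero [simp]: "free_hom b 0 = 0"
  by (simp add: free_hom_def)

lemma free_hom_uminus: "free_hom b (- f) = - free_hom b f"
  using free_hom_add[of b f "- f"] by (simp add: add_eq_0_iff)

lemma free_hom_diff: "free_hom b (f - g) = free_hom b f - free_hom b g"
  using free_hom_add[of b f "- g"] by (simp add: free_hom_uminus)

lemma free_hom_sum: "free_hom b (sum f S) = (\<Sum>x\<in>S. free_hom b (f x))"
  by (induction S rule: infinite_finite_induct) (simp_all add: free_hom_add)

lemma free_hom_mult: "free_hom b (f * g) = free_hom b f * free_hom b g"
proof (induction f rule: falg_induct)
  case (single w c)
  show ?case
  proof (induction g rule: falg_induct)
    case (single v d)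
    let ?w = "word_hom b (letters w)" and ?v = "word_hom b (letters v)"
    have "scal (c * d) * (?w * ?v) = scal c * (?w * (scal d * ?v))"
      by (simp only: mult_scal[of ?w] scal_scal)
    then show ?case
      by (simp add: mult_single free_hom_single word_hom_append mult.assoc)
  qed (simp add: free_hom_add distrib_left)
qed (simp add: free_hom_add distrib_right)

lemma free_hom_scal: "free_hom b (scal c * f) = scal c * free_hom b f"
  by (simp add: free_hom_mult free_hom_single word_hom_def)

lemma free_hom_free_adj: "free_hom b (free_adj f) = free_adj (free_hom b f)"
  by (induction f rule: falg_induct)
    (simp_all add: free_adj_single free_hom_single word_hom_word_adj free_adj_scal free_adj_add free_hom_add)

lemma free_hom_gen [simp]: "free_hom b (gen x) = b x"
  by (simp add: gen_def free_hom_single word_hom_def letter_hom_def)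

lemma fcarr_letter_hom: "b (fst l) \<in> fcarr \<Gamma> \<Longrightarrow> letter_hom b l \<in> fcarr \<Gamma>"
  by (auto simp: letter_hom_def)

lemma fcarr_word_hom:
  "w \<noteq> [] \<Longrightarrow> (\<And>x. x \<in> fst ` set w \<Longrightarrow> b x \<in> fcarr \<Gamma>) \<Longrightarrow> word_hom b w \<in> fcarr \<Gamma>"
proof (induction w)
  case (Cons l w)
  then show ?case by (cases "w = []") (auto simp: word_hom_def fcarr_letter_hom)
qed simp

lemma fcarr_free_hom:
  assumes "f \<in> fcarr \<Lambda>" "\<And>x. x \<in> mor \<Lambda> \<Longrightarrow> b x \<in> fcarr \<Gamma>"
  shows "free_hom b f \<in> fcarr \<Gamma>"
  unfolding free_hom_def
proof (intro fcarr_sum fcarr_scal fcarr_word_hom)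
  fix w x assume w: "w \<in> keys f"
  then show "letters w \<noteq> []" using assms(1) by (auto simp: fcarr_def star_word_eq_iff)
  assume "x \<in> fst ` set (letters w)"
  then have "x \<in> mor \<Lambda>" using w assms(1) by (auto simp: fcarr_def)
  then show "b x \<in> fcarr \<Gamma>" by (rule assms(2))
qed

lemma word_hom_gen: "word_hom gen w = Poly_Mapping.single (Star_Word w) 1"
proof -
  have "letter_hom gen l = Poly_Mapping.single (Star_Word [l]) 1" for l :: "'a \<times> bool"
    by (cases l) (auto simp: letter_hom_def gen_def free_adj_single word_adj_def)
  then show ?thesis
    by (induction w) (simp_all add: word_hom_def mult_single plus_star_word_def flip: zero_star_word_def)
qed

lemma fcarr_induct [consumes 1, case_names zero word add]:
  assumes f: "f \<in> fcarr \<Lambda>" and "P 0"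
    and word: "\<And>w c. w \<noteq> [] \<Longrightarrow> fst ` set w \<subseteq> mor \<Lambda> \<Longrightarrow> P (scal c * word_hom gen w)"
    and add: "\<And>f g. f \<in> fcarr \<Lambda> \<Longrightarrow> g \<in> fcarr \<Lambda> \<Longrightarrow> P f \<Longrightarrow> P g \<Longrightarrow> P (f + g)"
  shows "P f"
proof -
  have "P (\<Sum>w\<in>S. scal (lookup f w) * word_hom gen (letters w)) \<and>
      (\<Sum>w\<in>S. scal (lookup f w) * word_hom gen (letters w)) \<in> fcarr \<Lambda>" if "finite S" "S \<subseteq> keys f" for S
    using that
  proof (induction S)
    case empty show ?case using \<open>P 0\<close> by simp
  next
    case (insert w S)
    have w: "letters w \<noteq> []" "fst ` set (letters w) \<subseteq> mor \<Lambda>"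
      using insert.prems f by (auto simp: fcarr_def star_word_eq_iff)
    moreover have "scal (lookup f w) * word_hom gen (letters w) \<in> fcarr \<Lambda>"
      using w by (intro fcarr_scal fcarr_word_hom) auto
    ultimately show ?case using insert word[of "letters w" "lookup f w"] add by auto
  qed
  from this[of "keys f"] have "P (\<Sum>w\<in>keys f. scal (lookup f w) * word_hom gen (letters w))" by simp
  then show ?thesis by (simp add: word_hom_gen mult_single flip: poly_mapping_sum_single)
qed

lemma letter_hom_comp: "free_hom b (letter_hom a l) = letter_hom (\<lambda>x. free_hom b (a x)) l"
  by (simp add: letter_hom_def free_hom_free_adj)

lemma free_hom_one [simp]: "free_hom b 1 = 1"
  using free_hom_single[of b 0 1] by (simp add: word_hom_def)

lemma free_hom_word_hom: "free_hom b (word_hom a w) = word_hom (\<lambda>x. free_hom b (a x)) w"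
  by (induction w) (simp_all add: word_hom_def free_hom_mult letter_hom_comp)

lemma free_hom_free_hom: "free_hom b (free_hom a f) = free_hom (\<lambda>x. free_hom b (a x)) f"
  by (induction f rule: falg_induct) (simp_all add: free_hom_single free_hom_scal free_hom_word_hom
    free_hom_add)

lemma free_hom_gen_id: "f \<in> fcarr \<Lambda> \<Longrightarrow> free_hom gen f = f"
  by (induction rule: fcarr_induct) (simp_all add: free_hom_scal free_hom_word_hom free_hom_add)

subsection \<open>Seminorms\<close>

locale falg_seminorm =
  fixes \<Lambda> :: "('a, 'k::finite) kgraph" and p :: "'a falg \<Rightarrow> real"
  assumes seminormed: "cstar_seminormed (free_star_algebra \<Lambda> p)"
begin

lemma p_nonneg: "f \<in> fcarr \<Lambda> \<Longrightarrow> 0 \<le> p f"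
  using cstar_seminormed.nrm_nonneg[OF seminormed, of f] by simp

lemma p_triangle: "f \<in> fcarr \<Lambda> \<Longrightarrow> g \<in> fcarr \<Lambda> \<Longrightarrow> p (f + g) \<le> p f + p g"
  using cstar_seminormed.nrm_triangle[OF seminormed, of f g] by simp

lemma p_scal: "f \<in> fcarr \<Lambda> \<Longrightarrow> p (scal c * f) = cmod c * p f"
  using cstar_seminormed.nrm_smul[OF seminormed, of f c] by simp

lemma p_mult: "f \<in> fcarr \<Lambda> \<Longrightarrow> g \<in> fcarr \<Lambda> \<Longrightarrow> p (f * g) \<le> p f * p g"
  using cstar_seminormed.nrm_tim[OF seminormed, of f g] by simp

lemma p_cstar: "f \<in> fcarr \<Lambda> \<Longrightarrow> p (free_adj f * f) = (p f)\<^sup>2"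
  using cstar_seminormed.nrm_cstar[OF seminormed, of f] by simp

lemma p_zero [simp]: "p 0 = 0"
  using p_scal[of 0 0] by simp

lemma p_uminus: "f \<in> fcarr \<Lambda> \<Longrightarrow> p (- f) = p f"
  using p_scal[of f "-1"] by (simp add: single_uminus)

lemma p_diff_commute: "f \<in> fcarr \<Lambda> \<Longrightarrow> g \<in> fcarr \<Lambda> \<Longrightarrow> p (f - g) = p (g - f)"
  using p_uminus[OF fcarr_diff, of f g] by simp

lemma p_triangle_diff: "f \<in> fcarr \<Lambda> \<Longrightarrow> g \<in> fcarr \<Lambda> \<Longrightarrow> h \<in> fcarr \<Lambda> \<Longrightarrow> p (f - h) \<le> p (f - g) + p (g - h)"
  using p_triangle[of "f - g" "g - h"] by auto

lemma p_le_diff: "f \<in> fcarr \<Lambda> \<Longrightarrow> g \<in> fcarr \<Lambda> \<Longrightarrow> p f \<le> p g + p (f - g)"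
  using p_triangle[of g "f - g"] by auto

lemma p_sum: "(\<And>x. x \<in> S \<Longrightarrow> f x \<in> fcarr \<Lambda>) \<Longrightarrow> p (sum f S) \<le> (\<Sum>x\<in>S. p (f x))"
proof (induction S rule: infinite_finite_induct)
  case (insert x S)
  then show ?case using p_triangle[of "f x" "sum f S"] by force
qed simp_all

lemma p_free_adj: assumes f: "f \<in> fcarr \<Lambda>" shows "p (free_adj f) = p f"
proof -
  have le: "p g \<le> p (free_adj g)" if "g \<in> fcarr \<Lambda>" for g
  proof (cases "p g = 0")
    case False
    have "p g * p g \<le> p (free_adj g) * p g"
      using p_mult[of "free_adj g" g] p_cstar[of g] that by (auto simp: power2_eq_square)
    then show ?thesis using False p_nonneg[OF that] by simp
  qed (use p_nonneg that in auto)
  show ?thesis using le[OF f] le[of "free_adj f"] f by auto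
qed

text \<open>C*-seminorms pull back along *-homomorphisms; the seminorms compared later with the
  universal one arise in this way.\<close>

lemma free_hom_seminormed:
  assumes "\<And>x. x \<in> mor \<Gamma> \<Longrightarrow> b x \<in> fcarr \<Lambda>"
  shows "cstar_seminormed (free_star_algebra \<Gamma> (\<lambda>f. p (free_hom b f)))"
proof -
  have b: "f \<in> fcarr \<Gamma> \<Longrightarrow> free_hom b f \<in> fcarr \<Lambda>" for f by (rule fcarr_free_hom[OF _ assms])
  show ?thesis
    unfolding cstar_seminormed_def cstar_seminormed_axioms_def
    by (auto simp: star_algebra_free free_hom_add free_hom_mult[of b] free_hom_free_adj
      free_hom_single word_hom_def b p_nonneg
        p_triangle p_scal p_mult p_cstar)
qed

end

locale ck_family = k_graph \<Lambda> for \<Lambda> :: "('a, 'k::finite) kgraph" +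
  fixes p :: "'a falg \<Rightarrow> real"
  assumes ck: "ck_seminorm \<Lambda> p"

sublocale ck_family \<subseteq> falg_seminorm \<Lambda> p
  using ck by (simp add: falg_seminorm_def ck_seminorm_def)

context ck_family
begin

lemma p_relator: "r \<in> ck_relators \<Lambda> \<Longrightarrow> p r = 0"
  using ck by (simp add: ck_seminorm_def)

text \<open>The relation for the source projection and the C*-identity give p(s_v)^2 =
  p(s_v).\<close>

lemma p_vertex: assumes v: "v \<in> verts \<Lambda>" shows "p (gen v) = 0 \<or> p (gen v) = 1"
proof -
  have m: "v \<in> mor \<Lambda>" using v by (rule vert_mor)
  have "p (free_adj (gen v) * gen v - gen v) = 0"
    using p_relator[OF ck_relators.source_projection[OF m]] v by simp
  then have "p (free_adj (gen v) * gen v) = p (gen v)"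
    using p_le_diff[of "free_adj (gen v) * gen v" "gen v"] p_le_diff[of "gen v" "free_adj (gen v) * gen v"]
      p_diff_commute[of "gen v" "free_adj (gen v) * gen v"] fcarr_gen[OF m] by (auto intro!: antisym)
  then have "(p (gen v))\<^sup>2 = p (gen v)" using p_cstar[OF fcarr_gen[OF m]] by simp
  then show ?thesis by (simp add: power2_eq_square)
qed

lemma p_gen_le_1: assumes x: "x \<in> mor \<Lambda>" shows "p (gen x) \<le> 1"
proof -
  have s: "src \<Lambda> x \<in> verts \<Lambda>" using x by (rule src_verts)
  have "p (free_adj (gen x) * gen x - gen (src \<Lambda> x)) = 0"
    using p_relator[OF ck_relators.source_projection[OF x]] .
  then have "p (free_adj (gen x) * gen x) \<le> p (gen (src \<Lambda> x))"
    using p_le_diff[of "free_adj (gen x) * gen x" "gen (src \<Lambda> x)"] fcarr_gen[OF x] fcarr_gen[OF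
      vert_mor[OF s]] by auto
  then have "(p (gen x))\<^sup>2 \<le> 1" using p_cstar[OF fcarr_gen[OF x]] p_vertex[OF s] by auto
  then show ?thesis using p_nonneg[OF fcarr_gen[OF x]] by (metis abs_of_nonneg abs_square_le_1)
qed

lemma p_word_le_1: "w \<noteq> [] \<Longrightarrow> fst ` set w \<subseteq> mor \<Lambda> \<Longrightarrow> p (word_hom gen w) \<le> 1"
proof (induction w)
  case (Cons l w)
  have l: "p (letter_hom gen l) \<le> 1" "letter_hom gen l \<in> fcarr \<Lambda>"
    using Cons.prems p_gen_le_1[of "fst l"] p_free_adj[OF fcarr_gen, of "fst l"] fcarr_gen[of "fst l" \<Lambda>]
    by (auto simp: letter_hom_def)
  show ?case
  proof (cases "w = []")
    case True then show ?thesis using l by (simp add: word_hom_def)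
  next
    case False
    have w: "word_hom gen w \<in> fcarr \<Lambda>" using False Cons.prems by (intro fcarr_word_hom) auto
    have "p (word_hom gen (l # w)) \<le> p (letter_hom gen l) * p (word_hom gen w)"
      using p_mult[OF l(2) w] by (simp add: word_hom_def)
    also have "\<dots> \<le> 1 * 1" using l Cons False by (intro mult_mono p_nonneg w) auto
    finally show ?thesis by simp
  qed
qed simp

end

text \<open>Every nonempty word in the generators has seminorm at most 1, whatever p is; so the
  coefficients of f provide the bound.\<close>

lemma (in k_graph) ck_seminorm_bounded:
  assumes "f \<in> fcarr \<Lambda>"
  shows "\<exists>B. \<forall>p. ck_seminorm \<Lambda> p \<longrightarrow> p f \<le> B"
  using assms
proof (induction rule: fcarr_induct)
  case zero
  have "p 0 = 0" if "ck_seminorm \<Lambda> p" for p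
  proof -
    interpret ck_family \<Lambda> p by unfold_locales (fact that)
    show ?thesis by simp
  qed
  then show ?case by (metis order_refl)
next
  case (word w c)
  have "p (scal c * word_hom gen w) \<le> cmod c" if "ck_seminorm \<Lambda> p" for p
  proof -
    interpret ck_family \<Lambda> p by unfold_locales (fact that)
    have "word_hom gen w \<in> fcarr \<Lambda>" using word by (intro fcarr_word_hom) auto
    then show ?thesis using p_scal[of "word_hom gen w" c] p_word_le_1[OF word] by (simp add: mult_left_le)
  qed
  then show ?case by blast
next
  case (add f g)
  then obtain B C where B: "\<forall>p. ck_seminorm \<Lambda> p \<longrightarrow> p f \<le> B" and C: "\<forall>p. ck_seminorm \<Lambda> p \<longrightarrow> p g \<le> C"
    by blast
  have "p (f + g) \<le> B + C" if "ck_seminorm \<Lambda> p" for p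
  proof -
    interpret ck_family \<Lambda> p by unfold_locales (fact that)
    have "p (f + g) \<le> p f + p g" using add by (intro p_triangle)
    also have "\<dots> \<le> B + C" using B C that by (intro add_mono) auto
    finally show ?thesis .
  qed
  then show ?case by blast
qed

context k_graph
begin

lemma ck_seminorm_zero: "ck_seminorm \<Lambda> (\<lambda>f. 0)"
  by (simp add: ck_seminorm_def cstar_seminormed_def cstar_seminormed_axioms_def star_algebra_free)

lemma universal_upper:
  assumes "ck_seminorm \<Lambda> p" "f \<in> fcarr \<Lambda>"
  shows "p f \<le> universal_seminorm \<Lambda> f"
proof -
  obtain B where "\<forall>p. ck_seminorm \<Lambda> p \<longrightarrow> p f \<le> B" using ck_seminorm_bounded[OF assms(2)] by blast
  then have "bdd_above ((\<lambda>p. p f) ` {p. ck_seminorm \<Lambda> p})" by (auto intro!: bdd_aboveI2)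
  then show ?thesis unfolding universal_seminorm_def using assms(1) by (auto intro: cSUP_upper)
qed

lemma universal_least:
  assumes "\<And>p. ck_seminorm \<Lambda> p \<Longrightarrow> p f \<le> c"
  shows "universal_seminorm \<Lambda> f \<le> c"
  unfolding universal_seminorm_def using assms ck_seminorm_zero by (intro cSUP_least) auto

text \<open>All axioms pass to the supremum over p. Where p occurs with a factor or squared, the
  inequality is first solved for p, by dividing by the modulus of c or by taking a square
  root.\<close>

lemma ck_seminorm_universal: "ck_seminorm \<Lambda> (universal_seminorm \<Lambda>)"
proof -
  let ?U = "universal_seminorm \<Lambda>"
  have sem: "falg_seminorm \<Lambda> p" if "ck_seminorm \<Lambda> p" for p
    using that by (simp add: falg_seminorm_def ck_seminorm_def)
  have nonneg: "0 \<le> ?U f" if "f \<in> fcarr \<Lambda>" for f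
    using universal_upper[OF ck_seminorm_zero that] by simp
  have "?U (f + g) \<le> ?U f + ?U g" if f: "f \<in> fcarr \<Lambda>" and g: "g \<in> fcarr \<Lambda>" for f g
    by (rule universal_least)
      (meson falg_seminorm.p_triangle[OF sem] universal_upper f g add_mono order_trans)
  moreover have "?U (scal c * f) = cmod c * ?U f" if f: "f \<in> fcarr \<Lambda>" for f c
  proof (rule antisym)
    show "?U (scal c * f) \<le> cmod c * ?U f"
      by (rule universal_least) (simp add: falg_seminorm.p_scal[OF sem f] universal_upper f mult_left_mono)
    show "cmod c * ?U f \<le> ?U (scal c * f)"
    proof (cases "c = 0")
      case True then show ?thesis using nonneg[of 0] by simp
    next
      case False
      have "?U f \<le> ?U (scal c * f) / cmod c"
      proof (rule universal_least)
        fix p assume p: "ck_seminorm \<Lambda> p"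
        have "cmod c * p f \<le> ?U (scal c * f)"
          using universal_upper[OF p fcarr_scal[OF f]] by (simp add: falg_seminorm.p_scal[OF sem[OF p] f])
        then show "p f \<le> ?U (scal c * f) / cmod c" using False by (simp add: field_simps)
      qed
      then show ?thesis using False by (simp add: field_simps)
    qed
  qed
  moreover have "?U (f * g) \<le> ?U f * ?U g" if f: "f \<in> fcarr \<Lambda>" and g: "g \<in> fcarr \<Lambda>" for f g
  proof (rule universal_least)
    fix p assume p: "ck_seminorm \<Lambda> p"
    have "p (f * g) \<le> p f * p g" by (rule falg_seminorm.p_mult[OF sem[OF p] f g])
    also have "\<dots> \<le> ?U f * ?U g"
      by (rule mult_mono[OF universal_upper[OF p f] universal_upper[OF p g] nonneg[OF f]
            falg_seminorm.p_nonneg[OF sem[OF p] g]])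
    finally show "p (f * g) \<le> ?U f * ?U g" .
  qed
  moreover have "?U (free_adj f * f) = (?U f)\<^sup>2" if f: "f \<in> fcarr \<Lambda>" for f
  proof (rule antisym)
    show "?U (free_adj f * f) \<le> (?U f)\<^sup>2"
    proof (rule universal_least)
      fix p assume p: "ck_seminorm \<Lambda> p"
      show "p (free_adj f * f) \<le> (?U f)\<^sup>2"
        using universal_upper[OF p f] falg_seminorm.p_nonneg[OF sem[OF p] f]
        by (simp add: falg_seminorm.p_cstar[OF sem[OF p] f] power_mono)
    qed
    have "?U f \<le> sqrt (?U (free_adj f * f))"
    proof (rule universal_least)
      fix p assume p: "ck_seminorm \<Lambda> p"
      have "(p f)\<^sup>2 \<le> ?U (free_adj f * f)"
        using universal_upper[OF p, of "free_adj f * f"] f falg_seminorm.p_cstar[OF sem[OF p] f] by auto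
      then show "p f \<le> sqrt (?U (free_adj f * f))" by (rule real_le_rsqrt)
    qed
    then have "(?U f)\<^sup>2 \<le> (sqrt (?U (free_adj f * f)))\<^sup>2" using nonneg[OF f] by (rule power_mono)
    also have "\<dots> = ?U (free_adj f * f)" using nonneg[of "free_adj f * f"] f by auto
    finally show "(?U f)\<^sup>2 \<le> ?U (free_adj f * f)" .
  qed
  moreover have "?U r = 0" if r: "r \<in> ck_relators \<Lambda>" for r
  proof -
    have "p r = 0" if "ck_seminorm \<Lambda> p" for p using that r by (simp add: ck_seminorm_def)
    then have "(\<lambda>p. p r) ` {p. ck_seminorm \<Lambda> p} = {0}" using ck_seminorm_zero by force
    then show ?thesis by (simp add: universal_seminorm_def)
  qed
  ultimately show ?thesis
    by (simp add: ck_seminorm_def cstar_seminormed_def cstar_seminormed_axioms_def star_algebra_free nonneg)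
qed

lemma ck_family_universal: "ck_family \<Lambda> (universal_seminorm \<Lambda>)"
  using ck_seminorm_universal by unfold_locales

end


declare single_of_nat [simp del]

section \<open>Orthogonality of the range projections\<close>

subsection \<open>The unit is an extreme point of the unit ball\<close>

text \<open>Up to the factor 2^m this is four times the variance m/4 of the binomial distribution
  with parameter 1/2, computed from the moments of the Bernstein polynomials at 1/2.\<close>

lemma sum_binomial_square_dev: "(\<Sum>k\<le>m. real (m choose k) * (2 * real k - real m)\<^sup>2) = real m * 2 ^ m"
proof -
  have B: "real (m choose k) = 2 ^ m * Bernstein m k (1/2)" if "k \<le> m" for k
  proof -
    have "(1/2::real) ^ k * (1/2) ^ (m - k) = 1 / 2 ^ m"
      using that by (simp add: power_one_over flip: power_add)
    then show ?thesis by (simp add: Bernstein_def mult.assoc)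
  qed
  have "(\<Sum>k\<le>m. real (m choose k) * (2 * real k - real m)\<^sup>2) =
    (\<Sum>k\<le>m. 2 ^ m * (4 * (real k * (real k - 1) * Bernstein m k (1/2))
      + (4 - 4 * real m) * (real k * Bernstein m k (1/2)) + (real m)\<^sup>2 * Bernstein m k (1/2)))"
    by (intro sum.cong refl) (simp add: B power2_eq_square algebra_simps)
  also have "\<dots> = 2 ^ m * (4 * (\<Sum>k\<le>m. real k * (real k - 1) * Bernstein m k (1/2))
      + (4 - 4 * real m) * (\<Sum>k\<le>m. real k * Bernstein m k (1/2)) + (real m)\<^sup>2 * (\<Sum>k\<le>m. Bernstein m k (1/2)))"
    by (simp only: sum_distrib_left sum.distrib[symmetric])
  also have "\<dots> = real m * 2 ^ m"
    unfolding sum_kk_Bernstein sum_k_Bernstein sum_Bernstein by (simp add: power2_eq_square field_simps)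
  finally show ?thesis .
qed

text \<open>Cauchy-Schwarz bounds the mean absolute deviation by the standard deviation.\<close>

lemma sum_abs_binomial_dev: "(\<Sum>k\<le>m. real (m choose k) * \<bar>2 * real k - real m\<bar>) \<le> sqrt (real m) * 2 ^ m"
proof -
  let ?c = "\<lambda>k. real (m choose k)" and ?d = "\<lambda>k. \<bar>2 * real k - real m\<bar>"
  have "(\<Sum>k\<le>m. ?c k * ?d k) = (\<Sum>k\<le>m. sqrt (?c k) * (sqrt (?c k) * ?d k))"
    by (simp flip: mult.assoc)
  also have "\<dots> \<le> sqrt (\<Sum>k\<le>m. (sqrt (?c k))\<^sup>2) * sqrt (\<Sum>k\<le>m. (sqrt (?c k) * ?d k)\<^sup>2)"
    using L2_set_mult_ineq[of "\<lambda>k. sqrt (?c k)" "\<lambda>k. sqrt (?c k) * ?d k" "{..m}"] by (simp add: L2_set_def)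
  also have "\<dots> = sqrt (2 ^ m) * sqrt (real m * 2 ^ m)"
  proof -
    have "(\<Sum>k\<le>m. ?c k) = 2 ^ m" using choose_row_sum[of m] by (metis of_nat_numeral of_nat_power of_nat_sum)
    then show ?thesis by (simp add: power_mult_distrib sum_binomial_square_dev)
  qed
  also have "\<dots> = sqrt (real m) * 2 ^ m" by (simp add: real_sqrt_mult)
  finally show ?thesis .
qed

text \<open>The difference on the left is the coefficient of A^k B^(n+1-k) in (A - B)(A + B)^n; the
  case distinction sets the missing binomial coefficient at k = 0 to zero.\<close>

lemma binomial_diff:
  assumes "k \<le> Suc n"
  shows "(real (Suc n)) * ((if k = 0 then 0 else real (n choose (k - 1))) - real (n choose k)) =
    real (Suc n choose k) * (2 * real k - real (Suc n))"
proof (cases k)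
  case 0
  then show ?thesis by simp
next
  case (Suc j)
  have a: "real (Suc j) * real (Suc n choose Suc j) = real (Suc n) * real (n choose j)"
    by (metis Suc_times_binomial_eq mult.commute of_nat_mult)
  have "real (Suc n choose Suc j) = real (n choose j) + real (n choose Suc j)" by simp
  then have b: "real (n choose Suc j) = real (Suc n choose Suc j) - real (n choose j)" by linarith
  show ?thesis unfolding Suc using a by (simp only: b) (simp add: algebra_simps del: binomial_Suc_Suc)
qed

text \<open>Expanding \<open>2y = (A - B) ((A + B)/2)^n\<close> for the commuting contractions \<open>A = 1 + y\<close> and
  \<open>B = 1 - y\<close> bounds \<open>N y\<close> by a multiple of \<open>1 / sqrt n\<close>.\<close>

lemma contractions_about_one:
  fixes N :: "'r::comm_ring_1 \<Rightarrow> real" and y :: 'r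
  assumes tri: "\<And>a b. N (a + b) \<le> N a + N b" and mult: "\<And>a b. N (a * b) \<le> N a * N b"
    and int: "\<And>i a. N (of_int i * a) = \<bar>of_int i\<bar> * N a"
    and one: "N 1 \<le> 1" and A: "N (1 + y) \<le> 1" and B: "N (1 - y) \<le> 1"
  shows "N y = 0"
proof -
  have N0: "N 0 = 0" using int[of 0 0] by simp
  have nn: "0 \<le> N a" for a using tri[of a "-a"] int[of "-1" a] N0 by simp
  have pw: "N (a ^ n) \<le> 1" if "N a \<le> 1" for a n
  proof (induction n)
    case (Suc n)
    have "N (a ^ Suc n) \<le> N a * N (a ^ n)" using mult by simp
    also have "\<dots> \<le> 1 * 1" using that Suc nn by (intro mult_mono) auto
    finally show ?case by simp
  qed (use one in simp)
  have Nsum: "N (sum f S) \<le> (\<Sum>x\<in>S. N (f x))" for f and S :: "nat set"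
  proof (induction S rule: infinite_finite_induct)
    case (insert x S)
    then show ?case using tri[of "f x" "sum f S"] by simp
  qed (simp_all add: N0)
  let ?A = "1 + y" and ?B = "1 - y"
  have bound: "2 * N y \<le> 2 / sqrt (real (Suc n))" for n
  proof -
    let ?c = "\<lambda>k. (if k = 0 then 0 else int (n choose (k - 1))) - int (n choose k)"
    have "of_int (2 ^ Suc n) * y = (?A - ?B) * (?A + ?B) ^ n" by (simp add: mult.commute)
    also have "\<dots> = ?A * (?A + ?B) ^ n - ?B * (?A + ?B) ^ n" by (rule left_diff_distrib)
    also have "\<dots> = (\<Sum>k\<le>n. of_nat (n choose k) * ?A ^ Suc k * ?B ^ (n - k))
        - (\<Sum>k\<le>n. of_nat (n choose k) * ?A ^ k * ?B ^ (Suc n - k))"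
      unfolding binomial_ring[of ?A ?B] sum_distrib_left
      by (intro arg_cong2[of _ _ _ _ "(-)"] sum.cong refl) (simp_all add: Suc_diff_le mult_ac)
    also have "(\<Sum>k\<le>n. of_nat (n choose k) * ?A ^ Suc k * ?B ^ (n - k)) =
        (\<Sum>k\<le>Suc n. of_int (if k = 0 then 0 else int (n choose (k - 1))) * (?A ^ k * ?B ^ (Suc n - k)))"
      by (subst sum.atMost_Suc_shift) (simp add: mult.assoc)
    also have "(\<Sum>k\<le>n. of_nat (n choose k) * ?A ^ k * ?B ^ (Suc n - k)) =
        (\<Sum>k\<le>Suc n. of_int (int (n choose k)) * (?A ^ k * ?B ^ (Suc n - k)))"
      by (simp add: mult.assoc binomial_eq_0)
    finally have eq: "of_int (2 ^ Suc n) * y = (\<Sum>k\<le>Suc n. of_int (?c k) * (?A ^ k * ?B ^ (Suc n - k)))"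
      by (simp add: left_diff_distrib sum_subtractf del: sum.atMost_Suc)
    have "2 ^ Suc n * N y = N (of_int (2 ^ Suc n) * y)" by (simp only: int) simp
    also have "\<dots> \<le> (\<Sum>k\<le>Suc n. N (of_int (?c k) * (?A ^ k * ?B ^ (Suc n - k))))"
      unfolding eq by (rule Nsum)
    also have "\<dots> \<le> (\<Sum>k\<le>Suc n. \<bar>of_int (?c k)\<bar>)"
    proof (rule sum_mono)
      fix k
      have "N (?A ^ k * ?B ^ (Suc n - k)) \<le> N (?A ^ k) * N (?B ^ (Suc n - k))" by (rule mult)
      also have "\<dots> \<le> 1 * 1" using pw A B nn by (intro mult_mono) auto
      finally have "\<bar>of_int (?c k)\<bar> * N (?A ^ k * ?B ^ (Suc n - k)) \<le> \<bar>of_int (?c k) :: real\<bar> * 1"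
        by (intro mult_left_mono) auto
      then show "N (of_int (?c k) * (?A ^ k * ?B ^ (Suc n - k))) \<le> \<bar>of_int (?c k)\<bar>"
        by (simp only: int mult_1_right)
    qed
    \<comment> \<open>What remains is a mean absolute deviation of a binomial distribution; it is of
      order sqrt(n + 1), against the divisor n + 1.\<close>
    also have "\<dots> = (\<Sum>k\<le>Suc n. real (Suc n choose k) * \<bar>2 * real k - real (Suc n)\<bar>) / real (Suc n)"
      unfolding sum_divide_distrib
    proof (rule sum.cong[OF refl])
      fix k assume "k \<in> {..Suc n}"
      then have "real (Suc n) * of_int (?c k) = real (Suc n choose k) * (2 * real k - real (Suc n))"
        using binomial_diff[of k n] by (cases "k = 0") simp_all
      then have "real (Suc n) * \<bar>of_int (?c k)\<bar> = real (Suc n choose k) * \<bar>2 * real k - real (Suc n)\<bar>"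
        by (metis abs_mult abs_of_nat)
      then show "\<bar>of_int (?c k)\<bar> = real (Suc n choose k) * \<bar>2 * real k - real (Suc n)\<bar> / real (Suc n)"
        by (metis nonzero_mult_div_cancel_left of_nat_neq_0)
    qed
    also have "\<dots> \<le> sqrt (real (Suc n)) * 2 ^ Suc n / real (Suc n)"
      by (intro divide_right_mono sum_abs_binomial_dev) simp
    also have "\<dots> = 2 ^ Suc n * (1 / sqrt (real (Suc n)))"
      by (metis (no_types, lifting) mult.commute real_divide_square_eq real_sqrt_mult_self abs_of_nat
        times_divide_eq_right times_divide_eq_left mult_1_right)
    finally have "N y \<le> 1 / sqrt (real (Suc n))"
      by (simp only: mult_le_cancel_left_pos[OF zero_less_power[OF zero_less_numeral]])
    then show ?thesis by simp
  qed
  have "(\<lambda>n. 2 / sqrt (real (Suc n))) \<longlonglongrightarrow> 0" by real_asymp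
  then have "2 * N y \<le> 0" by (rule LIMSEQ_le_const) (use bound in auto)
  then show ?thesis using nn[of y] by simp
qed

subsection \<open>Calculus modulo a seminorm\<close>

context falg_seminorm
begin

text \<open>Equality modulo the null elements of p. Membership in the carrier is included, so that
  the relation itself supplies the closure conditions of the rules below.\<close>

definition eqv :: "'a falg \<Rightarrow> 'a falg \<Rightarrow> bool" (infix \<open>\<simeq>\<close> 50) where
  "f \<simeq> g \<longleftrightarrow> f \<in> fcarr \<Lambda> \<and> g \<in> fcarr \<Lambda> \<and> p (f - g) = 0"

lemma eqv_refl [intro]: "f \<in> fcarr \<Lambda> \<Longrightarrow> f \<simeq> f"
  by (simp add: eqv_def)

lemma eqv_sym: "f \<simeq> g \<Longrightarrow> g \<simeq> f"
  by (auto simp: eqv_def p_diff_commute)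

lemma eqv_trans [trans]: "f \<simeq> g \<Longrightarrow> g \<simeq> h \<Longrightarrow> f \<simeq> h"
  unfolding eqv_def using p_triangle_diff[of f g h] p_nonneg[of "f - h"] by auto

lemma eqv_add: "f \<simeq> f' \<Longrightarrow> g \<simeq> g' \<Longrightarrow> f + g \<simeq> f' + g'"
  unfolding eqv_def using p_triangle[of "f - f'" "g - g'"] p_nonneg[of "(f + g) - (f' + g')"]
  by (simp add: fcarr_add fcarr_diff add_diff_add)

lemma eqv_scal: "f \<simeq> f' \<Longrightarrow> scal c * f \<simeq> scal c * f'"
  unfolding eqv_def using p_scal[of "f - f'" c] by (auto simp: algebra_simps)

lemma eqv_uminus: "f \<simeq> f' \<Longrightarrow> - f \<simeq> - f'"
  using eqv_scal[of f f' "-1"] by (simp add: single_uminus)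

lemma eqv_diff: "f \<simeq> f' \<Longrightarrow> g \<simeq> g' \<Longrightarrow> f - g \<simeq> f' - g'"
  using eqv_add[OF _ eqv_uminus, of f f' g g'] by simp

lemma eqv_mult_left: assumes "f \<in> fcarr \<Lambda>" "g \<simeq> g'" shows "f * g \<simeq> f * g'"
proof -
  have g: "g \<in> fcarr \<Lambda>" "g' \<in> fcarr \<Lambda>" "p (g - g') = 0" using assms by (auto simp: eqv_def)
  have "p (f * (g - g')) \<le> 0" using p_mult[of f "g - g'"] assms g by auto
  then have "p (f * g - f * g') = 0"
    using p_nonneg[of "f * (g - g')"] assms g by (auto simp: algebra_simps)
  then show ?thesis using assms g by (auto simp: eqv_def)
qed

lemma eqv_mult_right: assumes "g \<in> fcarr \<Lambda>" "f \<simeq> f'" shows "f * g \<simeq> f' * g"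
proof -
  have f: "f \<in> fcarr \<Lambda>" "f' \<in> fcarr \<Lambda>" "p (f - f') = 0" using assms by (auto simp: eqv_def)
  have "p ((f - f') * g) \<le> 0" using p_mult[of "f - f'" g] assms f by auto
  then have "p (f * g - f' * g) = 0"
    using p_nonneg[of "(f - f') * g"] assms f by (auto simp: algebra_simps)
  then show ?thesis using assms f by (auto simp: eqv_def)
qed

lemma eqv_mult: "f \<simeq> f' \<Longrightarrow> g \<simeq> g' \<Longrightarrow> f * g \<simeq> f' * g'"
  by (meson eqv_def eqv_mult_left eqv_mult_right eqv_trans)

lemma eqv_free_adj: "f \<simeq> g \<Longrightarrow> free_adj f \<simeq> free_adj g"
  unfolding eqv_def using p_free_adj[of "f - g"] by (auto simp: free_adj_diff)

lemma eqv_sum: "(\<And>x. x \<in> S \<Longrightarrow> f x \<simeq> g x) \<Longrightarrow> sum f S \<simeq> sum g S"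
  by (induction S rule: infinite_finite_induct) (auto intro: eqv_add)

lemma eqv_p: "f \<simeq> g \<Longrightarrow> p f = p g"
  unfolding eqv_def using p_le_diff[of f g] p_le_diff[of g f] p_diff_commute[of f g] by auto

lemma eqv_carr: "f \<simeq> g \<Longrightarrow> f \<in> fcarr \<Lambda>" "f \<simeq> g \<Longrightarrow> g \<in> fcarr \<Lambda>"
  by (auto simp: eqv_def)

lemma eqv_zero_iff: "f \<simeq> 0 \<longleftrightarrow> f \<in> fcarr \<Lambda> \<and> p f = 0"
  by (auto simp: eqv_def)

lemma eqv_diff_zero: "f - g \<simeq> 0 \<Longrightarrow> f \<in> fcarr \<Lambda> \<Longrightarrow> g \<in> fcarr \<Lambda> \<Longrightarrow> f \<simeq> g"
  by (auto simp: eqv_def)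

lemma eqv_mult_zero: "f \<in> fcarr \<Lambda> \<Longrightarrow> g \<simeq> 0 \<Longrightarrow> f * g \<simeq> 0" "f \<in> fcarr \<Lambda> \<Longrightarrow> g \<simeq> 0 \<Longrightarrow> g * f \<simeq> 0"
  using eqv_mult_left[of f g 0] eqv_mult_right[of f g 0] by simp_all

lemma eqv_p_projection:
  assumes "f * f \<simeq> f" "free_adj f \<simeq> f"
  shows "p f = 0 \<or> p f = 1"
proof -
  have f: "f \<in> fcarr \<Lambda>" using assms eqv_carr by blast
  have "free_adj f * f \<simeq> f" using eqv_mult_right[OF f assms(2)] assms(1) by (rule eqv_trans)
  then have "(p f)\<^sup>2 = p f" using eqv_p p_cstar[OF f] by metis
  then show ?thesis by (simp add: power2_eq_square)
qed

text \<open>\<open>contractions_about_one\<close> asks for a commutative ring. Modulo p the algebra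
  generated by e and y is commutative, and it is reached by pulling p back to polynomials in one
  variable.\<close>

lemma extreme_unit:
  assumes ee: "e * e \<simeq> e" and ey: "e * y \<simeq> y" and ye: "y * e \<simeq> y" and e1: "p e \<le> 1"
    and A: "p (e + y) \<le> 1" and B: "p (e - y) \<le> 1"
  shows "p y = 0"
proof -
  have e: "e \<in> fcarr \<Lambda>" and y: "y \<in> fcarr \<Lambda>" using ee ey eqv_carr by blast+
  \<comment> \<open>Horner evaluation at y with e in place of the constant 1. The variable goes to y
    e, which agrees with y only modulo p.\<close>
  define ev :: "complex poly \<Rightarrow> 'a falg" where "ev q = fold_coeffs (\<lambda>a f. scal a * e + y * f) q 0" for q
  have ev0: "ev 0 = 0" by (simp add: ev_def)
  have evp: "ev (pCons a q) = scal a * e + y * ev q" for a q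
    by (cases "a = 0 \<and> q = 0") (auto simp: ev_def)
  have evc: "ev q \<in> fcarr \<Lambda>" for q
    by (induction q) (simp_all add: ev0 evp e y fcarr_add fcarr_scal fcarr_mult)
  have ev_add: "ev (q + r) = ev q + ev r" for q r
    by (induction q r rule: poly_induct2) (simp_all add: ev0 evp single_add algebra_simps)
  have ev_smult: "ev (smult c q) = scal c * ev q" for c q
    by (induction q) (simp_all add: ev0 evp mult_scal[of y] scal_scal distrib_left)
  have e_ev: "e * ev q \<simeq> ev q" for q
  proof (induction q)
    case 0 show ?case by (auto simp: ev0)
  next
    case (pCons a q)
    have "e * ev (pCons a q) = scal a * (e * e) + (e * y) * ev q"
      by (simp add: evp distrib_left mult_scal mult.assoc)
    also have "\<dots> \<simeq> scal a * e + y * ev q"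
      using ee ey evc by (intro eqv_add eqv_scal eqv_mult_right)
    finally show ?case by (simp add: evp)
  qed
  have ev_mult: "ev (q * r) \<simeq> ev q * ev r" for q r
  proof (induction q)
    case 0 show ?case by (auto simp: ev0)
  next
    case (pCons a q)
    have "ev (pCons a q * r) = scal a * ev r + y * ev (q * r)"
      by (simp add: ev_add ev_smult evp)
    also have "\<dots> \<simeq> scal a * (e * ev r) + y * (ev q * ev r)"
      using e_ev eqv_sym pCons y by (intro eqv_add eqv_scal eqv_mult_left) auto
    also have "\<dots> = ev (pCons a q) * ev r" by (simp add: evp distrib_right mult.assoc)
    finally show ?case .
  qed
  have "p (ev [:0, 1:]) = 0"
  proof (rule contractions_about_one[of "\<lambda>q. p (ev q)"])
    show "p (ev (a + b)) \<le> p (ev a) + p (ev b)" for a b by (simp add: ev_add p_triangle evc)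
    show "p (ev (a * b)) \<le> p (ev a) * p (ev b)" for a b
      using p_mult[OF evc evc, of a b] eqv_p[OF ev_mult[of a b]] by simp
    show "p (ev (of_int i * a)) = \<bar>of_int i\<bar> * p (ev a)" for i a
    proof -
      have "of_int i * a = smult (of_int i) a" by (simp add: of_int_poly)
      then show ?thesis by (simp only: ev_smult p_scal evc norm_of_int)
    qed
    have "ev 1 = e" using evp[of 1 0] by (simp add: ev0 one_pCons)
    moreover have evX: "ev [:0, 1:] = y * e" by (simp add: evp ev0)
    moreover have "e * (y * e) \<simeq> y * e" using eqv_mult_right[OF e ey] by (simp add: mult.assoc)
    ultimately show "p (ev 1) \<le> 1" using e1 by simp
    have ev_1: "ev (1 + [:0, c:]) = e + scal c * (y * e)" for c
      using evp[of 1 "[:c:]"] by (simp add: evp ev0 one_pCons mult_scal)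
    have c: "e + y * e \<simeq> (e + y) * e" "e - y * e \<simeq> (e - y) * e"
      using eqv_add[OF eqv_sym[OF ee] eqv_refl[OF fcarr_mult[OF y e]]]
        eqv_diff[OF eqv_sym[OF ee] eqv_refl[OF fcarr_mult[OF y e]]] by (simp_all add: algebra_simps)
    have "p ((e + y) * e) \<le> 1 * 1" "p ((e - y) * e) \<le> 1 * 1"
      using p_mult[of "e + y" e] p_mult[of "e - y" e] mult_mono[OF A e1] mult_mono[OF B e1]
        p_nonneg[OF e] e y by fastforce+
    moreover have "ev (1 + [:0, 1:]) = e + y * e" using ev_1[of 1] by simp
    moreover have m1: "(1 :: complex poly) - [:0, 1:] = 1 + [:0, - 1:]" by simp
    have "ev (1 - [:0, 1:]) = e - y * e" unfolding m1 ev_1 by (simp add: single_uminus)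
    ultimately show "p (ev (1 + [:0, 1:])) \<le> 1" "p (ev (1 - [:0, 1:])) \<le> 1"
      using eqv_p[OF c(1)] eqv_p[OF c(2)] by simp_all
  qed
  moreover have "ev [:0, 1:] = y * e" by (simp add: evp ev0)
  ultimately show ?thesis using eqv_p[OF ye] by simp
qed

end

locale lc_ck = lc_kgraph \<Lambda> + ck_family \<Lambda> p
  for \<Lambda> :: "('a, 'k::finite) kgraph" and p :: "'a falg \<Rightarrow> real"
begin

abbreviation st :: "'a \<Rightarrow> 'a falg" where "st x \<equiv> free_adj (gen x)"

lemma gen_carr: "x \<in> mor \<Lambda> \<Longrightarrow> gen x \<in> fcarr \<Lambda>" and st_carr: "x \<in> mor \<Lambda> \<Longrightarrow> st x \<in> fcarr \<Lambda>"
  by auto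

lemma verts_gen_carr: "v \<in> verts \<Lambda> \<Longrightarrow> gen v \<in> fcarr \<Lambda>"
  by (auto simp: vert_mor)

lemma relator_eqv: "f - g \<in> ck_relators \<Lambda> \<Longrightarrow> f \<in> fcarr \<Lambda> \<Longrightarrow> g \<in> fcarr \<Lambda> \<Longrightarrow> f \<simeq> g"
  using p_relator by (simp add: eqv_def)

lemma eqv_product: "x \<in> mor \<Lambda> \<Longrightarrow> y \<in> mor \<Lambda> \<Longrightarrow> src \<Lambda> x = rng \<Lambda> y \<Longrightarrow> gen x * gen y \<simeq> gen (cmp \<Lambda> x y)"
  by (intro relator_eqv ck_relators.product fcarr_mult gen_carr cmp_closed)

lemma eqv_source: "x \<in> mor \<Lambda> \<Longrightarrow> st x * gen x \<simeq> gen (src \<Lambda> x)"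
  by (intro relator_eqv ck_relators.source_projection fcarr_mult gen_carr st_carr src_closed)

lemma eqv_vertices: "v \<in> verts \<Lambda> \<Longrightarrow> w \<in> verts \<Lambda> \<Longrightarrow> v \<noteq> w \<Longrightarrow> gen v * gen w \<simeq> 0"
  using ck_relators.vertices[of v \<Lambda> w] relator_eqv[of "gen v * gen w" 0]
    by (simp add: verts_gen_carr fcarr_mult)

lemma eqv_idem: "v \<in> verts \<Lambda> \<Longrightarrow> gen v * gen v \<simeq> gen v"
  using ck_relators.vertices[of v \<Lambda> v] relator_eqv[of "gen v * gen v" "gen v"]
    by (simp add: verts_gen_carr fcarr_mult)

lemma eqv_ck: "v \<in> verts \<Lambda> \<Longrightarrow> (\<Sum>x \<in> le_paths v n. gen x * st x) \<simeq> gen v"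
  by (rule eqv_sym) (intro relator_eqv ck_relators.cuntz_krieger verts_gen_carr fcarr_sum fcarr_mult
    gen_carr st_carr;
      simp add: le_paths_mor)

lemma eqv_rng: "x \<in> mor \<Lambda> \<Longrightarrow> gen (rng \<Lambda> x) * gen x \<simeq> gen x"
  using eqv_product[of "rng \<Lambda> x" x] by (simp add: rng_closed src_rng cmp_rng)

lemma eqv_src: "x \<in> mor \<Lambda> \<Longrightarrow> gen x * gen (src \<Lambda> x) \<simeq> gen x"
  using eqv_product[of x "src \<Lambda> x"] by (simp add: src_closed rng_src cmp_src)

lemma eqv_st_vertex: assumes v: "v \<in> verts \<Lambda>" shows "st v \<simeq> gen v"
proof -
  have "st v * gen v \<simeq> gen v" using eqv_source[OF vert_mor[OF v]] v by simp
  from eqv_sym[OF this] eqv_free_adj[OF this] show ?thesis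
    by (simp add: free_adj_mult) (meson eqv_sym eqv_trans)
qed

lemma eqv_st_rng: "x \<in> mor \<Lambda> \<Longrightarrow> st x * gen (rng \<Lambda> x) \<simeq> st x"
  using eqv_free_adj[OF eqv_rng] eqv_mult_left[OF st_carr eqv_st_vertex[OF rng_verts], of x x] eqv_sym eqv_trans
  unfolding free_adj_mult by blast

lemma eqv_zero_if_src_rng:
  assumes "x \<in> mor \<Lambda>" "y \<in> mor \<Lambda>" "src \<Lambda> x \<noteq> rng \<Lambda> y" shows "gen x * gen y \<simeq> 0"
proof -
  have "gen x * gen y \<simeq> (gen x * gen (src \<Lambda> x)) * (gen (rng \<Lambda> y) * gen y)"
    by (intro eqv_mult eqv_sym[OF eqv_src] eqv_sym[OF eqv_rng] assms)
  also have "\<dots> = gen x * ((gen (src \<Lambda> x) * gen (rng \<Lambda> y)) * gen y)" by (simp add: mult.assoc)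
  also have "\<dots> \<simeq> 0"
    by (intro eqv_mult_zero eqv_vertices src_verts rng_verts gen_carr assms)
  finally show ?thesis .
qed

lemma eqv_zero_if_rng_rng:
  assumes "x \<in> mor \<Lambda>" "y \<in> mor \<Lambda>" "rng \<Lambda> x \<noteq> rng \<Lambda> y" shows "st x * gen y \<simeq> 0"
proof -
  have "st x * gen y \<simeq> (st x * gen (rng \<Lambda> x)) * (gen (rng \<Lambda> y) * gen y)"
    by (intro eqv_mult eqv_sym[OF eqv_st_rng] eqv_sym[OF eqv_rng] assms)
  also have "\<dots> = st x * ((gen (rng \<Lambda> x) * gen (rng \<Lambda> y)) * gen y)" by (simp add: mult.assoc)
  also have "\<dots> \<simeq> 0"
    by (intro eqv_mult_zero eqv_vertices rng_verts gen_carr st_carr assms)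
  finally show ?thesis .
qed

lemma eqv_partial_isometry: "x \<in> mor \<Lambda> \<Longrightarrow> gen x * st x * gen x \<simeq> gen x"
  by (intro relator_eqv ck_relators.partial_isometry fcarr_mult gen_carr st_carr)

text \<open>Only the sum of the projections \<open>s\<^sub>x s\<^sub>x\<^sup>*\<close> is prescribed by the relations; their mutual
  orthogonality is a consequence.\<close>

lemma le_paths_orthogonal:
  assumes v: "v \<in> verts \<Lambda>" and x: "x \<in> le_paths v n" and y: "y \<in> le_paths v n" and xy: "x \<noteq> y"
  shows "st y * gen x \<simeq> 0"
proof -
  define P where "P z = gen z * st z" for z
  define e where "e = P x"
  define S where "S = le_paths v n"
  have fin: "finite S" unfolding S_def by (rule finite_le_paths[OF v])
  have m: "z \<in> mor \<Lambda>" "rng \<Lambda> z = v" if "z \<in> S" for z using that le_paths_mor S_def by auto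
  have Pc: "P z \<in> fcarr \<Lambda>" if "z \<in> S" for z unfolding P_def using m[OF that] by auto
  have xS: "x \<in> S" and yS: "y \<in> S" using x y by (auto simp: S_def)
  have ec: "e \<in> fcarr \<Lambda>" unfolding e_def using Pc[OF xS] .
  have vc: "gen v \<in> fcarr \<Lambda>" using v by (rule verts_gen_carr)
  have PP: "P z * P z \<simeq> P z" if "z \<in> S" for z
    using eqv_mult_right[OF st_carr eqv_partial_isometry, of z z] m[OF that] by (simp add: P_def mult.assoc)
  have Padj: "free_adj (P z) = P z" for z by (simp add: P_def free_adj_mult)
  have vP: "gen v * P z \<simeq> P z" if "z \<in> S" for z
    using eqv_mult_right[OF st_carr eqv_rng, of z z] m[OF that] by (simp add: P_def mult.assoc)
  have Pv: "P z * gen v \<simeq> P z" if "z \<in> S" for z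
    using eqv_mult_left[OF gen_carr eqv_st_rng, of z z] m[OF that] by (simp add: P_def mult.assoc)
  have ee: "e * e \<simeq> e" using PP[OF xS] by (simp add: e_def)
  have "free_adj e \<simeq> e" using ec by (simp add: e_def Padj eqv_refl)
  then have p1: "p e \<le> 1" using eqv_p_projection[OF ee] by auto
  \<comment> \<open>The compressions of the range projections by e. By the Cuntz-Krieger relation
    those with z different from x sum to zero; the aim is that \<open>Y y\<close> vanishes by
    itself.\<close>
  define Y where "Y z = e * P z * e" for z
  have Yc: "Y z \<in> fcarr \<Lambda>" if "z \<in> S" for z unfolding Y_def using ec Pc[OF that] by auto
  have eY: "e * Y z \<simeq> Y z" "Y z * e \<simeq> Y z" if "z \<in> S" for z
  proof -
    have "e * Y z = (e * e) * (P z * e)" "Y z * e = (e * P z) * (e * e)" by (simp_all add: Y_def mult.assoc)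
    then show "e * Y z \<simeq> Y z" "Y z * e \<simeq> Y z"
      using eqv_mult_right[OF _ ee, of "P z * e"] eqv_mult_left[OF _ ee, of "e * P z"] ec Pc[OF that]
      by (auto simp: Y_def mult.assoc)
  qed
  \<comment> \<open>\<open>e - Y z\<close> is the compression by e of \<open>gen v - P z\<close>,
    which is again a projection.\<close>
  have bound: "p (e - Y z) \<le> 1" if z: "z \<in> S" for z
  proof -
    let ?q = "gen v - P z"
    have qc: "?q \<in> fcarr \<Lambda>" using vc Pc[OF z] by auto
    have "?q * ?q = (gen v * gen v - gen v * P z) - (P z * gen v - P z * P z)" by (simp add: algebra_simps)
    also have "\<dots> \<simeq> (gen v - P z) - (P z - P z)"
      by (intro eqv_diff eqv_idem vP Pv PP v z)
    finally have qq: "?q * ?q \<simeq> ?q" by simp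
    have "free_adj ?q \<simeq> ?q"
      unfolding free_adj_diff Padj by (intro eqv_diff eqv_st_vertex v eqv_refl Pc z)
    then have q1: "p ?q \<le> 1" using eqv_p_projection[OF qq] by auto
    have "e - Y z \<simeq> e * e - Y z"
      by (intro eqv_diff eqv_sym[OF ee] eqv_refl Yc z)
    also have "\<dots> \<simeq> e * (gen v * e) - Y z"
      using vP[OF xS] by (intro eqv_diff eqv_mult_left ec eqv_sym[OF vP[OF xS, folded e_def]] eqv_refl Yc z)
    also have "\<dots> = e * ?q * e" by (simp add: Y_def algebra_simps)
    finally have "p (e - Y z) = p (e * ?q * e)" by (rule eqv_p)
    also have "\<dots> \<le> p (e * ?q) * p e" using p_mult[of "e * ?q" e] ec qc by auto
    also have "\<dots> \<le> (p e * p ?q) * p e" using p_mult[OF ec qc] p_nonneg[OF ec] by (intro mult_right_mono)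
    also have "\<dots> \<le> (1 * 1) * 1" using p1 q1 p_nonneg[OF ec] p_nonneg[OF qc] by (intro mult_mono) auto
    finally show ?thesis by simp
  qed
  let ?T = "S - {x}"
  have finT: "finite ?T" and yT: "y \<in> ?T" using fin xy yS by auto
  let ?M = "card ?T"
  have M: "real ?M > 0" using finT yT by (auto simp: card_gt_0_iff)
  have "(\<Sum>z\<in>S. Y z) = e * (\<Sum>z\<in>S. P z) * e"
    by (simp add: Y_def sum_distrib_left sum_distrib_right)
  also have "\<dots> \<simeq> e * gen v * e"
    using eqv_ck[OF v, of n] by (intro eqv_mult_left eqv_mult_right ec) (simp add: P_def S_def)
  also have "\<dots> = e * (gen v * e)" by (simp add: mult.assoc)
  also have "\<dots> \<simeq> e * e" by (intro eqv_mult_left ec vP[OF xS, folded e_def])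
  also have "\<dots> \<simeq> Y x" unfolding Y_def
    using eqv_mult_right[OF ec eqv_sym[OF PP[OF xS]]] ee ec by (simp add: e_def)
  finally have sumS: "(\<Sum>z\<in>S. Y z) \<simeq> Y x" .
  have "(\<Sum>z\<in>S. Y z) - Y x \<simeq> Y x - Y x"
    by (intro eqv_diff sumS eqv_refl Yc xS)
  moreover have "(\<Sum>z\<in>S. Y z) = Y x + (\<Sum>z\<in>?T. Y z)" by (rule sum.remove[OF fin xS])
  ultimately have "(\<Sum>z\<in>?T. Y z) \<simeq> 0" by simp
  moreover have "(\<Sum>z\<in>?T. Y z) = Y y + (\<Sum>z\<in>?T - {y}. Y z)" by (rule sum.remove[OF finT yT])
  ultimately have "Y y + (\<Sum>z\<in>?T - {y}. Y z) \<simeq> 0" by simp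
  then have others: "Y y \<simeq> - (\<Sum>z\<in>?T - {y}. Y z)"
    using eqv_diff_zero[of "Y y" "- (\<Sum>z\<in>?T - {y}. Y z)"] Yc yS by (auto intro!: fcarr_uminus fcarr_sum)
  have card: "card (?T - {y}) = ?M - 1" using finT yT by simp
  \<comment> \<open>As \<open>Y y\<close> is minus the sum of the other compressions, this element
    is e plus M - 1 contractions of the form \<open>e - Y z\<close>, where M counts the paths other
    than x.\<close>
  have two: "p (scal (of_nat ?M) * e + Y y) \<le> ?M"
  proof -
    have "scal (of_nat ?M) * e + Y y \<simeq> scal (of_nat ?M) * e - (\<Sum>z\<in>?T - {y}. Y z)"
      using eqv_add[OF eqv_refl[OF fcarr_scal[OF ec]] others] by (simp only: add_uminus_conv_diff)
    also have "\<dots> = e + (\<Sum>z\<in>?T - {y}. (e - Y z))"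
    proof -
      have "real ?M = 1 + real (card (?T - {y}))" using card M by simp
      then have "scal (of_nat ?M) = (1 :: 'a falg) + scal (of_nat (card (?T - {y})))"
        by (metis of_nat_1 of_nat_add of_nat_eq_iff single_add single_one)
      then show ?thesis by (simp add: sum_subtractf distrib_right single_of_nat)
    qed
    finally have "p (scal (of_nat ?M) * e + Y y) = p (e + (\<Sum>z\<in>?T - {y}. (e - Y z)))" by (rule eqv_p)
    also have "\<dots> \<le> p e + p (\<Sum>z\<in>?T - {y}. (e - Y z))" using ec Yc by (intro p_triangle fcarr_sum) auto
    also have "\<dots> \<le> p e + (\<Sum>z\<in>?T - {y}. p (e - Y z))" using ec Yc by (intro add_left_mono p_sum) auto
    also have "\<dots> \<le> 1 + (\<Sum>z\<in>?T - {y}. 1)" using p1 bound by (intro add_mono sum_mono) auto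
    also have "\<dots> = real ?M" using card M by simp
    finally show ?thesis .
  qed
  \<comment> \<open>Here M - 1 copies of e and the single contraction \<open>e - Y y\<close> are
    added.\<close>
  have three: "p (scal (of_nat ?M) * e - Y y) \<le> ?M"
  proof -
    have "scal (of_nat ?M) * e - Y y = scal (of_nat (?M - 1)) * e + (e - Y y)"
      using M by (simp add: of_nat_diff single_diff left_diff_distrib)
    then have "p (scal (of_nat ?M) * e - Y y) \<le> p (scal (of_nat (?M - 1)) * e) + p (e - Y y)"
      using p_triangle[of "scal (of_nat (?M - 1)) * e" "e - Y y"] ec Yc[OF yS]
      by (simp add: fcarr_scal fcarr_diff add_diff_eq del: single_of_nat)
    also have "\<dots> \<le> real (?M - 1) * 1 + 1"
      unfolding p_scal[OF ec] using p1 bound[OF yS] by (intro add_mono) (auto simp: mult_left_le)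
    also have "\<dots> = real ?M" using M by (simp add: of_nat_diff)
    finally show ?thesis .
  qed
  let ?c = "1 / of_nat ?M :: complex"
  have cM: "scal ?c * (scal (of_nat ?M) * e) = e" using M by (simp add: scal_scal del: single_of_nat)
  \<comment> \<open>Adding or subtracting \<open>Y y\<close> divided by M keeps e in the unit ball,
    and e is the unit of its corner.\<close>
  have "p (scal ?c * Y y) = 0"
  proof (rule extreme_unit[OF ee])
    show "e * (scal ?c * Y y) \<simeq> scal ?c * Y y" "scal ?c * Y y * e \<simeq> scal ?c * Y y"
      using eY[OF yS] by (simp_all add: mult_scal mult.assoc eqv_scal)
    have "e + scal ?c * Y y = scal ?c * (scal (of_nat ?M) * e + Y y)" "e - scal ?c * Y y = scal ?c
      * (scal (of_nat ?M) * e - Y y)"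
      using cM by (simp_all add: distrib_left right_diff_distrib)
    then show "p (e + scal ?c * Y y) \<le> 1" "p (e - scal ?c * Y y) \<le> 1"
      using two three M ec Yc[OF yS] p_scal[of "scal (of_nat ?M) * e
        + Y y" ?c] p_scal[of "scal (of_nat ?M) * e - Y y" ?c]
      by (auto simp: norm_divide fcarr_add fcarr_diff fcarr_scal)
  qed (use p1 in auto)
  then have "p (Y y) = 0" using p_scal[OF Yc[OF yS], of ?c] M by (simp add: norm_divide)
  \<comment> \<open>By the C*-identity \<open>P y * e\<close> is null as well; s_y^* s_x is this
    product placed between s_y^* and s_x.\<close>
  moreover have "free_adj (P y * e) * (P y * e) \<simeq> Y y"
  proof -
    have "free_adj (P y * e) * (P y * e) = e * ((P y * P y) * e)"
      by (simp add: free_adj_mult e_def Padj mult.assoc)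
    also have "\<dots> \<simeq> e * (P y * e)" by (intro eqv_mult_left eqv_mult_right PP yS ec)
    finally show ?thesis by (simp add: Y_def mult.assoc)
  qed
  ultimately have "p (P y * e) = 0"
    using eqv_p p_cstar[of "P y * e"] Pc[OF yS] ec by (metis fcarr_mult power2_eq_square mult_eq_0_iff)
  then have Pe: "P y * e \<simeq> 0" using Pc[OF yS] ec by (auto simp: eqv_zero_iff)
  note mx = m[OF xS] and my = m[OF yS]
  have py: "st y * gen y * st y \<simeq> st y"
    using eqv_free_adj[OF eqv_partial_isometry[OF my(1)]] by (simp add: free_adj_mult mult.assoc)
  have "st y * gen x \<simeq> (st y * gen y * st y) * (gen x * st x * gen x)"
    by (rule eqv_mult[OF eqv_sym[OF py] eqv_sym[OF eqv_partial_isometry[OF mx(1)]]])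
  also have "\<dots> = st y * (P y * e) * gen x" by (simp add: P_def e_def mult.assoc)
  also have "\<dots> \<simeq> 0" by (intro eqv_mult_zero(2)[OF gen_carr[OF mx(1)]] eqv_mult_zero(1)[OF st_carr[OF my(1)]] Pe)
  finally show ?thesis .
qed

lemma paths_le_orthogonal:
  assumes "x \<in> paths_le \<Lambda> n" "y \<in> paths_le \<Lambda> n" "x \<noteq> y"
  shows "st y * gen x \<simeq> 0"
proof (cases "rng \<Lambda> x = rng \<Lambda> y")
  case True
  then show ?thesis
    using le_paths_orthogonal[of "rng \<Lambda> x" x n y] assms rng_verts paths_le_mor by (auto simp: le_paths_iff)
next
  case False
  then show ?thesis using eqv_zero_if_rng_rng[of y x] assms paths_le_mor by metis
qed

end

section \<open>Words as partial injections of the set of paths\<close>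

subsection \<open>The action of words on paths\<close>

context k_graph
begin

text \<open>In the representation on \<open>\<ell>\<^sup>2\<close> of the paths in which \<open>s\<^sub>x\<close> prepends \<open>x\<close>, a word \<open>w\<close> maps the basis
  vector of \<open>m\<close> to that of \<open>m'\<close> if \<open>act w m = Some m'\<close>, and to \<open>0\<close> if \<open>act w m = None\<close>.\<close>

definition act1 :: "'a \<times> bool \<Rightarrow> 'a \<Rightarrow> 'a option" where
  "act1 l m = (if snd l then (if \<exists>b\<in>mor \<Lambda>. src \<Lambda> (fst l) = rng \<Lambda> b \<and> m = cmp \<Lambda> (fst l) b
      then Some (THE b. b \<in> mor \<Lambda> \<and> src \<Lambda> (fst l) = rng \<Lambda> b \<and> m = cmp \<Lambda> (fst l) b) else None)
    else if src \<Lambda> (fst l) = rng \<Lambda> m then Some (cmp \<Lambda> (fst l) m) else None)"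

fun act :: "('a \<times> bool) list \<Rightarrow> 'a \<Rightarrow> 'a option" where
  "act [] m = Some m"
| "act (l # w) m = Option.bind (act w m) (act1 l)"

text \<open>This is kept apart from \<open>deg_star\<close>: the difference of the two is the degree
  under the gauge action, while \<open>deg_star w\<close> alone bounds how much of a path the word w
  can strip off.\<close>

definition deg_plus :: "('a \<times> bool) list \<Rightarrow> nat ^ 'k" where
  "deg_plus w = sum_list (map (\<lambda>l. if snd l then 0 else deg \<Lambda> (fst l)) w)"

definition deg_star :: "('a \<times> bool) list \<Rightarrow> nat ^ 'k" where
  "deg_star w = sum_list (map (\<lambda>l. if snd l then deg \<Lambda> (fst l) else 0) w)"

lemma act1_False: "act1 (x, False) m = (if src \<Lambda> x = rng \<Lambda> m then Some (cmp \<Lambda> x m) else None)"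
  by (simp add: act1_def)

lemma act1_True:
  assumes "x \<in> mor \<Lambda>"
  shows "act1 (x, True) m = Some b \<longleftrightarrow> b \<in> mor \<Lambda> \<and> src \<Lambda> x = rng \<Lambda> b \<and> m = cmp \<Lambda> x b"
proof -
  have "(THE b. b \<in> mor \<Lambda> \<and> src \<Lambda> x = rng \<Lambda> b \<and> m = cmp \<Lambda> x b) = b"
    if "b \<in> mor \<Lambda>" "src \<Lambda> x = rng \<Lambda> b" "m = cmp \<Lambda> x b" for b
    using that cancel_left[OF assms] by (intro the_equality) auto
  note the = this
  show ?thesis
  proof
    assume act: "act1 (x, True) m = Some b"
    then obtain b' where b': "b' \<in> mor \<Lambda>" "src \<Lambda> x = rng \<Lambda> b'" "m = cmp \<Lambda> x b'"
      by (auto simp: act1_def split: if_splits)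
    then have "act1 (x, True) m = Some b'" using the[OF b'] by (auto simp: act1_def)
    then show "b \<in> mor \<Lambda> \<and> src \<Lambda> x = rng \<Lambda> b \<and> m = cmp \<Lambda> x b" using act b' by simp
  qed (use the in \<open>auto simp: act1_def\<close>)
qed

end

context lc_kgraph
begin

lemma act1_level:
  assumes "act1 (x, s) m = Some m'" "x \<in> mor \<Lambda>" "m \<in> paths_le \<Lambda> N" "s \<Longrightarrow> deg \<Lambda> x \<le> N"
  shows "src \<Lambda> m' = src \<Lambda> m \<and> (\<exists>N'. N' + deg_star [(x, s)] = N + deg_plus [(x, s)] \<and> m' \<in> paths_le \<Lambda> N')"
proof (cases s)
  case False
  then have "src \<Lambda> x = rng \<Lambda> m" "m' = cmp \<Lambda> x m" using assms(1) by (auto simp: act1_False split: if_splits)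
  moreover have "cmp \<Lambda> x m \<in> paths_le \<Lambda> (deg \<Lambda> x + N)"
    using calculation assms by (intro cmp_paths_le self_paths_le) auto
  ultimately show ?thesis using False assms paths_le_mor[OF assms(3)]
    by (auto simp: deg_plus_def deg_star_def src_cmp add.commute)
next
  case True
  then have m': "m' \<in> mor \<Lambda>" "src \<Lambda> x = rng \<Lambda> m'" "m = cmp \<Lambda> x m'" using assms by (auto simp: act1_True)
  have sm: "src \<Lambda> m = src \<Lambda> m'" and dm: "deg \<Lambda> m = deg \<Lambda> x + deg \<Lambda> m'"
    using m' assms by (auto simp: src_cmp deg_cmp)
  have le: "deg \<Lambda> x $ i \<le> N $ i" for i using assms(4)[OF True] by (simp add: less_eq_vec_def)
  have "m' \<in> paths_le \<Lambda> (N - deg \<Lambda> x)"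
  proof (rule paths_leI[OF m'(1)])
    fix i
    have "deg \<Lambda> m $ i \<le> N $ i" using paths_le_deg[OF assms(3)] by (simp add: less_eq_vec_def)
    then show "deg \<Lambda> m' $ i \<le> (N - deg \<Lambda> x) $ i" using dm by simp
    assume "deg \<Lambda> m' $ i < (N - deg \<Lambda> x) $ i"
    then have "deg \<Lambda> m $ i < N $ i" using dm le[of i] by simp
    then show "edges_at (src \<Lambda> m') i = {}" using paths_le_edges[OF assms(3)] sm by simp
  qed
  moreover have "N - deg \<Lambda> x + deg \<Lambda> x = N" using le by (simp add: vec_eq_iff)
  ultimately show ?thesis using True sm by (auto simp: deg_plus_def deg_star_def)
qed

text \<open>A word shifts the level of a path by its degree; the equation between sums avoids the
  truncated subtraction of \<open>nat ^ 'k\<close>. The bound on \<open>deg_star w\<close> ensures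
  that each starred letter meets a path of sufficient level.\<close>

lemma act_level:
  assumes "act w m = Some m'" "fst ` set w \<subseteq> mor \<Lambda>" "m \<in> paths_le \<Lambda> N" "deg_star w \<le> N"
  shows "src \<Lambda> m' = src \<Lambda> m \<and> (\<exists>N'. N' + deg_star w = N + deg_plus w \<and> m' \<in> paths_le \<Lambda> N')"
  using assms
proof (induction w arbitrary: m')
  case Nil
  then show ?case by (auto simp: deg_star_def deg_plus_def)
next
  case (Cons l w)
  obtain x s where l: "l = (x, s)" by (cases l)
  obtain k where k: "act w m = Some k" "act1 l k = Some m'" using Cons.prems(1)
    by (auto simp: bind_eq_Some_conv)
  have ds: "deg_star (l # w) = deg_star [l] + deg_star w" "deg_plus (l # w) = deg_plus [l] + deg_plus w"
    by (simp_all add: deg_star_def deg_plus_def)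
  have dsi: "deg_star [l] $ i + deg_star w $ i \<le> N $ i" for i
    using Cons.prems(4) by (simp add: ds(1) less_eq_vec_def)
  then have dw: "deg_star w \<le> N" unfolding less_eq_vec_def by (metis add_leD2)
  obtain N1 where N1: "src \<Lambda> k = src \<Lambda> m" "N1 + deg_star w = N + deg_plus w" "k \<in> paths_le \<Lambda> N1"
    using Cons.IH[OF k(1) _ Cons.prems(3) dw] Cons.prems(2) by auto
  have N1i: "N1 $ i + deg_star w $ i = N $ i + deg_plus w $ i" for i
    using N1(2) by (metis vector_add_component)
  have "deg \<Lambda> x \<le> N1" if s
    unfolding less_eq_vec_def
  proof
    fix i
    have "deg \<Lambda> x $ i + deg_star w $ i \<le> N $ i" using dsi[of i] that by (simp add: deg_star_def l)
    then show "deg \<Lambda> x $ i \<le> N1 $ i" using N1i[of i] by linarith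
  qed
  then obtain N' where N': "src \<Lambda> m' = src \<Lambda> k" "N' + deg_star [l] = N1 + deg_plus [l]" "m' \<in> paths_le \<Lambda> N'"
    using act1_level[of x s k m' N1] k l N1 Cons.prems(2) by auto
  have N'i: "N' $ i + deg_star [l] $ i = N1 $ i + deg_plus [l] $ i" for i
    using N'(2) by (metis vector_add_component)
  have "N' + deg_star (l # w) = N + deg_plus (l # w)"
    unfolding vec_eq_iff ds
  proof
    fix i show "(N' + (deg_star [l] + deg_star w)) $ i = (N + (deg_plus [l] + deg_plus w)) $ i"
      using N1i[of i] N'i[of i] by simp
  qed
  then show ?case using N' N1(1) by auto
qed

end

context lc_ck
begin

text \<open>A starred letter is evaluated by splitting m at level d(x): the initial segment is
  either x, which cancels, or another member of \<open>paths_le \<Lambda> (deg \<Lambda> x)\<close>,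
  which is orthogonal to x.\<close>

lemma letter_act:
  assumes l: "x \<in> mor \<Lambda>" and m: "m \<in> paths_le \<Lambda> N" and s: "s \<Longrightarrow> deg \<Lambda> x \<le> N"
  shows "letter_hom gen (x, s) * gen m \<simeq> (case act1 (x, s) m of None \<Rightarrow> 0 | Some m' \<Rightarrow> gen m')"
proof -
  have mm: "m \<in> mor \<Lambda>" using m by (rule paths_le_mor)
  show ?thesis
  proof (cases s)
    case False
    then show ?thesis
      using eqv_product[OF l mm] eqv_zero_if_src_rng[OF l mm] by (simp add: letter_hom_def act1_False)
  next
    case True
    have "deg \<Lambda> x $ i \<le> N $ i" for i using s[OF True] by (simp add: less_eq_vec_def)
    then have N: "N = deg \<Lambda> x + (N - deg \<Lambda> x)" by (simp add: vec_eq_iff)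
    from m have "m \<in> paths_le \<Lambda> (deg \<Lambda> x + (N - deg \<Lambda> x))" using N by simp
    then obtain a b where ab: "a \<in> paths_le \<Lambda> (deg \<Lambda> x)" "b \<in> paths_le \<Lambda> (N - deg \<Lambda> x)"
      "src \<Lambda> a = rng \<Lambda> b" "m = cmp \<Lambda> a b" by (rule paths_le_factor)
    note am = paths_le_mor[OF ab(1)] and bm = paths_le_mor[OF ab(2)]
    have "st x * gen m \<simeq> st x * (gen a * gen b)"
      unfolding ab(4) by (intro eqv_mult_left st_carr l eqv_sym[OF eqv_product] am bm ab)
    also have "\<dots> = (st x * gen a) * gen b" by (simp add: mult.assoc)
    finally have e1: "st x * gen m \<simeq> (st x * gen a) * gen b" .
    show ?thesis
    proof (cases "a = x")
      case ax: True
      then have "act1 (x, True) m = Some b" using act1_True[OF l] ab bm by simp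
      moreover have "(st x * gen a) * gen b \<simeq> gen (src \<Lambda> x) * gen b"
        unfolding ax by (intro eqv_mult_right gen_carr bm eqv_source l)
      moreover have "gen (src \<Lambda> x) * gen b \<simeq> gen b" using eqv_rng[OF bm] ab ax by simp
      ultimately show ?thesis using True eqv_trans[OF e1 eqv_trans] by (simp add: letter_hom_def)
    next
      case ax: False
      have "act1 (x, True) m \<noteq> Some b'" for b'
        using act1_True[OF l, of m b'] paths_le_factor_unique(1)[OF ab(1) bm ab(3) self_paths_le[OF
          l], of b'] ab(4) ax by auto
      then have "act1 (x, True) m = None" by auto
      moreover have "(st x * gen a) * gen b \<simeq> 0"
        using paths_le_orthogonal[OF ab(1) self_paths_le[OF l] ax]
          by (rule eqv_mult_zero(2)[OF gen_carr[OF bm]])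
      ultimately show ?thesis using True eqv_trans[OF e1] by (simp add: letter_hom_def)
    qed
  qed
qed

lemma word_act:
  assumes "fst ` set w \<subseteq> mor \<Lambda>" "m \<in> paths_le \<Lambda> N" "deg_star w \<le> N"
  shows "word_hom gen w * gen m \<simeq> (case act w m of None \<Rightarrow> 0 | Some m' \<Rightarrow> gen m')"
  using assms
proof (induction w)
  case Nil
  then show ?case using paths_le_mor by (auto simp: word_hom_def)
next
  case (Cons l w)
  obtain x s where l: "l = (x, s)" by (cases l)
  have x: "x \<in> mor \<Lambda>" and w: "fst ` set w \<subseteq> mor \<Lambda>" using Cons.prems l by auto
  have lc: "letter_hom gen l \<in> fcarr \<Lambda>" using x l by (intro fcarr_letter_hom gen_carr) simp
  have dsi: "deg_star [l] $ i + deg_star w $ i \<le> N $ i" for i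
    using Cons.prems(3) by (simp add: deg_star_def less_eq_vec_def)
  then have dw: "deg_star w \<le> N" unfolding less_eq_vec_def by (metis add_leD2)
  have "word_hom gen (l # w) * gen m = letter_hom gen l * (word_hom gen w * gen m)"
    by (simp add: word_hom_def mult.assoc)
  also have "\<dots> \<simeq> letter_hom gen l * (case act w m of None \<Rightarrow> 0 | Some m' \<Rightarrow> gen m')"
    using Cons.IH[OF w Cons.prems(2) dw] by (rule eqv_mult_left[OF lc])
  finally have e1: "word_hom gen (l # w) * gen m \<simeq> letter_hom gen l
    * (case act w m of None \<Rightarrow> 0 | Some m' \<Rightarrow> gen m')" .
  show ?case
  proof (cases "act w m")
    case None
    then show ?thesis using e1 by simp
  next
    case (Some k)
    obtain N1 where N1: "N1 + deg_star w = N + deg_plus w" "k \<in> paths_le \<Lambda> N1"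
      using act_level[OF Some w Cons.prems(2) dw] by auto
    have N1i: "N1 $ i + deg_star w $ i = N $ i + deg_plus w $ i" for i
      using N1(1) by (metis vector_add_component)
    have "deg \<Lambda> x \<le> N1" if s
      unfolding less_eq_vec_def
    proof
      fix i
      have "deg \<Lambda> x $ i + deg_star w $ i \<le> N $ i" using dsi[of i] that by (simp add: deg_star_def l)
      then show "deg \<Lambda> x $ i \<le> N1 $ i" using N1i[of i] by linarith
    qed
    from letter_act[OF x N1(2) this]
    have "letter_hom gen l * gen k \<simeq> (case act1 l k of None \<Rightarrow> 0 | Some m' \<Rightarrow> gen m')" by (simp add: l)
    then show ?thesis using e1 Some eqv_trans[OF e1] by simp
  qed
qed

definition homogeneous :: "'a falg \<Rightarrow> bool" where
  "homogeneous f \<longleftrightarrow> (\<forall>w\<in>keys f. deg_plus (letters w) = deg_star (letters w))"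

text \<open>A word of degree zero takes m to 0 or to a path of the same level N, and two paths of
  one level are equal or orthogonal.\<close>

lemma compress_word:
  assumes w: "fst ` set w \<subseteq> mor \<Lambda>" "deg_plus w = deg_star w" and m: "m \<in> paths_le \<Lambda> N" and N: "deg_star w \<le> N"
  shows "\<exists>c. st m * (word_hom gen w * gen m) \<simeq> scal c * gen (src \<Lambda> m)"
proof -
  have mm: "m \<in> mor \<Lambda>" using m by (rule paths_le_mor)
  note e1 = eqv_mult_left[OF st_carr[OF mm] word_act[OF w(1) m N]]
  have z: "scal 0 * gen (src \<Lambda> m) = 0" by simp
  show ?thesis
  proof (cases "act w m")
    case None
    then have "st m * (word_hom gen w * gen m) \<simeq> scal 0 * gen (src \<Lambda> m)" using e1 by simp
    then show ?thesis by blast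
  next
    case (Some k)
    then have e2: "st m * (word_hom gen w * gen m) \<simeq> st m * gen k" using e1 by simp
    obtain N' where "N' + deg_star w = N + deg_plus w" "k \<in> paths_le \<Lambda> N'"
      using act_level[OF Some w(1) m N] by auto
    moreover from this(1) have "N' = N" using w(2) by (simp add: vec_eq_iff)
    ultimately have k: "k \<in> paths_le \<Lambda> N" by simp
    show ?thesis
    proof (cases "k = m")
      case True
      then have "st m * gen k \<simeq> scal 1 * gen (src \<Lambda> m)" using eqv_source[OF mm] by simp
      then show ?thesis using e2 eqv_trans by blast
    next
      case False
      then have "st m * gen k \<simeq> scal 0 * gen (src \<Lambda> m)" using paths_le_orthogonal[OF k m] by simp
      then show ?thesis using e2 eqv_trans by blast
    qed
  qed
qed

lemma compress_homogeneous:
  assumes f: "f \<in> fcarr \<Lambda>" and h: "homogeneous f"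
  shows "\<exists>N. \<forall>m\<in>paths_le \<Lambda> N. \<exists>c. st m * (f * gen m) \<simeq> scal c * gen (src \<Lambda> m)"
proof (rule exI, rule ballI)
  \<comment> \<open>A level not below the starred degree of any word of f.\<close>
  let ?N = "\<Sum>w\<in>keys f. deg_star (letters w)"
  fix m assume m: "m \<in> paths_le \<Lambda> ?N"
  have mm: "m \<in> mor \<Lambda>" using m by (rule paths_le_mor)
  have le: "deg_star (letters w) \<le> ?N" if "w \<in> keys f" for w
  proof -
    have "deg_star (letters w) $ i \<le> (\<Sum>w\<in>keys f. deg_star (letters w) $ i)" for i
      using that by (intro member_le_sum) auto
    then show ?thesis by (simp add: less_eq_vec_def sum_component)
  qed
  have ex: "\<exists>c. st m * (word_hom gen (letters w) * gen m) \<simeq> scal c * gen (src \<Lambda> m)" if "w \<in> keys f" for w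
    using that f h le by (intro compress_word[OF _ _ m]) (auto simp: fcarr_def homogeneous_def)
  then obtain c where c: "\<And>w. w \<in> keys f \<Longrightarrow> st m * (word_hom gen (letters w) * gen m) \<simeq> scal (c w)
    * gen (src \<Lambda> m)"
    by metis
  have "st m * (f * gen m) = (\<Sum>w\<in>keys f. scal (lookup f w) * (st m * (word_hom gen (letters w) * gen m)))"
  proof -
    have "f = (\<Sum>w\<in>keys f. scal (lookup f w) * word_hom gen (letters w))"
      using free_hom_gen_id[OF f] by (simp add: free_hom_def)
    then have "st m * (f * gen m) = st m * ((\<Sum>w\<in>keys f. scal (lookup f w) * word_hom gen (letters w)) * gen m)"
      by simp
    also have "\<dots> = (\<Sum>w\<in>keys f. st m * (scal (lookup f w) * (word_hom gen (letters w) * gen m)))"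
      by (simp add: sum_distrib_left sum_distrib_right mult.assoc)
    also have "\<dots> = (\<Sum>w\<in>keys f. scal (lookup f w) * (st m * (word_hom gen (letters w) * gen m)))"
      by (simp only: mult_scal[of "st m"])
    finally show ?thesis .
  qed
  also have "\<dots> \<simeq> (\<Sum>w\<in>keys f. scal (lookup f w) * (scal (c w) * gen (src \<Lambda> m)))"
    by (intro eqv_sum eqv_scal c)
  also have "\<dots> = scal (\<Sum>w\<in>keys f. lookup f w * c w) * gen (src \<Lambda> m)"
  proof -
    have "scal (\<Sum>w\<in>S. lookup f w * c w) = (\<Sum>w\<in>S. scal (lookup f w * c w) :: 'a falg)" for S
      by (induction S rule: infinite_finite_induct) (simp_all add: single_add)
    then show ?thesis by (simp add: scal_scal sum_distrib_right)
  qed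
  finally show "\<exists>c. st m * (f * gen m) \<simeq> scal c * gen (src \<Lambda> m)" by blast
qed

end


section \<open>The representation on finite paths and its asymptotic norm\<close>

subsection \<open>Nonvanishing vertex projections\<close>

text \<open>The Hilbert space norm of finitely supported functions; on infinite support its value is
  0 by convention.\<close>

definition l2 :: "('a \<Rightarrow> complex) \<Rightarrow> real" where
  "l2 \<xi> = L2_set (\<lambda>y. cmod (\<xi> y)) {y. \<xi> y \<noteq> 0}"

lemma l2_eq: assumes "finite S" "{y. \<xi> y \<noteq> 0} \<subseteq> S" shows "l2 \<xi> = L2_set (\<lambda>y. cmod (\<xi> y)) S"
  unfolding l2_def L2_set_def using assms
  by (intro arg_cong[of _ _ sqrt] sum.mono_neutral_left) auto

lemma l2_nonneg [simp]: "0 \<le> l2 \<xi>"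
  by (simp add: l2_def)

lemma l2_add:
  assumes "finite {y. \<xi> y \<noteq> 0}" "finite {y. \<eta> y \<noteq> 0}"
  shows "l2 (\<lambda>y. \<xi> y + \<eta> y) \<le> l2 \<xi> + l2 \<eta>"
proof -
  let ?S = "{y. \<xi> y \<noteq> 0} \<union> {y. \<eta> y \<noteq> 0}"
  have f: "finite ?S" using assms by simp
  have "l2 (\<lambda>y. \<xi> y + \<eta> y) = L2_set (\<lambda>y. cmod (\<xi> y + \<eta> y)) ?S" by (rule l2_eq[OF f]) auto
  also have "\<dots> \<le> L2_set (\<lambda>y. cmod (\<xi> y) + cmod (\<eta> y)) ?S"
    by (rule L2_set_mono) (simp_all add: norm_triangle_ineq)
  also have "\<dots> \<le> L2_set (\<lambda>y. cmod (\<xi> y)) ?S + L2_set (\<lambda>y. cmod (\<eta> y)) ?S"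
    by (rule L2_set_triangle_ineq)
  also have "\<dots> = l2 \<xi> + l2 \<eta>" using l2_eq[OF f, of \<xi>] l2_eq[OF f, of \<eta>] by simp
  finally show ?thesis .
qed

lemma l2_cmult: "l2 (\<lambda>y. c * \<xi> y) = cmod c * l2 \<xi>"
proof (cases "c = 0")
  case False
  then have "{y. c * \<xi> y \<noteq> 0} = {y. \<xi> y \<noteq> 0}" by auto
  then show ?thesis by (simp add: l2_def norm_mult L2_set_right_distrib)
qed (simp add: l2_def L2_set_def)

context k_graph
begin

definition wadj :: "('a \<times> bool) list \<Rightarrow> ('a \<times> bool) list" where
  "wadj w = rev (map (\<lambda>(x, s). (x, \<not> s)) w)"

lemma wadj_Cons: "wadj ((x, s) # w) = wadj w @ [(x, \<not> s)]"
  by (simp add: wadj_def)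

lemma wadj_append: "wadj (u @ v) = wadj v @ wadj u"
  by (simp add: wadj_def)

lemma wadj_wadj [simp]: "wadj (wadj w) = w"
  by (simp add: wadj_def rev_map comp_def case_prod_unfold)

lemma fst_wadj [simp]: "fst ` set (wadj w) = fst ` set w"
  by (force simp: wadj_def image_iff)

lemma act_append: "act (u @ v) m = Option.bind (act v m) (act u)"
  by (induction u) (auto split: bind_splits)

lemma act1_mor: "x \<in> mor \<Lambda> \<Longrightarrow> m \<in> mor \<Lambda> \<Longrightarrow> act1 (x, s) m = Some m' \<Longrightarrow> m' \<in> mor \<Lambda>"
  by (cases s) (auto simp: act1_True act1_False cmp_closed split: if_splits)

lemma act_mor: "fst ` set w \<subseteq> mor \<Lambda> \<Longrightarrow> m \<in> mor \<Lambda> \<Longrightarrow> act w m = Some m' \<Longrightarrow> m' \<in> mor \<Lambda>"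
proof (induction w arbitrary: m')
  case (Cons l w)
  then show ?case using act1_mor[of "fst l"] by (cases l) (auto simp: bind_eq_Some_conv)
qed simp

lemma act1_inverse:
  assumes "x \<in> mor \<Lambda>" "m \<in> mor \<Lambda>" "m' \<in> mor \<Lambda>"
  shows "act1 (x, \<not> s) m' = Some m \<longleftrightarrow> act1 (x, s) m = Some m'"
  using assms by (cases s) (auto simp: act1_True act1_False)

text \<open>Words act by partial injections, with the adjoint word as partial inverse. This
  injectivity makes \<open>Tw\<close> contractive and yields its adjoint.\<close>

lemma act_inverse:
  assumes "fst ` set w \<subseteq> mor \<Lambda>" "m \<in> mor \<Lambda>" "m' \<in> mor \<Lambda>"
  shows "act (wadj w) m' = Some m \<longleftrightarrow> act w m = Some m'"
  using assms
proof (induction w arbitrary: m')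
  case Nil
  then show ?case by (auto simp: wadj_def)
next
  case (Cons l w)
  obtain x s where l: "l = (x, s)" by (cases l)
  have x: "x \<in> mor \<Lambda>" and w: "fst ` set w \<subseteq> mor \<Lambda>" using Cons.prems l by auto
  have "act (wadj (l # w)) m' = Some m \<longleftrightarrow> (\<exists>k. act1 (x, \<not> s) m' = Some k \<and> act (wadj w) k = Some m)"
    by (simp add: l wadj_Cons act_append bind_eq_Some_conv)
  also have "\<dots> \<longleftrightarrow> (\<exists>k. act1 (x, s) k = Some m' \<and> act w m = Some k)"
    using Cons.IH[OF w Cons.prems(2)] act1_inverse[OF x _ Cons.prems(3)] act1_mor[OF x Cons.prems(3)]
      act_mor[OF w Cons.prems(2)] by metis
  also have "\<dots> \<longleftrightarrow> act (l # w) m = Some m'"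
    by (auto simp: l bind_eq_Some_conv)
  finally show ?case .
qed

text \<open>The coordinate of the image at y is that of \<xi> at the unique preimage of y under w,
  which is found by running the adjoint word.\<close>

definition Tw :: "('a \<times> bool) list \<Rightarrow> ('a \<Rightarrow> complex) \<Rightarrow> 'a \<Rightarrow> complex" where
  "Tw w \<xi> y = (if y \<in> mor \<Lambda> then (case act (wadj w) y of None \<Rightarrow> 0 | Some x \<Rightarrow> \<xi> x) else 0)"

definition T :: "'a falg \<Rightarrow> ('a \<Rightarrow> complex) \<Rightarrow> 'a \<Rightarrow> complex" where
  "T f \<xi> y = (\<Sum>w\<in>keys f. lookup f w * Tw (letters w) \<xi> y)"

lemma Tw_append: "fst ` set u \<subseteq> mor \<Lambda> \<Longrightarrow> Tw (u @ v) \<xi> = Tw u (Tw v \<xi>)"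
  using act_mor[of "wadj u"] by (auto simp: Tw_def wadj_append act_append fun_eq_iff split: option.splits)

lemma T_add: "T (f + g) \<xi> y = T f \<xi> y + T g \<xi> y"
  unfolding T_def by (rule setsum_keys_plus_distrib) (simp_all add: distrib_right)

lemma T_zero [simp]: "T 0 \<xi> y = 0"
  by (simp add: T_def)

lemma T_single: "T (Poly_Mapping.single w c) \<xi> y = c * Tw (letters w) \<xi> y"
  by (simp add: T_def)

lemma T_scal: "T (scal c * f) \<xi> y = c * T f \<xi> y"
  by (induction f rule: falg_induct) (simp_all add: mult_single T_single distrib_left T_add)

lemma T_diff: "T (f - g) \<xi> y = T f \<xi> y - T g \<xi> y"
  using T_add[of f "scal (-1) * g"] by (simp add: T_scal) (simp add: single_uminus)

lemma T_sum: "T (sum f S) \<xi> y = (\<Sum>x\<in>S. T (f x) \<xi> y)"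
  by (induction S rule: infinite_finite_induct) (simp_all add: T_add)

lemma T_word: "T (word_hom gen w) \<xi> y = Tw w \<xi> y"
  by (simp add: word_hom_gen T_single)

lemma T_mult: assumes "f \<in> fcarr \<Lambda>" shows "T (f * g) \<xi> y = T f (T g \<xi>) y"
  using assms
proof (induction rule: fcarr_induct)
  case zero show ?case by simp
next
  case (word w c)
  have "T (word_hom gen w * g) \<xi> y = Tw w (T g \<xi>) y"
  proof (induction g rule: falg_induct)
    case (single v d)
    have "word_hom gen w * Poly_Mapping.single v d = Poly_Mapping.single (Star_Word w + v) d"
      by (simp add: word_hom_gen mult_single)
    then show ?case using word Tw_append[of w "letters v" \<xi>]
      by (simp add: T_single) (simp add: Tw_def T_single split: option.splits)
  next
    case (add g h)
    have "Tw w (T (g + h) \<xi>) y = Tw w (T g \<xi>) y + Tw w (T h \<xi>) y"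
      by (simp add: Tw_def T_add split: option.splits)
    then show ?case by (simp only: distrib_left T_add[of "word_hom gen w * g"] add)
  qed
  then show ?case by (simp add: T_scal mult.assoc T_word)
next
  case (add f f')
  then show ?case by (simp add: distrib_right T_add)
qed

lemma letter_carr: "x \<in> mor \<Lambda> \<Longrightarrow> gen x \<in> fcarr \<Lambda>" "x \<in> mor \<Lambda> \<Longrightarrow> free_adj (gen x) \<in> fcarr \<Lambda>"
  by auto

lemma T_gen: "T (gen x) \<xi> y = (if y \<in> mor \<Lambda> then (case act1 (x, True) y of None \<Rightarrow> 0 | Some b \<Rightarrow> \<xi> b) else 0)"
  using T_word[of "[(x, False)]" \<xi> y] by (simp add: word_hom_def letter_hom_def Tw_def wadj_def)

lemma T_st: "T (free_adj (gen x)) \<xi> y = (if y \<in> mor \<Lambda> \<and> src \<Lambda> x = rng \<Lambda> y then \<xi> (cmp \<Lambda> x y) else 0)"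
  using T_word[of "[(x, True)]" \<xi> y] by (simp add: word_hom_def letter_hom_def Tw_def wadj_def act1_False)

lemma act1_cmp: "x \<in> mor \<Lambda> \<Longrightarrow> b \<in> mor \<Lambda> \<Longrightarrow> src \<Lambda> x = rng \<Lambda> b \<Longrightarrow> act1 (x, True) (cmp \<Lambda> x b) = Some b"
  by (simp add: act1_True)

lemma act1_vertex: assumes "v \<in> verts \<Lambda>" "y \<in> mor \<Lambda>"
  shows "act1 (v, True) y = (if rng \<Lambda> y = v then Some y else None)"
proof (cases "rng \<Lambda> y = v")
  case True
  then show ?thesis using assms act1_True[of v y y] cmp_rng[of y] by (auto simp: vert_mor)
next
  case False
  have "act1 (v, True) y \<noteq> Some b" for b
    using act1_True[of v y b] assms False rng_cmp[of v b] by (auto simp: vert_mor)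
  then show ?thesis using False by auto
qed

lemma T_proj: assumes "x \<in> mor \<Lambda>"
  shows "T (gen x * free_adj (gen x)) \<xi> y =
    (if y \<in> mor \<Lambda> \<and> (\<exists>b\<in>mor \<Lambda>. src \<Lambda> x = rng \<Lambda> b \<and> y = cmp \<Lambda> x b) then \<xi> y else 0)"
proof (cases "act1 (x, True) y")
  case None
  then have "\<not> (\<exists>b\<in>mor \<Lambda>. src \<Lambda> x = rng \<Lambda> b \<and> y = cmp \<Lambda> x b)" using act1_True[OF assms, of y] by auto
  then show ?thesis using None by (auto simp: T_mult letter_carr assms T_gen)
next
  case (Some b)
  then have "b \<in> mor \<Lambda>" "src \<Lambda> x = rng \<Lambda> b" "y = cmp \<Lambda> x b" using act1_True[OF assms, of y] by auto
  then show ?thesis using Some by (auto simp: T_mult letter_carr assms T_gen T_st)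
qed

definition fin_vec :: "('a \<Rightarrow> complex) \<Rightarrow> bool" where
  "fin_vec \<xi> \<longleftrightarrow> finite {y. \<xi> y \<noteq> 0} \<and> {y. \<xi> y \<noteq> 0} \<subseteq> mor \<Lambda>"

lemma fin_vec_finite: "fin_vec \<xi> \<Longrightarrow> finite {y. \<xi> y \<noteq> 0}"
  by (simp add: fin_vec_def)

lemma Tw_supp:
  assumes "fst ` set w \<subseteq> mor \<Lambda>" "fin_vec \<xi>"
  shows "{y. Tw w \<xi> y \<noteq> 0} \<subseteq> (\<lambda>x. the (act w x)) ` {x. \<xi> x \<noteq> 0 \<and> act w x \<noteq> None}"
    "inj_on (\<lambda>x. the (act w x)) {x. \<xi> x \<noteq> 0 \<and> act w x \<noteq> None}"
    "\<And>x. \<xi> x \<noteq> 0 \<Longrightarrow> act w x \<noteq> None \<Longrightarrow> Tw w \<xi> (the (act w x)) = \<xi> x"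
proof -
  have sub: "\<xi> x \<noteq> 0 \<Longrightarrow> x \<in> mor \<Lambda>" for x using assms by (auto simp: fin_vec_def)
  have inv: "act (wadj w) y = Some x \<longleftrightarrow> act w x = Some y" if "x \<in> mor \<Lambda>" "y \<in> mor \<Lambda>" for x y
    using act_inverse[OF assms(1) that] .
  show 1: "Tw w \<xi> (the (act w x)) = \<xi> x" if x: "\<xi> x \<noteq> 0" "act w x \<noteq> None" for x
  proof -
    obtain y where y: "act w x = Some y" using x(2) by auto
    have "y \<in> mor \<Lambda>" using act_mor[OF assms(1) sub[OF x(1)] y] .
    then show ?thesis using y inv[OF sub[OF x(1)], of y] by (simp add: Tw_def)
  qed
  show "{y. Tw w \<xi> y \<noteq> 0} \<subseteq> (\<lambda>x. the (act w x)) ` {x. \<xi> x \<noteq> 0 \<and> act w x \<noteq> None}"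
  proof
    fix y assume "y \<in> {y. Tw w \<xi> y \<noteq> 0}"
    then obtain x where x: "y \<in> mor \<Lambda>" "act (wadj w) y = Some x" "\<xi> x \<noteq> 0"
      by (auto simp: Tw_def split: if_splits option.splits)
    then have "act w x = Some y" using inv[OF sub[OF x(3)] x(1)] by simp
    then show "y \<in> (\<lambda>x. the (act w x)) ` {x. \<xi> x \<noteq> 0 \<and> act w x \<noteq> None}"
      using x by (intro image_eqI[of _ _ x]) auto
  qed
  show "inj_on (\<lambda>x. the (act w x)) {x. \<xi> x \<noteq> 0 \<and> act w x \<noteq> None}"
  proof (rule inj_onI, clarsimp)
    fix x x' y assume "\<xi> x \<noteq> 0" "\<xi> x' \<noteq> 0" "act w x = Some y" "act w x' = Some y"
    then show "x = x'" using inv[of x y] inv[of x' y] sub act_mor[OF assms(1)] by (metis option.inject)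
  qed
qed

lemma Tw_fin_vec: assumes "fst ` set w \<subseteq> mor \<Lambda>" "fin_vec \<xi>" shows "fin_vec (Tw w \<xi>)"
proof -
  have "finite {x. \<xi> x \<noteq> 0 \<and> act w x \<noteq> None}"
    by (rule finite_subset[OF _ fin_vec_finite[OF assms(2)]]) auto
  then have "finite {y. Tw w \<xi> y \<noteq> 0}" by (rule finite_subset[OF Tw_supp(1)[OF assms] finite_imageI])
  moreover have "{y. Tw w \<xi> y \<noteq> 0} \<subseteq> mor \<Lambda>" by (auto simp: Tw_def)
  ultimately show ?thesis by (simp add: fin_vec_def)
qed

lemma Tw_l2: assumes "fst ` set w \<subseteq> mor \<Lambda>" "fin_vec \<xi>" shows "l2 (Tw w \<xi>) \<le> l2 \<xi>"
proof -
  let ?D = "{x. \<xi> x \<noteq> 0 \<and> act w x \<noteq> None}"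
  have fD: "finite ?D" "finite {x. \<xi> x \<noteq> 0}"
    using assms by (auto simp: fin_vec_def intro: finite_subset[of _ "{x. \<xi> x \<noteq> 0}"])
  have "l2 (Tw w \<xi>) = L2_set (\<lambda>y. cmod (Tw w \<xi> y)) ((\<lambda>x. the (act w x)) ` ?D)"
    using fD Tw_supp(1)[OF assms] by (intro l2_eq) auto
  also have "\<dots> = L2_set (\<lambda>x. cmod (\<xi> x)) ?D"
    unfolding L2_set_def sum.reindex[OF Tw_supp(2)[OF assms]]
    by (intro arg_cong[of _ _ sqrt] sum.cong refl) (auto simp: Tw_supp(3)[OF assms])
  also have "\<dots> \<le> l2 \<xi>"
    unfolding l2_def L2_set_def using fD by (intro real_sqrt_le_mono sum_mono2) auto
  finally show ?thesis .
qed

lemma fin_vec_lin: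
  assumes "fin_vec \<xi>" "fin_vec \<eta>" shows "fin_vec (\<lambda>y. a * \<xi> y + b * \<eta> y)"
proof -
  have sub: "{y. a * \<xi> y + b * \<eta> y \<noteq> 0} \<subseteq> {y. \<xi> y \<noteq> 0} \<union> {y. \<eta> y \<noteq> 0}" by auto
  moreover have "finite ({y. \<xi> y \<noteq> 0} \<union> {y. \<eta> y \<noteq> 0})" using assms by (simp add: fin_vec_def)
  moreover have "{y. \<xi> y \<noteq> 0} \<union> {y. \<eta> y \<noteq> 0} \<subseteq> mor \<Lambda>" using assms by (simp add: fin_vec_def)
  ultimately show ?thesis unfolding fin_vec_def by (meson finite_subset subset_trans)
qed

lemma T_fin_vec: assumes "f \<in> fcarr \<Lambda>" "fin_vec \<xi>" shows "fin_vec (T f \<xi>)"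
  using assms(1)
proof (induction rule: fcarr_induct)
  case zero
  have "T 0 \<xi> = (\<lambda>y. 0)" by (simp add: fun_eq_iff)
  then show ?case by (simp add: fin_vec_def)
next
  case (word w c)
  have "T (scal c * word_hom gen w) \<xi> = (\<lambda>y. c * Tw w \<xi> y + 0 * Tw w \<xi> y)"
    by (simp add: fun_eq_iff T_scal T_word)
  then show ?case
    using fin_vec_lin[OF Tw_fin_vec Tw_fin_vec, OF word(2) assms(2) word(2) assms(2), of c 0] by simp
next
  case (add f g)
  have "T (f + g) \<xi> = (\<lambda>y. 1 * T f \<xi> y + 1 * T g \<xi> y)" by (simp add: fun_eq_iff T_add)
  then show ?case using fin_vec_lin[OF add(3,4), of 1 1] by simp
qed

lemma T_bounded: assumes "f \<in> fcarr \<Lambda>" shows "\<exists>C\<ge>0. \<forall>\<xi>. fin_vec \<xi> \<longrightarrow> l2 (T f \<xi>) \<le> C * l2 \<xi>"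
  using assms
proof (induction rule: fcarr_induct)
  case zero
  have "T 0 \<xi> = (\<lambda>y. 0)" for \<xi> by (simp add: fun_eq_iff)
  then show ?case by (intro exI[of _ 0]) (simp add: l2_def)
next
  case (word w c)
  have "T (scal c * word_hom gen w) \<xi> = (\<lambda>y. c * Tw w \<xi> y)" for \<xi> by (simp add: fun_eq_iff T_scal T_word)
  then show ?case using word by (intro exI[of _ "cmod c"]) (simp add: l2_cmult Tw_l2 mult_left_mono)
next
  case (add f g)
  then obtain B C where BC: "B \<ge> 0" "C \<ge> 0" "\<forall>\<xi>. fin_vec \<xi> \<longrightarrow> l2 (T f \<xi>) \<le> B * l2 \<xi>"
    "\<forall>\<xi>. fin_vec \<xi> \<longrightarrow> l2 (T g \<xi>) \<le> C * l2 \<xi>" by blast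
  have "l2 (T (f + g) \<xi>) \<le> (B + C) * l2 \<xi>" if "fin_vec \<xi>" for \<xi>
  proof -
    have "T (f + g) \<xi> = (\<lambda>y. T f \<xi> y + T g \<xi> y)" by (simp add: fun_eq_iff T_add)
    then have "l2 (T (f + g) \<xi>) \<le> l2 (T f \<xi>) + l2 (T g \<xi>)"
      using that add T_fin_vec fin_vec_finite by (simp add: l2_add)
    also have "\<dots> \<le> (B + C) * l2 \<xi>" using BC that by (auto simp: distrib_right intro: add_mono)
    finally show ?thesis .
  qed
  then show ?case using BC by (intro exI[of _ "B + C"]) auto
qed

text \<open>For a word both sums run over the pairs of x and its image. The induction over f uses
  sums over the support of the first argument, because a common set S would change from one summand
  of f to the next.\<close>

lemma T_adjoint:
  assumes f: "f \<in> fcarr \<Lambda>" and x: "fin_vec \<xi>" and e: "fin_vec \<eta>"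
    and S: "finite S" "S \<subseteq> mor \<Lambda>" "{y. T f \<xi> y \<noteq> 0} \<subseteq> S" "{y. \<xi> y \<noteq> 0} \<subseteq> S"
      "{y. \<eta> y \<noteq> 0} \<subseteq> S" "{y. T (free_adj f) \<eta> y \<noteq> 0} \<subseteq> S"
  shows "(\<Sum>y\<in>S. T f \<xi> y * cnj (\<eta> y)) = (\<Sum>y\<in>S. \<xi> y * cnj (T (free_adj f) \<eta> y))"
proof -
  define D where "D w = {x. \<xi> x \<noteq> 0 \<and> act w x \<noteq> None}" for w
  define ip where "ip \<alpha> \<beta> = (\<Sum>y\<in>{y. \<alpha> y \<noteq> 0}. \<alpha> y * cnj (\<beta> y))" for \<alpha> \<beta> :: "'a \<Rightarrow> complex"
  have ip_eq: "ip \<alpha> \<beta> = (\<Sum>y\<in>U. \<alpha> y * cnj (\<beta> y))" if "finite U" "{y. \<alpha> y \<noteq> 0} \<subseteq> U" for \<alpha> \<beta> U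
    unfolding ip_def using that by (intro sum.mono_neutral_left) auto
  have ip_eq2: "ip \<alpha> \<beta> = (\<Sum>y\<in>U. \<alpha> y * cnj (\<beta> y))"
    if "finite {y. \<alpha> y \<noteq> 0}" "finite U" "{y. \<beta> y \<noteq> 0} \<subseteq> U" for \<alpha> \<beta> U
  proof -
    have "ip \<alpha> \<beta> = (\<Sum>y\<in>U \<union> {y. \<alpha> y \<noteq> 0}. \<alpha> y * cnj (\<beta> y))" using that by (intro ip_eq) auto
    also have "\<dots> = (\<Sum>y\<in>U. \<alpha> y * cnj (\<beta> y))" using that by (intro sum.mono_neutral_right) auto
    finally show ?thesis .
  qed
  have w: "ip (Tw w \<xi>) \<eta> = ip \<xi> (Tw (wadj w) \<eta>)" if w: "fst ` set w \<subseteq> mor \<Lambda>" for w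
  proof -
    have fD: "finite (D w)" unfolding D_def by (rule finite_subset[OF _ fin_vec_finite[OF x]]) auto
    have "ip (Tw w \<xi>) \<eta> = (\<Sum>y\<in>(\<lambda>x. the (act w x)) ` D w. Tw w \<xi> y * cnj (\<eta> y))"
      using fD Tw_supp(1)[OF w x] by (intro ip_eq) (auto simp: D_def)
    also have "\<dots> = (\<Sum>z\<in>D w. \<xi> z * cnj (\<eta> (the (act w z))))"
      using Tw_supp(2)[OF w x] by (subst sum.reindex) (auto simp: D_def Tw_supp(3)[OF w x])
    also have "\<dots> = (\<Sum>z\<in>D w. \<xi> z * cnj (Tw (wadj w) \<eta> z))"
      using x by (intro sum.cong refl) (auto simp: D_def Tw_def fin_vec_def)
    also have "\<dots> = ip \<xi> (Tw (wadj w) \<eta>)"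
      unfolding ip_def using x
      by (intro sum.mono_neutral_left) (auto simp: D_def fin_vec_def Tw_def split: option.splits)
    finally show ?thesis .
  qed
  have "ip (T f \<xi>) \<eta> = ip \<xi> (T (free_adj f) \<eta>)"
    using f
  proof (induction rule: fcarr_induct)
    case zero
    have "T 0 \<alpha> = (\<lambda>y. 0)" for \<alpha> by (simp add: fun_eq_iff)
    then show ?case by (simp add: ip_def)
  next
    case (word u c)
    have 1: "T (scal c * word_hom gen u) \<xi> = (\<lambda>y. c * Tw u \<xi> y)" by (simp add: fun_eq_iff T_scal T_word)
    have "free_adj (scal c * word_hom gen u) = scal (cnj c) * word_hom gen (wadj u)"
      by (simp add: free_adj_scal word_hom_gen free_adj_single word_adj_def wadj_def)
    then have 2: "T (free_adj (scal c * word_hom gen u)) \<eta> = (\<lambda>y. cnj c * Tw (wadj u) \<eta> y)"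
      by (simp add: fun_eq_iff T_scal T_word)
    have f1: "finite {y. Tw u \<xi> y \<noteq> 0}" using Tw_fin_vec[OF word(2) x] fin_vec_finite by blast
    have "ip (\<lambda>y. c * Tw u \<xi> y) \<eta> = (\<Sum>y\<in>{y. Tw u \<xi> y \<noteq> 0}. (c * Tw u \<xi> y) * cnj (\<eta> y))"
      using f1 by (intro ip_eq) auto
    also have "\<dots> = c * ip (Tw u \<xi>) \<eta>" by (simp add: ip_def sum_distrib_left mult.assoc)
    also have "\<dots> = ip \<xi> (\<lambda>y. cnj c * Tw (wadj u) \<eta> y)"
      unfolding w[OF word(2)] by (simp add: ip_def sum_distrib_left mult_ac)
    finally show ?case by (simp add: 1 2)
  next
    case (add f g)
    have fs: "finite {y. T f \<xi> y \<noteq> 0}" "finite {y. T g \<xi> y \<noteq> 0}" using T_fin_vec x add fin_vec_finite by blast+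
    have "ip (T (f + g) \<xi>) \<eta> = (\<Sum>y\<in>{y. T f \<xi> y \<noteq> 0} \<union> {y. T g \<xi> y \<noteq> 0}. T (f + g) \<xi> y * cnj (\<eta> y))"
      using fs by (intro ip_eq) (auto simp: T_add)
    also have "\<dots> = ip (T f \<xi>) \<eta> + ip (T g \<xi>) \<eta>"
      using fs ip_eq[of "{y. T f \<xi> y \<noteq> 0} \<union> {y. T g \<xi> y \<noteq> 0}" "T f \<xi>" \<eta>]
        ip_eq[of "{y. T f \<xi> y \<noteq> 0} \<union> {y. T g \<xi> y \<noteq> 0}" "T g \<xi>" \<eta>]
      by (simp add: T_add distrib_right sum.distrib)
    also have "\<dots> = ip \<xi> (T (free_adj (f + g)) \<eta>)"
      using add by (simp add: ip_def free_adj_add T_add distrib_left sum.distrib)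
    finally show ?case .
  qed
  then show ?thesis using ip_eq[OF S(1,3)] ip_eq[OF S(1,4)] by simp
qed

text \<open>Cauchy-Schwarz applied to the inner product of T(f^* f)\<xi> and \<xi>. In this form the
  estimate restricts to vectors on long paths and becomes the C*-identity in the limit.\<close>

lemma T_cstar_bound:
  assumes f: "f \<in> fcarr \<Lambda>" and x: "fin_vec \<xi>"
  shows "(l2 (T f \<xi>))\<^sup>2 \<le> l2 (T (free_adj f * f) \<xi>) * l2 \<xi>"
proof -
  let ?\<eta> = "T f \<xi>" and ?\<zeta> = "T (free_adj f * f) \<xi>"
  have fv: "fin_vec ?\<eta>" "fin_vec ?\<zeta>" using f x by (auto intro: T_fin_vec)
  have Tz: "T (free_adj f) ?\<eta> = ?\<zeta>" using T_mult[OF fcarr_free_adj[OF f]] by (simp add: fun_eq_iff)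
  let ?S = "{y. \<xi> y \<noteq> 0} \<union> {y. ?\<eta> y \<noteq> 0} \<union> {y. ?\<zeta> y \<noteq> 0}"
  have S: "finite ?S" "?S \<subseteq> mor \<Lambda>" using fv x by (auto simp: fin_vec_def)
  have "complex_of_real ((l2 ?\<eta>)\<^sup>2) = (\<Sum>y\<in>?S. ?\<eta> y * cnj (?\<eta> y))"
  proof -
    have "l2 ?\<eta> = L2_set (\<lambda>y. cmod (?\<eta> y)) ?S" by (rule l2_eq[OF S(1)]) auto
    then have "(l2 ?\<eta>)\<^sup>2 = (\<Sum>y\<in>?S. (cmod (?\<eta> y))\<^sup>2)" by (simp add: L2_set_def sum_nonneg)
    then show ?thesis by (simp only: of_real_sum complex_norm_square)
  qed
  also have "\<dots> = (\<Sum>y\<in>?S. \<xi> y * cnj (?\<zeta> y))"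
    using T_adjoint[OF f x fv(1) S] by (simp add: Tz) blast
  finally have "(l2 ?\<eta>)\<^sup>2 = cmod (\<Sum>y\<in>?S. \<xi> y * cnj (?\<zeta> y))"
    by (metis norm_of_real abs_of_nonneg zero_le_power2)
  also have "\<dots> \<le> (\<Sum>y\<in>?S. \<bar>cmod (\<xi> y)\<bar> * \<bar>cmod (?\<zeta> y)\<bar>)"
    by (rule order_trans[OF norm_sum]) (simp add: norm_mult)
  also have "\<dots> \<le> L2_set (\<lambda>y. cmod (\<xi> y)) ?S * L2_set (\<lambda>y. cmod (?\<zeta> y)) ?S"
    by (rule L2_set_mult_ineq)
  also have "\<dots> = l2 \<xi> * l2 ?\<zeta>"
    by (intro arg_cong2[of _ _ _ _ "(*)"] l2_eq[symmetric] S(1)) auto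
  finally show ?thesis by (simp add: mult.commute)
qed

end

context lc_kgraph
begin

text \<open>The Toeplitz representation on all finite paths satisfies the relations only in the limit, on
  paths that are long in the sense of \<open>\<Lambda>\<^sup>\<le>\<^sup>M\<close> for large \<open>M\<close>.\<close>

definition long_paths :: "nat \<Rightarrow> 'a set" where
  "long_paths N = {x. \<exists>M. (\<forall>i. N \<le> M $ i) \<and> x \<in> paths_le \<Lambda> M}"

definition long_vec :: "nat \<Rightarrow> ('a \<Rightarrow> complex) \<Rightarrow> bool" where
  "long_vec N \<xi> \<longleftrightarrow> fin_vec \<xi> \<and> {y. \<xi> y \<noteq> 0} \<subseteq> long_paths N"

text \<open>The bounds valid on all sufficiently long paths. Their infimum is the limit of the
  decreasing operator norms on the spaces \<open>long_vec N\<close>, so elements that act on short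
  paths only become null.\<close>

definition asymptotic_bounds :: "'a falg \<Rightarrow> real set" where
  "asymptotic_bounds f = {C. 0 \<le> C \<and> (\<exists>N. \<forall>\<xi>. long_vec N \<xi> \<longrightarrow> l2 (T f \<xi>) \<le> C * l2 \<xi>)}"

definition asymptotic_norm :: "'a falg \<Rightarrow> real" where
  "asymptotic_norm f = Inf (asymptotic_bounds f)"

lemma long_paths_antimono: "M \<le> N \<Longrightarrow> long_paths N \<subseteq> long_paths M"
  by (auto simp: long_paths_def) (meson order_trans)

lemma long_vec_antimono: "M \<le> N \<Longrightarrow> long_vec N \<xi> \<Longrightarrow> long_vec M \<xi>"
  using long_paths_antimono[of M N] by (auto simp: long_vec_def)

lemma long_vec_lin:
  assumes "long_vec N \<xi>" "long_vec N \<eta>" shows "long_vec N (\<lambda>y. a * \<xi> y + b * \<eta> y)"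
proof -
  have "{y. a * \<xi> y + b * \<eta> y \<noteq> 0} \<subseteq> {y. \<xi> y \<noteq> 0} \<union> {y. \<eta> y \<noteq> 0}" by auto
  then show ?thesis using assms fin_vec_lin[of \<xi> \<eta> a b] by (auto simp: long_vec_def)
qed

lemma long_vec_cmult: "long_vec N \<xi> \<Longrightarrow> long_vec N (\<lambda>y. c * \<xi> y)"
  using long_vec_lin[of N \<xi> \<xi> c 0] by simp

text \<open>A word lowers the level in direction i by at most the i-th coordinate of
  \<open>deg_star w\<close>; the sum of the coordinates bounds them all.\<close>

lemma long_vec_Tw:
  assumes w: "fst ` set w \<subseteq> mor \<Lambda>"
  shows "\<exists>K. \<forall>\<xi> N. long_vec (N + K) \<xi> \<longrightarrow> long_vec N (Tw w \<xi>)"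
proof (intro exI allI impI)
  let ?K = "\<Sum>i\<in>UNIV. deg_star w $ i"
  fix \<xi> N assume \<xi>: "long_vec (N + ?K) \<xi>"
  then have fv: "fin_vec \<xi>" by (simp add: long_vec_def)
  have "y \<in> long_paths N" if y: "Tw w \<xi> y \<noteq> 0" for y
  proof -
    obtain x where x: "y \<in> mor \<Lambda>" "act (wadj w) y = Some x" "\<xi> x \<noteq> 0"
      using y by (auto simp: Tw_def split: if_splits option.splits)
    have "x \<in> mor \<Lambda>" using fv x(3) by (auto simp: fin_vec_def)
    from act_inverse[OF w this x(1)] have xy: "act w x = Some y" using x(2) by simp
    have "x \<in> long_paths (N + ?K)" using \<xi> x(3) by (auto simp: long_vec_def)
    then obtain M where M: "\<And>i. N + ?K \<le> M $ i" "x \<in> paths_le \<Lambda> M" by (auto simp: long_paths_def)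
    have K: "deg_star w $ i \<le> ?K" for i by (rule member_le_sum) auto
    have "deg_star w \<le> M"
      unfolding less_eq_vec_def using M(1) K by (meson add_leD2 order_trans)
    from act_level[OF xy w M(2) this] obtain N' where N': "N' + deg_star w = M + deg_plus w" "y \<in> paths_le \<Lambda> N'"
      by blast
    have "N \<le> N' $ i" for i
    proof -
      have "N' $ i + deg_star w $ i = M $ i + deg_plus w $ i" using N'(1) by (metis vector_add_component)
      then show ?thesis using M(1)[of i] K[of i] by linarith
    qed
    then show ?thesis using N'(2) by (auto simp: long_paths_def)
  qed
  then show "long_vec N (Tw w \<xi>)" using Tw_fin_vec[OF w fv] by (auto simp: long_vec_def)
qed

lemma long_vec_T:
  assumes "f \<in> fcarr \<Lambda>" shows "\<exists>K. \<forall>\<xi> N. long_vec (N + K) \<xi> \<longrightarrow> long_vec N (T f \<xi>)"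
  using assms
proof (induction rule: fcarr_induct)
  case zero
  have "T 0 \<xi> = (\<lambda>y. 0)" for \<xi> by (simp add: fun_eq_iff)
  then show ?case by (simp add: long_vec_def fin_vec_def)
next
  case (word w c)
  have "T (scal c * word_hom gen w) \<xi> = (\<lambda>y. c * Tw w \<xi> y + 0 * Tw w \<xi> y)" for \<xi>
    by (simp add: fun_eq_iff T_scal T_word)
  moreover obtain K where "\<And>\<xi> N. long_vec (N + K) \<xi> \<Longrightarrow> long_vec N (Tw w \<xi>)"
    using long_vec_Tw[OF word(2)] by blast
  ultimately have "\<And>\<xi> N. long_vec (N + K) \<xi> \<Longrightarrow> long_vec N (T (scal c * word_hom gen w) \<xi>)"
    using long_vec_cmult by simp
  then show ?case by blast
next
  case (add f g)
  obtain K L where K: "\<And>\<xi> N. long_vec (N + K) \<xi> \<Longrightarrow> long_vec N (T f \<xi>)"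
    and L: "\<And>\<xi> N. long_vec (N + L) \<xi> \<Longrightarrow> long_vec N (T g \<xi>)" using add by blast
  have "long_vec N (T (f + g) \<xi>)" if v: "long_vec (N + (K + L)) \<xi>" for \<xi> N
  proof -
    have "long_vec N (T f \<xi>)" "long_vec N (T g \<xi>)"
      by (rule K[OF long_vec_antimono[OF _ v]] L[OF long_vec_antimono[OF _ v]]; simp)+
    moreover have "T (f + g) \<xi> = (\<lambda>y. 1 * T f \<xi> y + 1 * T g \<xi> y)" by (simp add: fun_eq_iff T_add)
    ultimately show ?thesis using long_vec_lin[of N "T f \<xi>" "T g \<xi>" 1 1] by simp
  qed
  then show ?case by blast
qed

lemma asymptotic_bounds_nonempty: assumes "f \<in> fcarr \<Lambda>" shows "asymptotic_bounds f \<noteq> {}"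
  using T_bounded[OF assms] by (auto simp: asymptotic_bounds_def long_vec_def)

lemma asymptotic_bounds_bdd: "bdd_below (asymptotic_bounds f)"
  by (rule bdd_belowI[of _ 0]) (simp add: asymptotic_bounds_def)

lemma asymptotic_norm_le: "C \<in> asymptotic_bounds f \<Longrightarrow> asymptotic_norm f \<le> C"
  unfolding asymptotic_norm_def by (rule cInf_lower[OF _ asymptotic_bounds_bdd])

lemma asymptotic_norm_nonneg: "f \<in> fcarr \<Lambda> \<Longrightarrow> 0 \<le> asymptotic_norm f"
  unfolding asymptotic_norm_def
  by (rule cInf_greatest[OF asymptotic_bounds_nonempty]) (simp_all add: asymptotic_bounds_def)

lemma asymptotic_norm_bound:
  assumes "f \<in> fcarr \<Lambda>" "0 < e" shows "asymptotic_norm f + e \<in> asymptotic_bounds f"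
proof -
  obtain C where C: "C \<in> asymptotic_bounds f" "C < asymptotic_norm f + e"
    using cInf_lessD[OF asymptotic_bounds_nonempty[OF assms(1)], of "asymptotic_norm f + e"] assms(2)
    by (auto simp: asymptotic_norm_def)
  then obtain N where N: "\<And>\<xi>. long_vec N \<xi> \<Longrightarrow> l2 (T f \<xi>) \<le> C * l2 \<xi>" "0 \<le> C"
    by (auto simp: asymptotic_bounds_def)
  have "l2 (T f \<xi>) \<le> (asymptotic_norm f + e) * l2 \<xi>" if "long_vec N \<xi>" for \<xi>
    using N(1)[OF that] C(2) mult_right_mono[of C "asymptotic_norm f + e" "l2 \<xi>"] by force
  then show ?thesis using C N(2) by (auto simp: asymptotic_bounds_def)
qed

lemma asymptotic_norm_leI:
  assumes "\<And>e. 0 < e \<Longrightarrow> asymptotic_norm f \<le> c + e" shows "asymptotic_norm f \<le> c"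
  using assms by (rule field_le_epsilon)

lemma asymptotic_norm_add:
  assumes f: "f \<in> fcarr \<Lambda>" and g: "g \<in> fcarr \<Lambda>"
  shows "asymptotic_norm (f + g) \<le> asymptotic_norm f + asymptotic_norm g"
proof (rule asymptotic_norm_leI)
  fix e :: real assume e: "0 < e"
  let ?C = "asymptotic_norm f + e / 2" and ?D = "asymptotic_norm g + e / 2"
  obtain N M where N: "\<And>\<xi>. long_vec N \<xi> \<Longrightarrow> l2 (T f \<xi>) \<le> ?C * l2 \<xi>"
    and M: "\<And>\<xi>. long_vec M \<xi> \<Longrightarrow> l2 (T g \<xi>) \<le> ?D * l2 \<xi>"
    using asymptotic_norm_bound[OF f, of "e / 2"] asymptotic_norm_bound[OF g, of "e / 2"] e
    by (auto simp: asymptotic_bounds_def)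
  have "l2 (T (f + g) \<xi>) \<le> (?C + ?D) * l2 \<xi>" if v: "long_vec (N + M) \<xi>" for \<xi>
  proof -
    have fv: "fin_vec \<xi>" using v by (simp add: long_vec_def)
    have "T (f + g) \<xi> = (\<lambda>y. T f \<xi> y + T g \<xi> y)" by (simp add: fun_eq_iff T_add)
    then have "l2 (T (f + g) \<xi>) \<le> l2 (T f \<xi>) + l2 (T g \<xi>)"
      using T_fin_vec[OF f fv] T_fin_vec[OF g fv] fin_vec_finite by (simp add: l2_add)
    also have "\<dots> \<le> ?C * l2 \<xi> + ?D * l2 \<xi>"
      by (intro add_mono N M long_vec_antimono[OF _ v]) simp_all
    finally show ?thesis by (simp add: distrib_right)
  qed
  then have "?C + ?D \<in> asymptotic_bounds (f + g)"
    using asymptotic_norm_nonneg[OF f] asymptotic_norm_nonneg[OF g] e by (auto simp: asymptotic_bounds_def)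
  from asymptotic_norm_le[OF this] show "asymptotic_norm (f + g) \<le> asymptotic_norm f + asymptotic_norm g + e"
    by simp
qed

lemma asymptotic_norm_mult:
  assumes f: "f \<in> fcarr \<Lambda>" and g: "g \<in> fcarr \<Lambda>"
  shows "asymptotic_norm (f * g) \<le> asymptotic_norm f * asymptotic_norm g"
proof -
  have nn: "0 \<le> asymptotic_norm f" "0 \<le> asymptotic_norm g" using f g asymptotic_norm_nonneg by auto
  have "asymptotic_norm (f * g) \<le> (asymptotic_norm f + e) * (asymptotic_norm g + e)" if e: "0 < e" for e
  proof (rule asymptotic_norm_le)
    obtain N M where N: "\<And>\<xi>. long_vec N \<xi> \<Longrightarrow> l2 (T f \<xi>) \<le> (asymptotic_norm f + e) * l2 \<xi>"
      and M: "\<And>\<xi>. long_vec M \<xi> \<Longrightarrow> l2 (T g \<xi>) \<le> (asymptotic_norm g + e) * l2 \<xi>"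
      using asymptotic_norm_bound[OF f e] asymptotic_norm_bound[OF g e] by (auto simp: asymptotic_bounds_def)
    \<comment> \<open>Applying g costs up to K levels, so \<xi> has to be longer by K for the bound
      of f to apply to \<open>T g \<xi>\<close>.\<close>
    obtain K where K: "\<And>\<xi> N. long_vec (N + K) \<xi> \<Longrightarrow> long_vec N (T g \<xi>)" using long_vec_T[OF g] by blast
    have "l2 (T (f * g) \<xi>) \<le> ((asymptotic_norm f + e) * (asymptotic_norm g + e)) * l2 \<xi>"
      if v: "long_vec (N + K + M) \<xi>" for \<xi>
    proof -
      have v1: "long_vec (N + K) \<xi>" "long_vec M \<xi>" using long_vec_antimono[OF _ v] by auto
      have "T (f * g) \<xi> = T f (T g \<xi>)" by (simp add: fun_eq_iff T_mult[OF f])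
      then have "l2 (T (f * g) \<xi>) \<le> (asymptotic_norm f + e) * l2 (T g \<xi>)" using N[OF K[OF v1(1)]] by simp
      also have "\<dots> \<le> (asymptotic_norm f + e) * ((asymptotic_norm g + e) * l2 \<xi>)"
        using M[OF v1(2)] nn e by (intro mult_left_mono) auto
      finally show ?thesis by (simp add: mult.assoc)
    qed
    then show "(asymptotic_norm f + e) * (asymptotic_norm g + e) \<in> asymptotic_bounds (f * g)"
      using nn e by (auto simp: asymptotic_bounds_def)
  qed
  \<comment> \<open>The product of the two perturbed norms is not the wanted product plus e, so the
    error is removed by letting e tend to 0.\<close>
  then have "\<forall>\<^sub>F e in at_right 0. asymptotic_norm (f * g) \<le> (asymptotic_norm f + e) * (asymptotic_norm g + e)"
    by (simp add: eventually_at_right_less eventually_mono[OF eventually_at_right_less])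
  moreover have "((\<lambda>e. (asymptotic_norm f + e) * (asymptotic_norm g + e)) \<longlongrightarrow>
      (asymptotic_norm f + 0) * (asymptotic_norm g + 0)) (at_right 0)"
    by (intro tendsto_intros)
  ultimately show ?thesis using tendsto_lowerbound[of _ _ "at_right (0::real)"] by fastforce
qed

lemma asymptotic_norm_scal:
  assumes f: "f \<in> fcarr \<Lambda>" shows "asymptotic_norm (scal c * f) = cmod c * asymptotic_norm f"
proof -
  have le: "asymptotic_norm (scal c * g) \<le> cmod c * asymptotic_norm g" if g: "g \<in> fcarr \<Lambda>" for c g
  proof (rule asymptotic_norm_leI)
    fix e :: real assume e: "0 < e"
    let ?e = "e / (cmod c + 1)"
    have c1: "cmod c + 1 > 0" by (simp add: add_nonneg_pos)
    then have e': "?e > 0" "cmod c * ?e \<le> e" using e by (simp_all add: pos_divide_le_eq algebra_simps)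
    obtain N where N: "\<And>\<xi>. long_vec N \<xi> \<Longrightarrow> l2 (T g \<xi>) \<le> (asymptotic_norm g + ?e) * l2 \<xi>"
      using asymptotic_norm_bound[OF g e'(1)] by (auto simp: asymptotic_bounds_def)
    have "l2 (T (scal c * g) \<xi>) \<le> (cmod c * (asymptotic_norm g + ?e)) * l2 \<xi>" if "long_vec N \<xi>" for \<xi>
    proof -
      have "T (scal c * g) \<xi> = (\<lambda>y. c * T g \<xi> y)" by (simp add: fun_eq_iff T_scal)
      then show ?thesis using N[OF that] by (simp add: l2_cmult mult.assoc mult_left_mono)
    qed
    then have "cmod c * (asymptotic_norm g + ?e) \<in> asymptotic_bounds (scal c * g)"
      using asymptotic_norm_nonneg[OF g] e' by (auto simp: asymptotic_bounds_def)
    from asymptotic_norm_le[OF this] show "asymptotic_norm (scal c * g) \<le> cmod c * asymptotic_norm g + e"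
      using e'(2) by (simp add: distrib_left)
  qed
  show ?thesis
  proof (cases "c = 0")
    case True
    then show ?thesis using le[OF f, of 0] asymptotic_norm_nonneg[of 0] by simp
  next
    case False
    have "asymptotic_norm f = asymptotic_norm (scal (inverse c) * (scal c * f))"
      using False by (simp add: scal_scal)
    also have "\<dots> \<le> cmod (inverse c) * asymptotic_norm (scal c * f)" using f by (intro le) auto
    finally have "cmod c * asymptotic_norm f \<le> asymptotic_norm (scal c * f)"
      using False by (simp add: norm_divide field_simps)
    then show ?thesis using le[OF f, of c] by simp
  qed
qed

text \<open>\<open>T_cstar_bound\<close> on long vectors gives one inequality. It also forces f and
  its adjoint to have the same norm, and submultiplicativity then gives the other one.\<close>

lemma asymptotic_norm_cstar:
  assumes f: "f \<in> fcarr \<Lambda>" shows "asymptotic_norm (free_adj f * f) = (asymptotic_norm f)\<^sup>2"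
proof -
  have ge: "(asymptotic_norm g)\<^sup>2 \<le> asymptotic_norm (free_adj g * g)" if g: "g \<in> fcarr \<Lambda>" for g
  proof (rule field_le_epsilon)
    fix e :: real assume e: "0 < e"
    let ?C = "asymptotic_norm (free_adj g * g) + e"
    have c: "free_adj g * g \<in> fcarr \<Lambda>" using g by auto
    have C: "0 \<le> ?C" using asymptotic_norm_nonneg[OF c] e by simp
    obtain N where N: "\<And>\<xi>. long_vec N \<xi> \<Longrightarrow> l2 (T (free_adj g * g) \<xi>) \<le> ?C * l2 \<xi>"
      using asymptotic_norm_bound[OF c e] by (auto simp: asymptotic_bounds_def)
    have "l2 (T g \<xi>) \<le> sqrt ?C * l2 \<xi>" if v: "long_vec N \<xi>" for \<xi>
    proof -
      have "(l2 (T g \<xi>))\<^sup>2 \<le> l2 (T (free_adj g * g) \<xi>) * l2 \<xi>"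
        using T_cstar_bound[OF g] v by (simp add: long_vec_def)
      also have "\<dots> \<le> ?C * l2 \<xi> * l2 \<xi>" using N[OF v] by (intro mult_right_mono) auto
      also have "\<dots> = (sqrt ?C * l2 \<xi>)\<^sup>2" using C by (simp add: power2_eq_square mult_ac)
      finally show ?thesis by (rule power2_le_imp_le) (use C in simp)
    qed
    then have "sqrt ?C \<in> asymptotic_bounds g" using C by (auto simp: asymptotic_bounds_def)
    from asymptotic_norm_le[OF this] have "(asymptotic_norm g)\<^sup>2 \<le> (sqrt ?C)\<^sup>2"
      using asymptotic_norm_nonneg[OF g] by (rule power_mono)
    then show "(asymptotic_norm g)\<^sup>2 \<le> ?C" using C by simp
  qed
  have le: "asymptotic_norm g \<le> asymptotic_norm (free_adj g)" if g: "g \<in> fcarr \<Lambda>" for g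
  proof (cases "asymptotic_norm g = 0")
    case False
    have "asymptotic_norm g * asymptotic_norm g \<le> asymptotic_norm (free_adj g) * asymptotic_norm g"
      using ge[OF g] asymptotic_norm_mult[OF fcarr_free_adj[OF g] g] by (simp add: power2_eq_square)
    then show ?thesis using False asymptotic_norm_nonneg[OF g] by simp
  qed (use asymptotic_norm_nonneg[OF fcarr_free_adj[OF g]] in simp)
  have "asymptotic_norm (free_adj f) = asymptotic_norm f"
    using le[OF f] le[OF fcarr_free_adj[OF f]] by simp
  then show ?thesis
    using ge[OF f] asymptotic_norm_mult[OF fcarr_free_adj[OF f] f] by (simp add: power2_eq_square)
qed

lemma asymptotic_norm_zeroI:
  assumes "\<And>\<xi> y. long_vec N \<xi> \<Longrightarrow> T f \<xi> y = 0" and "f \<in> fcarr \<Lambda>"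
  shows "asymptotic_norm f = 0"
proof -
  have "l2 (T f \<xi>) = 0" if "long_vec N \<xi>" for \<xi>
  proof -
    have "T f \<xi> = (\<lambda>y. 0)" using assms(1)[OF that] by (simp add: fun_eq_iff)
    then show ?thesis by (simp add: l2_def)
  qed
  then have "0 \<in> asymptotic_bounds f" by (auto simp: asymptotic_bounds_def intro!: exI[of _ N])
  from asymptotic_norm_le[OF this] asymptotic_norm_nonneg[OF assms(2)] show ?thesis by (rule antisym)
qed

lemma T_vertex: "v \<in> verts \<Lambda> \<Longrightarrow> T (gen v) \<xi> y = (if y \<in> mor \<Lambda> \<and> rng \<Lambda> y = v then \<xi> y else 0)"
  by (simp add: T_gen act1_vertex)

lemma relator_carr: "r \<in> ck_relators \<Lambda> \<Longrightarrow> r \<in> fcarr \<Lambda>"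
proof (induction rule: ck_relators.induct)
  case (cuntz_krieger v n)
  have "(\<Sum>x\<in>le_paths v n. gen x * free_adj (gen x)) \<in> fcarr \<Lambda>"
  proof (rule fcarr_sum)
    fix x assume "x \<in> le_paths v n"
    then have "x \<in> mor \<Lambda>" using le_paths_mor[of x v n] by simp
    then show "gen x * free_adj (gen x) \<in> fcarr \<Lambda>" by (simp add: fcarr_mult letter_carr)
  qed
  then show ?case using cuntz_krieger by (simp add: fcarr_diff letter_carr vert_mor)
qed (auto simp: letter_carr vert_mor src_closed cmp_closed intro!: fcarr_diff fcarr_mult)

text \<open>The relators other than those of Cuntz-Krieger type act as 0 on every vector. The
  Cuntz-Krieger ones do so on long vectors: a path too short for level n need not begin with a
  member of \<open>paths_le \<Lambda> n\<close>.\<close>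

lemma asymptotic_norm_relator:
  assumes "r \<in> ck_relators \<Lambda>" shows "asymptotic_norm r = 0"
  using assms
proof cases
  case (partial_isometry x)
  have "T r \<xi> y = 0" for \<xi> y
  proof (cases "act1 (x, True) y")
    case None
    then show ?thesis
      using partial_isometry by (simp add: T_diff T_mult letter_carr fcarr_mult T_gen)
  next
    case (Some b)
    then have "b \<in> mor \<Lambda>" "src \<Lambda> x = rng \<Lambda> b" "y = cmp \<Lambda> x b" using act1_True partial_isometry by auto
    then show ?thesis
      using partial_isometry Some by (simp add: T_diff T_mult letter_carr fcarr_mult T_gen T_st cmp_closed)
  qed
  then show ?thesis by (rule asymptotic_norm_zeroI[OF _ relator_carr[OF assms]])
next
  case (vertices v w)
  have "T r \<xi> y = 0" for \<xi> y
    using vertices by (auto simp: T_diff T_mult letter_carr vert_mor T_vertex)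
  then show ?thesis by (rule asymptotic_norm_zeroI[OF _ relator_carr[OF assms]])
next
  case (product x y)
  have "T r \<xi> z = 0" for \<xi> z
  proof (cases "act1 (cmp \<Lambda> x y, True) z")
    case None
    have "T (gen x * gen y) \<xi> z = 0"
    proof (rule ccontr)
      assume "T (gen x * gen y) \<xi> z \<noteq> 0"
      then obtain b c where "z \<in> mor \<Lambda>" "act1 (x, True) z = Some b" "act1 (y, True) b = Some c"
        using product by (auto simp: T_mult letter_carr T_gen split: if_splits option.splits)
      then have bc: "z = cmp \<Lambda> x b" "c \<in> mor \<Lambda>" "src \<Lambda> y = rng \<Lambda> c" "b = cmp \<Lambda> y c"
        using product act1_True[of x z b] act1_True[of y b c] by simp_all
      have "src \<Lambda> (cmp \<Lambda> x y) = rng \<Lambda> c" using src_cmp[of x y] product bc(3) by simp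
      moreover have "z = cmp \<Lambda> (cmp \<Lambda> x y) c" using cmp_assoc[of x y c] product bc by simp
      moreover note bc(2)
      ultimately show False using None act1_True[OF cmp_closed, of x y z c] product by simp
    qed
    then show ?thesis using None product by (simp add: T_diff T_gen[of "cmp \<Lambda> x y"])
  next
    case (Some c)
    then have c: "c \<in> mor \<Lambda>" "src \<Lambda> y = rng \<Lambda> c" "z = cmp \<Lambda> x (cmp \<Lambda> y c)"
      using product act1_True[OF cmp_closed, of x y z c] by (auto simp: src_cmp cmp_assoc)
    then have "act1 (x, True) z = Some (cmp \<Lambda> y c)" "act1 (y, True) (cmp \<Lambda> y c) = Some c"
      using product by (simp_all add: act1_True cmp_closed rng_cmp)
    then show ?thesis using Some product c
      by (simp add: T_diff T_mult letter_carr T_gen cmp_closed rng_cmp)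
  qed
  then show ?thesis by (rule asymptotic_norm_zeroI[OF _ relator_carr[OF assms]])
next
  case (source_projection x)
  have "T r \<xi> y = 0" for \<xi> y
    using source_projection act1_cmp[of x y]
    by (auto simp: T_diff T_mult letter_carr T_st T_gen[of x] T_vertex src_verts cmp_closed)
  then show ?thesis by (rule asymptotic_norm_zeroI[OF _ relator_carr[OF assms]])
next
  case (cuntz_krieger v n)
  let ?N = "\<Sum>i\<in>UNIV. n $ i"
  have fin: "finite (le_paths v n)" using cuntz_krieger by (intro finite_le_paths)
  have m: "x \<in> mor \<Lambda>" if "x \<in> le_paths v n" for x using le_paths_mor[OF that] by simp
  have "T r \<xi> y = 0" if \<xi>: "long_vec ?N \<xi>" for \<xi> y
  proof (cases "\<xi> y = 0")
    case True
    have "T (gen x * free_adj (gen x)) \<xi> y = 0" if "x \<in> le_paths v n" for x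
      using True by (simp add: T_proj[OF m[OF that]])
    then show ?thesis using True cuntz_krieger by (simp add: T_diff T_sum T_vertex)
  next
    case False
    then have "y \<in> long_paths ?N" and ym: "y \<in> mor \<Lambda>" using \<xi> by (auto simp: long_vec_def fin_vec_def)
    then obtain M where M: "\<And>i. ?N \<le> M $ i" "y \<in> paths_le \<Lambda> M" by (auto simp: long_paths_def)
    have "n $ i \<le> M $ i" for i
    proof -
      have "n $ i \<le> ?N" by (rule member_le_sum) auto
      then show ?thesis using M(1)[of i] by linarith
    qed
    then have nM: "n + (M - n) = M" by (simp add: vec_eq_iff)
    have "y \<in> paths_le \<Lambda> (n + (M - n))" unfolding nM by (rule M(2))
    then obtain a b where ab: "a \<in> paths_le \<Lambda> n" "b \<in> paths_le \<Lambda> (M - n)" "src \<Lambda> a = rng \<Lambda> b" "y = cmp \<Lambda> a b"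
      by (rule paths_le_factor)
    note am = paths_le_mor[OF ab(1)] and bm = paths_le_mor[OF ab(2)]
    have ra: "rng \<Lambda> a = rng \<Lambda> y" using ab am bm by (simp add: rng_cmp)
    have T: "T (gen x * free_adj (gen x)) \<xi> y = (if x = a then \<xi> y else 0)" if x: "x \<in> le_paths v n" for x
    proof -
      have "(\<exists>c\<in>mor \<Lambda>. src \<Lambda> x = rng \<Lambda> c \<and> y = cmp \<Lambda> x c) \<longleftrightarrow> x = a"
        using paths_le_factor_unique(1)[OF ab(1) bm ab(3), of x] ab am bm x by (auto simp: le_paths_iff)
      then show ?thesis using ym by (simp add: T_proj[OF m[OF x]])
    qed
    have "a \<in> le_paths v n \<longleftrightarrow> rng \<Lambda> y = v" using ab(1) ra by (simp add: le_paths_iff)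
    moreover have "(\<Sum>x\<in>le_paths v n. T (gen x * free_adj (gen x)) \<xi> y) = (\<Sum>x\<in>le_paths v n. if x
      = a then \<xi> y else 0)"
      by (rule sum.cong[OF refl T])
    ultimately show ?thesis using cuntz_krieger ym fin by (simp add: T_diff T_sum T_vertex)
  qed
  then show ?thesis by (rule asymptotic_norm_zeroI[OF _ relator_carr[OF assms]])
qed

lemma ck_seminorm_asymptotic_norm: "ck_seminorm \<Lambda> asymptotic_norm"
  by (simp add: ck_seminorm_def cstar_seminormed_def cstar_seminormed_axioms_def star_algebra_free
    asymptotic_norm_nonneg asymptotic_norm_add asymptotic_norm_scal asymptotic_norm_mult
    asymptotic_norm_cstar asymptotic_norm_relator)

text \<open>There are paths of every level at v, and s_v fixes their basis vectors.\<close>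

lemma asymptotic_norm_vertex: assumes v: "v \<in> verts \<Lambda>" shows "asymptotic_norm (gen v) \<ge> 1"
  unfolding asymptotic_norm_def
proof (rule cInf_greatest[OF asymptotic_bounds_nonempty])
  show "gen v \<in> fcarr \<Lambda>" by (rule fcarr_gen[OF vert_mor[OF v]])
  fix C assume "C \<in> asymptotic_bounds (gen v)"
  then obtain N where N: "\<And>\<xi>. long_vec N \<xi> \<Longrightarrow> l2 (T (gen v) \<xi>) \<le> C * l2 \<xi>"
    by (auto simp: asymptotic_bounds_def)
  obtain x where x: "x \<in> le_paths v (\<chi> i. N)" using le_paths_nonempty[OF v] by blast
  then have xm: "x \<in> mor \<Lambda>" "rng \<Lambda> x = v" using le_paths_mor by auto
  define \<xi> where "\<xi> y = (if y = x then 1 else 0 :: complex)" for y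
  have supp: "{y. \<xi> y \<noteq> 0} = {x}" by (auto simp: \<xi>_def)
  have "x \<in> long_paths N" using x by (auto simp: long_paths_def le_paths_iff intro!: exI[of _ "\<chi> i. N"])
  then have "long_vec N \<xi>" using xm by (simp add: long_vec_def fin_vec_def supp)
  moreover have "T (gen v) \<xi> = \<xi>" using xm by (auto simp: fun_eq_iff T_vertex[OF v] \<xi>_def)
  moreover have "l2 \<xi> = 1" by (simp add: l2_def supp) (simp add: \<xi>_def)
  ultimately show "1 \<le> C" using N by force
qed

lemma universal_vertex: assumes v: "v \<in> verts \<Lambda>" shows "universal_seminorm \<Lambda> (gen v) = 1"
proof -
  interpret U: ck_family \<Lambda> "universal_seminorm \<Lambda>" by (rule ck_family_universal)
  have "1 \<le> universal_seminorm \<Lambda> (gen v)"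
    using universal_upper[OF ck_seminorm_asymptotic_norm fcarr_gen[OF vert_mor[OF v]]]
      asymptotic_norm_vertex[OF v]
    by (rule order_trans[rotated])
  then show ?thesis using U.p_vertex[OF v] by auto
qed

end


section \<open>Abstract C*-algebras: completions, central projections and direct sums\<close>

subsection \<open>Algebra in carriers\<close>

context star_algebra
begin

lemma zer_pls: "x \<in> carr A \<Longrightarrow> pls A (zer A) x = x"
  using pls_commute[of "zer A" x] pls_zer zer_closed by simp

lemma pls_left_commute:
  "x \<in> carr A \<Longrightarrow> y \<in> carr A \<Longrightarrow> z \<in> carr A \<Longrightarrow> pls A x (pls A y z) = pls A y (pls A x z)"
  by (metis pls_assoc pls_commute)

lemmas closed [simp] = zer_closed pls_closed smul_closed tim_closed adj_closed

lemma sub_closed [simp]: "x \<in> carr A \<Longrightarrow> y \<in> carr A \<Longrightarrow> sub A x y \<in> carr A"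
  by (simp add: sub_def)

lemma pls_cancel: assumes "x \<in> carr A" "y \<in> carr A" "z \<in> carr A" "pls A x y = pls A x z" shows "y = z"
proof -
  have *: "pls A (smul A (-1) x) (pls A x w) = w" if "w \<in> carr A" for w
  proof -
    have "pls A (smul A (-1) x) (pls A x w) = pls A (pls A x (smul A (-1) x)) w"
      using assms that by (simp add: pls_assoc pls_left_commute)
    then show ?thesis using sub_self[OF assms(1)] that by (simp add: sub_def zer_pls)
  qed
  show ?thesis using *[OF assms(2)] *[OF assms(3)] unfolding assms(4) by simp
qed

lemma smul_zero: assumes "x \<in> carr A" shows "smul A 0 x = zer A"
  using add_smul[OF assms, of 0 0] pls_cancel[of "smul A 0 x" "smul A 0 x" "zer A"] assms
  by (simp add: pls_zer)

lemma smul_zer: "smul A c (zer A) = zer A"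
  using smul_smul[of "zer A" c 0] smul_zero[OF zer_closed] by simp

lemma tim_zer: assumes "x \<in> carr A" shows "tim A x (zer A) = zer A"
  using tim_smul[of x "zer A" 0] assms smul_zero by simp

lemma zer_tim: assumes "x \<in> carr A" shows "tim A (zer A) x = zer A"
  using smul_tim[of "zer A" x 0] assms smul_zero by simp

lemma adj_zer: "adj A (zer A) = zer A"
  using adj_smul[of "zer A" 0] smul_zero by simp

lemma sub_zer: "x \<in> carr A \<Longrightarrow> sub A x (zer A) = x"
  by (simp add: sub_def smul_zer pls_zer)

lemma pls_sub_cancel: assumes "x \<in> carr A" "y \<in> carr A" shows "pls A (sub A x y) y = x"
proof -
  have "pls A (sub A x y) y = pls A x (sub A y y)"
    using assms by (simp add: sub_def pls_assoc) (metis pls_commute smul_closed)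
  then show ?thesis using assms by (simp add: sub_self pls_zer)
qed

lemma sub_eq_zer: "x \<in> carr A \<Longrightarrow> y \<in> carr A \<Longrightarrow> sub A x y = zer A \<longleftrightarrow> x = y"
  by (metis pls_sub_cancel sub_self zer_pls)

lemma smul_sub: "x \<in> carr A \<Longrightarrow> y \<in> carr A \<Longrightarrow> smul A c (sub A x y) = sub A (smul A c x) (smul A c y)"
  by (simp add: sub_def smul_pls smul_smul mult.commute)

lemma adj_sub: "x \<in> carr A \<Longrightarrow> y \<in> carr A \<Longrightarrow> adj A (sub A x y) = sub A (adj A x) (adj A y)"
  by (simp add: sub_def adj_pls adj_smul)

lemma tim_sub: "x \<in> carr A \<Longrightarrow> y \<in> carr A \<Longrightarrow> z \<in> carr A \<Longrightarrow> tim A x (sub A y z) = sub A (tim A x y) (tim A x z)"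
  by (simp add: sub_def tim_pls tim_smul)

lemma sub_tim: "x \<in> carr A \<Longrightarrow> y \<in> carr A \<Longrightarrow> z \<in> carr A \<Longrightarrow> tim A (sub A x y) z = sub A (tim A x z) (tim A y z)"
  by (simp add: sub_def pls_tim smul_tim)

lemma sub_pls_pls:
  assumes "x \<in> carr A" "y \<in> carr A" "x' \<in> carr A" "y' \<in> carr A"
  shows "sub A (pls A x y) (pls A x' y') = pls A (sub A x x') (sub A y y')"
  using assms by (simp add: sub_def smul_pls pls_assoc pls_left_commute)

lemma sub_sub_pls:
  assumes "x \<in> carr A" "y \<in> carr A" "z \<in> carr A"
  shows "pls A (sub A x y) (sub A y z) = sub A x z"
proof -
  have "pls A (sub A x y) (sub A y z) = pls A (pls A (sub A x y) y) (smul A (-1) z)"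
    using assms by (simp add: sub_def pls_assoc)
  then show ?thesis using pls_sub_cancel[OF assms(1,2)] by (simp add: sub_def)
qed

lemma sub_tim_tim:
  assumes "x \<in> carr A" "y \<in> carr A" "x' \<in> carr A" "y' \<in> carr A"
  shows "sub A (tim A x y) (tim A x' y') = pls A (tim A (sub A x x') y) (tim A x' (sub A y y'))"
  using assms by (simp add: sub_tim tim_sub sub_sub_pls)

lemma sub_swap: "x \<in> carr A \<Longrightarrow> y \<in> carr A \<Longrightarrow> sub A x y = smul A (-1) (sub A y x)"
  by (simp add: sub_def smul_pls smul_smul smul_one pls_commute)

end

context cstar_seminormed
begin

lemma nrm_zer: "nrm A (zer A) = 0"
  using nrm_smul[of "zer A" 0] smul_zero by simp

lemma nrm_sub_commute: "x \<in> carr A \<Longrightarrow> y \<in> carr A \<Longrightarrow> nrm A (sub A x y) = nrm A (sub A y x)"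
  using nrm_smul[of "sub A y x" "-1"] sub_swap[of x y] by simp

lemma nrm_sub_triangle:
  "x \<in> carr A \<Longrightarrow> y \<in> carr A \<Longrightarrow> z \<in> carr A \<Longrightarrow> nrm A (sub A x z) \<le> nrm A (sub A x y) + nrm A (sub A y z)"
  using nrm_triangle[of "sub A x y" "sub A y z"] by (simp add: sub_sub_pls)

lemma nrm_le_sub: "x \<in> carr A \<Longrightarrow> y \<in> carr A \<Longrightarrow> nrm A x \<le> nrm A y + nrm A (sub A x y)"
  using nrm_triangle[of "sub A x y" y] by (simp add: pls_sub_cancel)

lemma nrm_diff_le: "x \<in> carr A \<Longrightarrow> y \<in> carr A \<Longrightarrow> \<bar>nrm A x - nrm A y\<bar> \<le> nrm A (sub A x y)"
  using nrm_le_sub[of x y] nrm_le_sub[of y x] nrm_sub_commute[of x y] by auto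

lemma nrm_adj: assumes x: "x \<in> carr A" shows "nrm A (adj A x) = nrm A x"
proof -
  have le: "nrm A y \<le> nrm A (adj A y)" if "y \<in> carr A" for y
  proof (cases "nrm A y = 0")
    case False
    have "nrm A y * nrm A y \<le> nrm A (adj A y) * nrm A y"
      using nrm_tim[of "adj A y" y] nrm_cstar[of y] that by (simp add: power2_eq_square)
    then show ?thesis using False nrm_nonneg[OF that] by simp
  qed (use nrm_nonneg that in auto)
  show ?thesis using le[OF x] le[of "adj A x"] x by (simp add: adj_adj)
qed

lemma nrm_sub_pls:
  assumes "x \<in> carr A" "y \<in> carr A" "x' \<in> carr A" "y' \<in> carr A"
  shows "nrm A (sub A (pls A x y) (pls A x' y')) \<le> nrm A (sub A x x') + nrm A (sub A y y')"
  unfolding sub_pls_pls[OF assms] using assms by (intro nrm_triangle) simp_all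

lemma nrm_sub_tim:
  assumes "x \<in> carr A" "y \<in> carr A" "x' \<in> carr A" "y' \<in> carr A"
  shows "nrm A (sub A (tim A x y) (tim A x' y')) \<le> nrm A (sub A x x') * nrm A y + nrm A x' * nrm A (sub A y y')"
proof -
  have "nrm A (sub A (tim A x y) (tim A x' y')) \<le> nrm A (tim A (sub A x x') y) + nrm A (tim A x' (sub A y y'))"
    unfolding sub_tim_tim[OF assms] using assms by (intro nrm_triangle) simp_all
  also have "\<dots> \<le> nrm A (sub A x x') * nrm A y + nrm A x' * nrm A (sub A y y')"
    using assms by (intro add_mono nrm_tim) simp_all
  finally show ?thesis .
qed

lemma nrm_sub_smul: "x \<in> carr A \<Longrightarrow> y \<in> carr A \<Longrightarrow> nrm A (sub A (smul A c x) (smul A c y)) = cmod c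
  * nrm A (sub A x y)"
  by (simp flip: smul_sub add: nrm_smul)

lemma nrm_sub_adj: "x \<in> carr A \<Longrightarrow> y \<in> carr A \<Longrightarrow> nrm A (sub A (adj A x) (adj A y)) = nrm A (sub A x y)"
  by (simp flip: adj_sub add: nrm_adj)

subsection \<open>The completion\<close>

lemma cauchy_carr: "X \<in> cauchy_seqs A \<Longrightarrow> X n \<in> carr A"
  by (simp add: cauchy_seqs_def)

lemma cauchyD: "X \<in> cauchy_seqs A \<Longrightarrow> 0 < e \<Longrightarrow> \<exists>N. \<forall>m\<ge>N. \<forall>n\<ge>N. nrm A (sub A (X m) (X n)) < e"
  by (simp add: cauchy_seqs_def)

lemma cauchy_nrm: assumes "X \<in> cauchy_seqs A" shows "convergent (\<lambda>n. nrm A (X n))"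
proof -
  have "Cauchy (\<lambda>n. nrm A (X n))"
    unfolding Cauchy_def dist_real_def
  proof (intro allI impI)
    fix e :: real assume "0 < e"
    from cauchyD[OF assms this] obtain N where "\<forall>m\<ge>N. \<forall>n\<ge>N. nrm A (sub A (X m) (X n)) < e" ..
    then show "\<exists>N. \<forall>m\<ge>N. \<forall>n\<ge>N. \<bar>nrm A (X m) - nrm A (X n)\<bar> < e"
      using nrm_diff_le[OF cauchy_carr[OF assms] cauchy_carr[OF assms]] by (meson le_less_trans)
  qed
  then show ?thesis by (rule Cauchy_convergent)
qed

lemma cauchy_bounded: assumes "X \<in> cauchy_seqs A" shows "\<exists>K>0. \<forall>n. nrm A (X n) \<le> K"
proof -
  have "Bseq (\<lambda>n. nrm A (X n))" using cauchy_nrm[OF assms] by (rule convergent_imp_Bseq)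
  then obtain K where "K > 0" "\<forall>n. norm (nrm A (X n)) \<le> K" unfolding Bseq_def by blast
  then have "K > 0" "\<forall>n. nrm A (X n) \<le> K" by (auto intro: order_trans[OF abs_ge_self])
  then show ?thesis by blast
qed

lemma cauchyI:
  assumes "\<And>n. X n \<in> carr A" "\<And>e. 0 < e \<Longrightarrow> \<exists>N. \<forall>m\<ge>N. \<forall>n\<ge>N. nrm A (sub A (X m) (X n)) < e"
  shows "X \<in> cauchy_seqs A"
  using assms by (simp add: cauchy_seqs_def)

lemma cauchy_const [simp]: "x \<in> carr A \<Longrightarrow> (\<lambda>n. x) \<in> cauchy_seqs A"
  by (rule cauchyI) (simp_all add: sub_self nrm_zer)

lemma cauchy_pls: assumes X: "X \<in> cauchy_seqs A" and Y: "Y \<in> cauchy_seqs A"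
  shows "(\<lambda>n. pls A (X n) (Y n)) \<in> cauchy_seqs A"
proof (rule cauchyI)
  fix e :: real assume "0 < e"
  then have e: "0 < e / 2" by simp
  obtain N where N: "\<And>m n. m \<ge> N \<Longrightarrow> n \<ge> N \<Longrightarrow> nrm A (sub A (X m) (X n)) < e / 2" using cauchyD[OF X e] by blast
  obtain M where M: "\<And>m n. m \<ge> M \<Longrightarrow> n \<ge> M \<Longrightarrow> nrm A (sub A (Y m) (Y n)) < e / 2" using cauchyD[OF Y e] by blast
  have "nrm A (sub A (pls A (X m) (Y m)) (pls A (X n) (Y n))) < e" if "m \<ge> max N M" "n \<ge> max N M" for m n
    using nrm_sub_pls[OF cauchy_carr[OF X, of m] cauchy_carr[OF Y, of m] cauchy_carr[OF X, of n]
      cauchy_carr[OF Y, of n]]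
      N[of m n] M[of m n] that by simp
  then show "\<exists>N. \<forall>m\<ge>N. \<forall>n\<ge>N. nrm A (sub A (pls A (X m) (Y m)) (pls A (X n) (Y n))) < e" by blast
qed (use cauchy_carr X Y in simp)

lemma cauchy_smul: assumes X: "X \<in> cauchy_seqs A" shows "(\<lambda>n. smul A c (X n)) \<in> cauchy_seqs A"
proof (rule cauchyI)
  fix e :: real assume e: "0 < e"
  have c: "0 < cmod c + 1" by (simp add: add_nonneg_pos)
  then have "0 < e / (cmod c + 1)" using e by simp
  from cauchyD[OF X this] obtain N where N: "\<And>m n. m \<ge> N \<Longrightarrow> n \<ge> N \<Longrightarrow> nrm A (sub A (X m) (X n)) < e / (cmod c + 1)"
    by blast
  have "nrm A (sub A (smul A c (X m)) (smul A c (X n))) < e" if "m \<ge> N" "n \<ge> N" for m n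
  proof -
    have "cmod c * nrm A (sub A (X m) (X n)) \<le> (cmod c + 1) * nrm A (sub A (X m) (X n))"
      using nrm_nonneg cauchy_carr[OF X] by (intro mult_right_mono) auto
    also have "\<dots> < e" using N[OF that] c by (simp add: pos_less_divide_eq mult.commute)
    finally show ?thesis using cauchy_carr[OF X] by (simp add: nrm_sub_smul)
  qed
  then show "\<exists>N. \<forall>m\<ge>N. \<forall>n\<ge>N. nrm A (sub A (smul A c (X m)) (smul A c (X n))) < e" by blast
qed (use cauchy_carr X in simp)

lemma cauchy_adj: assumes X: "X \<in> cauchy_seqs A" shows "(\<lambda>n. adj A (X n)) \<in> cauchy_seqs A"
  by (rule cauchyI) (use cauchy_carr[OF X] cauchyD[OF X] in \<open>simp_all add: nrm_sub_adj\<close>)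

lemma cauchy_tim: assumes X: "X \<in> cauchy_seqs A" and Y: "Y \<in> cauchy_seqs A"
  shows "(\<lambda>n. tim A (X n) (Y n)) \<in> cauchy_seqs A"
proof (rule cauchyI)
  fix e :: real assume e: "0 < e"
  obtain K where K: "K > 0" "\<And>n. nrm A (X n) \<le> K" using cauchy_bounded[OF X] by blast
  obtain L where L: "L > 0" "\<And>n. nrm A (Y n) \<le> L" using cauchy_bounded[OF Y] by blast
  have eK: "0 < e / (2 * L)" "0 < e / (2 * K)" using e K L by simp_all
  obtain N where N: "\<And>m n. m \<ge> N \<Longrightarrow> n \<ge> N \<Longrightarrow> nrm A (sub A (X m) (X n)) < e / (2 * L)"
    using cauchyD[OF X eK(1)] by blast
  obtain M where M: "\<And>m n. m \<ge> M \<Longrightarrow> n \<ge> M \<Longrightarrow> nrm A (sub A (Y m) (Y n)) < e / (2 * K)"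
    using cauchyD[OF Y eK(2)] by blast
  have "nrm A (sub A (tim A (X m) (Y m)) (tim A (X n) (Y n))) < e" if mn: "m \<ge> max N M" "n \<ge> max N M" for m n
  proof -
    have "nrm A (sub A (tim A (X m) (Y m)) (tim A (X n) (Y n)))
        \<le> nrm A (sub A (X m) (X n)) * nrm A (Y m) + nrm A (X n) * nrm A (sub A (Y m) (Y n))"
      by (intro nrm_sub_tim cauchy_carr X Y)
    also have "\<dots> \<le> nrm A (sub A (X m) (X n)) * L + K * nrm A (sub A (Y m) (Y n))"
      using K L nrm_nonneg cauchy_carr[OF X] cauchy_carr[OF Y] by (intro add_mono mult_mono) auto
    also have "\<dots> < e / (2 * L) * L + K * (e / (2 * K))"
      using N[of m n] M[of m n] mn K L by (intro add_strict_mono mult_strict_right_mono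
        mult_strict_left_mono) auto
    also have "\<dots> = e" using K L by simp
    finally show ?thesis .
  qed
  then show "\<exists>N. \<forall>m\<ge>N. \<forall>n\<ge>N. nrm A (sub A (tim A (X m) (Y m)) (tim A (X n) (Y n))) < e" by blast
qed (use cauchy_carr X Y in simp)

lemma cauchy_sub: "X \<in> cauchy_seqs A \<Longrightarrow> Y \<in> cauchy_seqs A \<Longrightarrow> (\<lambda>n. sub A (X n) (Y n)) \<in> cauchy_seqs A"
  unfolding sub_def by (intro cauchy_pls cauchy_smul)

definition null_diff :: "(nat \<Rightarrow> 'a) \<Rightarrow> (nat \<Rightarrow> 'a) \<Rightarrow> bool" where
  "null_diff X Y \<longleftrightarrow> (\<lambda>n. nrm A (sub A (X n) (Y n))) \<longlonglongrightarrow> 0"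

lemma null_diff_refl: "X \<in> cauchy_seqs A \<Longrightarrow> null_diff X X"
  using cauchy_carr by (simp add: null_diff_def sub_self nrm_zer)

lemma null_diffI:
  assumes "\<And>n. X n \<in> carr A" "\<And>n. Y n \<in> carr A" "\<And>n. nrm A (sub A (X n) (Y n)) \<le> f n" "f \<longlonglongrightarrow> 0"
  shows "null_diff X Y"
  unfolding null_diff_def
  by (rule tendsto_sandwich[OF _ _ tendsto_const assms(4)]) (use assms(1-3) nrm_nonneg in auto)

lemma null_diff_sym: "X \<in> cauchy_seqs A \<Longrightarrow> Y \<in> cauchy_seqs A \<Longrightarrow> null_diff X Y \<Longrightarrow> null_diff Y X"
  using nrm_sub_commute cauchy_carr by (simp add: null_diff_def)

lemma null_diff_trans:
  assumes "X \<in> cauchy_seqs A" "Y \<in> cauchy_seqs A" "Z \<in> cauchy_seqs A" "null_diff X Y" "null_diff Y Z"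
  shows "null_diff X Z"
proof (rule null_diffI)
  show "(\<lambda>n. nrm A (sub A (X n) (Y n)) + nrm A (sub A (Y n) (Z n))) \<longlonglongrightarrow> 0"
    using tendsto_add[OF assms(4,5)[unfolded null_diff_def]] by simp
qed (use assms cauchy_carr nrm_sub_triangle in auto)

lemma class_eq_iff:
  assumes "X \<in> cauchy_seqs A" "Y \<in> cauchy_seqs A"
  shows "cauchy_class A X = cauchy_class A Y \<longleftrightarrow> null_diff X Y"
proof
  assume "cauchy_class A X = cauchy_class A Y"
  moreover have "Y \<in> cauchy_class A Y"
    using assms null_diff_refl[of Y] by (simp add: cauchy_class_def null_diff_def)
  ultimately have "Y \<in> cauchy_class A X" by simp
  then show "null_diff X Y" by (simp add: cauchy_class_def null_diff_def)
next
  assume xy: "null_diff X Y"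
  show "cauchy_class A X = cauchy_class A Y"
    unfolding cauchy_class_def null_diff_def[symmetric]
    using null_diff_trans[OF assms(1,2) _ xy] null_diff_trans[OF assms(2,1) _ null_diff_sym[OF assms
      xy]] by blast
qed

lemma representative_class:
  assumes "X \<in> cauchy_seqs A"
  shows "representative (cauchy_class A X) \<in> cauchy_seqs A" "null_diff X (representative (cauchy_class A X))"
proof -
  have "X \<in> cauchy_class A X" using assms null_diff_refl by (simp add: cauchy_class_def null_diff_def)
  then have "representative (cauchy_class A X) \<in> cauchy_class A X"
    unfolding representative_def by (rule someI[where P = "\<lambda>X. X \<in> _"])
  then show "representative (cauchy_class A X) \<in> cauchy_seqs A" "null_diff X (representative
    (cauchy_class A X))"
    by (auto simp: cauchy_class_def null_diff_def)
qed

lemma completion_carr: "carr (completion A) = cauchy_class A ` cauchy_seqs A"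
  by (simp add: completion_def)

lemma completion_zer: "zer (completion A) = cauchy_class A (\<lambda>n. zer A)"
  by (simp add: completion_def)

text \<open>The completion computes with chosen representatives; here and in the lemmas on the other
  operations any Cauchy sequence of the class is shown to serve.\<close>

lemma completion_pls:
  assumes X: "X \<in> cauchy_seqs A" and Y: "Y \<in> cauchy_seqs A"
  shows "pls (completion A) (cauchy_class A X) (cauchy_class A Y) = cauchy_class A (\<lambda>n. pls A (X n) (Y n))"
proof -
  let ?X = "representative (cauchy_class A X)" and ?Y = "representative (cauchy_class A Y)"
  note R = representative_class[OF X] representative_class[OF Y]
  have "null_diff (\<lambda>n. pls A (X n) (Y n)) (\<lambda>n. pls A (?X n) (?Y n))"
  proof (rule null_diffI)
    show "(\<lambda>n. nrm A (sub A (X n) (?X n)) + nrm A (sub A (Y n) (?Y n))) \<longlonglongrightarrow> 0"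
      using tendsto_add[OF R(2,4)[unfolded null_diff_def]] by simp
  qed (use X Y R cauchy_carr nrm_sub_pls in auto)
  then show ?thesis using X Y R by (simp add: completion_def class_eq_iff[symmetric] cauchy_pls)
qed

lemma completion_smul:
  assumes X: "X \<in> cauchy_seqs A"
  shows "smul (completion A) c (cauchy_class A X) = cauchy_class A (\<lambda>n. smul A c (X n))"
proof -
  let ?X = "representative (cauchy_class A X)"
  note R = representative_class[OF X]
  have "null_diff (\<lambda>n. smul A c (X n)) (\<lambda>n. smul A c (?X n))"
  proof (rule null_diffI)
    show "(\<lambda>n. cmod c * nrm A (sub A (X n) (?X n))) \<longlonglongrightarrow> 0"
      using tendsto_mult_left[OF R(2)[unfolded null_diff_def]] by simp
  qed (use X R cauchy_carr nrm_sub_smul in auto)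
  then show ?thesis using X R by (simp add: completion_def class_eq_iff[symmetric] cauchy_smul)
qed

lemma completion_adj:
  assumes X: "X \<in> cauchy_seqs A"
  shows "adj (completion A) (cauchy_class A X) = cauchy_class A (\<lambda>n. adj A (X n))"
proof -
  let ?X = "representative (cauchy_class A X)"
  note R = representative_class[OF X]
  have "null_diff (\<lambda>n. adj A (X n)) (\<lambda>n. adj A (?X n))"
  proof (rule null_diffI)
    show "(\<lambda>n. nrm A (sub A (X n) (?X n))) \<longlonglongrightarrow> 0" using R(2) by (simp add: null_diff_def)
  qed (use X R cauchy_carr nrm_sub_adj in auto)
  then show ?thesis using X R by (simp add: completion_def class_eq_iff[symmetric] cauchy_adj)
qed

lemma completion_tim:
  assumes X: "X \<in> cauchy_seqs A" and Y: "Y \<in> cauchy_seqs A"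
  shows "tim (completion A) (cauchy_class A X) (cauchy_class A Y) = cauchy_class A (\<lambda>n. tim A (X n) (Y n))"
proof -
  let ?X = "representative (cauchy_class A X)" and ?Y = "representative (cauchy_class A Y)"
  note R = representative_class[OF X] representative_class[OF Y]
  obtain K where K: "K > 0" "\<And>n. nrm A (?X n) \<le> K" using cauchy_bounded[OF R(1)] by blast
  obtain L where L: "L > 0" "\<And>n. nrm A (Y n) \<le> L" using cauchy_bounded[OF Y] by blast
  have "null_diff (\<lambda>n. tim A (X n) (Y n)) (\<lambda>n. tim A (?X n) (?Y n))"
  proof (rule null_diffI)
    show "(\<lambda>n. nrm A (sub A (X n) (?X n)) * L + K * nrm A (sub A (Y n) (?Y n))) \<longlonglongrightarrow> 0"
      using tendsto_add[OF tendsto_mult_right[OF R(2)[unfolded null_diff_def]] tendsto_mult_left[OF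
        R(4)[unfolded null_diff_def]]]
      by simp
    fix n
    have "nrm A (sub A (tim A (X n) (Y n)) (tim A (?X n) (?Y n)))
        \<le> nrm A (sub A (X n) (?X n)) * nrm A (Y n) + nrm A (?X n) * nrm A (sub A (Y n) (?Y n))"
      by (intro nrm_sub_tim cauchy_carr X Y R)
    also have "\<dots> \<le> nrm A (sub A (X n) (?X n)) * L + K * nrm A (sub A (Y n) (?Y n))"
      using K L nrm_nonneg cauchy_carr[OF X] cauchy_carr[OF Y] cauchy_carr[OF R(1)] cauchy_carr[OF R(3)]
      by (intro add_mono mult_mono) auto
    finally show "nrm A (sub A (tim A (X n) (Y n)) (tim A (?X n) (?Y n)))
      \<le> nrm A (sub A (X n) (?X n)) * L + K * nrm A (sub A (Y n) (?Y n))" .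
  qed (use X Y R cauchy_carr in auto)
  then show ?thesis using X Y R by (simp add: completion_def class_eq_iff[symmetric] cauchy_tim)
qed

lemma completion_sub:
  assumes X: "X \<in> cauchy_seqs A" and Y: "Y \<in> cauchy_seqs A"
  shows "sub (completion A) (cauchy_class A X) (cauchy_class A Y) = cauchy_class A (\<lambda>n. sub A (X n) (Y n))"
  using X Y by (simp add: sub_def completion_smul completion_pls cauchy_smul)

lemma completion_nrm:
  assumes X: "X \<in> cauchy_seqs A"
  shows "(\<lambda>n. nrm A (X n)) \<longlonglongrightarrow> nrm (completion A) (cauchy_class A X)"
proof -
  let ?X = "representative (cauchy_class A X)"
  note R = representative_class[OF X]
  have "(\<lambda>n. nrm A (?X n)) \<longlonglongrightarrow> nrm (completion A) (cauchy_class A X)"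
    using cauchy_nrm[OF R(1)] by (simp add: completion_def convergent_LIMSEQ_iff)
  moreover have "(\<lambda>n. nrm A (X n) - nrm A (?X n)) \<longlonglongrightarrow> 0"
    by (rule Lim_null_comparison[OF _ R(2)[unfolded null_diff_def]])
      (use nrm_diff_le cauchy_carr X R in auto)
  ultimately have "(\<lambda>n. (nrm A (X n) - nrm A (?X n)) + nrm A (?X n)) \<longlonglongrightarrow> 0
    + nrm (completion A) (cauchy_class A X)"
    by (intro tendsto_add)
  then show ?thesis by simp
qed

lemma completion_elim:
  assumes "C \<in> carr (completion A)" obtains X where "X \<in> cauchy_seqs A" "C = cauchy_class A X"
  using assms by (auto simp: completion_carr)

lemmas completion_ops = completion_pls completion_smul completion_adj completion_tim completion_sub
  completion_zer
  cauchy_pls cauchy_smul cauchy_adj cauchy_tim cauchy_sub cauchy_carr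

lemma completion_star_algebra: "star_algebra (completion A)"
proof unfold_locales
  show "zer (completion A) \<in> carr (completion A)" by (simp add: completion_carr completion_zer)
  show "pls (completion A) x y = pls (completion A) y x"
    if x: "x \<in> carr (completion A)" and y: "y \<in> carr (completion A)" for x y
  proof -
    obtain X where X: "X \<in> cauchy_seqs A" "x = cauchy_class A X" using x by (rule completion_elim)
    obtain Y where Y: "Y \<in> cauchy_seqs A" "y = cauchy_class A Y" using y by (rule completion_elim)
    have "pls A (X n) (Y n) = pls A (Y n) (X n)" for n
      by (rule pls_commute[OF cauchy_carr[OF X(1)] cauchy_carr[OF Y(1)]])
    then show ?thesis using X(1) Y(1) by (simp add: X(2) Y(2) completion_pls)
  qed
qed (auto elim!: completion_elim simp: completion_ops pls_assoc pls_zer sub_self smul_one smul_smul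
  smul_pls add_smul
    tim_assoc tim_pls pls_tim smul_tim tim_smul adj_adj adj_pls adj_smul adj_tim
    completion_carr)

lemma completion_seminormed: "cstar_seminormed (completion A)"
proof (intro cstar_seminormed.intro completion_star_algebra cstar_seminormed_axioms.intro)
  fix C assume "C \<in> carr (completion A)"
  then obtain X where X: "X \<in> cauchy_seqs A" "C = cauchy_class A X" by (rule completion_elim)
  note lX = completion_nrm[OF X(1)]
  show "0 \<le> nrm (completion A) C"
    unfolding X(2) by (rule LIMSEQ_le_const[OF lX]) (use nrm_nonneg cauchy_carr[OF X(1)] in auto)
  show "nrm (completion A) (smul (completion A) c C) = cmod c * nrm (completion A) C" for c
  proof -
    have "(\<lambda>n. cmod c * nrm A (X n)) \<longlonglongrightarrow> nrm (completion A) (smul (completion A) c C)"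
      using completion_nrm[OF cauchy_smul[OF X(1), of c]] X cauchy_carr[OF X(1)]
        by (simp add: completion_smul nrm_smul)
    then show ?thesis using LIMSEQ_unique tendsto_mult_left[OF lX] X(2) by metis
  qed
  show "nrm (completion A) (tim (completion A) (adj (completion A) C) C) = (nrm (completion A) C)\<^sup>2"
  proof -
    have "(\<lambda>n. (nrm A (X n))\<^sup>2) \<longlonglongrightarrow> nrm (completion A) (tim (completion A) (adj (completion A) C) C)"
      using completion_nrm[OF cauchy_tim[OF cauchy_adj[OF X(1)] X(1)]] X cauchy_carr[OF X(1)]
      by (simp add: completion_tim completion_adj cauchy_adj nrm_cstar)
    then show ?thesis using LIMSEQ_unique tendsto_power[OF lX] X(2) by metis
  qed
  fix D assume "D \<in> carr (completion A)"
  then obtain Y where Y: "Y \<in> cauchy_seqs A" "D = cauchy_class A Y" by (rule completion_elim)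
  note lY = completion_nrm[OF Y(1)]
  show "nrm (completion A) (pls (completion A) C D) \<le> nrm (completion A) C + nrm (completion A) D"
    unfolding X(2) Y(2) completion_pls[OF X(1) Y(1)]
    by (rule LIMSEQ_le[OF completion_nrm[OF cauchy_pls[OF X(1) Y(1)]] tendsto_add[OF lX lY]])
      (use nrm_triangle cauchy_carr X(1) Y(1) in blast)
  show "nrm (completion A) (tim (completion A) C D) \<le> nrm (completion A) C * nrm (completion A) D"
    unfolding X(2) Y(2) completion_tim[OF X(1) Y(1)]
    by (rule LIMSEQ_le[OF completion_nrm[OF cauchy_tim[OF X(1) Y(1)]] tendsto_mult[OF lX lY]])
      (use nrm_tim cauchy_carr X(1) Y(1) in blast)
qed

definition embed :: "'a \<Rightarrow> (nat \<Rightarrow> 'a) set" where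
  "embed x = cauchy_class A (\<lambda>n. x)"

lemma embed_carr: "x \<in> carr A \<Longrightarrow> embed x \<in> carr (completion A)"
  by (simp add: embed_def completion_carr)

lemma embed_ops:
  "x \<in> carr A \<Longrightarrow> y \<in> carr A \<Longrightarrow> embed (pls A x y) = pls (completion A) (embed x) (embed y)"
  "x \<in> carr A \<Longrightarrow> y \<in> carr A \<Longrightarrow> embed (sub A x y) = sub (completion A) (embed x) (embed y)"
  "x \<in> carr A \<Longrightarrow> y \<in> carr A \<Longrightarrow> embed (tim A x y) = tim (completion A) (embed x) (embed y)"
  "x \<in> carr A \<Longrightarrow> embed (smul A c x) = smul (completion A) c (embed x)"
  "x \<in> carr A \<Longrightarrow> embed (adj A x) = adj (completion A) (embed x)"
  "embed (zer A) = zer (completion A)"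
  by (simp_all add: embed_def completion_ops)

lemma embed_nrm: "x \<in> carr A \<Longrightarrow> nrm (completion A) (embed x) = nrm A x"
  using completion_nrm[of "\<lambda>n. x"] by (simp add: embed_def LIMSEQ_const_iff)

lemma embed_eq_iff: "x \<in> carr A \<Longrightarrow> y \<in> carr A \<Longrightarrow> embed x = embed y \<longleftrightarrow> nrm A (sub A x y) = 0"
  by (simp add: embed_def class_eq_iff null_diff_def LIMSEQ_const_iff)

lemma embed_dense:
  assumes X: "X \<in> cauchy_seqs A"
  shows "(\<lambda>n. nrm (completion A) (sub (completion A) (cauchy_class A X) (embed (X n)))) \<longlonglongrightarrow> 0"
proof (rule LIMSEQ_I)
  interpret C: cstar_seminormed "completion A" by (rule completion_seminormed)
  have Xc: "cauchy_class A X \<in> carr (completion A)" using X by (simp add: completion_carr)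
  fix e :: real assume "0 < e"
  then have e: "0 < e / 2" by simp
  obtain N where N: "\<And>m n. m \<ge> N \<Longrightarrow> n \<ge> N \<Longrightarrow> nrm A (sub A (X m) (X n)) < e / 2" using cauchyD[OF X e] by blast
  have "nrm (completion A) (sub (completion A) (cauchy_class A X) (embed (X n))) < e" if n: "n \<ge> N" for n
  proof -
    have "nrm (completion A) (sub (completion A) (cauchy_class A X) (embed (X n))) =
        nrm (completion A) (cauchy_class A (\<lambda>m. sub A (X m) (X n)))"
      using X cauchy_carr[OF X] by (simp add: embed_def completion_sub)
    also have "\<dots> \<le> e / 2"
    proof (rule LIMSEQ_le_const2[OF completion_nrm])
      show "(\<lambda>m. sub A (X m) (X n)) \<in> cauchy_seqs A" using X cauchy_carr[OF X] by (simp add: cauchy_sub)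
      show "\<exists>M. \<forall>m\<ge>M. nrm A (sub A (X m) (X n)) \<le> e / 2" using N n less_imp_le by blast
    qed
    also have "\<dots> < e" using \<open>0 < e\<close> by simp
    finally show ?thesis .
  qed
  then show "\<exists>N. \<forall>n\<ge>N. norm (nrm (completion A) (sub (completion A) (cauchy_class A X) (embed (X n))) - 0) < e"
    using C.nrm_nonneg Xc embed_carr cauchy_carr[OF X] by (auto simp: abs_of_nonneg)
qed

lemma embed_approx:
  assumes "C \<in> carr (completion A)" "0 < e"
  shows "\<exists>x\<in>carr A. nrm (completion A) (sub (completion A) C (embed x)) < e"
proof -
  interpret C: cstar_seminormed "completion A" by (rule completion_seminormed)
  obtain X where X: "X \<in> cauchy_seqs A" "C = cauchy_class A X" using assms(1) by (rule completion_elim)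
  obtain n where "norm (nrm (completion A) (sub (completion A) (cauchy_class A X) (embed (X n))) - 0) < e"
    using LIMSEQ_D[OF embed_dense[OF X(1)] assms(2)] by blast
  then have "nrm (completion A) (sub (completion A) C (embed (X n))) < e" by (simp add: X(2))
  then show ?thesis using cauchy_carr[OF X(1)] by blast
qed

theorem completion_cstar_algebra: "cstar_algebra (completion A)"
proof (intro cstar_algebra.intro completion_seminormed cstar_algebra_axioms.intro)
  interpret C: cstar_seminormed "completion A" by (rule completion_seminormed)
  fix C assume C: "C \<in> carr (completion A)" "nrm (completion A) C = 0"
  then obtain X where X: "X \<in> cauchy_seqs A" "C = cauchy_class A X" by (elim completion_elim)
  have "null_diff X (\<lambda>n. zer A)"
    using completion_nrm[OF X(1)] C(2) X cauchy_carr[OF X(1)] by (simp add: null_diff_def sub_zer)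
  then show "C = zer (completion A)" using X by (simp add: completion_zer class_eq_iff)
next
  interpret C: cstar_seminormed "completion A" by (rule completion_seminormed)
  fix Z assume Z: "Z \<in> cauchy_seqs (completion A)"
  note Zc = C.cauchy_carr[OF Z]
  let ?d = "\<lambda>x y. nrm (completion A) (sub (completion A) x y)"
  \<comment> \<open>A diagonal argument: the k-th class is replaced by an element of A at distance
    below 1/(k+1), and the class of the resulting sequence is the limit.\<close>
  have "\<forall>k. \<exists>y\<in>carr A. ?d (Z k) (embed y) < 1 / Suc k"
    using embed_approx[OF Zc] by simp
  then obtain Y where Y: "\<And>k. Y k \<in> carr A" "\<And>k. ?d (Z k) (embed (Y k)) < 1 / Suc k" by metis
  have lim0: "(\<lambda>k. 1 / real (Suc k)) \<longlonglongrightarrow> 0" by real_asymp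
  have Yc: "Y \<in> cauchy_seqs A"
  proof (rule cauchyI[OF Y(1)])
    fix e :: real assume "0 < e"
    then have e: "0 < e / 3" by simp
    obtain N where N: "\<And>m n. m \<ge> N \<Longrightarrow> n \<ge> N \<Longrightarrow> ?d (Z m) (Z n) < e / 3" using C.cauchyD[OF Z e] by blast
    obtain M where M: "\<And>k. k \<ge> M \<Longrightarrow> 1 / real (Suc k) < e / 3" using LIMSEQ_D[OF lim0 e]
      by (auto simp: abs_of_nonneg)
    have "nrm A (sub A (Y m) (Y n)) < e" if mn: "m \<ge> max N M" "n \<ge> max N M" for m n
    proof -
      have "nrm A (sub A (Y m) (Y n)) = ?d (embed (Y m)) (embed (Y n))"
        using Y(1) by (simp add: embed_nrm flip: embed_ops)
      also have "\<dots> \<le> ?d (embed (Y m)) (Z m) + (?d (Z m) (Z n) + ?d (Z n) (embed (Y n)))"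
        using C.nrm_sub_triangle[of "embed (Y m)" "Z m" "embed (Y n)"] C.nrm_sub_triangle[of "Z m"
          "Z n" "embed (Y n)"]
          Zc embed_carr Y(1) by force
      also have "\<dots> < e / 3 + (e / 3 + e / 3)"
        using N[of m n] Y(2)[of m] Y(2)[of n] M[of m] M[of n] mn
          C.nrm_sub_commute[OF embed_carr[OF Y(1)] Zc, of m m] by auto
      finally show ?thesis by simp
    qed
    then show "\<exists>N. \<forall>m\<ge>N. \<forall>n\<ge>N. nrm A (sub A (Y m) (Y n)) < e" by blast
  qed
  have c: "cauchy_class A Y \<in> carr (completion A)" using Yc by (simp add: completion_carr)
  have "(\<lambda>k. ?d (Z k) (cauchy_class A Y)) \<longlonglongrightarrow> 0"
  proof (rule tendsto_sandwich[OF _ _ tendsto_const])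
    show "(\<lambda>k. 1 / Suc k + ?d (cauchy_class A Y) (embed (Y k))) \<longlonglongrightarrow> 0"
      using tendsto_add[OF lim0 embed_dense[OF Yc]] by simp
    have "?d (Z k) (cauchy_class A Y) \<le> 1 / Suc k + ?d (cauchy_class A Y) (embed (Y k))" for k
      using C.nrm_sub_triangle[OF Zc embed_carr[OF Y(1)] c, of k k] Y(2)[of k]
        C.nrm_sub_commute[OF embed_carr[OF Y(1)] c, of k] by linarith
    then show "\<forall>\<^sub>F k in sequentially. ?d (Z k) (cauchy_class A Y) \<le> 1 / Suc k
      + ?d (cauchy_class A Y) (embed (Y k))"
      by simp
  qed (use C.nrm_nonneg Zc c in simp)
  then show "\<exists>x\<in>carr (completion A). (\<lambda>k. ?d (Z k) x) \<longlonglongrightarrow> 0" using c by blast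
qed

end


subsection \<open>Isomorphisms\<close>

lemma star_isoD:
  assumes "star_iso \<phi> A B"
  shows "bij_betw \<phi> (carr A) (carr B)" "x \<in> carr A \<Longrightarrow> \<phi> x \<in> carr B"
    "x \<in> carr A \<Longrightarrow> y \<in> carr A \<Longrightarrow> \<phi> (pls A x y) = pls B (\<phi> x) (\<phi> y)"
    "x \<in> carr A \<Longrightarrow> y \<in> carr A \<Longrightarrow> \<phi> (tim A x y) = tim B (\<phi> x) (\<phi> y)"
    "x \<in> carr A \<Longrightarrow> \<phi> (adj A x) = adj B (\<phi> x)" "x \<in> carr A \<Longrightarrow> \<phi> (smul A c x) = smul B c (\<phi> x)"
  using assms by (auto simp: star_iso_def bij_betw_def)

lemma star_isoI:
  assumes "bij_betw \<phi> (carr A) (carr B)"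
    "\<And>x y. x \<in> carr A \<Longrightarrow> y \<in> carr A \<Longrightarrow> \<phi> (pls A x y) = pls B (\<phi> x) (\<phi> y)"
    "\<And>x y. x \<in> carr A \<Longrightarrow> y \<in> carr A \<Longrightarrow> \<phi> (tim A x y) = tim B (\<phi> x) (\<phi> y)"
    "\<And>x. x \<in> carr A \<Longrightarrow> \<phi> (adj A x) = adj B (\<phi> x)"
    "\<And>x c. x \<in> carr A \<Longrightarrow> \<phi> (smul A c x) = smul B c (\<phi> x)"
  shows "star_iso \<phi> A B"
  using assms by (simp add: star_iso_def)

lemma star_iso_inv:
  assumes \<phi>: "star_iso \<phi> A B" and A: "star_algebra A"
  shows "star_iso (inv_into (carr A) \<phi>) B A"
    "x \<in> carr A \<Longrightarrow> inv_into (carr A) \<phi> (\<phi> x) = x" "y \<in> carr B \<Longrightarrow> \<phi> (inv_into (carr A) \<phi> y) = y"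
proof -
  interpret A: star_algebra A by (rule A)
  note bij = star_isoD(1)[OF \<phi>]
  let ?\<psi> = "inv_into (carr A) \<phi>"
  show l: "?\<psi> (\<phi> x) = x" if "x \<in> carr A" for x using bij_betw_inv_into_left[OF bij that] .
  show r: "\<phi> (?\<psi> y) = y" if "y \<in> carr B" for y using bij_betw_inv_into_right[OF bij that] .
  have b: "bij_betw ?\<psi> (carr B) (carr A)" by (rule bij_betw_inv_into[OF bij])
  have c: "?\<psi> y \<in> carr A" if "y \<in> carr B" for y using b that by (auto simp: bij_betw_def)
  have eq: "?\<psi> z = x" if "x \<in> carr A" "z = \<phi> x" for x z using l that by simp
  show "star_iso ?\<psi> B A"
    by (rule star_isoI[OF b]) (rule eq; simp add: c star_isoD[OF \<phi>] r)+
qed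

lemma star_iso_comp: "star_iso \<phi> A B \<Longrightarrow> star_iso \<psi> B D \<Longrightarrow> star_iso (\<psi> \<circ> \<phi>) A D"
  by (rule star_isoI, rule bij_betw_trans[OF star_isoD(1) star_isoD(1)], assumption+) (simp_all add: star_isoD)

lemma star_isomorphic_trans: "star_isomorphic A B \<Longrightarrow> star_isomorphic B D \<Longrightarrow> star_isomorphic A D"
  unfolding star_isomorphic_def using star_iso_comp by blast

lemma star_isomorphic_sym: "star_algebra A \<Longrightarrow> star_isomorphic A B \<Longrightarrow> star_isomorphic B A"
  unfolding star_isomorphic_def using star_iso_inv(1) by blast

lemma decomposable_cong:
  fixes A B :: "'x star_alg"
  assumes "star_isomorphic A B" "star_algebra A"
  shows "decomposable A \<longleftrightarrow> decomposable B"
proof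
  assume "decomposable A"
  then obtain D :: "nat \<Rightarrow> 'x star_alg" where D: "\<forall>i<2. cstar_algebra (D i) \<and> nonzero_alg (D i)"
    "star_isomorphic A (direct_sum {..<2} D)" unfolding decomposable_def by (elim exE conjE)
  then have "star_isomorphic B (direct_sum {..<2} D)"
    by (intro star_isomorphic_trans[OF star_isomorphic_sym[OF assms(2,1)]])
  with D(1) show "decomposable B" unfolding decomposable_def by (intro exI[of _ D] conjI)
next
  assume "decomposable B"
  then obtain D :: "nat \<Rightarrow> 'x star_alg" where D: "\<forall>i<2. cstar_algebra (D i) \<and> nonzero_alg (D i)"
    "star_isomorphic B (direct_sum {..<2} D)" unfolding decomposable_def by (elim exE conjE)
  then have "star_isomorphic A (direct_sum {..<2} D)" by (intro star_isomorphic_trans[OF assms(1)])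
  with D(1) show "decomposable A" unfolding decomposable_def by (intro exI[of _ D] conjI)
qed

subsection \<open>Central projections\<close>

text \<open>\<open>central_proj A P\<close> says that \<open>P\<close> is multiplication by a central projection of the multiplier
  algebra of \<open>A\<close>.\<close>

definition central_proj :: "'x star_alg \<Rightarrow> ('x \<Rightarrow> 'x) \<Rightarrow> bool" where
  "central_proj A P \<longleftrightarrow> (\<forall>x\<in>carr A. P x \<in> carr A \<and> P (P x) = P x \<and> P (adj A x) = adj A (P x) \<and>
     (\<forall>c. P (smul A c x) = smul A c (P x)) \<and>
     (\<forall>y\<in>carr A. P (pls A x y) = pls A (P x) (P y) \<and> P (tim A x y) = tim A (P x) y \<and> P (tim A x y) =
       tim A x (P y)))"

lemma central_projD:
  assumes "central_proj A P"
  shows "x \<in> carr A \<Longrightarrow> P x \<in> carr A" "x \<in> carr A \<Longrightarrow> P (P x) = P x" "x \<in> carr A \<Longrightarrow> P (adj A x) = adj A (P x)"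
    "x \<in> carr A \<Longrightarrow> P (smul A c x) = smul A c (P x)"
    "x \<in> carr A \<Longrightarrow> y \<in> carr A \<Longrightarrow> P (pls A x y) = pls A (P x) (P y)"
    "x \<in> carr A \<Longrightarrow> y \<in> carr A \<Longrightarrow> P (tim A x y) = tim A (P x) y"
    "x \<in> carr A \<Longrightarrow> y \<in> carr A \<Longrightarrow> P (tim A x y) = tim A x (P y)"
  using assms unfolding central_proj_def by blast+

lemma central_projI:
  assumes "\<And>x. x \<in> carr A \<Longrightarrow> P x \<in> carr A" "\<And>x. x \<in> carr A \<Longrightarrow> P (P x) = P x"
    "\<And>x. x \<in> carr A \<Longrightarrow> P (adj A x) = adj A (P x)" "\<And>x c. x \<in> carr A \<Longrightarrow> P (smul A c x) = smul A c (P x)"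
    "\<And>x y. x \<in> carr A \<Longrightarrow> y \<in> carr A \<Longrightarrow> P (pls A x y) = pls A (P x) (P y)"
    "\<And>x y. x \<in> carr A \<Longrightarrow> y \<in> carr A \<Longrightarrow> P (tim A x y) = tim A (P x) y"
    "\<And>x y. x \<in> carr A \<Longrightarrow> y \<in> carr A \<Longrightarrow> P (tim A x y) = tim A x (P y)"
  shows "central_proj A P"
  using assms by (simp add: central_proj_def)

definition corner :: "'x star_alg \<Rightarrow> ('x \<Rightarrow> 'x) \<Rightarrow> 'x star_alg" where
  "corner A P = A\<lparr>carr := P ` carr A\<rparr>"

lemma corner_sel [simp]:
  "carr (corner A P) = P ` carr A" "zer (corner A P) = zer A" "pls (corner A P)
    = pls A" "smul (corner A P) = smul A"
  "tim (corner A P) = tim A" "adj (corner A P) = adj A" "nrm (corner A P) = nrm A" "sub (corner A P) = sub A"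
  by (simp_all add: corner_def sub_def fun_eq_iff)

context star_algebra
begin

lemma central_proj_zer: assumes "central_proj A P" shows "P (zer A) = zer A"
  using central_projD(4)[OF assms, of "zer A" 0] central_projD(1)[OF assms] by (simp add: smul_zero)

lemma central_proj_tim:
  assumes P: "central_proj A P" and x: "x \<in> carr A" and y: "y \<in> carr A"
  shows "P (tim A x y) = tim A (P x) (P y)"
proof -
  have "P (tim A x y) = P (P (tim A x y))" using central_projD(2)[OF P, of "tim A x y"] x y by simp
  also have "\<dots> = P (tim A (P x) y)" unfolding central_projD(6)[OF P x y] ..
  also have "\<dots> = tim A (P x) (P y)" by (rule central_projD(7)[OF P central_projD(1)[OF P x] y])
  finally show ?thesis .
qed

lemma central_proj_sub:
  assumes "central_proj A P" "x \<in> carr A" "y \<in> carr A" shows "P (sub A x y) = sub A (P x) (P y)"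
  using assms by (simp add: sub_def central_projD)

lemma central_proj_compl: assumes P: "central_proj A P" shows "central_proj A (\<lambda>x. sub A x (P x))"
proof (rule central_projI)
  note D = central_projD[OF P]
  fix x assume x: "x \<in> carr A"
  show "sub A x (P x) \<in> carr A" using x D(1) by simp
  have "P (sub A x (P x)) = zer A" using x by (simp add: central_proj_sub[OF P] D(1,2) sub_self)
  then show "sub A (sub A x (P x)) (P (sub A x (P x))) = sub A x (P x)" using x D(1) by (simp add: sub_zer)
  show "sub A (adj A x) (P (adj A x)) = adj A (sub A x (P x))" using x by (simp add: D(1,3) adj_sub)
  show "sub A (smul A c x) (P (smul A c x)) = smul A c (sub A x (P x))" for c using x
    by (simp add: D(1,4) smul_sub)
  fix y assume y: "y \<in> carr A"
  show "sub A (pls A x y) (P (pls A x y)) = pls A (sub A x (P x)) (sub A y (P y))"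
    using x y by (simp add: D(1,5) sub_pls_pls)
  show "sub A (tim A x y) (P (tim A x y)) = tim A (sub A x (P x)) y" using x y by (simp add: D(1,6) sub_tim)
  show "sub A (tim A x y) (P (tim A x y)) = tim A x (sub A y (P y))" using x y by (simp add: D(1,7) tim_sub)
qed

lemma central_proj_corner_iff: "central_proj A P \<Longrightarrow> x \<in> P ` carr A \<longleftrightarrow> x \<in> carr A \<and> P x = x"
  by (auto simp: central_projD image_iff) metis

lemma corner_star_algebra: assumes P: "central_proj A P" shows "star_algebra (corner A P)"
proof -
  have c: "x \<in> P ` carr A \<Longrightarrow> x \<in> carr A" for x using central_proj_corner_iff[OF P] by blast
  note f = central_proj_corner_iff[OF P]
  show ?thesis
    by unfold_locales (auto simp: f central_projD[OF P] central_proj_zer[OF P] pls_assoc pls_zer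
      sub_self smul_one
      smul_smul smul_pls add_smul tim_assoc tim_pls pls_tim smul_tim tim_smul adj_adj adj_pls adj_smul adj_tim
        intro: pls_commute)
qed

end

context cstar_algebra
begin

text \<open>The choice of x^* for y and the C*-identity give the norm of x. This replaces a unit:
  elements are compared through their products.\<close>

lemma annihilator: assumes "x \<in> carr A" "\<And>y. y \<in> carr A \<Longrightarrow> tim A x y = zer A" shows "x = zer A"
proof -
  have "(nrm A (adj A x))\<^sup>2 = nrm A (tim A x (adj A x))"
    using nrm_cstar[of "adj A x"] assms(1) by (simp add: adj_adj)
  then have "nrm A x = 0" using assms by (simp add: nrm_adj nrm_zer)
  then show ?thesis using nrm_definite assms(1) by blast
qed

lemma eq_if_tim_eq:
  assumes "x \<in> carr A" "x' \<in> carr A" "\<And>y. y \<in> carr A \<Longrightarrow> tim A x y = tim A x' y" shows "x = x'"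
proof -
  have "sub A x x' = zer A" by (rule annihilator) (use assms in \<open>simp_all add: sub_tim sub_self\<close>)
  then show ?thesis using assms by (simp add: sub_eq_zer)
qed

text \<open>In a product x y each projection can be attached to either factor, so P Q x and Q P x
  agree after multiplication by any y.\<close>

lemma central_proj_commute:
  assumes P: "central_proj A P" and Q: "central_proj A Q" and x: "x \<in> carr A"
  shows "P (Q x) = Q (P x)"
proof (rule eq_if_tim_eq)
  fix y assume y: "y \<in> carr A"
  have "tim A (P (Q x)) y = tim A (Q x) (P y)"
    using central_projD(6,7)[OF P, of "Q x" y] central_projD(1)[OF Q] x y by simp
  also have "\<dots> = tim A x (Q (P y))"
    using central_projD(6,7)[OF Q, of x "P y"] central_projD(1)[OF P] x y by simp
  also have "\<dots> = Q (P (tim A x y))"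
    using central_projD(7)[OF Q, of x "P y"] central_projD(7)[OF P, of x y] central_projD(1)[OF P] x y by simp
  also have "\<dots> = tim A (Q (P x)) y"
    using central_projD(6)[OF Q, of "P x" y] central_projD(6)[OF P, of x y] central_projD(1)[OF P] x y by simp
  finally show "tim A (P (Q x)) y = tim A (Q (P x)) y" .
qed (simp_all add: central_projD(1)[OF P] central_projD(1)[OF Q] x)

lemma central_proj_comp:
  assumes P: "central_proj A P" and Q: "central_proj A Q" shows "central_proj A (\<lambda>x. P (Q x))"
proof (rule central_projI)
  fix x assume x: "x \<in> carr A"
  show "P (Q (P (Q x))) = P (Q x)"
    using central_proj_commute[OF P Q, of "Q x"] x by (simp add: central_projD[OF P] central_projD[OF Q])
  fix y assume y: "y \<in> carr A"
  show "P (Q (tim A x y)) = tim A (P (Q x)) y" "P (Q (tim A x y)) = tim A x (P (Q y))"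
    using central_projD(6)[OF Q x y] central_projD(6)[OF P, of "Q x" y] central_projD(7)[OF Q x y]
      central_projD(7)[OF P, of x "Q y"] central_projD(1)[OF Q] x y by simp_all
qed (simp_all add: central_projD(1-5)[OF P] central_projD(1-5)[OF Q])

lemma limit_unique:
  assumes "x \<in> carr A" "y \<in> carr A" "\<And>n. X n \<in> carr A" "(\<lambda>n. nrm A (sub A (X n) x)) \<longlonglongrightarrow> 0"
    "(\<lambda>n. nrm A (sub A (X n) y)) \<longlonglongrightarrow> 0"
  shows "x = y"
proof -
  have "(\<lambda>n. nrm A (sub A (X n) x) + nrm A (sub A (X n) y)) \<longlonglongrightarrow> 0" using tendsto_add[OF assms(4,5)] by simp
  moreover have "nrm A (sub A x y) \<le> nrm A (sub A (X n) x) + nrm A (sub A (X n) y)" for n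
    using nrm_sub_triangle[of x "X n" y] nrm_sub_commute[of x "X n"] assms(1-3) by simp
  ultimately have "nrm A (sub A x y) \<le> 0" by (intro LIMSEQ_le_const) auto
  then have "nrm A (sub A x y) = 0" using nrm_nonneg[of "sub A x y"] assms(1,2) by simp
  then show ?thesis using nrm_definite[of "sub A x y"] assms(1,2) by (simp add: sub_eq_zer)
qed

lemma tendsto_tim_left:
  assumes "x \<in> carr A" "y \<in> carr A" "\<And>n. X n \<in> carr A" "(\<lambda>n. nrm A (sub A (X n) x)) \<longlonglongrightarrow> 0"
  shows "(\<lambda>n. nrm A (sub A (tim A (X n) y) (tim A x y))) \<longlonglongrightarrow> 0"
proof (rule tendsto_sandwich[OF _ _ tendsto_const])
  show "(\<lambda>n. nrm A (sub A (X n) x) * nrm A y) \<longlonglongrightarrow> 0" using tendsto_mult_right[OF assms(4)] by simp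
  have "nrm A (sub A (tim A (X n) y) (tim A x y)) \<le> nrm A (sub A (X n) x) * nrm A y" for n
    using nrm_tim[of "sub A (X n) x" y] assms(1-3) by (simp add: sub_tim)
  then show "\<forall>\<^sub>F n in sequentially. nrm A (sub A (tim A (X n) y) (tim A x y))
    \<le> nrm A (sub A (X n) x) * nrm A y" by simp
qed (use nrm_nonneg assms(1-3) in simp)

lemma corner_cstar_algebra: assumes P: "central_proj A P" shows "cstar_algebra (corner A P)"
proof -
  interpret D: star_algebra "corner A P" by (rule corner_star_algebra[OF P])
  have f: "x \<in> P ` carr A \<longleftrightarrow> x \<in> carr A \<and> P x = x" for x using central_proj_corner_iff[OF P] .
  show ?thesis
  proof unfold_locales
    fix X assume X: "X \<in> cauchy_seqs (corner A P)"
    then have Xc: "X n \<in> carr A" "P (X n) = X n" for n by (auto simp: cauchy_seqs_def f)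
    have "X \<in> cauchy_seqs A" using X Xc by (simp add: cauchy_seqs_def)
    then obtain x where x: "x \<in> carr A" "(\<lambda>n. nrm A (sub A (X n) x)) \<longlonglongrightarrow> 0" using complete by blast
    \<comment> \<open>Continuity of P is not part of \<open>central_proj\<close>. Instead x and P x
      are compared through their products with y, where P can be moved to the constant factor
      y.\<close>
    have "x = P x"
    proof (rule eq_if_tim_eq)
      fix y assume y: "y \<in> carr A"
      have Py: "P y \<in> carr A" using central_projD(1)[OF P y] .
      have "tim A (X n) (P y) = tim A (X n) y" for n
        using central_projD(6,7)[OF P, of "X n" y] Xc y by simp
      then have "(\<lambda>n. nrm A (sub A (tim A (X n) y) (tim A x (P y)))) \<longlonglongrightarrow> 0"
        using tendsto_tim_left[OF x(1) Py Xc(1) x(2)] by simp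
      then have "tim A x y = tim A x (P y)"
        using limit_unique[OF _ _ _ tendsto_tim_left[OF x(1) y Xc(1) x(2)]] x y Py Xc by simp
      then show "tim A x y = tim A (P x) y"
        using central_projD(6,7)[OF P x(1) y] by simp
    qed (use x central_projD(1)[OF P] in auto)
    then have "x \<in> carr (corner A P)" using x f[of x] by simp
    then show "\<exists>x\<in>carr (corner A P). (\<lambda>n. nrm (corner A P) (sub (corner A P) (X n) x)) \<longlonglongrightarrow> 0" using x by auto
  qed (auto simp: f nrm_nonneg nrm_triangle nrm_smul nrm_tim nrm_cstar nrm_definite)
qed

end

lemma central_proj_transport:
  assumes \<phi>: "star_iso \<phi> A B" and A: "star_algebra A" and E: "central_proj B E"
  shows "central_proj A (\<lambda>x. inv_into (carr A) \<phi> (E (\<phi> x)))"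
proof -
  interpret A: star_algebra A by (rule A)
  note i = star_isoD[OF star_iso_inv(1)[OF \<phi> A]] star_isoD[OF \<phi>] star_iso_inv(2,3)[OF \<phi> A]
  show ?thesis
  proof (rule central_projI)
    fix x y assume xy: "x \<in> carr A" "y \<in> carr A"
    show "inv_into (carr A) \<phi> (E (\<phi> (tim A x y))) = tim A (inv_into (carr A) \<phi> (E (\<phi> x))) y"
      using xy by (simp add: i central_projD(1,6)[OF E])
    show "inv_into (carr A) \<phi> (E (\<phi> (tim A x y))) = tim A x (inv_into (carr A) \<phi> (E (\<phi> y)))"
      using xy by (simp add: i central_projD(1,7)[OF E])
  qed (simp_all add: i central_projD(1-5)[OF E])
qed

subsection \<open>Direct sums\<close>

lemma direct_sum_sel [simp]:
  "carr (direct_sum I B) = (\<Pi>\<^sub>E i\<in>I. carr (B i))" "zer (direct_sum I B) = (\<lambda>i\<in>I. zer (B i))"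
  "pls (direct_sum I B) x y = (\<lambda>i\<in>I. pls (B i) (x i) (y i))" "smul (direct_sum I B) c x
    = (\<lambda>i\<in>I. smul (B i) c (x i))"
  "tim (direct_sum I B) x y = (\<lambda>i\<in>I. tim (B i) (x i) (y i))" "adj (direct_sum I B) x = (\<lambda>i\<in>I. adj (B i) (x i))"
  by (simp_all add: direct_sum_def)

definition at_coord :: "'i set \<Rightarrow> ('i \<Rightarrow> 'x star_alg) \<Rightarrow> 'i \<Rightarrow> 'x \<Rightarrow> 'i \<Rightarrow> 'x" where
  "at_coord I B i b = (\<lambda>j\<in>I. if j = i then b else zer (B j))"

lemma central_proj_coord:
  assumes B: "\<And>i. i \<in> I \<Longrightarrow> star_algebra (B i)"
  shows "central_proj (direct_sum I B) (\<lambda>x. at_coord I B i (x i))"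
proof -
  note z = star_algebra.zer_closed[OF B] star_algebra.smul_zer[OF B] star_algebra.adj_zer[OF B]
    star_algebra.pls_zer[OF B star_algebra.zer_closed[OF B]] star_algebra.tim_zer[OF B]
      star_algebra.zer_tim[OF B]
  show ?thesis
    by (rule central_projI) (auto simp: at_coord_def fun_eq_iff z PiE_iff extensional_def)
qed

locale decomposition =
  fixes A :: "'x star_alg" and I :: "'i set" and B :: "'i \<Rightarrow> 'y star_alg" and \<phi> :: "'x \<Rightarrow> 'i \<Rightarrow> 'y"
  assumes A: "cstar_algebra A" and B: "\<And>i. i \<in> I \<Longrightarrow> cstar_algebra (B i)"
    and iso: "star_iso \<phi> A (direct_sum I B)"
begin

sublocale A: cstar_algebra A by (rule A)

lemma Bs: "i \<in> I \<Longrightarrow> star_algebra (B i)"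
  using B by (simp add: cstar_algebra_def cstar_seminormed_def)

lemma As: "star_algebra A" by unfold_locales

definition coord_proj :: "'i \<Rightarrow> 'x \<Rightarrow> 'x" where
  "coord_proj i x = inv_into (carr A) \<phi> (at_coord I B i (\<phi> x i))"

lemma \<phi>_carr: "x \<in> carr A \<Longrightarrow> i \<in> I \<Longrightarrow> \<phi> x i \<in> carr (B i)"
  using star_isoD(2)[OF iso] by (auto simp: PiE_iff)

lemma at_coord_carr: "i \<in> I \<Longrightarrow> b \<in> carr (B i) \<Longrightarrow> at_coord I B i b \<in> carr (direct_sum I B)"
  using star_algebra.zer_closed[OF Bs] by (auto simp: at_coord_def)

lemma \<phi>_coord_proj: "x \<in> carr A \<Longrightarrow> i \<in> I \<Longrightarrow> \<phi> (coord_proj i x) = at_coord I B i (\<phi> x i)"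
  unfolding coord_proj_def by (rule star_iso_inv(3)[OF iso As at_coord_carr]) (auto simp: \<phi>_carr)

lemma coord_proj_central: "i \<in> I \<Longrightarrow> central_proj A (coord_proj i)"
  using central_proj_transport[OF iso As central_proj_coord[of I B i]] Bs by (simp add: coord_proj_def[abs_def])

text \<open>\<open>star_iso\<close> does not mention zero; it is recovered as the multiple of an
  element by the scalar 0.\<close>

lemma \<phi>_zer: "i \<in> I \<Longrightarrow> \<phi> (zer A) i = zer (B i)"
proof -
  assume i: "i \<in> I"
  have "\<phi> (zer A) = smul (direct_sum I B) 0 (\<phi> (zer A))"
    using star_isoD(6)[OF iso A.zer_closed, of 0] by (simp only: A.smul_zero[OF A.zer_closed])
  then have "\<phi> (zer A) i = smul (direct_sum I B) 0 (\<phi> (zer A)) i" by (rule fun_cong)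
  also have "\<dots> = smul (B i) 0 (\<phi> (zer A) i)" using i by simp
  also have "\<dots> = zer (B i)" by (rule star_algebra.smul_zero[OF Bs[OF i] \<phi>_carr[OF A.zer_closed i]])
  finally show ?thesis .
qed

lemma \<phi>_eqI: "x \<in> carr A \<Longrightarrow> y \<in> carr A \<Longrightarrow> (\<And>i. i \<in> I \<Longrightarrow> \<phi> x i = \<phi> y i) \<Longrightarrow> x = y"
proof -
  assume xy: "x \<in> carr A" "y \<in> carr A" "\<And>i. i \<in> I \<Longrightarrow> \<phi> x i = \<phi> y i"
  have "\<phi> x = \<phi> y" using star_isoD(2)[OF iso] xy by (intro PiE_ext[of _ I "\<lambda>i. carr (B i)"]) auto
  then show "x = y" using star_isoD(1)[OF iso] xy by (auto simp: bij_betw_def inj_on_def)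
qed

lemma coord_proj_carr: "x \<in> carr A \<Longrightarrow> i \<in> I \<Longrightarrow> coord_proj i x \<in> carr A"
  using central_projD(1)[OF coord_proj_central] by blast

lemma coord_proj_eq_iff:
  assumes x: "x \<in> carr A" and i: "i \<in> I"
  shows "coord_proj i x = x \<longleftrightarrow> (\<forall>j\<in>I - {i}. \<phi> x j = zer (B j))"
    and "coord_proj i x = zer A \<longleftrightarrow> \<phi> x i = zer (B i)"
proof -
  note \<phi>P = \<phi>_coord_proj[OF x i] and c = coord_proj_carr[OF x i]
  show "coord_proj i x = x \<longleftrightarrow> (\<forall>j\<in>I - {i}. \<phi> x j = zer (B j))"
  proof
    assume "coord_proj i x = x"
    then have "\<phi> x = at_coord I B i (\<phi> x i)" using \<phi>P by simp
    then have eq: "\<phi> x j = at_coord I B i (\<phi> x i) j" for j by (rule fun_cong)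
    show "\<forall>j\<in>I - {i}. \<phi> x j = zer (B j)"
    proof
      fix j assume "j \<in> I - {i}"
      then show "\<phi> x j = zer (B j)" using eq[of j] by (simp add: at_coord_def)
    qed
  next
    assume "\<forall>j\<in>I - {i}. \<phi> x j = zer (B j)"
    then show "coord_proj i x = x" by (intro \<phi>_eqI c x) (auto simp: \<phi>P at_coord_def)
  qed
  show "coord_proj i x = zer A \<longleftrightarrow> \<phi> x i = zer (B i)"
  proof
    assume "coord_proj i x = zer A"
    then have "at_coord I B i (\<phi> x i) = \<phi> (zer A)" using \<phi>P by simp
    then have "at_coord I B i (\<phi> x i) i = \<phi> (zer A) i" by simp
    then show "\<phi> x i = zer (B i)" using i by (simp add: at_coord_def \<phi>_zer)
  next
    assume "\<phi> x i = zer (B i)"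
    then show "coord_proj i x = zer A" by (intro \<phi>_eqI c A.zer_closed) (auto simp: \<phi>P at_coord_def \<phi>_zer)
  qed
qed

lemma coord_proj_zeros: "x \<in> carr A \<Longrightarrow> (\<And>i. i \<in> I \<Longrightarrow> coord_proj i x = zer A) \<Longrightarrow> x = zer A"
  using coord_proj_eq_iff(2) by (intro \<phi>_eqI) (auto simp: \<phi>_zer)

lemma coord_proj_orth: "x \<in> carr A \<Longrightarrow> i \<in> I \<Longrightarrow> j \<in> I \<Longrightarrow> i \<noteq> j \<Longrightarrow> coord_proj i (coord_proj j x) = zer A"
  using coord_proj_eq_iff(2)[OF coord_proj_carr, of x j i] \<phi>_coord_proj[of x j] by (simp add: at_coord_def)

lemma summand_eq: "i \<in> I \<Longrightarrow> summand A I B \<phi> i = coord_proj i ` carr A"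
  using A.central_proj_corner_iff[OF coord_proj_central, of i] coord_proj_eq_iff(1)[of _ i]
  by (auto simp: summand_def)

lemma corner_iso: assumes i: "i \<in> I" shows "star_iso (\<lambda>x. \<phi> x i) (corner A (coord_proj i)) (B i)"
proof (rule star_isoI)
  note f = A.central_proj_corner_iff[OF coord_proj_central[OF i]]
  show "bij_betw (\<lambda>x. \<phi> x i) (carr (corner A (coord_proj i))) (carr (B i))"
  proof (rule bij_betwI')
    fix x y assume "x \<in> carr (corner A (coord_proj i))" "y \<in> carr (corner A (coord_proj i))"
    then have xy: "x \<in> carr A" "y \<in> carr A" "coord_proj i x = x" "coord_proj i y = y" by (auto simp: f)
    then show "\<phi> x i = \<phi> y i \<longleftrightarrow> x = y"
      using coord_proj_eq_iff(1)[of x i] coord_proj_eq_iff(1)[of y i] i \<phi>_eqI[of x y]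
        by (metis DiffI empty_iff insert_iff)
  next
    fix x assume "x \<in> carr (corner A (coord_proj i))"
    then show "\<phi> x i \<in> carr (B i)" using \<phi>_carr i by (auto simp: f)
  next
    fix b assume b: "b \<in> carr (B i)"
    define x where "x = inv_into (carr A) \<phi> (at_coord I B i b)"
    have "\<phi> x = at_coord I B i b" unfolding x_def by (rule star_iso_inv(3)[OF iso As at_coord_carr[OF i b]])
    moreover have "x \<in> carr A" unfolding x_def
      using star_isoD(2)[OF star_iso_inv(1)[OF iso As]] at_coord_carr[OF i b] by blast
    ultimately have "x \<in> carr A" "coord_proj i x = x" "b = \<phi> x i"
      using coord_proj_eq_iff(1)[of x i] i by (auto simp: at_coord_def)
    then show "\<exists>x\<in>carr (corner A (coord_proj i)). b = \<phi> x i" by (intro bexI[of _ x]) (simp_all add: f)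
  qed
  fix x assume x: "x \<in> carr (corner A (coord_proj i))"
  then have xA: "x \<in> carr A" by (simp add: f)
  show "\<phi> (adj (corner A (coord_proj i)) x) i = adj (B i) (\<phi> x i)" using star_isoD(5)[OF iso xA] i by simp
  show "\<phi> (smul (corner A (coord_proj i)) c x) i = smul (B i) c (\<phi> x i)" for c
    using star_isoD(6)[OF iso xA] i by simp
  fix y assume "y \<in> carr (corner A (coord_proj i))"
  then have yA: "y \<in> carr A" by (simp add: f)
  show "\<phi> (pls (corner A (coord_proj i)) x y) i = pls (B i) (\<phi> x i) (\<phi> y i)"
    using star_isoD(3)[OF iso xA yA] i by simp
  show "\<phi> (tim (corner A (coord_proj i)) x y) i = tim (B i) (\<phi> x i) (\<phi> y i)"
    using star_isoD(4)[OF iso xA yA] i by simp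
qed

lemma nonzero_iff: assumes i: "i \<in> I" shows "nonzero_alg (B i) \<longleftrightarrow> (\<exists>x\<in>carr A. coord_proj i x \<noteq> zer A)"
proof
  assume "nonzero_alg (B i)"
  then obtain b where b: "b \<in> carr (B i)" "b \<noteq> zer (B i)"
    using star_algebra.zer_closed[OF Bs[OF i]] by (auto simp: nonzero_alg_def)
  then have "b \<in> (\<lambda>x. \<phi> x i) ` carr (corner A (coord_proj i))"
    using star_isoD(1)[OF corner_iso[OF i]] by (simp only: bij_betw_def)
  then obtain x where "x \<in> carr (corner A (coord_proj i))" "\<phi> x i = b" by (elim imageE) simp
  then show "\<exists>x\<in>carr A. coord_proj i x \<noteq> zer A"
    using b A.central_proj_corner_iff[OF coord_proj_central[OF i]] coord_proj_eq_iff(2)[of x i] i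
    by (intro bexI[of _ x]) auto
next
  assume "\<exists>x\<in>carr A. coord_proj i x \<noteq> zer A"
  then show "nonzero_alg (B i)" using coord_proj_eq_iff(2) \<phi>_carr i by (auto simp: nonzero_alg_def)
qed

end

text \<open>A coordinate projection serves in one direction, the corners of P and 1 - P in the
  other. Decomposability thus becomes a question about central multipliers.\<close>

lemma decomposable_iff:
  assumes A: "cstar_algebra A"
  shows "decomposable A \<longleftrightarrow> (\<exists>P. central_proj A P \<and> (\<exists>x\<in>carr A. P x \<noteq> zer A) \<and> (\<exists>x\<in>carr A. P x \<noteq> x))"
proof
  assume "decomposable A"
  then obtain B :: "nat \<Rightarrow> 'a star_alg" and \<phi> where B: "\<And>i. i < 2 \<Longrightarrow> cstar_algebra (B i)" "\<And>i. i < 2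
    \<Longrightarrow> nonzero_alg (B i)"
    and \<phi>: "star_iso \<phi> A (direct_sum {..<2} B)"
    unfolding decomposable_def star_isomorphic_def by blast
  interpret D: decomposition A "{..<2}" B \<phi> by (rule decomposition.intro) (use A B \<phi> in auto)
  obtain x where x: "x \<in> carr A" "D.coord_proj 0 x \<noteq> zer A" using D.nonzero_iff[of 0] B(2)[of 0] by auto
  obtain y where y: "y \<in> carr A" "D.coord_proj 1 y \<noteq> zer A" using D.nonzero_iff[of 1] B(2)[of 1] by auto
  have "D.coord_proj 0 y \<noteq> y"
  proof
    assume "D.coord_proj 0 y = y"
    then have "D.coord_proj 1 y = D.coord_proj 1 (D.coord_proj 0 y)" by simp
    also have "\<dots> = zer A" using y by (intro D.coord_proj_orth) auto
    finally show False using y by simp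
  qed
  then show "\<exists>P. central_proj A P \<and> (\<exists>x\<in>carr A. P x \<noteq> zer A) \<and> (\<exists>x\<in>carr A. P x \<noteq> x)"
    using D.coord_proj_central[of 0] x y by (intro exI[of _ "D.coord_proj 0"]) auto
next
  interpret A: cstar_algebra A by (rule A)
  assume "\<exists>P. central_proj A P \<and> (\<exists>x\<in>carr A. P x \<noteq> zer A) \<and> (\<exists>x\<in>carr A. P x \<noteq> x)"
  then obtain P x y where P: "central_proj A P" and x: "x \<in> carr A" "P x \<noteq> zer A" and y: "y \<in> carr
    A" "P y \<noteq> y" by blast
  define Q where "Q = (\<lambda>x. sub A x (P x))"
  have Q: "central_proj A Q" unfolding Q_def by (rule A.central_proj_compl[OF P])
  define B where "B = (\<lambda>i::nat. corner A (if i = 0 then P else Q))"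
  have "cstar_algebra (B i)" for i using A.corner_cstar_algebra P Q by (simp add: B_def)
  moreover have "nonzero_alg (B i)" if "i < 2" for i
  proof -
    have "Q y \<noteq> zer A" using y central_projD(1)[OF P] by (auto simp: Q_def A.sub_eq_zer)
    then show ?thesis using x y by (auto simp: nonzero_alg_def B_def)
  qed
  moreover
  \<comment> \<open>The element x corresponds to the pair of P x and x - P x, from which it is
    recovered as the sum.\<close>
  have "star_iso (\<lambda>x. \<lambda>i\<in>{..<2::nat}. if i = 0 then P x else Q x) A (direct_sum {..<2} B)"
  proof (rule star_isoI)
    let ?\<phi> = "\<lambda>x. \<lambda>i\<in>{..<2::nat}. if i = 0 then P x else Q x"
    have c: "P x \<in> carr A" "Q x \<in> carr A" if "x \<in> carr A" for x
      using central_projD(1)[OF P that] central_projD(1)[OF Q that] by auto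
    have PQ: "P (Q x) = zer A" "Q (P x) = zer A" "pls A (P x) (Q x) = x" if "x \<in> carr A" for x
      using that by (simp_all add: Q_def A.central_proj_sub[OF P] central_projD[OF P] A.sub_self
        A.pls_sub_cancel
          A.pls_commute[of "P x" "sub A x (P x)"])
    show "bij_betw ?\<phi> (carr A) (carr (direct_sum {..<2} B))"
    proof (rule bij_betwI')
      fix x y assume xy: "x \<in> carr A" "y \<in> carr A"
      have "P x = P y \<and> Q x = Q y" if "?\<phi> x = ?\<phi> y"
        using fun_cong[OF that, of 0] fun_cong[OF that, of 1] by auto
      then show "?\<phi> x = ?\<phi> y \<longleftrightarrow> x = y" using PQ(3) xy by metis
    next
      fix f assume f: "f \<in> carr (direct_sum {..<2} B)"
      then have "f 0 \<in> P ` carr A" "f 1 \<in> Q ` carr A"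
        by (auto simp: PiE_iff B_def dest: bspec[of _ _ 0] bspec[of _ _ 1])
      then have f01: "f 0 \<in> carr A" "P (f 0) = f 0" "f 1 \<in> carr A" "Q (f 1) = f 1"
        using A.central_proj_corner_iff P Q by blast+
      then have "P (f 1) = zer A" "Q (f 0) = zer A" using PQ by metis+
      then have "P (pls A (f 0) (f 1)) = f 0" "Q (pls A (f 0) (f 1)) = f 1"
        using f01 by (simp_all add: central_projD(5)[OF P] central_projD(5)[OF Q] A.pls_zer A.zer_pls)
      moreover have "f i = undefined" if "\<not> i < 2" for i using f that by (auto simp: PiE_iff extensional_def)
      ultimately have "f = ?\<phi> (pls A (f 0) (f 1))" by (auto simp: fun_eq_iff less_2_cases_iff One_nat_def)
      then show "\<exists>x\<in>carr A. f = ?\<phi> x" using f01 by (intro bexI[of _ "pls A (f 0) (f 1)"]) auto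
    qed (auto simp: B_def)
  qed (auto simp: restrict_def B_def central_projD(3-5)[OF P] central_projD(3-5)[OF Q]
      A.central_proj_tim[OF P] A.central_proj_tim[OF Q])
  then have "star_isomorphic A (direct_sum {..<2} B)" unfolding star_isomorphic_def by blast
  ultimately show "decomposable A" unfolding decomposable_def by (intro exI[of _ B]) simp
qed

text \<open>A central projection of A restricts to the corner since it commutes with P, and a
  central projection R of the corner extends to A as R after P.\<close>

lemma indecomposable_corner_iff:
  assumes A: "cstar_algebra A" and P: "central_proj A P"
  shows "indecomposable (corner A P) \<longleftrightarrow>
    (\<forall>Q. central_proj A Q \<longrightarrow> (\<forall>x\<in>carr A. Q (P x) = zer A) \<or> (\<forall>x\<in>carr A. Q (P x) = P x))"
proof -
  interpret A: cstar_algebra A by (rule A)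
  note f = A.central_proj_corner_iff[OF P]
  have dec: "decomposable (corner A P) \<longleftrightarrow> (\<exists>Q. central_proj (corner A P) Q \<and>
      (\<exists>x\<in>carr A. Q (P x) \<noteq> zer A) \<and> (\<exists>x\<in>carr A. Q (P x) \<noteq> P x))"
    by (simp add: decomposable_iff[OF A.corner_cstar_algebra[OF P]])
  have 1: "central_proj (corner A P) Q" if Q: "central_proj A Q" for Q
    by (rule central_projI, unfold corner_sel f)
      (auto simp: A.central_proj_commute[OF P Q] central_projD(1-5)[OF Q] intro: central_projD(6,7)[OF Q])
  have 2: "central_proj A (\<lambda>x. R (P x))" if R: "central_proj (corner A P) R" for R
  proof -
    have R1: "R x \<in> carr A" "P (R x) = R x" "R (R x) = R x" "R (adj A x)
      = adj A (R x)" "R (smul A c x) = smul A c (R x)"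
      if "x \<in> carr A" "P x = x" for x c
      using central_projD[OF R, of x] that f by simp_all
    have R2: "R (pls A x y) = pls A (R x) (R y)" "R (tim A x y) = tim A (R x) y" "R (tim A x y) = tim A x (R y)"
      if "x \<in> carr A" "P x = x" "y \<in> carr A" "P y = y" for x y
      using central_projD(5-7)[OF R, of x y] that f by simp_all
    note Pc = central_projD(1,2)[OF P]
    note PP = A.central_proj_tim[OF P]
    show ?thesis
    proof (rule central_projI)
      fix x y assume xy: "x \<in> carr A" "y \<in> carr A"
      show "R (P (tim A x y)) = tim A (R (P x)) y"
      proof -
        have "R (P (tim A x y)) = tim A (R (P x)) (P y)" using xy by (simp add: PP R2 Pc)
        also have "\<dots> = tim A (P (R (P x))) y"
          using central_projD(6,7)[OF P, of "R (P x)" y] xy R1(1)[of "P x"] Pc by simp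
        finally show ?thesis using R1(2)[of "P x"] xy Pc by simp
      qed
      show "R (P (tim A x y)) = tim A x (R (P y))"
      proof -
        have "R (P (tim A x y)) = tim A (P x) (R (P y))" using xy by (simp add: PP R2(3) Pc)
        also have "\<dots> = tim A x (P (R (P y)))"
          using central_projD(6,7)[OF P, of x "R (P y)"] xy R1(1)[of "P y"] Pc by simp
        finally show ?thesis using R1(2)[of "P y"] xy Pc by simp
      qed
    qed (simp_all add: R1 R2 Pc central_projD(3-5)[OF P])
  qed
  show ?thesis
  proof
    assume ind: "indecomposable (corner A P)"
    show "\<forall>Q. central_proj A Q \<longrightarrow> (\<forall>x\<in>carr A. Q (P x) = zer A) \<or> (\<forall>x\<in>carr A. Q (P x) = P x)"
      using ind 1 dec unfolding indecomposable_def by blast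
  next
    assume all: "\<forall>Q. central_proj A Q \<longrightarrow> (\<forall>x\<in>carr A. Q (P x) = zer A) \<or> (\<forall>x\<in>carr A. Q (P x) = P x)"
    show "indecomposable (corner A P)"
      unfolding indecomposable_def dec
    proof
      assume "\<exists>Q. central_proj (corner A P) Q \<and> (\<exists>x\<in>carr A. Q (P x) \<noteq> zer A) \<and> (\<exists>x\<in>carr A. Q (P x) \<noteq> P x)"
      then obtain R where R: "central_proj (corner A P) R" "\<exists>x\<in>carr A. R (P x) \<noteq> zer A" "\<exists>x\<in>carr A.
        R (P x) \<noteq> P x" by blast
      have "(\<forall>x\<in>carr A. R (P (P x)) = zer A) \<or> (\<forall>x\<in>carr A. R (P (P x)) = P x)" using all 2[OF R(1)] by blast
      then show False using R central_projD(2)[OF P] by auto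
    qed
  qed
qed

text \<open>The corner of A is a copy of \<open>B i\<close> inside A. The summands share the type of
  A because \<open>decomposable\<close> ranges over summands of one type.\<close>

lemma decomposition_indecomposable_iff:
  fixes A :: "'x star_alg" and B :: "'i \<Rightarrow> 'x star_alg"
  assumes D: "decomposition A I B \<phi>" and i: "i \<in> I"
  shows "indecomposable (B i) \<longleftrightarrow> (\<forall>Q. central_proj A Q \<longrightarrow>
    (\<forall>x\<in>carr A. Q (decomposition.coord_proj A I B \<phi> i x) = zer A) \<or>
    (\<forall>x\<in>carr A. Q (decomposition.coord_proj A I B \<phi> i x) = decomposition.coord_proj A I B \<phi> i x))"
proof -
  interpret D: decomposition A I B \<phi> by (rule D)
  have "star_isomorphic (corner A (D.coord_proj i)) (B i)"
    unfolding star_isomorphic_def using D.corner_iso[OF i] by blast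
  then have "indecomposable (B i) \<longleftrightarrow> indecomposable (corner A (D.coord_proj i))"
    using decomposable_cong D.A.corner_star_algebra[OF D.coord_proj_central[OF i]]
      by (auto simp: indecomposable_def)
  then show ?thesis using indecomposable_corner_iff[OF D.A D.coord_proj_central[OF i]] by simp
qed


subsection \<open>Maps between completions\<close>

definition comp_map :: "'x star_alg \<Rightarrow> 'y star_alg \<Rightarrow> ('x \<Rightarrow> 'y) \<Rightarrow> (nat \<Rightarrow> 'x) set \<Rightarrow> (nat \<Rightarrow> 'y) set" where
  "comp_map A B h C = cauchy_class B (\<lambda>n. h (representative C n))"

locale contraction = A: cstar_seminormed A + B: cstar_seminormed B
  for A :: "'x star_alg" and B :: "'y star_alg" +
  fixes h :: "'x \<Rightarrow> 'y"
  assumes h_carr: "x \<in> carr A \<Longrightarrow> h x \<in> carr B"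
    and h_pls: "x \<in> carr A \<Longrightarrow> y \<in> carr A \<Longrightarrow> h (pls A x y) = pls B (h x) (h y)"
    and h_tim: "x \<in> carr A \<Longrightarrow> y \<in> carr A \<Longrightarrow> h (tim A x y) = tim B (h x) (h y)"
    and h_smul: "x \<in> carr A \<Longrightarrow> h (smul A c x) = smul B c (h x)"
    and h_adj: "x \<in> carr A \<Longrightarrow> h (adj A x) = adj B (h x)"
    and h_nrm: "x \<in> carr A \<Longrightarrow> nrm B (h x) \<le> nrm A x"
begin

lemma h_sub: "x \<in> carr A \<Longrightarrow> y \<in> carr A \<Longrightarrow> h (sub A x y) = sub B (h x) (h y)"
  by (simp add: sub_def h_pls h_smul)

lemma h_dist: "x \<in> carr A \<Longrightarrow> y \<in> carr A \<Longrightarrow> nrm B (sub B (h x) (h y)) \<le> nrm A (sub A x y)"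
  using h_nrm[of "sub A x y"] by (simp add: h_sub)

lemma h_cauchy: assumes X: "X \<in> cauchy_seqs A" shows "(\<lambda>n. h (X n)) \<in> cauchy_seqs B"
proof (rule B.cauchyI)
  show "h (X n) \<in> carr B" for n using h_carr A.cauchy_carr[OF X] by blast
  fix e :: real assume "0 < e"
  from A.cauchyD[OF X this] obtain N where "\<forall>m\<ge>N. \<forall>n\<ge>N. nrm A (sub A (X m) (X n)) < e" ..
  then show "\<exists>N. \<forall>m\<ge>N. \<forall>n\<ge>N. nrm B (sub B (h (X m)) (h (X n))) < e"
    using h_dist[OF A.cauchy_carr[OF X] A.cauchy_carr[OF X]] by (meson le_less_trans)
qed

lemma comp_map_class:
  assumes X: "X \<in> cauchy_seqs A"
  shows "comp_map A B h (cauchy_class A X) = cauchy_class B (\<lambda>n. h (X n))"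
proof -
  note R = A.representative_class[OF X]
  have "B.null_diff (\<lambda>n. h (X n)) (\<lambda>n. h (representative (cauchy_class A X) n))"
    by (rule B.null_diffI[OF _ _ _ R(2)[unfolded A.null_diff_def]])
      (simp_all add: h_carr h_dist A.cauchy_carr[OF X] A.cauchy_carr[OF R(1)])
  then show ?thesis unfolding comp_map_def
    using B.class_eq_iff[OF h_cauchy[OF X] h_cauchy[OF R(1)]] by simp
qed

lemma comp_map_carr: "C \<in> carr (completion A) \<Longrightarrow> comp_map A B h C \<in> carr (completion B)"
  by (auto elim!: A.completion_elim simp: comp_map_class B.completion_carr h_cauchy)

lemma comp_map_ops:
  assumes "C \<in> carr (completion A)"
  shows "comp_map A B h (smul (completion A) c C) = smul (completion B) c (comp_map A B h C)"
    "comp_map A B h (adj (completion A) C) = adj (completion B) (comp_map A B h C)"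
    "nrm (completion B) (comp_map A B h C) \<le> nrm (completion A) C"
    "D \<in> carr (completion A) \<Longrightarrow> comp_map A B h (pls (completion A) C D)
      = pls (completion B) (comp_map A B h C) (comp_map A B h D)"
    "D \<in> carr (completion A) \<Longrightarrow> comp_map A B h (tim (completion A) C D)
      = tim (completion B) (comp_map A B h C) (comp_map A B h D)"
proof -
  obtain X where X: "X \<in> cauchy_seqs A" "C = cauchy_class A X" using assms by (rule A.completion_elim)
  note Xc = A.cauchy_carr[OF X(1)] and hX = h_cauchy[OF X(1)]
  show "comp_map A B h (smul (completion A) c C) = smul (completion B) c (comp_map A B h C)"
    using X(1) hX by (simp add: X(2) A.completion_smul comp_map_class A.cauchy_smul B.completion_smul h_smul Xc)
  show "comp_map A B h (adj (completion A) C) = adj (completion B) (comp_map A B h C)"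
    using X(1) hX by (simp add: X(2) A.completion_adj comp_map_class A.cauchy_adj B.completion_adj h_adj Xc)
  show "nrm (completion B) (comp_map A B h C) \<le> nrm (completion A) C"
    unfolding X(2) comp_map_class[OF X(1)]
    by (rule LIMSEQ_le[OF B.completion_nrm[OF hX] A.completion_nrm[OF X(1)]]) (use h_nrm Xc in blast)
  assume "D \<in> carr (completion A)"
  then obtain Y where Y: "Y \<in> cauchy_seqs A" "D = cauchy_class A Y" by (rule A.completion_elim)
  note Yc = A.cauchy_carr[OF Y(1)] and hY = h_cauchy[OF Y(1)]
  show "comp_map A B h (pls (completion A) C D) = pls (completion B) (comp_map A B h C) (comp_map A B h D)"
    using X(1) hX Y(1) hY by (simp add: X(2) Y(2) A.completion_pls comp_map_class A.cauchy_pls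
      B.completion_pls h_pls Xc Yc)
  show "comp_map A B h (tim (completion A) C D) = tim (completion B) (comp_map A B h C) (comp_map A B h D)"
    using X(1) hX Y(1) hY by (simp add: X(2) Y(2) A.completion_tim comp_map_class A.cauchy_tim
      B.completion_tim h_tim Xc Yc)
qed

lemma comp_map_embed: "x \<in> carr A \<Longrightarrow> comp_map A B h (A.embed x) = B.embed (h x)"
  by (simp add: A.embed_def B.embed_def comp_map_class)

end

context cstar_algebra
begin

lemma projection_norm:
  assumes "x \<in> carr A" "tim A x x = x" "adj A x = x" shows "x = zer A \<or> nrm A x = 1"
proof -
  have "(nrm A x)\<^sup>2 = nrm A x" using nrm_cstar[of x] assms by simp
  then have "nrm A x = 0 \<or> nrm A x = 1" by (simp add: power2_eq_square)
  then show ?thesis using nrm_definite assms(1) by blast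
qed

text \<open>For commuting projections x and y, x - x y = x (x - y) is a projection of norm at most
  that of x - y. Below norm 1 it must be 0; so x = x y, and y = y x by symmetry.\<close>

lemma close_commuting_projections:
  assumes a: "a \<in> carr A" "tim A a a = a" "adj A a = a" and b: "b \<in> carr A" "tim A b b = b" "adj A b = b"
    and ab: "tim A a b = tim A b a" and d: "nrm A (sub A a b) < 1"
  shows "a = b"
proof -
  have *: "x = tim A x y"
    if x: "x \<in> carr A" "tim A x x = x" "adj A x = x" and y: "y \<in> carr A" "tim A y y = y" "adj A y = y"
      and xy: "tim A x y = tim A y x" and d: "nrm A (sub A x y) < 1" for x y
  proof -
    have q2: "tim A (tim A x y) (tim A x y) = tim A x y"
    proof -
      have "tim A (tim A x y) (tim A x y) = tim A x (tim A (tim A y x) y)" using x y by (simp add: tim_assoc)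
      also have "\<dots> = tim A (tim A x x) (tim A y y)" using x(1) y(1) by (simp flip: xy add: tim_assoc)
      finally show ?thesis using x y by simp
    qed
    have xq: "tim A x (tim A x y) = tim A x y" using x y by (simp flip: tim_assoc)
    have qx: "tim A (tim A x y) x = tim A x y" using x(1) y(1) xq by (simp add: tim_assoc flip: xy)
    have rc: "sub A x (tim A x y) \<in> carr A" using x y by simp
    have "tim A (sub A x (tim A x y)) (sub A x (tim A x y)) = sub A x (tim A x y)"
      using x y by (simp add: sub_tim tim_sub q2 xq qx sub_self sub_zer)
    moreover have "adj A (sub A x (tim A x y)) = sub A x (tim A x y)"
      using x y by (simp add: adj_sub adj_tim flip: xy)
    moreover have "nrm A (sub A x (tim A x y)) < 1"
    proof -
      have "nrm A x \<le> 1" using projection_norm[OF x] nrm_zer by auto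
      moreover have "sub A x (tim A x y) = tim A x (sub A x y)" using x y by (simp add: tim_sub)
      ultimately have "nrm A (sub A x (tim A x y)) \<le> 1 * nrm A (sub A x y)"
        using nrm_tim[of x "sub A x y"] nrm_nonneg[of "sub A x y"] x y
        by (metis mult_right_mono order_trans sub_closed)
      then show ?thesis using d by simp
    qed
    ultimately have "sub A x (tim A x y) = zer A" using projection_norm[OF rc] by auto
    then show ?thesis using x y by (simp add: sub_eq_zer)
  qed
  have "a = tim A a b" by (rule *[OF a b ab d])
  moreover have "b = tim A b a"
    by (rule *[OF b a ab[symmetric]]) (use d nrm_sub_commute[OF a(1) b(1)] in simp)
  ultimately show ?thesis using ab by simp
qed

text \<open>If P e and e - P e were both nonzero, multiplying P e - c e by these projections of norm
  1 would give |1 - c| < 1/2 and |c| < 1/2, which is impossible.\<close>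

lemma near_scalar_central_proj:
  assumes P: "central_proj A P" and e: "e \<in> carr A" "tim A e e = e" "adj A e = e"
    and d: "nrm A (sub A (P e) (smul A c e)) < 1 / 2"
  shows "P e = zer A \<or> P e = e"
proof (rule ccontr)
  assume n: "\<not> ?thesis"
  let ?x = "P e" and ?y = "sub A e (P e)"
  note D = central_projD[OF P]
  have xc: "?x \<in> carr A" "?y \<in> carr A" using e D(1) by simp_all
  have xe: "tim A ?x e = ?x" "tim A e ?x = ?x" using D(6,7)[OF e(1) e(1)] e(2) by simp_all
  have xx: "tim A ?x ?x = ?x" using central_proj_tim[OF P e(1) e(1)] e(2) by simp
  have xa: "adj A ?x = ?x" using D(3)[OF e(1)] e(3) by simp
  have yy: "tim A ?y ?y = ?y" using e xc by (simp add: sub_tim tim_sub xe xx sub_self sub_zer)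
  have ya: "adj A ?y = ?y" using e xc by (simp add: adj_sub xa)
  have yx: "tim A ?y ?x = zer A" using e xc by (simp add: sub_tim xe xx sub_self)
  have ye: "tim A ?y e = ?y" using e xc by (simp add: sub_tim xe)
  have nx: "nrm A ?x = 1" using projection_norm[OF xc(1) xx xa] n by simp
  have "?y \<noteq> zer A" using n sub_eq_zer[OF e(1) xc(1)] by metis
  then have ny: "nrm A ?y = 1" using projection_norm[OF xc(2) yy ya] by simp
  let ?d = "sub A ?x (smul A c e)"
  have dc: "?d \<in> carr A" using xc e by simp
  have "tim A ?x ?d = smul A (1 - c) ?x"
  proof -
    have "tim A ?x ?d = sub A ?x (smul A c ?x)" using xc e by (simp add: tim_sub tim_smul xe xx)
    also have "\<dots> = smul A (1 - c) ?x"
      using add_smul[OF xc(1), of 1 "- c"] xc smul_smul[OF xc(1), of "-1" c] by (simp add: sub_def smul_one)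
    finally show ?thesis .
  qed
  then have "cmod (1 - c) < 1 / 2" using nrm_tim[OF xc(1) dc] nx nrm_smul[OF xc(1), of "1 - c"] d by simp
  moreover have "cmod c < 1 / 2"
  proof -
    have "tim A ?y ?d = smul A (- c) ?y"
      using xc e smul_smul[OF xc(2), of "-1" c] by (simp add: tim_sub tim_smul yx ye)
        (simp add: sub_def zer_pls)
    then show ?thesis using nrm_tim[OF xc(2) dc] ny nrm_smul[OF xc(2), of "- c"] d by simp
  qed
  moreover have "1 \<le> cmod (1 - c) + cmod c" using norm_triangle_ineq[of "1 - c" c] by simp
  ultimately show False by simp
qed

end

section \<open>The gauge action and the dichotomy on long paths\<close>

subsection \<open>Gauge automorphisms\<close>

context k_graph
begin

text \<open>The action of the i-th coordinate circle only; the averaging below treats one coordinate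
  at a time.\<close>

definition gauge_gen :: "complex \<Rightarrow> 'k \<Rightarrow> 'a \<Rightarrow> 'a falg" where
  "gauge_gen \<zeta> i x = scal (\<zeta> ^ (deg \<Lambda> x $ i)) * gen x"

text \<open>The eigenvalue on the word w. For \<zeta> of modulus 1 it is \<zeta> to the difference
  of the two degrees; the conjugate keeps the exponents natural.\<close>

definition gauge_char :: "complex \<Rightarrow> 'k \<Rightarrow> ('a \<times> bool) list \<Rightarrow> complex" where
  "gauge_char \<zeta> i w = \<zeta> ^ (deg_plus w $ i) * cnj \<zeta> ^ (deg_star w $ i)"

lemma gauge_word: "word_hom (gauge_gen \<zeta> i) w = scal (gauge_char \<zeta> i w) * word_hom gen w"
proof (induction w)
  case Nil show ?case by (simp add: word_hom_def gauge_char_def deg_plus_def deg_star_def)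
next
  case (Cons l w)
  define \<alpha> where "\<alpha> = (if snd l then cnj \<zeta> ^ (deg \<Lambda> (fst l) $ i) else \<zeta> ^ (deg \<Lambda> (fst l) $ i))"
  have l: "letter_hom (gauge_gen \<zeta> i) l = scal \<alpha> * letter_hom gen l"
    by (simp add: letter_hom_def gauge_gen_def free_adj_scal \<alpha>_def)
  have "gauge_char \<zeta> i (l # w) = \<alpha> * gauge_char \<zeta> i w"
    by (simp add: gauge_char_def deg_plus_def deg_star_def \<alpha>_def power_add)
  moreover have "word_hom (gauge_gen \<zeta> i) (l # w) = (scal \<alpha> * letter_hom gen l)
    * (scal (gauge_char \<zeta> i w) * word_hom gen w)"
    using Cons l by (simp add: word_hom_def)
  moreover have "\<dots> = scal \<alpha> * (scal (gauge_char \<zeta> i w) * (letter_hom gen l * word_hom gen w))"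
    by (simp only: mult.assoc mult_scal[of "letter_hom gen l"])
  ultimately show ?case by (simp add: scal_scal word_hom_def)
qed

lemma lookup_gauge: "lookup (free_hom (gauge_gen \<zeta> i) f) w = gauge_char \<zeta> i (letters w) * lookup f w"
proof (induction f rule: falg_induct)
  case (single v c)
  have "free_hom (gauge_gen \<zeta> i) (Poly_Mapping.single v c)
    = Poly_Mapping.single v (gauge_char \<zeta> i (letters v) * c)"
    by (simp add: free_hom_single gauge_word word_hom_gen scal_scal mult_single mult.commute)
  then show ?case by (simp add: lookup_single when_def)
qed (simp add: free_hom_add lookup_add distrib_left)

lemma gauge_carr: "f \<in> fcarr \<Lambda> \<Longrightarrow> free_hom (gauge_gen \<zeta> i) f \<in> fcarr \<Lambda>"
  by (rule fcarr_free_hom) (auto simp: gauge_gen_def)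

text \<open>Every relator is an eigenvector; only the partial isometry and product relators can have
  an eigenvalue other than 1.\<close>

lemma gauge_relator:
  assumes \<zeta>: "cmod \<zeta> = 1" and r: "r \<in> ck_relators \<Lambda>"
  shows "\<exists>c. free_hom (gauge_gen \<zeta> i) r = scal c * r"
proof -
  have u: "cnj \<zeta> ^ n * \<zeta> ^ n = 1" "\<zeta> ^ n * cnj \<zeta> ^ n = 1" for n
    using complex_norm_square[of \<zeta>] \<zeta> by (simp_all add: mult.commute flip: power_mult_distrib)
  have xx: "gauge_gen \<zeta> i x * free_adj (gauge_gen \<zeta> i x) = gen x * free_adj (gen x)"
    and xx': "free_adj (gauge_gen \<zeta> i x) * gauge_gen \<zeta> i x = free_adj (gen x) * gen x" for x
    by (simp_all add: gauge_gen_def free_adj_scal mult.assoc mult_scal[of "gen x"] mult_scal[of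
      "free_adj (gen x)"] scal_scal u)
  have v: "gauge_gen \<zeta> i v = gen v" if "v \<in> verts \<Lambda>" for v using that by (simp add: gauge_gen_def verts_iff)
  note hom = free_hom_diff free_hom_mult free_hom_free_adj free_hom_sum
  show ?thesis
    using r
  proof cases
    case (partial_isometry x)
    then show ?thesis
      by (intro exI[of _ "\<zeta> ^ (deg \<Lambda> x $ i)"])
        (simp add: hom xx, simp add: gauge_gen_def right_diff_distrib mult_scal[of "gen x * free_adj (gen x)"])
  next
    case (vertices a b)
    then show ?thesis by (intro exI[of _ 1]) (auto simp: hom v)
  next
    case (product x y)
    have "gauge_gen \<zeta> i x * gauge_gen \<zeta> i y = scal (\<zeta> ^ (deg \<Lambda> x $ i) * \<zeta> ^ (deg \<Lambda> y $ i)) * (gen x * gen y)"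
      by (simp add: gauge_gen_def mult.assoc mult_scal[of "gen x"] scal_scal)
    then show ?thesis using product
      by (intro exI[of _ "\<zeta> ^ (deg \<Lambda> x $ i) * \<zeta> ^ (deg \<Lambda> y $ i)"])
        (simp add: hom gauge_gen_def[of _ _ "cmp \<Lambda> x y"] deg_cmp power_add right_diff_distrib)
  next
    case (source_projection x)
    then show ?thesis by (intro exI[of _ 1]) (simp add: hom xx' v src_verts)
  next
    case (cuntz_krieger a n)
    then show ?thesis by (intro exI[of _ 1]) (simp add: hom xx v)
  qed
qed

text \<open>The universal property: the seminorm of \<Gamma> composed with such a homomorphism is
  one of the seminorms over which the supremum for \<Lambda> is taken.\<close>

lemma universal_free_hom_le:
  assumes \<Gamma>: "k_graph \<Gamma>" and b: "\<And>x. x \<in> mor \<Lambda> \<Longrightarrow> b x \<in> fcarr \<Gamma>"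
    and r: "\<And>r. r \<in> ck_relators \<Lambda> \<Longrightarrow> universal_seminorm \<Gamma> (free_hom b r) = 0" and f: "f \<in> fcarr \<Lambda>"
  shows "universal_seminorm \<Gamma> (free_hom b f) \<le> universal_seminorm \<Lambda> f"
proof -
  interpret G: ck_family \<Gamma> "universal_seminorm \<Gamma>" by (rule k_graph.ck_family_universal[OF \<Gamma>])
  have "ck_seminorm \<Lambda> (\<lambda>f. universal_seminorm \<Gamma> (free_hom b f))"
    using G.free_hom_seminormed[of \<Lambda> b] b r by (simp add: ck_seminorm_def)
  from universal_upper[OF this f] show ?thesis .
qed

lemma free_star_algebra_seminormed: "cstar_seminormed (free_star_algebra \<Lambda> (universal_seminorm \<Lambda>))"
  using ck_seminorm_universal by (simp add: ck_seminorm_def)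

lemma graph_cstar_algebra: "cstar_algebra (graph_cstar \<Lambda>)"
  unfolding graph_cstar_def by (rule cstar_seminormed.completion_cstar_algebra[OF free_star_algebra_seminormed])

end

locale graph_algebra = lc_kgraph \<Lambda> for \<Lambda> :: "('a, 'k::finite) kgraph"
begin

abbreviation FA where "FA \<equiv> free_star_algebra \<Lambda> (universal_seminorm \<Lambda>)"
abbreviation CA where "CA \<equiv> graph_cstar \<Lambda>"

sublocale U: lc_ck \<Lambda> "universal_seminorm \<Lambda>"
  by (intro lc_ck.intro ck_family_universal) unfold_locales

sublocale F: cstar_seminormed FA by (rule free_star_algebra_seminormed)

sublocale C: cstar_algebra CA by (rule graph_cstar_algebra)

definition \<iota> :: "'a falg \<Rightarrow> (nat \<Rightarrow> 'a falg) set" where "\<iota> f = F.embed f"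

lemma \<iota>_carr [simp]: "f \<in> fcarr \<Lambda> \<Longrightarrow> \<iota> f \<in> carr CA"
  using F.embed_carr[of f] by (simp add: \<iota>_def graph_cstar_def)

lemma \<iota>_ops:
  "f \<in> fcarr \<Lambda> \<Longrightarrow> g \<in> fcarr \<Lambda> \<Longrightarrow> \<iota> (f + g) = pls CA (\<iota> f) (\<iota> g)"
  "f \<in> fcarr \<Lambda> \<Longrightarrow> g \<in> fcarr \<Lambda> \<Longrightarrow> \<iota> (f - g) = sub CA (\<iota> f) (\<iota> g)"
  "f \<in> fcarr \<Lambda> \<Longrightarrow> g \<in> fcarr \<Lambda> \<Longrightarrow> \<iota> (f * g) = tim CA (\<iota> f) (\<iota> g)"
  "f \<in> fcarr \<Lambda> \<Longrightarrow> \<iota> (scal c * f) = smul CA c (\<iota> f)"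
  "f \<in> fcarr \<Lambda> \<Longrightarrow> \<iota> (free_adj f) = adj CA (\<iota> f)"
  "\<iota> 0 = zer CA"
  using F.embed_ops(1-3)[of f g] F.embed_ops(4)[of f c] F.embed_ops(5)[of f] F.embed_ops(6)
  by (simp_all add: \<iota>_def graph_cstar_def)

lemma \<iota>_nrm: "f \<in> fcarr \<Lambda> \<Longrightarrow> nrm CA (\<iota> f) = universal_seminorm \<Lambda> f"
  using F.embed_nrm[of f] by (simp add: \<iota>_def graph_cstar_def)

lemma \<iota>_eq: "U.eqv f g \<Longrightarrow> \<iota> f = \<iota> g"
  using F.embed_eq_iff[of f g] by (simp add: \<iota>_def U.eqv_def)

lemma \<iota>_approx: "C \<in> carr CA \<Longrightarrow> 0 < e \<Longrightarrow> \<exists>f\<in>fcarr \<Lambda>. nrm CA (sub CA C (\<iota> f)) < e"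
  using F.embed_approx[of C e] by (simp add: \<iota>_def graph_cstar_def)

lemma vertex_projection:
  assumes v: "v \<in> verts \<Lambda>"
  shows "\<iota> (gen v) \<in> carr CA" "tim CA (\<iota> (gen v)) (\<iota> (gen v)) = \<iota> (gen v)" "adj CA (\<iota> (gen v)) = \<iota> (gen v)"
    "nrm CA (\<iota> (gen v)) = 1" "\<iota> (gen v) \<noteq> zer CA"
proof -
  have c: "gen v \<in> fcarr \<Lambda>" by (rule U.verts_gen_carr[OF v])
  show "\<iota> (gen v) \<in> carr CA" using c by simp
  show "tim CA (\<iota> (gen v)) (\<iota> (gen v)) = \<iota> (gen v)" using \<iota>_eq[OF U.eqv_idem[OF v]] c by (simp add: \<iota>_ops)
  show "adj CA (\<iota> (gen v)) = \<iota> (gen v)" using \<iota>_eq[OF U.eqv_st_vertex[OF v]] c by (simp add: \<iota>_ops)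
  show n: "nrm CA (\<iota> (gen v)) = 1" using \<iota>_nrm[OF c] universal_vertex[OF v] by simp
  then show "\<iota> (gen v) \<noteq> zer CA" using C.nrm_zer by auto
qed

lemma gauge_contraction:
  assumes \<zeta>: "cmod \<zeta> = 1" shows "contraction FA FA (free_hom (gauge_gen \<zeta> i))"
proof (intro contraction.intro contraction_axioms.intro F.cstar_seminormed_axioms)
  have r0: "universal_seminorm \<Lambda> (free_hom (gauge_gen \<zeta> i) r) = 0" if r: "r \<in> ck_relators \<Lambda>" for r
  proof -
    obtain c where "free_hom (gauge_gen \<zeta> i) r = scal c * r" using gauge_relator[OF \<zeta> r] by blast
    then show ?thesis using U.p_scal[OF relator_carr[OF r]] U.p_relator[OF r] by simp
  qed
  show "nrm FA (free_hom (gauge_gen \<zeta> i) x) \<le> nrm FA x" if "x \<in> carr FA" for x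
    using that universal_free_hom_le[OF k_graph_axioms _ r0] by (simp add: gauge_gen_def fcarr_scal fcarr_gen)
qed (simp_all add: gauge_carr free_hom_add free_hom_mult free_hom_single word_hom_def free_hom_free_adj)

text \<open>A gauge automorphism close to the identity moves the projection \<open>P(s\<^sub>v)\<close> to a commuting
  projection at distance less than one, hence fixes it.\<close>

lemma gauge_fixes:
  assumes P: "central_proj CA P" and v: "v \<in> verts \<Lambda>" and \<zeta>: "cmod \<zeta> = 1" and g: "g \<in> fcarr \<Lambda>"
    and near: "nrm CA (sub CA (P (\<iota> (gen v))) (\<iota> g)) < 1 / 4"
    and move: "universal_seminorm \<Lambda> (free_hom (gauge_gen \<zeta> i) g - g) < 1 / 4"
  shows "comp_map FA FA (free_hom (gauge_gen \<zeta> i)) (P (\<iota> (gen v))) = P (\<iota> (gen v))"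
proof -
  let ?\<gamma> = "free_hom (gauge_gen \<zeta> i)"
  let ?G = "comp_map FA FA ?\<gamma>"
  interpret G: contraction FA FA ?\<gamma> by (rule gauge_contraction[OF \<zeta>])
  note D = central_projD[OF P]
  note E = vertex_projection[OF v]
  let ?e = "\<iota> (gen v)" and ?a = "P (\<iota> (gen v))"
  have vc: "gen v \<in> fcarr \<Lambda>" by (rule U.verts_gen_carr[OF v])
  have gg: "?\<gamma> g \<in> fcarr \<Lambda>" using g by (rule gauge_carr)
  have Gc: "?G x \<in> carr CA" if "x \<in> carr CA" for x using G.comp_map_carr that by (simp add: graph_cstar_def)
  note Go = G.comp_map_ops[folded graph_cstar_def]
  have G\<iota>: "?G (\<iota> f) = \<iota> (?\<gamma> f)" if "f \<in> fcarr \<Lambda>" for f using G.comp_map_embed[of f] that by (simp add: \<iota>_def)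
  have "?\<gamma> (gen v) = gen v" using v by (simp add: gauge_gen_def verts_iff)
  then have Ge: "?G ?e = ?e" using G\<iota>[OF vc] by simp
  have a: "?a \<in> carr CA" "tim CA ?a ?a = ?a" "adj CA ?a = ?a"
    using D(1,3)[OF E(1)] C.central_proj_tim[OF P E(1) E(1)] E(2,3) by simp_all
  have ea: "tim CA ?e ?a = ?a" "tim CA ?a ?e = ?a" using D(6,7)[OF E(1) E(1)] E(2) by simp_all
  let ?b = "?G ?a"
  have b: "?b \<in> carr CA" "tim CA ?b ?b = ?b" "adj CA ?b = ?b"
    using Gc[OF a(1)] Go(5)[OF a(1) a(1)] Go(2)[OF a(1)] a by simp_all
  have eb: "tim CA ?e ?b = ?b" "tim CA ?b ?e = ?b"
    using Go(5)[OF E(1) a(1)] Go(5)[OF a(1) E(1)] ea Ge by simp_all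
  \<comment> \<open>Both products equal P b: e is a unit for b, and P can be moved from the product
    to e on either side.\<close>
  have ab: "tim CA ?a ?b = tim CA ?b ?a"
    using D(6)[OF E(1) b(1)] D(7)[OF b(1) E(1)] eb by simp
  \<comment> \<open>Three errors below 1/4 add up: from P e to g, from g to its image, and from that
    image to b, the automorphism being a contraction.\<close>
  have "nrm CA (sub CA ?a ?b) < 1"
  proof -
    have "nrm CA (sub CA ?b (\<iota> (?\<gamma> g))) \<le> nrm CA (sub CA ?a (\<iota> g))"
    proof -
      have "sub CA ?b (\<iota> (?\<gamma> g)) = ?G (sub CA ?a (\<iota> g))"
        using a(1) g by (simp add: sub_def Go G\<iota>)
      then show ?thesis using Go(3)[of "sub CA ?a (\<iota> g)"] a(1) g by simp
    qed
    moreover have "nrm CA (sub CA (\<iota> (?\<gamma> g)) (\<iota> g)) < 1 / 4"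
      using move \<iota>_nrm[OF fcarr_diff[OF gg g]] g gg by (simp add: \<iota>_ops)
    moreover have "nrm CA (sub CA ?a ?b) \<le> nrm CA (sub CA ?a (\<iota> g))
      + (nrm CA (sub CA (\<iota> g) (\<iota> (?\<gamma> g))) + nrm CA (sub CA (\<iota> (?\<gamma> g)) ?b))"
      using C.nrm_sub_triangle[OF a(1) \<iota>_carr[OF g] b(1)] C.nrm_sub_triangle[OF \<iota>_carr[OF g]
        \<iota>_carr[OF gg] b(1)] by simp
    moreover have "nrm CA (sub CA (\<iota> g) (\<iota> (?\<gamma> g))) = nrm CA (sub CA (\<iota> (?\<gamma> g)) (\<iota> g))"
      "nrm CA (sub CA (\<iota> (?\<gamma> g)) ?b) = nrm CA (sub CA ?b (\<iota> (?\<gamma> g)))"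
      using C.nrm_sub_commute b(1) g gg by simp_all
    ultimately show ?thesis using near by linarith
  qed
  from C.close_commuting_projections[OF a b ab this] show ?thesis by simp
qed

text \<open>g is a finite combination of eigenvectors, and for each of them the eigenvalue tends to
  1.\<close>

lemma gauge_move_small:
  assumes g: "g \<in> fcarr \<Lambda>" and e: "0 < e"
  shows "\<forall>\<^sub>F N in sequentially. universal_seminorm \<Lambda> (free_hom (gauge_gen (cis (2 * pi / real N)) i) g - g) < e"
proof -
  let ?\<zeta> = "\<lambda>N. cis (2 * pi / real N)"
  let ?s = "\<lambda>N. \<Sum>w\<in>keys g. cmod (lookup g w) * cmod (gauge_char (?\<zeta> N) i (letters w) - 1)"
  have "(\<lambda>N. 2 * pi / real N) \<longlonglongrightarrow> 0" by real_asymp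
  then have "(\<lambda>N. ?\<zeta> N) \<longlonglongrightarrow> cis 0"
    unfolding cis_conv_exp by (intro tendsto_intros tendsto_of_real)
  then have z: "(\<lambda>N. ?\<zeta> N) \<longlonglongrightarrow> 1" by simp
  have "?s \<longlonglongrightarrow> (\<Sum>w\<in>keys g. cmod (lookup g w) * cmod (1 ^ (deg_plus (letters w) $ i)
    * cnj 1 ^ (deg_star (letters w) $ i) - 1))"
    unfolding gauge_char_def by (intro tendsto_intros z)
  then have "?s \<longlonglongrightarrow> 0" by simp
  then have "\<forall>\<^sub>F N in sequentially. ?s N < e" using e by (rule order_tendstoD)
  then show ?thesis
  proof (rule eventually_mono)
    fix N assume N: "?s N < e"
    let ?\<gamma> = "free_hom (gauge_gen (?\<zeta> N) i)"
    have w: "letters w \<noteq> []" "fst ` set (letters w) \<subseteq> mor \<Lambda>" if "w \<in> keys g" for w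
      using that g by (auto simp: fcarr_def star_word_eq_iff)
    have "?\<gamma> g - g = (\<Sum>w\<in>keys g. scal (lookup g w * (gauge_char (?\<zeta> N) i (letters w) - 1))
      * word_hom gen (letters w))"
    proof (rule poly_mapping_eqI)
      fix u
      have "lookup (\<Sum>w\<in>keys g. scal (lookup g w * (gauge_char (?\<zeta> N) i (letters w) - 1))
        * word_hom gen (letters w)) u
        = (\<Sum>w\<in>keys g. if w = u then lookup g w * (gauge_char (?\<zeta> N) i (letters w) - 1) else 0)"
        by (simp add: lookup_sum word_hom_gen mult_single lookup_single when_def)
      also have "\<dots> = lookup g u * (gauge_char (?\<zeta> N) i (letters u) - 1)" by (simp add: in_keys_iff)
      finally show "lookup (?\<gamma> g - g) u = lookup (\<Sum>w\<in>keys g. scal (lookup g w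
        * (gauge_char (?\<zeta> N) i (letters w) - 1)) * word_hom gen (letters w)) u"
        by (simp add: lookup_minus lookup_gauge algebra_simps)
    qed
    moreover have "scal c * word_hom gen (letters w) \<in> fcarr \<Lambda>" if "w \<in> keys g" for c w
      using w[OF that] by (intro fcarr_scal fcarr_word_hom fcarr_gen) auto
    ultimately have "universal_seminorm \<Lambda> (?\<gamma> g - g) \<le> (\<Sum>w\<in>keys g. universal_seminorm \<Lambda> (scal
      (lookup g w * (gauge_char (?\<zeta> N) i (letters w) - 1)) * word_hom gen (letters w)))"
      by (simp only: U.p_sum)
    also have "\<dots> \<le> ?s N"
    proof (rule sum_mono)
      fix v assume v: "v \<in> keys g"
      have c: "word_hom gen (letters v) \<in> fcarr \<Lambda>" using w[OF v] by (intro fcarr_word_hom) auto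
      show "universal_seminorm \<Lambda> (scal (lookup g v * (gauge_char (?\<zeta> N) i (letters v) - 1))
        * word_hom gen (letters v))
        \<le> cmod (lookup g v) * cmod (gauge_char (?\<zeta> N) i (letters v) - 1)"
        unfolding U.p_scal[OF c] norm_mult using U.p_word_le_1[OF w[OF v]] by (intro mult_left_le) auto
    qed
    finally show "universal_seminorm \<Lambda> (?\<gamma> g - g) < e" using N by simp
  qed
qed

text \<open>A geometric sum over an N-th root of unity; distinct exponents a, b < N keep that root
  from being 1.\<close>

lemma cis_power_sum:
  assumes N: "0 < N" and ab: "a \<noteq> b" "a < N" "b < N"
  shows "(\<Sum>j<N. (cis (2 * pi / real N) ^ a * cnj (cis (2 * pi / real N)) ^ b) ^ j) = 0"
proof -
  let ?\<zeta> = "cis (2 * pi / real N)"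
  let ?z = "?\<zeta> ^ a * cnj ?\<zeta> ^ b"
  have z: "?z = cis (2 * pi * (real a - real b) / real N)"
    by (simp only: cis_cnj Complex.DeMoivre cis_mult) (simp add: diff_divide_distrib right_diff_distrib mult_ac)
  have zN: "?z ^ N = 1"
  proof -
    have "?z ^ N = cis (2 * pi * of_int (int a - int b))"
      unfolding z using N by (simp add: Complex.DeMoivre)
    then show ?thesis by (simp only: cis_multiple_2pi[of "of_int (int a - int b)"] Ints_of_int)
  qed
  have "?z \<noteq> 1"
  proof
    assume "?z = 1"
    then have "cos (2 * pi * (real a - real b) / real N) = 1" unfolding z by (simp add: complex_eq_iff)
    then obtain k :: int where k: "2 * pi * (real a - real b) / real N = of_int k * 2 * pi"
      using cos_one_2pi_int by blast
    then have "(2 * pi) * (real a - real b) = (2 * pi) * (of_int k * real N)" using N by (simp add: field_simps)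
    then have "real a - real b = of_int k * real N" by (subst (asm) mult_left_cancel) simp_all
    then have eq: "int a - int b = k * int N" by (metis of_int_diff of_int_eq_iff of_int_mult of_int_of_nat_eq)
    then have "k \<noteq> 0" using ab by auto
    then have "int N \<le> \<bar>k * int N\<bar>" using N by (simp add: abs_mult)
    then show False using eq ab by linarith
  qed
  then show ?thesis using geometric_sum[of ?z N] zN by simp
qed

text \<open>Averaging g over the N-th roots of unity removes all words of nonzero i-th degree. The
  distance to P s_v does not grow, because P s_v is fixed by a generator of this group. No new words
  arise, so coordinates treated earlier are not spoiled.\<close>

lemma approx_degree_zero_step:
  assumes P: "central_proj CA P" and v: "v \<in> verts \<Lambda>" and g: "g \<in> fcarr \<Lambda>"
    and near: "nrm CA (sub CA (P (\<iota> (gen v))) (\<iota> g)) < 1 / 4"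
  shows "\<exists>g'\<in>fcarr \<Lambda>. nrm CA (sub CA (P (\<iota> (gen v))) (\<iota> g')) < 1 / 4 \<and> keys g' \<subseteq> keys g \<and>
    (\<forall>w\<in>keys g'. deg_plus (letters w) $ i = deg_star (letters w) $ i)"
proof -
  let ?a = "P (\<iota> (gen v))"
  have ac: "?a \<in> carr CA" using central_projD(1)[OF P vertex_projection(1)[OF v]] .
  \<comment> \<open>N has to exceed the i-th degrees of all words of g for the geometric sums to
    vanish; it is also taken so large that the first root of unity moves g by less than 1/4.\<close>
  let ?B = "Suc (\<Sum>w\<in>keys g. deg_plus (letters w) $ i + deg_star (letters w) $ i)"
  have "\<forall>\<^sub>F N in sequentially. universal_seminorm \<Lambda> (free_hom (gauge_gen (cis (2
    * pi / real N)) i) g - g) < 1 / 4 \<and> ?B \<le> N"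
    by (intro eventually_conj gauge_move_small g eventually_ge_at_top) simp
  then obtain N where N: "universal_seminorm \<Lambda> (free_hom (gauge_gen (cis (2
    * pi / real N)) i) g - g) < 1 / 4" "?B \<le> N"
    by (auto simp: eventually_sequentially)
  let ?\<zeta> = "cis (2 * pi / real N)"
  let ?\<gamma> = "free_hom (gauge_gen ?\<zeta> i)"
  have \<zeta>: "cmod ?\<zeta> = 1" by simp
  interpret G: contraction FA FA ?\<gamma> by (rule gauge_contraction[OF \<zeta>])
  have gfix: "comp_map FA FA ?\<gamma> ?a = ?a" by (rule gauge_fixes[OF P v \<zeta> g near N(1)])
  have fc: "(?\<gamma> ^^ j) g \<in> fcarr \<Lambda>" for j by (induction j) (simp_all add: g gauge_carr)
  have dist: "nrm CA (sub CA ?a (\<iota> ((?\<gamma> ^^ j) g))) \<le> nrm CA (sub CA ?a (\<iota> g))" for j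
  proof (induction j)
    case (Suc j)
    have G\<iota>: "comp_map FA FA ?\<gamma> (\<iota> ((?\<gamma> ^^ j) g)) = \<iota> (?\<gamma> ((?\<gamma> ^^ j) g))"
      using G.comp_map_embed[of "(?\<gamma> ^^ j) g"] fc by (simp add: \<iota>_def)
    have "sub CA ?a (\<iota> (?\<gamma> ((?\<gamma> ^^ j) g))) = comp_map FA FA ?\<gamma> (sub CA ?a (\<iota> ((?\<gamma> ^^ j) g)))"
      using ac fc by (simp add: sub_def G.comp_map_ops[folded graph_cstar_def] gfix G\<iota>)
    then have "nrm CA (sub CA ?a (\<iota> ((?\<gamma> ^^ Suc j) g))) \<le> nrm CA (sub CA ?a (\<iota> ((?\<gamma> ^^ j) g)))"
      using G.comp_map_ops(3)[folded graph_cstar_def, of "sub CA ?a (\<iota> ((?\<gamma> ^^ j) g))"] ac fc by simp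
    then show ?case using Suc by simp
  qed simp
  let ?S = "\<lambda>n. \<Sum>j<n. (?\<gamma> ^^ j) g"
  have Sc: "?S n \<in> fcarr \<Lambda>" for n using fc by (intro fcarr_sum) auto
  have sum: "nrm CA (sub CA (smul CA (of_nat n) ?a) (\<iota> (?S n))) \<le> of_nat n * nrm CA (sub CA ?a (\<iota> g))" for n
  proof (induction n)
    case 0
    then show ?case using ac by (simp add: C.smul_zero \<iota>_ops C.sub_self C.nrm_zer)
  next
    case (Suc n)
    have "smul CA (of_nat (Suc n)) ?a = pls CA (smul CA (of_nat n) ?a) ?a"
      using C.add_smul[OF ac, of "of_nat n" 1] ac by (simp add: C.smul_one add.commute)
    moreover have "\<iota> (?S (Suc n)) = pls CA (\<iota> (?S n)) (\<iota> ((?\<gamma> ^^ n) g))" using Sc fc by (simp add: \<iota>_ops)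
    ultimately have "nrm CA (sub CA (smul CA (of_nat (Suc n)) ?a) (\<iota> (?S (Suc n))))
        \<le> nrm CA (sub CA (smul CA (of_nat n) ?a) (\<iota> (?S n))) + nrm CA (sub CA ?a (\<iota> ((?\<gamma> ^^ n) g)))"
      using C.nrm_sub_pls[of "smul CA (of_nat n) ?a" ?a "\<iota> (?S n)" "\<iota> ((?\<gamma> ^^ n) g)"] ac Sc fc by simp
    then show ?case using Suc dist[of n] by (simp add: algebra_simps)
  qed
  have N0: "0 < N" using N(2) by simp
  define g' where "g' = scal (1 / of_nat N) * ?S N"
  have g'c: "g' \<in> fcarr \<Lambda>" unfolding g'_def using Sc by (rule fcarr_scal)
  have "sub CA ?a (\<iota> g') = smul CA (1 / of_nat N) (sub CA (smul CA (of_nat N) ?a) (\<iota> (?S N)))"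
    using ac Sc N0 by (simp add: g'_def \<iota>_ops C.smul_sub C.smul_smul C.smul_one)
  then have "nrm CA (sub CA ?a (\<iota> g')) = (1 / real N) * nrm CA (sub CA (smul CA (of_nat N) ?a) (\<iota> (?S N)))"
    using ac Sc by (simp add: C.nrm_smul norm_divide)
  also have "\<dots> \<le> (1 / real N) * (real N * nrm CA (sub CA ?a (\<iota> g)))"
    using sum[of N] by (intro mult_left_mono) auto
  also have "\<dots> < 1 / 4" using N0 near by simp
  finally have near': "nrm CA (sub CA ?a (\<iota> g')) < 1 / 4" .
  have lookup_pow: "lookup ((?\<gamma> ^^ j) g) w = gauge_char ?\<zeta> i (letters w) ^ j * lookup g w" for j w
    by (induction j) (simp_all add: lookup_gauge)
  have lookup_S: "lookup (?S n) w = (\<Sum>j<n. gauge_char ?\<zeta> i (letters w) ^ j) * lookup g w" for w n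
    by (simp add: lookup_sum lookup_pow sum_distrib_right)
  have lookup_scal: "lookup (scal c * f) w = c * lookup f w" for c and f :: "'a falg" and w
    by (induction f rule: falg_induct) (auto simp: mult_single lookup_single when_def distrib_left lookup_add)
  have lookup_g': "lookup g' w = 1 / of_nat N * ((\<Sum>j<N. gauge_char ?\<zeta> i (letters w) ^ j) * lookup g w)" for w
    by (simp only: g'_def lookup_scal lookup_S)
  have keys: "keys g' \<subseteq> keys g" by (auto simp: in_keys_iff lookup_g')
  have "deg_plus (letters w) $ i = deg_star (letters w) $ i" if w: "w \<in> keys g'" for w
  proof (rule ccontr)
    assume ne: "deg_plus (letters w) $ i \<noteq> deg_star (letters w) $ i"
    have "w \<in> keys g" using w keys by blast
    then have "deg_plus (letters w) $ i + deg_star (letters w) $ i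
      \<le> (\<Sum>w\<in>keys g. deg_plus (letters w) $ i + deg_star (letters w) $ i)"
      by (intro member_le_sum) auto
    then have "(\<Sum>j<N. gauge_char ?\<zeta> i (letters w) ^ j) = 0"
      unfolding gauge_char_def using N(2) N0 ne by (intro cis_power_sum) auto
    then have "lookup g' w = 0" by (simp add: lookup_g')
    then show False using w by (simp add: in_keys_iff)
  qed
  then show ?thesis using g'c near' keys by blast
qed

lemma approx_degree_zero:
  assumes P: "central_proj CA P" and v: "v \<in> verts \<Lambda>"
  shows "\<exists>g\<in>fcarr \<Lambda>. nrm CA (sub CA (P (\<iota> (gen v))) (\<iota> g)) < 1 / 4 \<and> U.homogeneous g"
proof -
  have "\<exists>g\<in>fcarr \<Lambda>. nrm CA (sub CA (P (\<iota> (gen v))) (\<iota> g)) < 1 / 4 \<and>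
      (\<forall>w\<in>keys g. \<forall>i\<in>S. deg_plus (letters w) $ i = deg_star (letters w) $ i)" for S :: "'k set"
    using finite[of S]
  proof (induction S rule: finite_induct)
    case empty
    show ?case using \<iota>_approx[OF central_projD(1)[OF P vertex_projection(1)[OF v]], of "1 / 4"] by simp
  next
    case (insert i S)
    then obtain g where g: "g \<in> fcarr \<Lambda>" "nrm CA (sub CA (P (\<iota> (gen v))) (\<iota> g)) < 1 / 4"
      "\<forall>w\<in>keys g. \<forall>i\<in>S. deg_plus (letters w) $ i = deg_star (letters w) $ i" by blast
    from approx_degree_zero_step[OF P v g(1,2), of i] g(3) show ?case by blast
  qed
  from this[of UNIV] show ?thesis by (auto simp: U.homogeneous_def vec_eq_iff)
qed

text \<open>For w = s(m), P s_w is the compression of P s_v by s_m. It is within 1/4 of the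
  compression of g, a multiple of s_w, and being a projection below s_w it is then 0 or s_w.\<close>

lemma central_proj_dichotomy:
  assumes P: "central_proj CA P" and v: "v \<in> verts \<Lambda>"
  shows "\<exists>N. \<forall>m\<in>le_paths v N. P (\<iota> (gen (src \<Lambda> m))) = zer CA \<or> P (\<iota> (gen (src \<Lambda> m))) = \<iota> (gen (src \<Lambda> m))"
proof -
  obtain g where g: "g \<in> fcarr \<Lambda>" "nrm CA (sub CA (P (\<iota> (gen v))) (\<iota> g)) < 1 / 4" "U.homogeneous g"
    using approx_degree_zero[OF P v] by blast
  obtain N where N: "\<forall>m\<in>paths_le \<Lambda> N. \<exists>c. U.eqv (U.st m * (g * gen m)) (scal c * gen (src \<Lambda> m))"
    using U.compress_homogeneous[OF g(1,3)] by blast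
  show ?thesis
  proof (intro exI ballI)
    fix m assume m: "m \<in> le_paths v N"
    then have ml: "m \<in> paths_le \<Lambda> N" and mm: "m \<in> mor \<Lambda>" "rng \<Lambda> m = v" using le_paths_mor[OF m]
      by (auto simp: le_paths_iff)
    let ?w = "src \<Lambda> m" and ?a = "P (\<iota> (gen v))" and ?s = "\<iota> (gen m)"
    have w: "?w \<in> verts \<Lambda>" using mm(1) by (rule src_verts)
    have mc: "gen m \<in> fcarr \<Lambda>" "U.st m \<in> fcarr \<Lambda>" "gen v \<in> fcarr \<Lambda>" "gen ?w \<in> fcarr \<Lambda>"
      using mm(1) U.verts_gen_carr v w by auto
    obtain c where c: "U.eqv (U.st m * (g * gen m)) (scal c * gen ?w)" using N ml by blast
    note D = central_projD[OF P]
    have ac: "?a \<in> carr CA" using mc D(1) by simp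
    have sc: "?s \<in> carr CA" "adj CA ?s \<in> carr CA" "\<iota> g \<in> carr CA" using mc g by simp_all
    have "P (\<iota> (gen ?w)) = tim CA (adj CA ?s) (tim CA ?a ?s)"
    proof -
      have vs: "tim CA (\<iota> (gen v)) ?s = ?s" using \<iota>_eq[OF U.eqv_rng[OF mm(1)]] mm mc by (simp add: \<iota>_ops)
      have "\<iota> (gen ?w) = tim CA (adj CA ?s) ?s" using \<iota>_eq[OF U.eqv_source[OF mm(1)]] mc by (simp add: \<iota>_ops)
      then have "P (\<iota> (gen ?w)) = tim CA (adj CA ?s) (P ?s)" using D(7)[OF sc(2,1)] by simp
      also have "P ?s = tim CA ?a ?s" using D(6)[OF \<iota>_carr[OF mc(3)] sc(1)] vs by simp
      finally show ?thesis .
    qed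
    moreover have "smul CA c (\<iota> (gen ?w)) = tim CA (adj CA ?s) (tim CA (\<iota> g) ?s)"
      using \<iota>_eq[OF c] mc g(1) by (simp add: \<iota>_ops fcarr_mult)
    ultimately have "sub CA (P (\<iota> (gen ?w))) (smul CA c (\<iota> (gen ?w)))
      = tim CA (adj CA ?s) (tim CA (sub CA ?a (\<iota> g)) ?s)"
      using ac sc by (simp add: C.sub_tim C.tim_sub)
    then have "nrm CA (sub CA (P (\<iota> (gen ?w))) (smul CA c (\<iota> (gen ?w))))
      = nrm CA (tim CA (adj CA ?s) (tim CA (sub CA ?a (\<iota> g)) ?s))"
      by simp
    also have "\<dots> \<le> nrm CA (adj CA ?s) * nrm CA (tim CA (sub CA ?a (\<iota> g)) ?s)"
      using ac sc by (intro C.nrm_tim) simp_all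
    also have "\<dots> \<le> nrm CA (adj CA ?s) * (nrm CA (sub CA ?a (\<iota> g)) * nrm CA ?s)"
      using ac sc by (intro mult_left_mono C.nrm_tim C.nrm_nonneg) simp_all
    also have "\<dots> \<le> 1 * (nrm CA (sub CA ?a (\<iota> g)) * 1)"
    proof -
      have "nrm CA ?s \<le> 1" using U.p_gen_le_1[OF mm(1)] \<iota>_nrm[OF mc(1)] by simp
      then show ?thesis using C.nrm_adj[OF sc(1)] C.nrm_nonneg sc ac by (intro mult_mono) auto
    qed
    also have "\<dots> < 1 / 2" using g(2) by simp
    finally show "P (\<iota> (gen ?w)) = zer CA \<or> P (\<iota> (gen ?w)) = \<iota> (gen ?w)"
      using C.near_scalar_central_proj[OF P vertex_projection(1-3)[OF w]] by blast
  qed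
qed

end


section \<open>Quotient graphs and splitting along hereditary sets\<close>

subsection \<open>Direct sum decompositions of completions\<close>

text \<open>The lower bound makes the map injective on the completion. For surjectivity, tuples lift
  exactly up to null elements, so a tuple of Cauchy sequences is lifted term by term, and the lower
  bound makes the lift a Cauchy sequence.\<close>

lemma completion_direct_sum:
  fixes A :: "'x star_alg" and B :: "nat \<Rightarrow> 'y star_alg" and h :: "nat \<Rightarrow> 'x \<Rightarrow> 'y"
  assumes A: "cstar_seminormed A" and h: "\<And>i. i < n \<Longrightarrow> contraction A (B i) (h i)"
    and lower: "\<And>x. x \<in> carr A \<Longrightarrow> nrm A x \<le> (\<Sum>i<n. nrm (B i) (h i x))"
    and dense: "\<And>f. (\<And>i. i < n \<Longrightarrow> f i \<in> carr (B i)) \<Longrightarrow>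
      \<exists>x\<in>carr A. \<forall>i<n. nrm (B i) (sub (B i) (h i x) (f i)) = 0"
  shows "star_iso (\<lambda>C. \<lambda>i\<in>{..<n}. comp_map A (B i) (h i) C) (completion A) (direct_sum {..<n} (\<lambda>i.
    completion (B i)))"
proof (rule star_isoI)
  interpret A: cstar_seminormed A by (rule A)
  have B: "cstar_seminormed (B i)" if "i < n" for i using h[OF that] by (simp add: contraction_def)
  let ?\<phi> = "\<lambda>C. \<lambda>i\<in>{..<n}. comp_map A (B i) (h i) C"
  note cm = contraction.comp_map_carr[OF h] contraction.comp_map_ops[OF h] contraction.comp_map_class[OF h]
  show "bij_betw ?\<phi> (carr (completion A)) (carr (direct_sum {..<n} (\<lambda>i. completion (B i))))"
  proof (rule bij_betwI')
    fix C D assume "C \<in> carr (completion A)" "D \<in> carr (completion A)"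
    then obtain X Y where X: "X \<in> cauchy_seqs A" "C = cauchy_class A X" and Y: "Y \<in> cauchy_seqs A"
      "D = cauchy_class A Y"
      by (auto simp: A.completion_carr)
    have "C = D" if eq: "?\<phi> C = ?\<phi> D"
    proof -
      have lim: "(\<lambda>m. nrm (B i) (h i (sub A (X m) (Y m)))) \<longlonglongrightarrow> 0" if i: "i < n" for i
      proof -
        interpret contraction A "B i" "h i" by (rule h[OF i])
        have "comp_map A (B i) (h i) C = comp_map A (B i) (h i) D" using fun_cong[OF eq, of i] i by simp
        then have "B.null_diff (\<lambda>m. h i (X m)) (\<lambda>m. h i (Y m))"
          using B.class_eq_iff[OF h_cauchy[OF X(1)] h_cauchy[OF Y(1)]] X Y by (simp add: comp_map_class)
        then show ?thesis unfolding B.null_diff_def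
          by (simp add: h_sub A.cauchy_carr[OF X(1)] A.cauchy_carr[OF Y(1)])
      qed
      have "A.null_diff X Y"
      proof (rule A.null_diffI[OF A.cauchy_carr[OF X(1)] A.cauchy_carr[OF Y(1)]])
        show "nrm A (sub A (X m) (Y m)) \<le> (\<Sum>i<n. nrm (B i) (h i (sub A (X m) (Y m))))" for m
          using lower A.cauchy_carr[OF X(1)] A.cauchy_carr[OF Y(1)] by simp
        have "(\<lambda>m. \<Sum>i<n. nrm (B i) (h i (sub A (X m) (Y m)))) \<longlonglongrightarrow> (\<Sum>i<n. 0)"
          by (intro tendsto_sum lim) simp
        then show "(\<lambda>m. \<Sum>i<n. nrm (B i) (h i (sub A (X m) (Y m)))) \<longlonglongrightarrow> 0" by simp
      qed
      then show ?thesis using A.class_eq_iff X Y by simp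
    qed
    then show "?\<phi> C = ?\<phi> D \<longleftrightarrow> C = D" by blast
  next
    fix C assume "C \<in> carr (completion A)"
    then show "?\<phi> C \<in> carr (direct_sum {..<n} (\<lambda>i. completion (B i)))" by (auto simp: cm)
  next
    fix F assume F: "F \<in> carr (direct_sum {..<n} (\<lambda>i. completion (B i)))"
    have "\<exists>X. X \<in> cauchy_seqs (B i) \<and> F i = cauchy_class (B i) X" if i: "i < n" for i
    proof -
      interpret B: cstar_seminormed "B i" by (rule B[OF i])
      have "F i \<in> carr (completion (B i))" using F i by (auto simp: PiE_iff)
      then show ?thesis by (auto simp: B.completion_carr)
    qed
    then obtain X where X: "\<And>i. i < n \<Longrightarrow> X i \<in> cauchy_seqs (B i)" "\<And>i. i < n \<Longrightarrow> F i
      = cauchy_class (B i) (X i)" by metis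
    have Xc: "X i m \<in> carr (B i)" if "i < n" for i m using X(1)[OF that] by (simp add: cauchy_seqs_def)
    have "\<forall>m. \<exists>x\<in>carr A. \<forall>i<n. nrm (B i) (sub (B i) (h i x) (X i m)) = 0" using dense[of "\<lambda>i. X i _"] Xc by simp
    then obtain g where g: "\<And>m. g m \<in> carr A" "\<And>m i. i < n
      \<Longrightarrow> nrm (B i) (sub (B i) (h i (g m)) (X i m)) = 0" by metis
    have gX: "nrm (B i) (h i (sub A (g m) (g l))) \<le> nrm (B i) (sub (B i) (X i m) (X i l))"
      if i: "i < n" for i m l
    proof -
      interpret contraction A "B i" "h i" by (rule h[OF i])
      have c: "h i (g m) \<in> carr (B i)" "h i (g l) \<in> carr (B i)" using g h_carr by auto
      have "nrm (B i) (sub (B i) (h i (g m)) (h i (g l))) \<le> nrm (B i) (sub (B i) (h i (g m)) (X i m)) +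
         (nrm (B i) (sub (B i) (X i m) (X i l)) + nrm (B i) (sub (B i) (X i l) (h i (g l))))"
        using B.nrm_sub_triangle[OF c(1) Xc[OF i, of m] c(2)] B.nrm_sub_triangle[OF Xc[OF i, of m]
          Xc[OF i, of l] c(2)] by simp
      then show ?thesis using g(2)[OF i] B.nrm_sub_commute[OF Xc[OF i, of l] c(2)] by (simp add: h_sub g(1))
    qed
    have gC: "g \<in> cauchy_seqs A"
    proof (rule A.cauchyI[OF g(1)])
      fix e :: real assume e: "0 < e"
      \<comment> \<open>Dividing by n + 1 keeps the final inequality strict and covers n =
        0.\<close>
      let ?e = "e / (real n + 1)"
      have e': "0 < ?e" using e by simp
      have "\<exists>N. \<forall>m\<ge>N. \<forall>l\<ge>N. nrm (B i) (sub (B i) (X i m) (X i l)) < ?e" if "i < n" for i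
        using X(1)[OF that] e' by (simp add: cauchy_seqs_def)
      then obtain N where N: "\<And>i m l. i < n \<Longrightarrow> m \<ge> N i \<Longrightarrow> l \<ge> N i
        \<Longrightarrow> nrm (B i) (sub (B i) (X i m) (X i l)) < ?e" by metis
      have "nrm A (sub A (g m) (g l)) < e" if ml: "m \<ge> (\<Sum>i<n. N i)" "l \<ge> (\<Sum>i<n. N i)" for m l
      proof -
        have Ni: "N i \<le> (\<Sum>i<n. N i)" if "i < n" for i using that by (intro member_le_sum) auto
        have "nrm A (sub A (g m) (g l)) \<le> (\<Sum>i<n. nrm (B i) (h i (sub A (g m) (g l))))" using lower g(1) by simp
        also have "\<dots> \<le> (\<Sum>i<n. ?e)"
        proof (rule sum_mono)
          fix i assume "i \<in> {..<n}"
          then have i: "i < n" by simp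
          show "nrm (B i) (h i (sub A (g m) (g l))) \<le> ?e"
            using gX[OF i, of m l] N[OF i, of m l] Ni[OF i] ml by linarith
        qed
        also have "\<dots> < e" using e by (simp add: field_simps)
        finally show ?thesis .
      qed
      then show "\<exists>N. \<forall>m\<ge>N. \<forall>l\<ge>N. nrm A (sub A (g m) (g l)) < e" by blast
    qed
    have "comp_map A (B i) (h i) (cauchy_class A g) = F i" if i: "i < n" for i
    proof -
      interpret contraction A "B i" "h i" by (rule h[OF i])
      have "B.null_diff (\<lambda>m. h i (g m)) (X i)" using g(2)[OF i] by (simp add: B.null_diff_def)
      then show ?thesis using B.class_eq_iff[OF h_cauchy[OF gC] X(1)[OF i]] X(2)[OF i]
        by (simp add: comp_map_class gC)
    qed
    moreover have "F i = undefined" if "\<not> i < n" for i using F that by (auto simp: PiE_iff extensional_def)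
    ultimately have "F = ?\<phi> (cauchy_class A g)" by (auto simp: fun_eq_iff)
    then show "\<exists>C\<in>carr (completion A). F = ?\<phi> C" using gC by (auto simp: A.completion_carr)
  qed
qed (auto simp: contraction.comp_map_ops[OF h] restrict_def fun_eq_iff)

subsection \<open>Homomorphisms modulo a seminorm\<close>

lemma (in falg_seminorm) eqv_free_hom:
  assumes f: "f \<in> fcarr \<Gamma>" and ab: "\<And>x. x \<in> mor \<Gamma> \<Longrightarrow> a x \<simeq> b x"
  shows "free_hom a f \<simeq> free_hom b f"
  using f
proof (induction rule: fcarr_induct)
  case zero
  show ?case by auto
next
  case (word w c)
  have l: "letter_hom a l \<simeq> letter_hom b l" if "fst l \<in> mor \<Gamma>" for l
    using ab[OF that] eqv_free_adj by (auto simp: letter_hom_def)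
  have "word_hom a w \<simeq> word_hom b w"
    using word
  proof (induction w)
    case (Cons l w)
    then show ?case using l[of l] eqv_mult by (cases "w = []") (auto simp: word_hom_def)
  qed simp
  then show ?case by (simp add: free_hom_scal free_hom_word_hom eqv_scal)
next
  case (add f g)
  then show ?case by (simp add: free_hom_add eqv_add)
qed

text \<open>The carrier excludes the empty word, so each word contains a generator that is sent to
  0.\<close>

lemma free_hom_zero_gens: "f \<in> fcarr \<Lambda> \<Longrightarrow> free_hom (\<lambda>_. 0 :: 'b falg) f = 0"
proof (induction rule: fcarr_induct)
  case (word w c)
  then obtain l u where "w = l # u" by (cases w) auto
  then have "word_hom (\<lambda>_. 0) w = (0 :: 'b falg)" by (cases u) (simp_all add: word_hom_def letter_hom_def)
  then show ?case by (simp add: free_hom_scal free_hom_word_hom)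
qed (simp_all add: free_hom_add)

subsection \<open>Graph algebras of quotient graphs\<close>

definition quotient_gen :: "('a, 'k::finite) kgraph \<Rightarrow> 'a set \<Rightarrow> 'a \<Rightarrow> 'a falg" where
  "quotient_gen \<Lambda> K x = (if src \<Lambda> x \<in> K then 0 else gen x)"

lemma fcarr_quotient_graph_mono: "f \<in> fcarr (quotient_graph \<Lambda> K) \<Longrightarrow> f \<in> fcarr \<Lambda>"
  by (fastforce simp: fcarr_def)

context lc_kgraph
begin

context
  fixes K assumes K: "K \<in> sat_her \<Lambda>"
begin

lemma fcarr_quotient_gen: "x \<in> mor \<Lambda> \<Longrightarrow> quotient_gen \<Lambda> K x \<in> fcarr (quotient_graph \<Lambda> K)"
  by (auto simp: quotient_gen_def intro!: fcarr_gen)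

lemma quotient_le_paths:
  "from_vertex \<Lambda> v (paths_le (quotient_graph \<Lambda> K) n) = {x \<in> le_paths v n. src \<Lambda> x \<notin> K}"
  unfolding quotient_paths_le[OF K] by (auto simp: from_vertex_def dest: paths_le_mor)

lemma quotient_relator:
  assumes "r \<in> ck_relators \<Lambda>"
  shows "free_hom (quotient_gen \<Lambda> K) r \<in> insert 0 (ck_relators (quotient_graph \<Lambda> K))"
proof -
  let ?\<Gamma> = "quotient_graph \<Lambda> K"
  note hom = free_hom_diff free_hom_mult free_hom_free_adj free_hom_sum
  note V = quotient_verts[OF K]
  show ?thesis
    using assms
  proof cases
    case (partial_isometry x)
    then show ?thesis
      using ck_relators.partial_isometry[of x ?\<Gamma>] by (auto simp: hom quotient_gen_def)
  next
    case (vertices v w)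
    then show ?thesis
      using ck_relators.vertices[of v ?\<Gamma> w] by (auto simp: hom quotient_gen_def V)
  next
    case (product x y)
    have "src \<Lambda> (cmp \<Lambda> x y) = src \<Lambda> y" using product by (simp add: src_cmp)
    \<comment> \<open>If y survives then so does x, because s(x) = r(y) and K is hereditary.\<close>
    moreover have "src \<Lambda> y \<notin> K \<Longrightarrow> src \<Lambda> x \<notin> K" using K_her[OF K, of y] product by simp
    ultimately show ?thesis
      using product ck_relators.product[of x ?\<Gamma> y] by (auto simp: hom quotient_gen_def)
  next
    case (source_projection x)
    then show ?thesis
      using ck_relators.source_projection[of x ?\<Gamma>] by (auto simp: hom quotient_gen_def src_src)
  next
    case (cuntz_krieger v n)
    have fin: "finite (le_paths v n)" using cuntz_krieger by (intro finite_le_paths)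
    have "(\<Sum>x\<in>le_paths v n. quotient_gen \<Lambda> K x * free_adj (quotient_gen \<Lambda> K x)) =
        (\<Sum>x\<in>{x \<in> le_paths v n. src \<Lambda> x \<notin> K}. gen x * free_adj (gen x))"
      using fin by (intro sum.mono_neutral_cong_right) (auto simp: quotient_gen_def)
    then have eq: "free_hom (quotient_gen \<Lambda> K) r = quotient_gen \<Lambda> K v - (\<Sum>x\<in>{x \<in> le_paths v n. src \<Lambda>
      x \<notin> K}. gen x * free_adj (gen x))"
      using cuntz_krieger by (simp add: hom)
    show ?thesis
    proof (cases "v \<in> K")
      case True
      \<comment> \<open>All paths from a vertex of K end in K, so in this case the relator becomes 0
        itself and not another relator.\<close>
      have "{x \<in> le_paths v n. src \<Lambda> x \<notin> K} = {}"
        using True K by (auto simp: sat_her_def dest: le_paths_mor hereditaryD)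
      moreover have "src \<Lambda> v \<in> K" using True cuntz_krieger by simp
      ultimately show ?thesis unfolding eq by (simp only: sum.empty) (simp add: quotient_gen_def)
    next
      case False
      then show ?thesis
        using eq ck_relators.cuntz_krieger[of v ?\<Gamma> n] cuntz_krieger
        by (simp add: V quotient_le_paths quotient_gen_def)
    qed
  qed
qed

lemma quotient_seminorm_le:
  assumes "f \<in> fcarr \<Lambda>"
  shows "universal_seminorm (quotient_graph \<Lambda> K) (free_hom (quotient_gen \<Lambda> K) f) \<le> universal_seminorm \<Lambda> f"
proof (rule universal_free_hom_le[OF quotient_k_graph[OF K] fcarr_quotient_gen _ assms])
  interpret G: ck_family "quotient_graph \<Lambda> K" "universal_seminorm (quotient_graph \<Lambda> K)"
    by (rule k_graph.ck_family_universal[OF quotient_k_graph[OF K]])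
  show "universal_seminorm (quotient_graph \<Lambda> K) (free_hom (quotient_gen \<Lambda> K) r) = 0"
    if "r \<in> ck_relators \<Lambda>" for r
    using quotient_relator[OF that] G.p_relator by auto
qed

lemma quotient_contraction:
  "contraction (free_star_algebra \<Lambda> (universal_seminorm \<Lambda>))
     (free_star_algebra (quotient_graph \<Lambda> K) (universal_seminorm (quotient_graph \<Lambda> K))) (free_hom
       (quotient_gen \<Lambda> K))"
  by (intro contraction.intro contraction_axioms.intro free_star_algebra_seminormed
      k_graph.free_star_algebra_seminormed[OF quotient_k_graph[OF K]])
    (simp_all add: fcarr_free_hom[OF _ fcarr_quotient_gen] free_hom_add free_hom_mult free_hom_free_adj
      free_hom_single word_hom_def quotient_seminorm_le)

text \<open>A CK seminorm vanishing on the vertices in \<open>K\<close> is a CK seminorm of the quotient graph.\<close>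

lemma quotient_upper_bound:
  assumes q: "ck_seminorm \<Lambda> q" and qK: "\<And>v. v \<in> K \<Longrightarrow> q (gen v) = 0" and f: "f \<in> fcarr \<Lambda>"
  shows "q f \<le> universal_seminorm (quotient_graph \<Lambda> K) (free_hom (quotient_gen \<Lambda> K) f)"
proof -
  interpret Q: lc_ck \<Lambda> q using q by (intro lc_ck.intro) unfold_locales
  let ?\<Gamma> = "quotient_graph \<Lambda> K"
  note G = fcarr_quotient_graph_mono[of _ \<Lambda> K]
  have KV: "K \<subseteq> verts \<Lambda>" using K by (simp add: sat_her_def)
  have gen0: "Q.eqv (gen x) 0" if x: "x \<in> mor \<Lambda>" "src \<Lambda> x \<in> K" for x
  proof -
    have "Q.eqv (gen (src \<Lambda> x)) 0" using qK[OF x(2)] Q.verts_gen_carr[OF src_verts[OF x(1)]]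
      by (simp add: Q.eqv_zero_iff)
    then have "Q.eqv (gen x * gen (src \<Lambda> x)) 0" by (rule Q.eqv_mult_zero(1)[OF Q.gen_carr[OF x(1)]])
    then show ?thesis by (rule Q.eqv_trans[OF Q.eqv_sym[OF Q.eqv_src[OF x(1)]]])
  qed
  have "q r = 0" if r: "r \<in> ck_relators ?\<Gamma>" for r
    using r
  proof cases
    case (cuntz_krieger v n)
    then have v: "v \<in> verts \<Lambda>" "v \<notin> K" using quotient_verts[OF K] by auto
    let ?S = "{x \<in> le_paths v n. src \<Lambda> x \<notin> K}"
    have fin: "finite (le_paths v n)" using v(1) by (rule finite_le_paths)
    have "Q.eqv (\<Sum>x\<in>le_paths v n. gen x * Q.st x) (\<Sum>x\<in>le_paths v n. if src \<Lambda> x \<notin> K then gen x * Q.st x else 0)"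
    proof (rule Q.eqv_sum)
      fix x assume "x \<in> le_paths v n"
      then have x: "x \<in> mor \<Lambda>" using le_paths_mor by blast
      show "Q.eqv (gen x * Q.st x) (if src \<Lambda> x \<notin> K then gen x * Q.st x else 0)"
        using gen0[OF x] Q.eqv_mult_zero(2)[OF Q.st_carr[OF x]] Q.eqv_refl[OF fcarr_mult[OF
          Q.gen_carr[OF x] Q.st_carr[OF x]]]
        by auto
    qed
    also have "(\<Sum>x\<in>le_paths v n. if src \<Lambda> x \<notin> K then gen x * Q.st x else 0) = (\<Sum>x\<in>?S. gen x * Q.st x)"
      using fin by (intro sum.mono_neutral_cong_right) auto
    finally have "Q.eqv (gen v) (\<Sum>x\<in>?S. gen x * Q.st x)" using Q.eqv_ck[OF v(1)] Q.eqv_sym Q.eqv_trans by blast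
    then show ?thesis using cuntz_krieger by (simp add: Q.eqv_def quotient_le_paths)
  next
    case (partial_isometry x)
    then show ?thesis using Q.p_relator[OF ck_relators.partial_isometry[of x]] by simp
  next
    case (vertices v w)
    then show ?thesis using Q.p_relator[OF ck_relators.vertices[of v \<Lambda> w]] quotient_verts[OF K] by simp
  next
    case (product x y)
    then show ?thesis using Q.p_relator[OF ck_relators.product[of x \<Lambda> y]] by simp
  next
    case (source_projection x)
    then show ?thesis using Q.p_relator[OF ck_relators.source_projection[of x]] by simp
  qed
  moreover have "cstar_seminormed (free_star_algebra ?\<Gamma> q)"
    by (simp add: cstar_seminormed_def cstar_seminormed_axioms_def star_algebra_free G Q.p_nonneg Q.p_triangle
        Q.p_scal Q.p_mult Q.p_cstar)
  ultimately have ck: "ck_seminorm ?\<Gamma> q" by (simp add: ck_seminorm_def)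
  have "Q.eqv (free_hom gen f) (free_hom (quotient_gen \<Lambda> K) f)"
    by (rule Q.eqv_free_hom[OF f]) (use gen0 Q.gen_carr in \<open>auto simp: quotient_gen_def\<close>)
  then have "q f = q (free_hom (quotient_gen \<Lambda> K) f)" using Q.eqv_p free_hom_gen_id[OF f] by metis
  also have "\<dots> \<le> universal_seminorm ?\<Gamma> (free_hom (quotient_gen \<Lambda> K) f)"
    using k_graph.universal_upper[OF quotient_k_graph[OF K] ck] fcarr_free_hom[OF f fcarr_quotient_gen] by simp
  finally show ?thesis .
qed

end

end

subsection \<open>Central projections from hereditary sets\<close>

context lc_ck
begin

text \<open>The Cuntz-Krieger sum at v restricted to the paths that end in H: modulo p, the
  projection below s_v onto what has entered H at level N.\<close>

definition zsum :: "'a set \<Rightarrow> 'a \<Rightarrow> nat ^ 'k \<Rightarrow> 'a falg" where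
  "zsum H v N = (\<Sum>m\<in>{m \<in> le_paths v N. src \<Lambda> m \<in> H}. gen m * st m)"

lemma zsum_carr [intro]: "zsum H v N \<in> fcarr \<Lambda>"
proof -
  have "m \<in> le_paths v N \<Longrightarrow> gen m * st m \<in> fcarr \<Lambda>" for m
    using le_paths_mor[of m v N] by (auto intro: gen_carr st_carr)
  then show ?thesis by (auto simp: zsum_def)
qed

lemma zsum_adj: "free_adj (zsum H v N) = zsum H v N"
  by (simp add: zsum_def free_adj_sum free_adj_mult)

lemma vertex_zsum: "gen v * zsum H v N \<simeq> zsum H v N"
  unfolding zsum_def sum_distrib_left
proof (rule eqv_sum)
  fix m assume "m \<in> {m \<in> le_paths v N. src \<Lambda> m \<in> H}"
  then have m: "m \<in> mor \<Lambda>" "rng \<Lambda> m = v" using le_paths_mor by auto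
  have "gen v * (gen m * st m) = (gen (rng \<Lambda> m) * gen m) * st m" by (simp add: m mult.assoc)
  also have "\<dots> \<simeq> gen m * st m" by (rule eqv_mult_right[OF st_carr[OF m(1)] eqv_rng[OF m(1)]])
  finally show "gen v * (gen m * st m) \<simeq> gen m * st m" .
qed

lemma zsum_vertex: "v \<in> verts \<Lambda> \<Longrightarrow> zsum H v N * gen v \<simeq> zsum H v N"
proof -
  assume v: "v \<in> verts \<Lambda>"
  have "zsum H v N * gen v \<simeq> zsum H v N * st v"
    by (rule eqv_mult_left[OF zsum_carr eqv_sym[OF eqv_st_vertex[OF v]]])
  also have "\<dots> = free_adj (gen v * zsum H v N)" by (simp add: free_adj_mult zsum_adj)
  also have "\<dots> \<simeq> free_adj (zsum H v N)" by (rule eqv_free_adj[OF vertex_zsum])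
  finally show ?thesis by (simp add: zsum_adj)
qed

lemma zsum_orth_vertices:
  assumes "v \<in> verts \<Lambda>" "w \<in> verts \<Lambda>" "v \<noteq> w" shows "zsum H v N * zsum H' w N' \<simeq> 0"
proof -
  have "zsum H v N * zsum H' w N' \<simeq> (zsum H v N * gen v) * (gen w * zsum H' w N')"
    by (intro eqv_mult eqv_sym[OF zsum_vertex] eqv_sym[OF vertex_zsum] assms)
  also have "\<dots> = (zsum H v N * (gen v * gen w)) * zsum H' w N'" by (simp add: mult.assoc)
  also have "\<dots> \<simeq> 0"
    by (intro eqv_mult_zero(2)[OF zsum_carr] eqv_mult_zero(1)[OF zsum_carr] eqv_vertices assms)
  finally show ?thesis .
qed

lemma zsum_mult:
  assumes v: "v \<in> verts \<Lambda>" shows "zsum H v N * zsum H' v N \<simeq> zsum (H \<inter> H') v N"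
proof -
  have fin: "finite {m \<in> le_paths v N. src \<Lambda> m \<in> U}" for U using finite_le_paths[OF v] by simp
  have 1: "zsum H v N * zsum H' v N = (\<Sum>m\<in>{m \<in> le_paths v N. src \<Lambda> m \<in> H}. \<Sum>k\<in>{m \<in> le_paths v N. src
    \<Lambda> m \<in> H'}. (gen m * st m) * (gen k * st k))"
    by (simp add: zsum_def sum_product)
  have 2: "zsum H v N * zsum H' v N \<simeq> (\<Sum>m\<in>{m \<in> le_paths v N. src \<Lambda> m \<in> H}. \<Sum>k\<in>{m \<in> le_paths v N. src
    \<Lambda> m \<in> H'}. if k = m then gen m * st m else 0)"
    unfolding 1
  proof (intro eqv_sum)
    fix m k assume "m \<in> {m \<in> le_paths v N. src \<Lambda> m \<in> H}" "k \<in> {m \<in> le_paths v N. src \<Lambda> m \<in> H'}"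
    then have mk: "m \<in> le_paths v N" "k \<in> le_paths v N" by auto
    have m: "m \<in> mor \<Lambda>" "k \<in> mor \<Lambda>" using le_paths_mor mk by auto
    show "(gen m * st m) * (gen k * st k) \<simeq> (if k = m then gen m * st m else 0)"
    proof (cases "k = m")
      case True
      have "(gen m * st m) * (gen m * st m) = (gen m * st m * gen m) * st m" by (simp add: mult.assoc)
      also have "\<dots> \<simeq> gen m * st m" by (rule eqv_mult_right[OF st_carr[OF m(1)] eqv_partial_isometry[OF m(1)]])
      finally show ?thesis using True by simp
    next
      case False
      have "st m * gen k \<simeq> 0" using le_paths_orthogonal[OF v mk(2,1) False] .
      then have "gen m * (st m * gen k) * st k \<simeq> 0"
        by (intro eqv_mult_zero(2)[OF st_carr[OF m(2)]] eqv_mult_zero(1)[OF gen_carr[OF m(1)]])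
      then show ?thesis using False by (simp add: mult.assoc)
    qed
  qed
  have "(\<Sum>m\<in>{m \<in> le_paths v N. src \<Lambda> m \<in> H}. \<Sum>k\<in>{m \<in> le_paths v N. src \<Lambda> m \<in> H'}. if k
    = m then gen m * st m else 0)
      = (\<Sum>m\<in>{m \<in> le_paths v N. src \<Lambda> m \<in> H}. if src \<Lambda> m \<in> H' then gen m * st m else 0)"
    by (rule sum.cong[OF refl]) (simp add: sum.delta[OF fin])
  also have "\<dots> = zsum (H \<inter> H') v N"
    unfolding zsum_def using fin by (intro sum.mono_neutral_cong_right) auto
  finally show ?thesis using 2 by simp
qed

text \<open>Once all paths of level N have entered H or H', a continuation ends in H exactly if its
  initial segment does. The inner sums over the continuations then collapse by the Cuntz-Krieger
  relation.\<close>

lemma zsum_shift: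
  assumes v: "v \<in> verts \<Lambda>" and H: "hereditary \<Lambda> H" "hereditary \<Lambda> H'" "H \<inter> H' = {}"
    and cov: "src \<Lambda> ` le_paths v N \<subseteq> H \<union> H'"
  shows "zsum H v (N + M) \<simeq> zsum H v N"
proof -
  let ?X = "{x \<in> le_paths v N. src \<Lambda> x \<in> H}"
  have fin: "finite ?X" using finite_le_paths[OF v] by simp
  note bij = bij_betw_le_paths_add[OF v, of N M]
  have xm: "x \<in> mor \<Lambda>" "src \<Lambda> x \<in> verts \<Lambda>" if "x \<in> le_paths v N" for x
    using le_paths_mor[OF that] src_verts by auto
  have "bij_betw (\<lambda>(x, y). cmp \<Lambda> x y) (SIGMA x:?X. le_paths (src \<Lambda> x) M) {z \<in> le_paths v (N + M). src \<Lambda> z \<in> H}"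
    unfolding bij_betw_def
  proof
    show "inj_on (\<lambda>(x, y). cmp \<Lambda> x y) (SIGMA x:?X. le_paths (src \<Lambda> x) M)"
      using bij by (rule inj_on_subset[OF bij_betw_imp_inj_on]) auto
    have src: "src \<Lambda> (cmp \<Lambda> x y) \<in> H \<longleftrightarrow> src \<Lambda> x \<in> H" if "x \<in> le_paths v N" "y \<in> le_paths (src \<Lambda> x) M" for x y
    proof -
      have y: "y \<in> mor \<Lambda>" "rng \<Lambda> y = src \<Lambda> x" using le_paths_mor[OF that(2)] by auto
      have "src \<Lambda> (cmp \<Lambda> x y) = src \<Lambda> y" using y xm[OF that(1)] by (simp add: src_cmp)
      moreover have "src \<Lambda> x \<in> H \<or> src \<Lambda> x \<in> H'" using cov that(1) by auto
      moreover have "src \<Lambda> x \<in> H \<Longrightarrow> src \<Lambda> y \<in> H" "src \<Lambda> x \<in> H' \<Longrightarrow> src \<Lambda> y \<in> H'"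
        using hereditaryD[OF H(1) y(1)] hereditaryD[OF H(2) y(1)] y(2) by auto
      ultimately show ?thesis using H(3) by auto
    qed
    show "(\<lambda>(x, y). cmp \<Lambda> x y) ` (SIGMA x:?X. le_paths (src \<Lambda> x) M) = {z \<in> le_paths v (N + M). src \<Lambda> z \<in> H}"
    proof (intro equalityI subsetI)
      fix z assume "z \<in> (\<lambda>(x, y). cmp \<Lambda> x y) ` (SIGMA x:?X. le_paths (src \<Lambda> x) M)"
      then obtain x y where xy: "x \<in> le_paths v N" "src \<Lambda> x \<in> H" "y \<in> le_paths (src \<Lambda> x) M" "z
        = cmp \<Lambda> x y" by auto
      then show "z \<in> {z \<in> le_paths v (N + M). src \<Lambda> z \<in> H}"
        using src[OF xy(1,3)] bij_betw_apply[OF bij, of "(x, y)"] by auto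
    next
      fix z assume z: "z \<in> {z \<in> le_paths v (N + M). src \<Lambda> z \<in> H}"
      then have "z \<in> (\<lambda>(x, y). cmp \<Lambda> x y) ` (SIGMA x:le_paths v N. le_paths (src \<Lambda> x) M)"
        using bij by (simp add: bij_betw_def)
      then obtain x y where xy: "x \<in> le_paths v N" "y \<in> le_paths (src \<Lambda> x) M" "z = cmp \<Lambda> x y" by auto
      then have "src \<Lambda> x \<in> H" using src[OF xy(1,2)] z by simp
      then show "z \<in> (\<lambda>(x, y). cmp \<Lambda> x y) ` (SIGMA x:?X. le_paths (src \<Lambda> x) M)"
        using xy by (intro image_eqI[of _ _ "(x, y)"]) auto
    qed
  qed
  then have "zsum H v (N + M) = (\<Sum>(x, y)\<in>(SIGMA x:?X. le_paths (src \<Lambda> x) M). gen (cmp \<Lambda> x y) * st (cmp \<Lambda> x y))"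
    unfolding zsum_def by (subst sum.reindex_bij_betw[symmetric]) (auto simp: case_prod_unfold)
  also have "\<dots> = (\<Sum>x\<in>?X. \<Sum>y\<in>le_paths (src \<Lambda> x) M. gen (cmp \<Lambda> x y) * st (cmp \<Lambda> x y))"
    using fin xm finite_le_paths by (subst sum.Sigma) auto
  also have "\<dots> \<simeq> (\<Sum>x\<in>?X. \<Sum>y\<in>le_paths (src \<Lambda> x) M. gen x * (gen y * st y) * st x)"
  proof (intro eqv_sum)
    fix x y assume "x \<in> ?X" and y: "y \<in> le_paths (src \<Lambda> x) M"
    then have c: "x \<in> mor \<Lambda>" "y \<in> mor \<Lambda>" "src \<Lambda> x = rng \<Lambda> y" using xm le_paths_mor[OF y] by auto
    have "gen (cmp \<Lambda> x y) * st (cmp \<Lambda> x y) \<simeq> (gen x * gen y) * free_adj (gen x * gen y)"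
      by (intro eqv_mult eqv_free_adj eqv_sym[OF eqv_product] c)
    then show "gen (cmp \<Lambda> x y) * st (cmp \<Lambda> x y) \<simeq> gen x * (gen y * st y) * st x"
      by (simp add: free_adj_mult mult.assoc)
  qed
  also have "\<dots> = (\<Sum>x\<in>?X. gen x * (\<Sum>y\<in>le_paths (src \<Lambda> x) M. gen y * st y) * st x)"
    by (simp add: sum_distrib_left sum_distrib_right)
  also have "\<dots> \<simeq> (\<Sum>x\<in>?X. gen x * gen (src \<Lambda> x) * st x)"
    using xm by (intro eqv_sum eqv_mult_right eqv_mult_left eqv_ck st_carr gen_carr) auto
  also have "\<dots> \<simeq> (\<Sum>x\<in>?X. gen x * st x)"
    using xm by (intro eqv_sum eqv_mult_right eqv_src st_carr) auto
  finally show ?thesis by (simp add: zsum_def)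
qed

text \<open>Every path of level d(x) + M is split at level d(x); by orthogonality s_x only meets
  those with initial segment x.\<close>

lemma zsum_gen:
  assumes x: "x \<in> mor \<Lambda>"
  shows "zsum H (rng \<Lambda> x) (deg \<Lambda> x + M) * gen x \<simeq> gen x * zsum H (src \<Lambda> x) M"
proof -
  let ?v = "rng \<Lambda> x"
  have v: "?v \<in> verts \<Lambda>" and s: "src \<Lambda> x \<in> verts \<Lambda>" using x rng_verts src_verts by auto
  let ?A = "le_paths ?v (deg \<Lambda> x)"
  let ?Y = "\<lambda>a. {y \<in> le_paths (src \<Lambda> a) M. src \<Lambda> y \<in> H}"
  have fin: "finite ?A" using finite_le_paths[OF v] .
  have am: "a \<in> mor \<Lambda>" "src \<Lambda> a \<in> verts \<Lambda>" if "a \<in> ?A" for a using le_paths_mor[OF that] src_verts by auto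
  have xA: "x \<in> ?A" using self_paths_le[OF x] by (simp add: le_paths_iff)
  note bij = bij_betw_le_paths_add[OF v, of "deg \<Lambda> x" M]
  have src: "src \<Lambda> (cmp \<Lambda> a y) = src \<Lambda> y" if "a \<in> ?A" "y \<in> le_paths (src \<Lambda> a) M" for a y
    using am[OF that(1)] le_paths_mor[OF that(2)] by (simp add: src_cmp)
  have "zsum H ?v (deg \<Lambda> x + M) = (\<Sum>z\<in>le_paths ?v (deg \<Lambda> x + M). if src \<Lambda> z \<in> H then gen z * st z else 0)"
    unfolding zsum_def using finite_le_paths[OF v] by (intro sum.mono_neutral_cong_left) auto
  also have "\<dots> = (\<Sum>(a, y)\<in>(SIGMA a:?A. le_paths (src \<Lambda> a) M). if src \<Lambda> (cmp \<Lambda> a y) \<in> H then gen (cmp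
    \<Lambda> a y) * st (cmp \<Lambda> a y) else 0)"
    by (subst sum.reindex_bij_betw[OF bij, symmetric]) (auto intro!: sum.cong)
  also have "\<dots> = (\<Sum>a\<in>?A. \<Sum>y\<in>le_paths (src \<Lambda> a) M. if src \<Lambda> (cmp \<Lambda> a y) \<in> H then gen (cmp \<Lambda> a y)
    * st (cmp \<Lambda> a y) else 0)"
    using fin am finite_le_paths by (subst sum.Sigma) auto
  also have "\<dots> = (\<Sum>a\<in>?A. \<Sum>y\<in>?Y a. gen (cmp \<Lambda> a y) * st (cmp \<Lambda> a y))"
    using am finite_le_paths src by (intro sum.cong refl sum.mono_neutral_cong_right) auto
  finally have "zsum H ?v (deg \<Lambda> x + M) * gen x = (\<Sum>a\<in>?A. \<Sum>y\<in>?Y a. gen (cmp \<Lambda> a y) * st (cmp \<Lambda> a y) * gen x)"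
    by (simp add: sum_distrib_right)
  also have "\<dots> \<simeq> (\<Sum>a\<in>?A. if a = x then \<Sum>y\<in>?Y a. gen x * (gen y * st y) else 0)"
  proof (rule eqv_sum)
    fix a assume a: "a \<in> ?A"
    have "(\<Sum>y\<in>?Y a. gen (cmp \<Lambda> a y) * st (cmp \<Lambda> a y) * gen x) \<simeq> (\<Sum>y\<in>?Y a. if a = x then gen x
      * (gen y * st y) else 0)"
    proof (rule eqv_sum)
      fix y assume "y \<in> ?Y a"
      then have c: "a \<in> mor \<Lambda>" "y \<in> mor \<Lambda>" "src \<Lambda> a = rng \<Lambda> y" using am[OF a] le_paths_mor by auto
      have "gen (cmp \<Lambda> a y) * st (cmp \<Lambda> a y) * gen x \<simeq> (gen a * gen y) * free_adj (gen a * gen y) * gen x"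
        by (intro eqv_mult_right[OF gen_carr[OF x]] eqv_mult eqv_free_adj eqv_sym[OF eqv_product] c)
      also have "\<dots> = (gen a * (gen y * st y)) * (st a * gen x)" by (simp add: free_adj_mult mult.assoc)
      also have "\<dots> \<simeq> (if a = x then gen x * (gen y * st y) else 0)"
      proof (cases "a = x")
        case True
        have "(gen a * (gen y * st y)) * (st a * gen x) \<simeq> (gen x * (gen y * st y)) * gen (src \<Lambda> x)"
          unfolding True using c x by (intro eqv_mult_left eqv_source fcarr_mult gen_carr st_carr)
        also have "\<dots> = (gen x * gen y) * (st y * gen (rng \<Lambda> y))" using c True by (simp add: mult.assoc)
        also have "\<dots> \<simeq> (gen x * gen y) * st y" using c x by (intro eqv_mult_left eqv_st_rng fcarr_mult gen_carr)
        finally show ?thesis using True by (simp add: mult.assoc)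
      next
        case False
        have "st a * gen x \<simeq> 0" using le_paths_orthogonal[OF v xA a] False by simp
        have "(gen a * (gen y * st y)) * (st a * gen x) \<simeq> 0"
          by (rule eqv_mult_zero(1)[OF _ \<open>st a * gen x \<simeq> 0\<close>]) (intro fcarr_mult gen_carr st_carr c)
        then show ?thesis using False by simp
      qed
      finally show "gen (cmp \<Lambda> a y) * st (cmp \<Lambda> a y) * gen x \<simeq> (if a = x then gen x * (gen y * st y) else 0)" .
    qed
    then show "(\<Sum>y\<in>?Y a. gen (cmp \<Lambda> a y) * st (cmp \<Lambda> a y) * gen x) \<simeq> (if a = x then \<Sum>y\<in>?Y a. gen x
      * (gen y * st y) else 0)"
      by (cases "a = x") simp_all
  qed
  also have "\<dots> = (\<Sum>y\<in>?Y x. gen x * (gen y * st y))" by (subst sum.delta[OF fin]) (simp only: xA if_True)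
  also have "\<dots> = gen x * zsum H (src \<Lambda> x) M" by (simp add: zsum_def sum_distrib_left)
  finally show ?thesis .
qed

end


subsection \<open>Splitting along disjoint hereditary sets\<close>

locale hereditary_cover = lc_ck \<Lambda> p
  for \<Lambda> :: "('a, 'k::finite) kgraph" and p :: "'a falg \<Rightarrow> real" +
  fixes n :: nat and H :: "nat \<Rightarrow> 'a set"
  assumes H_her: "i < n \<Longrightarrow> hereditary \<Lambda> (H i)" and H_verts: "i < n \<Longrightarrow> H i \<subseteq> verts \<Lambda>"
    and H_disjoint: "i < n \<Longrightarrow> j < n \<Longrightarrow> i \<noteq> j \<Longrightarrow> H i \<inter> H j = {}"
    and H_cover: "v \<in> verts \<Lambda> \<Longrightarrow> \<exists>N. src \<Lambda> ` le_paths v N \<subseteq> (\<Union>i<n. H i)"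
begin

definition lev :: "'a \<Rightarrow> nat ^ 'k" where
  "lev v = (SOME N. src \<Lambda> ` le_paths v N \<subseteq> (\<Union>i<n. H i))"

text \<open>\<open>Z i v\<close> is the product of \<open>s\<^sub>v\<close> with the \<open>i\<close>th central projection; up to the relations it does
  not change if \<open>lev v\<close> is enlarged.\<close>

definition Z :: "nat \<Rightarrow> 'a \<Rightarrow> 'a falg" where "Z i v = zsum (H i) v (lev v)"

text \<open>Modulo p these elements satisfy the Cuntz-Krieger relations again, so that cutting
  yields a new CK seminorm.\<close>

definition cut :: "nat \<Rightarrow> 'a \<Rightarrow> 'a falg" where "cut i x = gen x * Z i (src \<Lambda> x)"

lemma lev: "v \<in> verts \<Lambda> \<Longrightarrow> src \<Lambda> ` le_paths v (lev v) \<subseteq> (\<Union>i<n. H i)"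
  unfolding lev_def by (rule someI_ex[OF H_cover])

lemma Z_carr [simp]: "Z i v \<in> fcarr \<Lambda>"
  by (auto simp: Z_def)

lemma Z_adj [simp]: "free_adj (Z i v) = Z i v"
  by (simp add: Z_def zsum_adj)

text \<open>The union of the other sets \<open>H j\<close> takes the role of the second hereditary
  set in \<open>zsum_shift\<close>.\<close>

lemma Z_shift:
  assumes i: "i < n" and v: "v \<in> verts \<Lambda>" shows "zsum (H i) v (lev v + M) \<simeq> Z i v"
  unfolding Z_def
proof (rule zsum_shift[OF v H_her[OF i]])
  let ?R = "\<Union>j\<in>{..<n} - {i}. H j"
  show "hereditary \<Lambda> ?R" using H_her by (auto simp: hereditary_def)
  show "H i \<inter> ?R = {}" using H_disjoint[OF i] by blast
  show "src \<Lambda> ` le_paths v (lev v) \<subseteq> H i \<union> ?R" using lev[OF v] by blast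
qed

text \<open>This is centrality. The levels chosen at the two ends of x are unrelated, so they are
  first raised to two levels that differ by d(x), where \<open>zsum_gen\<close> applies.\<close>

lemma Z_commute:
  assumes i: "i < n" and x: "x \<in> mor \<Lambda>" shows "Z i (rng \<Lambda> x) * gen x \<simeq> gen x * Z i (src \<Lambda> x)"
proof -
  let ?r = "rng \<Lambda> x" and ?s = "src \<Lambda> x"
  have v: "?r \<in> verts \<Lambda>" "?s \<in> verts \<Lambda>" using x rng_verts src_verts by auto
  have "Z i ?r * gen x \<simeq> zsum (H i) ?r (lev ?r + (deg \<Lambda> x + lev ?s)) * gen x"
    by (rule eqv_mult_right[OF gen_carr[OF x] eqv_sym[OF Z_shift[OF i v(1)]]])
  also have "\<dots> = zsum (H i) ?r (deg \<Lambda> x + (lev ?s + lev ?r)) * gen x" by (simp add: add_ac)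
  also have "\<dots> \<simeq> gen x * zsum (H i) ?s (lev ?s + lev ?r)" by (rule zsum_gen[OF x])
  also have "\<dots> \<simeq> gen x * Z i ?s" by (rule eqv_mult_left[OF gen_carr[OF x] Z_shift[OF i v(2)]])
  finally show ?thesis .
qed

lemma Z_idem: "v \<in> verts \<Lambda> \<Longrightarrow> Z i v * Z i v \<simeq> Z i v"
  using zsum_mult[of v "H i" "lev v" "H i"] by (simp add: Z_def)

lemma Z_orthogonal:
  assumes ij: "i < n" "j < n" "i \<noteq> j" and v: "v \<in> verts \<Lambda>" "w \<in> verts \<Lambda>" shows "Z i v * Z j w \<simeq> 0"
proof (cases "v = w")
  case True
  have "zsum {} v (lev v) = 0" by (simp add: zsum_def)
  then show ?thesis using zsum_mult[OF v(1), of "H i" "lev v" "H j"] H_disjoint[OF ij] True by (simp add: Z_def)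
next
  case False
  then show ?thesis unfolding Z_def by (rule zsum_orth_vertices[OF v])
qed

lemma Z_vertex: "v \<in> verts \<Lambda> \<Longrightarrow> gen v * Z i v \<simeq> Z i v" "v \<in> verts \<Lambda> \<Longrightarrow> Z i v * gen v \<simeq> Z i v"
  unfolding Z_def using vertex_zsum zsum_vertex by blast+

lemma Z_sum: assumes v: "v \<in> verts \<Lambda>" shows "(\<Sum>i<n. Z i v) \<simeq> gen v"
proof -
  have fin: "finite (le_paths v (lev v))" by (rule finite_le_paths[OF v])
  have "le_paths v (lev v) = (\<Union>i<n. {m \<in> le_paths v (lev v). src \<Lambda> m \<in> H i})" using lev[OF v] by blast
  then have "(\<Sum>m\<in>le_paths v (lev v). gen m * st m) = (\<Sum>m\<in>(\<Union>i<n. {m \<in> le_paths v (lev v). src \<Lambda> m \<in> H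
    i}). gen m * st m)"
    by simp
  also have "\<dots> = (\<Sum>i<n. Z i v)"
    unfolding Z_def zsum_def using fin H_disjoint by (intro sum.UNION_disjoint) fastforce+
  finally show ?thesis using eqv_ck[OF v, of "lev v"] by simp
qed

lemma Z_cpl: assumes i: "i < n" and v: "v \<in> cpl (H i)" shows "Z i v = 0"
proof -
  have "{m \<in> le_paths v (lev v). src \<Lambda> m \<in> H i} = {}" using v src_le_paths_tree by (fastforce simp: cpl_iff)
  then show ?thesis unfolding Z_def zsum_def by (simp only: sum.empty)
qed

lemma cut_carr [simp]: "x \<in> mor \<Lambda> \<Longrightarrow> cut i x \<in> fcarr \<Lambda>"
  unfolding cut_def by (intro fcarr_mult gen_carr Z_carr)

lemma cut_adj: "free_adj (cut i x) = Z i (src \<Lambda> x) * st x"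
  by (simp add: cut_def free_adj_mult)

lemma cut_Z: "x \<in> mor \<Lambda> \<Longrightarrow> cut i x * Z i (src \<Lambda> x) \<simeq> cut i x"
  unfolding cut_def mult.assoc by (intro eqv_mult_left gen_carr Z_idem src_verts)

lemma cut_vertex: "v \<in> verts \<Lambda> \<Longrightarrow> cut i v \<simeq> Z i v"
  using Z_vertex(1) by (simp add: cut_def)

lemma cut_source: assumes x: "x \<in> mor \<Lambda>" shows "free_adj (cut i x) * cut i x \<simeq> Z i (src \<Lambda> x)"
proof -
  let ?s = "src \<Lambda> x"
  have s: "?s \<in> verts \<Lambda>" using x by (rule src_verts)
  have "free_adj (cut i x) * cut i x = Z i ?s * (st x * gen x) * Z i ?s" unfolding cut_adj
    by (simp add: cut_def mult.assoc)
  also have "\<dots> \<simeq> Z i ?s * gen ?s * Z i ?s" by (intro eqv_mult_right eqv_mult_left Z_carr eqv_source x)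
  also have "\<dots> \<simeq> Z i ?s * Z i ?s" by (intro eqv_mult_right Z_carr Z_vertex(2) s)
  also have "\<dots> \<simeq> Z i ?s" by (rule Z_idem[OF s])
  finally show ?thesis .
qed

lemma cut_product:
  assumes i: "i < n" and c: "x \<in> mor \<Lambda>" "y \<in> mor \<Lambda>" "src \<Lambda> x = rng \<Lambda> y"
  shows "cut i x * cut i y \<simeq> cut i (cmp \<Lambda> x y)"
proof -
  have s: "src \<Lambda> y \<in> verts \<Lambda>" using c by (simp add: src_verts)
  have "cut i x * cut i y = gen x * (Z i (rng \<Lambda> y) * gen y) * Z i (src \<Lambda> y)" by (simp add: cut_def c mult.assoc)
  also have "\<dots> \<simeq> gen x * (gen y * Z i (src \<Lambda> y)) * Z i (src \<Lambda> y)"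
    by (intro eqv_mult_right eqv_mult_left Z_carr gen_carr Z_commute c i)
  also have "\<dots> = (gen x * gen y) * (Z i (src \<Lambda> y) * Z i (src \<Lambda> y))" by (simp add: mult.assoc)
  also have "\<dots> \<simeq> gen (cmp \<Lambda> x y) * Z i (src \<Lambda> y)" by (intro eqv_mult eqv_product Z_idem s c)
  finally show ?thesis using c by (simp add: cut_def src_cmp)
qed

lemma cut_range:
  assumes i: "i < n" and x: "x \<in> mor \<Lambda>"
  shows "cut i x * free_adj (cut i x) \<simeq> Z i (rng \<Lambda> x) * (gen x * st x)"
proof -
  have "cut i x * free_adj (cut i x) = (cut i x * Z i (src \<Lambda> x)) * st x" by (simp add: cut_adj mult.assoc)
  also have "\<dots> \<simeq> cut i x * st x" by (intro eqv_mult_right st_carr cut_Z x)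
  also have "\<dots> \<simeq> (Z i (rng \<Lambda> x) * gen x) * st x"
    unfolding cut_def by (intro eqv_mult_right st_carr eqv_sym[OF Z_commute] x i)
  finally show ?thesis by (simp add: mult.assoc)
qed

lemma cut_relator:
  assumes i: "i < n" and r: "r \<in> ck_relators \<Lambda>" shows "free_hom (cut i) r \<simeq> 0"
proof -
  note hom = free_hom_diff free_hom_mult free_hom_free_adj free_hom_sum free_hom_gen
  have D: "f \<simeq> g \<Longrightarrow> f - g \<simeq> 0" for f g using eqv_diff[of f g g g] by (auto dest: eqv_carr)
  show ?thesis
    using r
  proof cases
    case (partial_isometry x)
    have "cut i x * (free_adj (cut i x) * cut i x) \<simeq> cut i x * Z i (src \<Lambda> x)"
      by (intro eqv_mult_left cut_source cut_carr partial_isometry)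
    also have "\<dots> \<simeq> cut i x" by (intro cut_Z partial_isometry)
    finally have "cut i x * free_adj (cut i x) * cut i x \<simeq> cut i x" by (simp add: mult.assoc)
    from D[OF this] show ?thesis using partial_isometry by (simp add: hom)
  next
    case (vertices v w)
    have "cut i v * cut i w \<simeq> Z i v * Z i w" by (intro eqv_mult cut_vertex vertices)
    also have "\<dots> \<simeq> (if v = w then Z i v else 0)"
      using Z_idem[of v i] zsum_orth_vertices[of v w "H i" "lev v" "H i" "lev w"] vertices
        by (cases "v = w") (simp_all add: Z_def)
    also have "\<dots> \<simeq> (if v = w then cut i v else 0)"
      using eqv_sym[OF cut_vertex[of v i]] vertices by auto
    finally show ?thesis using D vertices by (auto simp: hom)
  next
    case (product x y)
    then show ?thesis using D[OF cut_product[OF i, of x y]] by (simp add: hom)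
  next
    case (source_projection x)
    have "free_adj (cut i x) * cut i x \<simeq> cut i (src \<Lambda> x)"
      by (rule eqv_trans[OF cut_source eqv_sym[OF cut_vertex]]) (use source_projection src_verts in auto)
    from D[OF this] show ?thesis using source_projection by (simp add: hom)
  next
    case (cuntz_krieger v N)
    have "(\<Sum>x\<in>le_paths v N. cut i x * free_adj (cut i x)) \<simeq> (\<Sum>x\<in>le_paths v N. Z i v * (gen x * st x))"
      using cut_range[OF i] le_paths_mor by (intro eqv_sum) metis
    also have "\<dots> = Z i v * (\<Sum>x\<in>le_paths v N. gen x * st x)" by (simp add: sum_distrib_left)
    also have "\<dots> \<simeq> Z i v * gen v" by (intro eqv_mult_left Z_carr eqv_ck cuntz_krieger)
    also have "\<dots> \<simeq> Z i v" by (intro Z_vertex cuntz_krieger)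
    also have "\<dots> \<simeq> cut i v" by (intro eqv_sym[OF cut_vertex] cuntz_krieger)
    finally show ?thesis using D[OF eqv_sym] cuntz_krieger by (simp add: hom)
  qed
qed

lemma cut_seminorm: assumes i: "i < n" shows "ck_seminorm \<Lambda> (\<lambda>f. p (free_hom (cut i) f))"
  using free_hom_seminormed[of \<Lambda> "cut i"] cut_relator[OF i] by (auto simp: ck_seminorm_def eqv_zero_iff)

text \<open>A starred letter runs backwards, so its two ends are exchanged.\<close>

definition letter_rng :: "'a \<times> bool \<Rightarrow> 'a" where
  "letter_rng l = (if snd l then src \<Lambda> (fst l) else rng \<Lambda> (fst l))"

definition letter_src :: "'a \<times> bool \<Rightarrow> 'a" where
  "letter_src l = (if snd l then rng \<Lambda> (fst l) else src \<Lambda> (fst l))"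

lemma letter_verts: "fst l \<in> mor \<Lambda> \<Longrightarrow> letter_rng l \<in> verts \<Lambda>" "fst l \<in> mor \<Lambda> \<Longrightarrow> letter_src l \<in> verts \<Lambda>"
  by (auto simp: letter_rng_def letter_src_def rng_verts src_verts)

lemma letter_carr: "fst l \<in> mor \<Lambda> \<Longrightarrow> letter_hom gen l \<in> fcarr \<Lambda>"
  by (auto simp: letter_hom_def)

lemma letter_cut:
  assumes i: "i < n" and l: "fst l \<in> mor \<Lambda>"
  shows "letter_hom (cut i) l \<simeq> letter_hom gen l * Z i (letter_src l)"
    and "letter_hom (cut i) l \<simeq> Z i (letter_rng l) * letter_hom gen l"
proof -
  let ?x = "fst l"
  have c: "cut i ?x \<simeq> Z i (rng \<Lambda> ?x) * gen ?x" unfolding cut_def by (rule eqv_sym[OF Z_commute[OF i l]])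
  have a: "free_adj (cut i ?x) \<simeq> st ?x * Z i (rng \<Lambda> ?x)" using eqv_free_adj[OF c] by (simp add: free_adj_mult)
  have r: "cut i ?x \<simeq> gen ?x * Z i (src \<Lambda> ?x)" "free_adj (cut i ?x) \<simeq> Z i (src \<Lambda> ?x) * st ?x"
    using eqv_refl[OF cut_carr[OF l]] eqv_free_adj[OF eqv_refl[OF cut_carr[OF l]]]
      by (simp_all add: cut_adj flip: cut_def)
  show "letter_hom (cut i) l \<simeq> letter_hom gen l * Z i (letter_src l)"
    using a r by (simp add: letter_hom_def letter_src_def)
  show "letter_hom (cut i) l \<simeq> Z i (letter_rng l) * letter_hom gen l"
    using c r by (simp add: letter_hom_def letter_rng_def)
qed

lemma letter_sum:
  assumes l: "fst l \<in> mor \<Lambda>" shows "letter_hom gen l \<simeq> (\<Sum>i<n. letter_hom (cut i) l)"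
proof -
  have "(\<Sum>i<n. letter_hom (cut i) l) \<simeq> (\<Sum>i<n. letter_hom gen l * Z i (letter_src l))"
    using letter_cut(1)[OF _ l] by (intro eqv_sum) simp
  also have "\<dots> = letter_hom gen l * (\<Sum>i<n. Z i (letter_src l))" by (simp add: sum_distrib_left)
  also have "\<dots> \<simeq> letter_hom gen l * gen (letter_src l)"
    by (intro eqv_mult_left Z_sum letter_carr letter_verts l)
  also have "\<dots> \<simeq> letter_hom gen l" using eqv_src[OF l] eqv_st_rng[OF l]
    by (simp add: letter_hom_def letter_src_def)
  finally show ?thesis by (rule eqv_sym)
qed

lemma letter_orthogonal:
  assumes ij: "i < n" "j < n" "i \<noteq> j" and l: "fst l \<in> mor \<Lambda>" "fst m \<in> mor \<Lambda>"
  shows "letter_hom (cut i) l * letter_hom (cut j) m \<simeq> 0"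
proof -
  have "letter_hom (cut i) l * letter_hom (cut j) m \<simeq> (letter_hom gen l * Z i (letter_src l))
    * (Z j (letter_rng m) * letter_hom gen m)"
    by (intro eqv_mult letter_cut ij l)
  also have "\<dots> = (letter_hom gen l * (Z i (letter_src l) * Z j (letter_rng m))) * letter_hom gen m"
    by (simp add: mult.assoc)
  also have "\<dots> \<simeq> 0"
    by (intro eqv_mult_zero(2)[OF letter_carr] eqv_mult_zero(1)[OF letter_carr] Z_orthogonal letter_verts ij l)
  finally show ?thesis .
qed

lemma word_hom_Cons: "word_hom b (l # w) = letter_hom b l * word_hom b w"
  by (simp add: word_hom_def)

lemma word_hom_singleton: "word_hom b [l] = letter_hom b l"
  by (simp add: word_hom_def)

text \<open>When the product of the sums for the letters is expanded, the mixed terms vanish: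
  neighbouring letters cut by different projections are orthogonal.\<close>

lemma word_sum:
  assumes "w \<noteq> []" "fst ` set w \<subseteq> mor \<Lambda>" shows "word_hom gen w \<simeq> (\<Sum>i<n. word_hom (cut i) w)"
  using assms
proof (induction w)
  case (Cons l w)
  then have l: "fst l \<in> mor \<Lambda>" by simp
  show ?case
  proof (cases w)
    case Nil
    then show ?thesis using letter_sum[OF l] by (simp add: word_hom_singleton)
  next
    case (Cons m u)
    have w: "fst ` set w \<subseteq> mor \<Lambda>" using Cons.prems by simp
    have wc: "word_hom (cut j) w \<in> fcarr \<Lambda>" if "j < n" for j
      using w Cons by (intro fcarr_word_hom cut_carr) auto
    have uc: "letter_hom (cut i) l * word_hom (cut j) w \<simeq> (if j
      = i then word_hom (cut i) (l # w) else 0)" if ij: "i < n" "j < n" for i j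
    proof (cases "j = i")
      case True
      have "word_hom (cut i) (l # w) \<in> fcarr \<Lambda>" using w l by (intro fcarr_word_hom cut_carr) auto
      then show ?thesis using True by (auto simp: word_hom_Cons)
    next
      case False
      have m: "fst m \<in> mor \<Lambda>" using w Cons by simp
      have 0: "letter_hom (cut i) l * letter_hom (cut j) m \<simeq> 0" using False
        by (intro letter_orthogonal ij l m) simp
      show ?thesis
      proof (cases "u = []")
        case True
        then show ?thesis using 0 False Cons by (simp add: word_hom_singleton)
      next
        case u: False
        have "word_hom (cut j) u \<in> fcarr \<Lambda>" using w Cons u by (intro fcarr_word_hom cut_carr) auto
        then have "(letter_hom (cut i) l * letter_hom (cut j) m) * word_hom (cut j) u \<simeq> 0" using 0
          by (rule eqv_mult_zero(2))
        then show ?thesis using False Cons by (simp add: word_hom_Cons mult.assoc)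
      qed
    qed
    have "word_hom gen (l # w) \<simeq> (\<Sum>i<n. letter_hom (cut i) l) * (\<Sum>j<n. word_hom (cut j) w)"
      unfolding word_hom_Cons by (rule eqv_mult[OF letter_sum[OF l] Cons.IH]) (use Cons w in auto)
    then have 1: "word_hom gen (l # w) \<simeq> (\<Sum>i<n. \<Sum>j<n. letter_hom (cut i) l * word_hom (cut j) w)"
      by (simp add: sum_product)
    have 2: "(\<Sum>i<n. \<Sum>j<n. letter_hom (cut i) l * word_hom (cut j) w) \<simeq> (\<Sum>i<n. \<Sum>j<n. if j
      = i then word_hom (cut i) (l # w) else 0)"
      using uc by (intro eqv_sum) simp
    have 3: "(\<Sum>i<n. \<Sum>j<n. if j = i then word_hom (cut i) (l # w) else 0) = (\<Sum>i<n. word_hom (cut i) (l # w))"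
      by (intro sum.cong refl) simp
    show ?thesis using eqv_trans[OF 1 2] unfolding 3 .
  qed
qed simp

lemma cut_sum: assumes "f \<in> fcarr \<Lambda>" shows "f \<simeq> (\<Sum>i<n. free_hom (cut i) f)"
  using assms
proof (induction rule: fcarr_induct)
  case zero
  show ?case by auto
next
  case (word w c)
  have "scal c * word_hom gen w \<simeq> scal c * (\<Sum>i<n. word_hom (cut i) w)" by (intro eqv_scal word_sum word)
  then show ?case by (simp add: free_hom_scal free_hom_word_hom sum_distrib_left)
next
  case (add f g)
  then show ?case using eqv_add by (simp add: free_hom_add sum.distrib)
qed

lemma cpl_H: "i < n \<Longrightarrow> cpl (H i) \<in> sat_her \<Lambda>"
  by (intro cpl_sat_her H_her)

text \<open>Modulo p, f is the sum of its cuts. Each of them is measured by a CK seminorm that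
  vanishes on \<open>cpl (H i)\<close>, hence by one dominated by the universal seminorm of the
  quotient graph.\<close>

lemma seminorm_le:
  assumes f: "f \<in> fcarr \<Lambda>"
  shows "p f \<le> (\<Sum>i<n. universal_seminorm (quotient_graph \<Lambda> (cpl (H i))) (free_hom (quotient_gen \<Lambda>
    (cpl (H i))) f))"
proof -
  have "p f = p (\<Sum>i<n. free_hom (cut i) f)" by (rule eqv_p[OF cut_sum[OF f]])
  also have "\<dots> \<le> (\<Sum>i<n. p (free_hom (cut i) f))" by (intro p_sum fcarr_free_hom[OF f cut_carr])
  also have "\<dots> \<le> (\<Sum>i<n. universal_seminorm (quotient_graph \<Lambda> (cpl (H i))) (free_hom (quotient_gen \<Lambda>
    (cpl (H i))) f))"
  proof (intro sum_mono)
    fix i assume "i \<in> {..<n}"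
    then have i: "i < n" by simp
    have "p (free_hom (cut i) (gen v)) = 0" if "v \<in> cpl (H i)" for v
      using Z_cpl[OF i that] that by (simp add: free_hom_gen cut_def cpl_iff)
    from quotient_upper_bound[OF cpl_H[OF i] cut_seminorm[OF i] this f]
    show "p (free_hom (cut i) f) \<le> universal_seminorm (quotient_graph \<Lambda> (cpl (H i))) (free_hom
      (quotient_gen \<Lambda> (cpl (H i))) f)" .
  qed
  finally show ?thesis .
qed

text \<open>At the level \<open>lev\<close> the paths that survive in the i-th quotient are those
  ending in \<open>H i\<close>, since the other sets lie in \<open>cpl (H i)\<close>. So at a
  surviving vertex \<open>Z i\<close> becomes the full Cuntz-Krieger sum, while \<open>Z j\<close>
  becomes 0 for j different from i.\<close>

lemma quotient_gen_cut:
  assumes i: "i < n" and j: "j < n" and x: "x \<in> mor (quotient_graph \<Lambda> (cpl (H j)))"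
  shows "falg_seminorm.eqv (quotient_graph \<Lambda> (cpl (H i))) (universal_seminorm (quotient_graph \<Lambda> (cpl (H i))))
    (free_hom (quotient_gen \<Lambda> (cpl (H i))) (cut j x)) (if i = j then gen x else 0)"
proof -
  let ?K = "cpl (H i)" and ?s = "src \<Lambda> x"
  let ?\<pi> = "free_hom (quotient_gen \<Lambda> ?K)"
  have xm: "x \<in> mor \<Lambda>" and s: "?s \<in> verts \<Lambda>" using x src_verts by auto
  interpret G: lc_ck "quotient_graph \<Lambda> ?K" "universal_seminorm (quotient_graph \<Lambda> ?K)"
    by (intro lc_ck.intro quotient_lc_kgraph[OF cpl_H[OF i]] k_graph.ck_family_universal
      quotient_k_graph[OF cpl_H[OF i]])
  have \<pi>Z: "?\<pi> (Z j ?s) = (\<Sum>m\<in>{m \<in> le_paths ?s (lev ?s). src \<Lambda> m \<in> H j}. quotient_gen \<Lambda> ?K m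
    * free_adj (quotient_gen \<Lambda> ?K m))"
    by (simp add: Z_def zsum_def free_hom_sum free_hom_mult free_hom_free_adj free_hom_gen)
  show ?thesis
  proof (cases "i = j")
    case True
    have sK: "?s \<notin> ?K" using x True by simp
    have "{m \<in> le_paths ?s (lev ?s). src \<Lambda> m \<in> H i} = {m \<in> le_paths ?s (lev ?s). src \<Lambda> m \<notin> ?K}"
    proof (intro Collect_cong conj_cong refl)
      fix m assume m: "m \<in> le_paths ?s (lev ?s)"
      then obtain j where j: "j < n" "src \<Lambda> m \<in> H j" using lev[OF s] by auto
      have "H j \<subseteq> ?K" if "j \<noteq> i" using j that H_disjoint[OF j(1) i] by (intro subset_cpl H_her H_verts) auto
      then show "src \<Lambda> m \<in> H i \<longleftrightarrow> src \<Lambda> m \<notin> ?K" using j cpl_disjoint[of "H i"] by (cases "j = i") auto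
    qed
    also have "\<dots> = G.le_paths ?s (lev ?s)" using quotient_le_paths[OF cpl_H[OF i]] by simp
    finally have eq: "{m \<in> le_paths ?s (lev ?s). src \<Lambda> m \<in> H i} = G.le_paths ?s (lev ?s)" .
    have "?\<pi> (Z j ?s) = (\<Sum>m\<in>G.le_paths ?s (lev ?s). gen m * G.st m)"
      unfolding \<pi>Z unfolding True[symmetric] eq
        by (intro sum.cong refl, drule G.le_paths_mor) (simp add: quotient_gen_def)
    also have "G.eqv \<dots> (gen ?s)" using s sK by (intro G.eqv_ck) (simp add: quotient_verts[OF cpl_H[OF i]])
    finally have "G.eqv (gen x * ?\<pi> (Z j ?s)) (gen x * gen ?s)" using x True
      by (intro G.eqv_mult_left G.gen_carr) simp_all
    also have "G.eqv \<dots> (gen x)" using G.eqv_src[of x] x True by simp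
    finally show ?thesis using True sK by (simp add: cut_def free_hom_mult free_hom_gen quotient_gen_def)
  next
    case False
    have "H j \<subseteq> ?K" using False H_disjoint[OF j i] by (intro subset_cpl H_her H_verts j) auto
    then have "?\<pi> (Z j ?s) = 0" unfolding \<pi>Z by (intro sum.neutral) (auto simp: quotient_gen_def)
    then show ?thesis using False by (auto simp: cut_def free_hom_mult)
  qed
qed

lemma quotient_dense:
  assumes f: "\<And>i. i < n \<Longrightarrow> f i \<in> fcarr (quotient_graph \<Lambda> (cpl (H i)))"
  shows "\<exists>g\<in>fcarr \<Lambda>. \<forall>i<n. universal_seminorm (quotient_graph \<Lambda> (cpl (H i))) (free_hom (quotient_gen
    \<Lambda> (cpl (H i))) g - f i) = 0"
proof (intro bexI allI impI)
  \<comment> \<open>The j-th cut of an element of the j-th quotient maps back to that element in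
    this quotient and to 0 in the others.\<close>
  let ?g = "\<Sum>j<n. free_hom (cut j) (f j)"
  show "?g \<in> fcarr \<Lambda>"
    using fcarr_quotient_graph_mono[OF f] by (intro fcarr_sum fcarr_free_hom[OF _ cut_carr]) auto
  fix i assume i: "i < n"
  let ?K = "cpl (H i)"
  let ?\<pi> = "free_hom (quotient_gen \<Lambda> ?K)"
  interpret G: lc_ck "quotient_graph \<Lambda> ?K" "universal_seminorm (quotient_graph \<Lambda> ?K)"
    by (intro lc_ck.intro quotient_lc_kgraph[OF cpl_H[OF i]] k_graph.ck_family_universal
      quotient_k_graph[OF cpl_H[OF i]])
  have "G.eqv (?\<pi> (free_hom (cut j) (f j))) (if j = i then f i else 0)" if j: "j < n" for j
  proof -
    have "G.eqv (?\<pi> (free_hom (cut j) (f j))) (free_hom (\<lambda>x. if i = j then gen x else 0) (f j))"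
      unfolding free_hom_free_hom by (rule G.eqv_free_hom[OF f[OF j] quotient_gen_cut[OF i j]])
    then show ?thesis using free_hom_gen_id[OF f[OF j]]
      by (cases "j = i") (simp_all add: free_hom_zero_gens[OF f[OF j]])
  qed
  then have "G.eqv (\<Sum>j<n. ?\<pi> (free_hom (cut j) (f j))) (\<Sum>j<n. if j = i then f i else 0)"
    by (intro G.eqv_sum) simp
  then have "G.eqv (?\<pi> ?g) (f i)" using i by (simp add: free_hom_sum)
  then show "universal_seminorm (quotient_graph \<Lambda> ?K) (?\<pi> ?g - f i) = 0" by (simp add: G.eqv_def)
qed

end

context graph_algebra
begin

abbreviation quotient_map :: "'a set \<Rightarrow> (nat \<Rightarrow> 'a falg) set \<Rightarrow> (nat \<Rightarrow> 'a falg) set" where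
  "quotient_map K \<equiv> comp_map FA (free_star_algebra (quotient_graph \<Lambda> K) (universal_seminorm
    (quotient_graph \<Lambda> K)))
     (free_hom (quotient_gen \<Lambda> K))"

text \<open>\<open>seminorm_le\<close> supplies the lower bound and \<open>quotient_dense\<close>
  the exact lifting that \<open>completion_direct_sum\<close> requires.\<close>

theorem hereditary_cover_iso:
  assumes "hereditary_cover \<Lambda> (universal_seminorm \<Lambda>) n H"
  shows "star_iso (\<lambda>C. \<lambda>i\<in>{..<n}. quotient_map (cpl (H i)) C) CA
    (direct_sum {..<n} (\<lambda>i. graph_cstar (quotient_graph \<Lambda> (cpl (H i)))))"
proof -
  interpret H: hereditary_cover \<Lambda> "universal_seminorm \<Lambda>" n H by (rule assms)
  show ?thesis
    unfolding graph_cstar_def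
    by (rule completion_direct_sum[OF free_star_algebra_seminormed quotient_contraction[OF H.cpl_H]])
      (use H.seminorm_le H.quotient_dense in simp_all)
qed

lemma quotient_map_vertex:
  assumes K: "K \<in> sat_her \<Lambda>" and v: "v \<in> verts \<Lambda>"
  shows "quotient_map K (\<iota> (gen v)) = (if v \<in> K then zer (graph_cstar (quotient_graph \<Lambda> K))
    else graph_algebra.\<iota> (quotient_graph \<Lambda> K) (gen v))"
proof -
  interpret h: contraction FA "free_star_algebra (quotient_graph \<Lambda> K) (universal_seminorm
    (quotient_graph \<Lambda> K))" "free_hom (quotient_gen \<Lambda> K)"
    by (rule quotient_contraction[OF K])
  interpret G: graph_algebra "quotient_graph \<Lambda> K" by (intro graph_algebra.intro quotient_lc_kgraph[OF K])
  have "quotient_map K (\<iota> (gen v)) = G.\<iota> (quotient_gen \<Lambda> K v)"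
    using h.comp_map_embed[of "gen v"] U.verts_gen_carr[OF v] by (simp add: \<iota>_def G.\<iota>_def free_hom_gen)
  then show ?thesis using v G.\<iota>_ops(6) by (simp add: quotient_gen_def)
qed

end


section \<open>Supports, and decompositions as atomic families\<close>

subsection \<open>Supports of central projections\<close>

context graph_algebra
begin

text \<open>Since a generator absorbs its range projection, Q kills generators and then words. As no
  bound on Q is given, a limit x is treated through products: (Q x) f = x (Q f) = 0 on a dense
  subalgebra.\<close>

lemma vanish_on_vertices:
  assumes Q: "central_proj CA Q" and v: "\<And>v. v \<in> verts \<Lambda> \<Longrightarrow> Q (\<iota> (gen v)) = zer CA" and x: "x \<in> carr CA"
  shows "Q x = zer CA"
proof -
  note D = central_projD[OF Q]
  have Qz: "Q (\<iota> f) = zer CA" if "f \<in> fcarr \<Lambda>" for f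
    using that
  proof (induction rule: fcarr_induct)
    case zero
    show ?case by (simp add: \<iota>_ops C.central_proj_zer[OF Q])
  next
    case (word w c)
    then obtain l u where w: "w = l # u" by (cases w) auto
    have l: "fst l \<in> mor \<Lambda>" using word w by simp
    have g: "Q (\<iota> (gen x)) = zer CA" if x: "x \<in> mor \<Lambda>" for x
    proof -
      have r: "rng \<Lambda> x \<in> verts \<Lambda>" using x by (rule rng_verts)
      have "\<iota> (gen x) = tim CA (\<iota> (gen (rng \<Lambda> x))) (\<iota> (gen x))"
        using \<iota>_eq[OF U.eqv_rng[OF x]] U.gen_carr[OF x] U.verts_gen_carr[OF r] by (simp add: \<iota>_ops)
      then have "Q (\<iota> (gen x)) = tim CA (Q (\<iota> (gen (rng \<Lambda> x)))) (\<iota> (gen x))"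
        using D(6)[of "\<iota> (gen (rng \<Lambda> x))" "\<iota> (gen x)"] U.gen_carr[OF x] U.verts_gen_carr[OF r] by simp
      then show ?thesis using v[OF r] U.gen_carr[OF x] by (simp add: C.zer_tim)
    qed
    have L: "Q (\<iota> (letter_hom gen l)) = zer CA"
      using g[OF l] D(3)[of "\<iota> (gen (fst l))"] U.gen_carr[OF l] by (simp add: letter_hom_def \<iota>_ops C.adj_zer)
    have lc: "letter_hom gen l \<in> fcarr \<Lambda>" using l by (auto simp: letter_hom_def)
    have "Q (\<iota> (word_hom gen w)) = zer CA"
    proof (cases "u = []")
      case True
      then show ?thesis using L w by (simp add: word_hom_def)
    next
      case False
      have uc: "word_hom gen u \<in> fcarr \<Lambda>" using word w False by (intro fcarr_word_hom fcarr_gen) auto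
      have "\<iota> (word_hom gen w) = tim CA (\<iota> (letter_hom gen l)) (\<iota> (word_hom gen u))"
        using lc uc by (simp add: w word_hom_def \<iota>_ops)
      then show ?thesis using D(6) L lc uc by (simp add: C.zer_tim)
    qed
    moreover have "word_hom gen w \<in> fcarr \<Lambda>" using word by (intro fcarr_word_hom fcarr_gen) auto
    ultimately show ?case using D(4) by (simp add: \<iota>_ops C.smul_zer)
  next
    case (add f g)
    then show ?case using D(5) C.zer_pls[OF C.zer_closed] by (simp add: \<iota>_ops)
  qed
  have Qx: "Q x \<in> carr CA" using D(1)[OF x] .
  show ?thesis
  proof (rule C.annihilator[OF Qx])
    fix y assume y: "y \<in> carr CA"
    have "nrm CA (tim CA (Q x) y) \<le> 0 + e" if e: "0 < e" for e
    proof -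
      let ?M = "nrm CA (Q x) + 1"
      have M: "0 < ?M" using C.nrm_nonneg[OF Qx] by simp
      then obtain f where f: "f \<in> fcarr \<Lambda>" "nrm CA (sub CA y (\<iota> f)) < e / ?M"
        using \<iota>_approx[OF y, of "e / ?M"] e by auto
      have "tim CA (Q x) (\<iota> f) = zer CA"
        using D(6,7)[OF x \<iota>_carr[OF f(1)]] Qz[OF f(1)] C.tim_zer[OF x] by simp
      then have "tim CA (Q x) y = tim CA (Q x) (sub CA y (\<iota> f))"
        using Qx y f(1) by (simp add: C.tim_sub C.sub_zer)
      then have "nrm CA (tim CA (Q x) y) \<le> nrm CA (Q x) * nrm CA (sub CA y (\<iota> f))"
        using C.nrm_tim[OF Qx, of "sub CA y (\<iota> f)"] y f(1) by simp
      also have "\<dots> \<le> ?M * (e / ?M)"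
        using f y C.nrm_nonneg[OF Qx] C.nrm_nonneg[of "sub CA y (\<iota> f)"] by (intro mult_mono) auto
      finally show ?thesis using M by simp
    qed
    then have "nrm CA (tim CA (Q x) y) \<le> 0" by (rule field_le_epsilon)
    then have "nrm CA (tim CA (Q x) y) = 0" using C.nrm_nonneg[of "tim CA (Q x) y"] Qx y by simp
    then show "tim CA (Q x) y = zer CA" using C.nrm_definite Qx y by simp
  qed
qed

definition support :: "((nat \<Rightarrow> 'a falg) set \<Rightarrow> (nat \<Rightarrow> 'a falg) set) \<Rightarrow> 'a set" where
  "support P = {v \<in> verts \<Lambda>. P (\<iota> (gen v)) = \<iota> (gen v)}"

lemma support_verts: "support P \<subseteq> verts \<Lambda>"
  by (auto simp: support_def)

lemma support_compl:
  assumes P: "central_proj CA P"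
  shows "support (\<lambda>x. sub CA x (P x)) = {v \<in> verts \<Lambda>. P (\<iota> (gen v)) = zer CA}"
proof -
  have "sub CA e (P e) = e \<longleftrightarrow> P e = zer CA" if e: "e \<in> carr CA" for e
  proof -
    have "P (sub CA e (P e)) = zer CA"
      using central_projD(1,2)[OF P e] e by (simp add: C.central_proj_sub[OF P] C.sub_self)
    then show ?thesis using C.sub_zer[OF e] by metis
  qed
  then show ?thesis using vertex_projection(1) by (auto simp: support_def)
qed

context
  fixes P assumes P: "central_proj CA P"
begin

lemma fixed_mult:
  assumes "f \<in> fcarr \<Lambda>" "g \<in> fcarr \<Lambda>" "P (\<iota> f) = \<iota> f \<or> P (\<iota> g) = \<iota> g" shows "P (\<iota> (f * g)) = \<iota> (f * g)"
  using assms central_projD(6,7)[OF P, of "\<iota> f" "\<iota> g"] by (auto simp: \<iota>_ops)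

lemma fixed_eqv: "P (\<iota> f) = \<iota> f \<Longrightarrow> U.eqv f g \<Longrightarrow> P (\<iota> g) = \<iota> g"
  using \<iota>_eq by metis

lemma fixed_sum: "(\<And>x. x \<in> S \<Longrightarrow> f x \<in> fcarr \<Lambda> \<and> P (\<iota> (f x)) = \<iota> (f x)) \<Longrightarrow> P (\<iota> (sum f S)) = \<iota> (sum f S)"
proof (induction S rule: infinite_finite_induct)
  case (insert x S)
  then have "f x \<in> fcarr \<Lambda>" "sum f S \<in> fcarr \<Lambda>" by (auto intro: fcarr_sum)
  then show ?case using insert central_projD(5)[OF P] by (simp add: \<iota>_ops)
qed (simp_all add: \<iota>_ops C.central_proj_zer[OF P])

text \<open>If P fixes the range projection of x, it fixes s_x and then s_x^* s_x, which is the
  source projection.\<close>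

lemma support_hereditary: "hereditary \<Lambda> (support P)"
  unfolding hereditary_def
proof (intro ballI impI)
  fix x assume x: "x \<in> mor \<Lambda>" and r: "rng \<Lambda> x \<in> support P"
  have "P (\<iota> (gen (rng \<Lambda> x) * gen x)) = \<iota> (gen (rng \<Lambda> x) * gen x)"
    using r x by (intro fixed_mult) (auto simp: support_def rng_closed)
  then have "P (\<iota> (gen x)) = \<iota> (gen x)" using U.eqv_rng[OF x] by (rule fixed_eqv)
  then have "P (\<iota> (U.st x * gen x)) = \<iota> (U.st x * gen x)" using x by (intro fixed_mult) auto
  then have "P (\<iota> (gen (src \<Lambda> x))) = \<iota> (gen (src \<Lambda> x))" using U.eqv_source[OF x] by (rule fixed_eqv)
  then show "src \<Lambda> x \<in> support P" using src_verts[OF x] by (simp add: support_def)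
qed

text \<open>If P fixes the source projections of all m in \<open>le_paths v N\<close>, it fixes each
  s_m s_m^* and hence their Cuntz-Krieger sum s_v.\<close>

lemma support_saturated: "saturated \<Lambda> (support P)"
  unfolding saturated_def
proof (intro ballI impI)
  fix v assume v: "v \<in> verts \<Lambda>" and "\<exists>N. src \<Lambda> ` le_paths v N \<subseteq> support P"
  then obtain N where N: "src \<Lambda> ` le_paths v N \<subseteq> support P" by blast
  have "gen m * U.st m \<in> fcarr \<Lambda> \<and> P (\<iota> (gen m * U.st m)) = \<iota> (gen m * U.st m)" if m: "m \<in> le_paths v N" for m
  proof -
    have mm: "m \<in> mor \<Lambda>" using le_paths_mor[OF m] by blast
    have "P (\<iota> (gen (src \<Lambda> m))) = \<iota> (gen (src \<Lambda> m))" using N m by (auto simp: support_def)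
    then have "P (\<iota> (gen m * gen (src \<Lambda> m))) = \<iota> (gen m * gen (src \<Lambda> m))" using mm
      by (intro fixed_mult) (auto simp: src_closed)
    then have "P (\<iota> (gen m)) = \<iota> (gen m)" using U.eqv_src[OF mm] by (rule fixed_eqv)
    then show ?thesis using mm fixed_mult[of "gen m" "U.st m"] by (simp add: fcarr_mult U.gen_carr U.st_carr)
  qed
  then have "P (\<iota> (\<Sum>m\<in>le_paths v N. gen m * U.st m)) = \<iota> (\<Sum>m\<in>le_paths v N. gen m * U.st m)" by (rule fixed_sum)
  then have "P (\<iota> (gen v)) = \<iota> (gen v)" using U.eqv_ck[OF v] by (rule fixed_eqv)
  then show "v \<in> support P" using v by (simp add: support_def)
qed

lemma support_sat_her: "support P \<in> sat_her \<Lambda>"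
  using support_verts support_hereditary support_saturated by (simp add: sat_her_def)

end

lemma support_nonzero: "v \<in> support P \<Longrightarrow> P (\<iota> (gen v)) \<noteq> zer CA"
  using vertex_projection(5) by (auto simp: support_def)

lemma support_disjoint_compl:
  assumes "central_proj CA P" shows "support P \<inter> support (\<lambda>x. sub CA x (P x)) = {}"
  using support_nonzero by (auto simp: support_compl[OF assms])

lemma support_cover:
  assumes P: "central_proj CA P" and v: "v \<in> verts \<Lambda>"
  shows "\<exists>N. src \<Lambda> ` le_paths v N \<subseteq> support P \<union> support (\<lambda>x. sub CA x (P x))"
proof -
  obtain N where "\<forall>m\<in>le_paths v N. P (\<iota> (gen (src \<Lambda> m))) = zer CA \<or> P (\<iota> (gen (src \<Lambda> m))) = \<iota> (gen (src \<Lambda> m))"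
    using central_proj_dichotomy[OF P v] by blast
  moreover have "src \<Lambda> m \<in> verts \<Lambda>" if "m \<in> le_paths v N" for m using le_paths_mor[OF that] src_verts by blast
  ultimately show ?thesis unfolding support_compl[OF P] by (intro exI[of _ N]) (auto simp: support_def)
qed

lemma support_clopens: assumes P: "central_proj CA P" shows "support P \<in> clopens"
proof -
  have "support (\<lambda>x. sub CA x (P x)) \<subseteq> cpl (support P)"
    using support_disjoint_compl[OF P] support_hereditary[OF C.central_proj_compl[OF P]] support_verts
    by (intro subset_cpl) auto
  then show ?thesis using support_sat_her[OF P] support_cover[OF P] unfolding clopens_def by blast
qed

text \<open>With empty support every cover lies in the support of the complement, which is saturated
  and so contains every vertex; thus P kills all s_v.\<close>

lemma support_empty:
  assumes P: "central_proj CA P" and e: "support P = {}" and x: "x \<in> carr CA" shows "P x = zer CA"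
proof (rule vanish_on_vertices[OF P _ x])
  fix v assume v: "v \<in> verts \<Lambda>"
  have "v \<in> support (\<lambda>x. sub CA x (P x))"
    using support_cover[OF P v] e saturatedD[OF support_saturated[OF C.central_proj_compl[OF P]] v] by auto
  then show "P (\<iota> (gen v)) = zer CA" unfolding support_compl[OF P] by simp
qed

lemma support_comp:
  assumes P: "central_proj CA P" and Q: "central_proj CA Q"
    shows "support (\<lambda>x. P (Q x)) = support P \<inter> support Q"
proof -
  have "P (Q e) = e \<longleftrightarrow> P e = e \<and> Q e = e" if e: "e \<in> carr CA" for e
  proof (intro iffI conjI)
    assume PQ: "P (Q e) = e"
    have Qe: "Q e \<in> carr CA" using central_projD(1)[OF Q e] .
    show "P e = e" using central_projD(2)[OF P Qe] PQ by simp
    show "Q e = e" using C.central_proj_commute[OF P Q Qe] central_projD(2)[OF Q e] PQ by simp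
  qed simp
  then have "v \<in> support (\<lambda>x. P (Q x)) \<longleftrightarrow> v \<in> support P \<and> v \<in> support Q" for v
    using vertex_projection(1)[of v] by (cases "v \<in> verts \<Lambda>") (simp_all add: support_def)
  then show ?thesis by blast
qed

lemma support_disjoint:
  assumes P: "central_proj CA P" and Q: "central_proj CA Q" and d: "support P \<inter> support Q
    = {}" and x: "x \<in> carr CA"
  shows "P (Q x) = zer CA"
  using support_empty[OF C.central_proj_comp[OF P Q] _ x] support_comp[OF P Q] d by simp

text \<open>The product of P with the complement of Q has empty support and is therefore 0.\<close>

lemma support_subset:
  assumes P: "central_proj CA P" and Q: "central_proj CA Q" and d: "support P \<subseteq> support Q" and x: "x \<in> carr CA"
  shows "Q (P x) = P x"
proof -
  have Px: "P x \<in> carr CA" "Q (P x) \<in> carr CA" using central_projD(1)[OF P x] central_projD(1)[OF Q] by auto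
  have "sub CA (P x) (Q (P x)) = zer CA"
    using support_disjoint[OF C.central_proj_compl[OF Q] P _ x] support_disjoint_compl[OF Q] d by blast
  then show ?thesis using Px by (simp add: C.sub_eq_zer)
qed

lemma support_eq:
  assumes P: "central_proj CA P" and Q: "central_proj CA Q" and d: "support P = support Q" and x: "x \<in> carr CA"
  shows "P x = Q x"
  using support_subset[OF P Q _ x] support_subset[OF Q P _ x] d C.central_proj_commute[OF P Q x] by simp

subsection \<open>Decompositions and atomic families\<close>

lemma cover_decomposition:
  assumes H: "hereditary_cover \<Lambda> (universal_seminorm \<Lambda>) n H" and c: "\<And>i. i < n \<Longrightarrow> H i \<in> clopens"
  shows "\<exists>\<phi>. decomposition CA {..<n} (\<lambda>i. graph_cstar (quotient_graph \<Lambda> (cpl (H i)))) \<phi> \<and>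
    (\<forall>i<n. support (decomposition.coord_proj CA {..<n} (\<lambda>i. graph_cstar (quotient_graph \<Lambda> (cpl (H
      i)))) \<phi> i) = H i)"
proof -
  interpret H: hereditary_cover \<Lambda> "universal_seminorm \<Lambda>" n H by (rule H)
  let ?B = "\<lambda>i. graph_cstar (quotient_graph \<Lambda> (cpl (H i)))"
  let ?\<phi> = "\<lambda>C. \<lambda>i\<in>{..<n}. quotient_map (cpl (H i)) C"
  interpret D: decomposition CA "{..<n}" ?B ?\<phi>
    by (intro decomposition.intro C.cstar_algebra_axioms hereditary_cover_iso H
        k_graph.graph_cstar_algebra quotient_k_graph H.cpl_H) simp
  \<comment> \<open>Vertices outside \<open>cpl (H j)\<close> survive in the j-th quotient, and the
    vertex projections of that quotient have norm 1.\<close>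
  have z: "?\<phi> (\<iota> (gen v)) j = zer (?B j) \<longleftrightarrow> v \<in> cpl (H j)" if v: "v \<in> verts \<Lambda>" and j: "j < n" for v j
  proof -
    interpret G: graph_algebra "quotient_graph \<Lambda> (cpl (H j))"
      by (intro graph_algebra.intro quotient_lc_kgraph[OF H.cpl_H[OF j]])
    show ?thesis
      using G.vertex_projection(5)[of v] v j
      by (simp add: quotient_map_vertex[OF H.cpl_H[OF j] v] quotient_verts[OF H.cpl_H[OF j]])
  qed
  have "support (D.coord_proj i) = H i" if i: "i < n" for i
  proof (intro equalityI subsetI)
    fix v assume "v \<in> support (D.coord_proj i)"
    then have v: "v \<in> verts \<Lambda>" and f: "D.coord_proj i (\<iota> (gen v)) = \<iota> (gen v)" by (auto simp: support_def)
    \<comment> \<open>Being fixed by the i-th projection means vanishing in all other coordinates.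
      The vertex then reaches no other \<open>H j\<close>, so its cover lies in \<open>H i\<close>,
      and saturation puts it there.\<close>
    have "v \<in> cpl (H j)" if "j < n" "j \<noteq> i" for j
      using f D.coord_proj_eq_iff(1)[OF vertex_projection(1)[OF v], of i] i that z[OF v] by auto
    moreover obtain N where N: "src \<Lambda> ` le_paths v N \<subseteq> (\<Union>i<n. H i)" using H.H_cover[OF v] by blast
    ultimately have "src \<Lambda> ` le_paths v N \<subseteq> H i"
      using src_le_paths_tree[of v N] unfolding cpl_iff by blast
    then show "v \<in> H i" using saturatedD[OF clopens_saturated[OF c[OF i]] v] by blast
  next
    fix v assume vH: "v \<in> H i"
    then have v: "v \<in> verts \<Lambda>" using H.H_verts[OF i] by blast
    have "v \<in> cpl (H j)" if "j < n" "j \<noteq> i" for j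
      using subset_cpl[OF H.H_her[OF i] H.H_verts[OF i] H.H_disjoint[OF i that(1)]] that vH by blast
    then have "D.coord_proj i (\<iota> (gen v)) = \<iota> (gen v)"
      using D.coord_proj_eq_iff(1)[OF vertex_projection(1)[OF v], of i] i z[OF v] by auto
    then show "v \<in> support (D.coord_proj i)" using v by (simp add: support_def)
  qed
  then show ?thesis using D.decomposition_axioms by blast
qed

lemma hereditary_coverI:
  assumes "\<And>i. i < n \<Longrightarrow> H i \<in> clopens" "\<And>i j. i < n \<Longrightarrow> j < n \<Longrightarrow> i \<noteq> j \<Longrightarrow> H i \<inter> H j = {}"
    "\<And>v. v \<in> verts \<Lambda> \<Longrightarrow> \<exists>N. src \<Lambda> ` le_paths v N \<subseteq> (\<Union>i<n. H i)"
  shows "hereditary_cover \<Lambda> (universal_seminorm \<Lambda>) n H"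
  using assms by (intro hereditary_cover.intro hereditary_cover_axioms.intro U.lc_ck_axioms)
    (auto dest: clopens_hereditary clopens_verts)

text \<open>The two-term cover by H and \<open>cpl H\<close> gives a direct sum whose first
  coordinate projection has support H.\<close>

lemma clopens_support: assumes H: "H \<in> clopens" shows "\<exists>P. central_proj CA P \<and> support P = H"
proof -
  let ?H = "\<lambda>i::nat. if i = 0 then H else cpl H"
  have "(\<Union>i<2. ?H i) = H \<union> cpl H" by (auto simp: lessThan_Suc numeral_2_eq_2)
  moreover have "i = 1" if "i < 2" "i \<noteq> 0" for i :: nat using that by simp
  ultimately have cov: "hereditary_cover \<Lambda> (universal_seminorm \<Lambda>) 2 ?H"
    using H cpl_clopens[OF H] clopens_cover[OF H] cpl_disjoint[of H] by (intro hereditary_coverI) auto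
  have "?H i \<in> clopens" for i using H cpl_clopens[OF H] by simp
  from cover_decomposition[OF cov this] obtain \<phi> where
    D: "decomposition CA {..<2} (\<lambda>i. graph_cstar (quotient_graph \<Lambda> (cpl (?H i)))) \<phi>" and
    s: "\<forall>i<2. support (decomposition.coord_proj CA {..<2} (\<lambda>i. graph_cstar (quotient_graph \<Lambda> (cpl
      (?H i)))) \<phi> i) = ?H i"
    by blast
  show ?thesis using decomposition.coord_proj_central[OF D, of 0] s by (intro exI conjI) auto
qed

lemma decomposition_atomic_family:
  fixes B :: "nat \<Rightarrow> (nat \<Rightarrow> 'a falg) set star_alg"
  assumes D: "decomposition CA {..<n} B \<phi>" and ind: "\<And>i. i < n \<Longrightarrow> indecomposable (B i)"
    and nz: "\<And>i. n \<ge> 2 \<Longrightarrow> i < n \<Longrightarrow> nonzero_alg (B i)"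
  shows "atomic_family n (\<lambda>i. support (decomposition.coord_proj CA {..<n} B \<phi> i))"
proof -
  interpret D: decomposition CA "{..<n}" B \<phi> by (rule D)
  let ?P = D.coord_proj
  have P: "central_proj CA (?P i)" if "i < n" for i using D.coord_proj_central that by simp
  have disj: "support (?P i) \<inter> support (?P j) = {}" if ij: "i < n" "j < n" "i \<noteq> j" for i j
  proof -
    have False if v: "v \<in> support (?P i)" "v \<in> support (?P j)" for v
      using D.coord_proj_orth[of "\<iota> (gen v)" i j] ij v support_nonzero[OF v(1)] vertex_projection(1)
      by (simp add: support_def)
    then show ?thesis by blast
  qed
  have cover: "\<exists>N. src \<Lambda> ` le_paths v N \<subseteq> (\<Union>i<n. support (?P i))" if v: "v \<in> verts \<Lambda>" for v
  proof -
    let ?C = "\<lambda>i. support (?P i) \<union> support (\<lambda>x. sub CA x (?P i x))"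
    have "\<exists>N. src \<Lambda> ` le_paths v N \<subseteq> ?C i" if "i < n" for i by (rule support_cover[OF P[OF that] v])
    then obtain N where N: "\<And>i. i < n \<Longrightarrow> src \<Lambda> ` le_paths v (N i) \<subseteq> ?C i" by metis
    \<comment> \<open>The sum of the n levels, at which all n covers hold together.\<close>
    let ?N = "\<Sum>i<n. N i"
    have C: "src \<Lambda> ` le_paths v ?N \<subseteq> ?C i" if i: "i < n" for i
    proof -
      have "?N = N i + (\<Sum>j\<in>{..<n} - {i}. N j)" using i by (intro sum.remove) auto
      then show ?thesis
        using src_le_paths_mono[OF hereditary_Un[OF support_hereditary[OF P[OF i]]
          support_hereditary[OF C.central_proj_compl[OF P[OF i]]]] N[OF i]] by simp
    qed
    have "src \<Lambda> m \<in> (\<Union>i<n. support (?P i))" if m: "m \<in> le_paths v ?N" for m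
    proof (rule ccontr)
      \<comment> \<open>Otherwise all coordinate projections would kill the vertex projection at the
        end of m, which is nonzero.\<close>
      assume no: "src \<Lambda> m \<notin> (\<Union>i<n. support (?P i))"
      have s: "src \<Lambda> m \<in> verts \<Lambda>" using le_paths_mor[OF m] src_verts by blast
      have "?P i (\<iota> (gen (src \<Lambda> m))) = zer CA" if i: "i \<in> {..<n}" for i
      proof -
        have "src \<Lambda> m \<in> support (\<lambda>x. sub CA x (?P i x))" using C[of i] i m no by blast
        then show ?thesis using support_compl[OF P[of i]] i by simp
      qed
      then have "\<iota> (gen (src \<Lambda> m)) = zer CA" by (rule D.coord_proj_zeros[OF vertex_projection(1)[OF s]])
      then show False using vertex_projection(5)[OF s] by simp
    qed
    then show ?thesis by blast
  qed
  have atom: "support (?P i) \<inter> H = {} \<or> support (?P i) \<subseteq> H" if i: "i < n" and H: "H \<in> clopens" for i H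
  proof -
    \<comment> \<open>Every clopen set is the support of a central projection, so indecomposability
      of the summand turns into atomicity of its support.\<close>
    obtain Q where Q: "central_proj CA Q" "support Q = H" using clopens_support[OF H] by blast
    have "(\<forall>x\<in>carr CA. Q (?P i x) = zer CA) \<or> (\<forall>x\<in>carr CA. Q (?P i x) = ?P i x)"
      using decomposition_indecomposable_iff[OF D, of i] ind[OF i] i Q(1) by simp
    then show ?thesis
    proof
      assume a: "\<forall>x\<in>carr CA. Q (?P i x) = zer CA"
      have "v \<notin> support Q" if v: "v \<in> support (?P i)" for v
        using a v support_nonzero[of v Q] vertex_projection(1)[of v] by (force simp: support_def[of "?P i"])
      then show ?thesis using Q(2) by blast
    next
      assume a: "\<forall>x\<in>carr CA. Q (?P i x) = ?P i x"
      have "v \<in> H" if v: "v \<in> support (?P i)" for v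
        using a v vertex_projection(1) unfolding Q(2)[symmetric] by (force simp: support_def)
      then show ?thesis by blast
    qed
  qed
  have "support (?P i) \<noteq> {}" if "n \<ge> 2" "i < n" for i
    using nz[OF that] D.nonzero_iff[of i] support_empty[OF P[OF that(2)]] that by auto
  then show ?thesis unfolding atomic_family_def using support_clopens[OF P] disj cover atom by blast
qed

text \<open>The support of any central projection is disjoint from an atom or contains it. As
  supports detect both vanishing and containment of central projections, each summand is
  indecomposable.\<close>

lemma atomic_family_decomposition:
  assumes A: "atomic_family n A"
  shows "\<exists>\<phi>. subgraph_decomposition \<Lambda> n (\<lambda>i. quotient_graph \<Lambda> (cpl (A i))) \<phi> \<and>
    (\<forall>i<n. support (decomposition.coord_proj CA {..<n} (\<lambda>i. graph_cstar (quotient_graph \<Lambda> (cpl (A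
      i)))) \<phi> i) = A i)"
proof -
  note At = atomic_familyD[OF A]
  let ?\<Gamma> = "\<lambda>i. quotient_graph \<Lambda> (cpl (A i))"
  let ?B = "\<lambda>i. graph_cstar (?\<Gamma> i)"
  have "hereditary_cover \<Lambda> (universal_seminorm \<Lambda>) n A" by (rule hereditary_coverI) (use At in auto)
  then obtain \<phi> where D: "decomposition CA {..<n} ?B \<phi>"
    and s: "\<And>i. i < n \<Longrightarrow> support (decomposition.coord_proj CA {..<n} ?B \<phi> i) = A i"
    using cover_decomposition[OF _ At(1)] by meson
  interpret D: decomposition CA "{..<n}" ?B \<phi> by (rule D)
  have P: "central_proj CA (D.coord_proj i)" if "i < n" for i using D.coord_proj_central that by simp
  have K: "cpl (A i) \<in> sat_her \<Lambda>" if "i < n" for i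
    by (rule cpl_sat_her[OF clopens_hereditary[OF At(1)[OF that]]])
  have "indecomposable (?B i)" if i: "i < n" for i
  proof -
    have "(\<forall>x\<in>carr CA. Q (D.coord_proj i x) = zer CA) \<or> (\<forall>x\<in>carr CA. Q (D.coord_proj i x) = D.coord_proj i x)"
      if Q: "central_proj CA Q" for Q
    proof (cases "A i \<inter> support Q = {}")
      case True
      then show ?thesis using support_disjoint[OF Q P[OF i]] s[OF i] by blast
    next
      case False
      then have "A i \<subseteq> support Q" by (rule At(4)[OF i support_clopens[OF Q]])
      then show ?thesis using support_subset[OF P[OF i] Q] s[OF i] by blast
    qed
    then show ?thesis using decomposition_indecomposable_iff[OF D, of i] i by simp
  qed
  moreover have "nonzero_alg (?B i)" if "n \<ge> 2" "i < n" for i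
  proof -
    have "A i \<noteq> {}" using At(5) that .
    then obtain v where "v \<in> A i" by blast
    then have "v \<in> support (D.coord_proj i)" using s that by simp
    then show ?thesis
      using D.nonzero_iff[of i] support_nonzero support_verts vertex_projection(1) that by blast
  qed
  ultimately have "subgraph_decomposition \<Lambda> n ?\<Gamma> \<phi>"
    unfolding subgraph_decomposition_def
    using D.iso K quotient_k_subgraph quotient_row_finite quotient_locally_convex by blast
  then show ?thesis using s by blast
qed

lemma subgraph_decompositionD:
  assumes "subgraph_decomposition \<Lambda> n \<Gamma> \<phi>"
  shows "decomposition CA {..<n} (\<lambda>i. graph_cstar (\<Gamma> i)) \<phi>"
    and "i < n \<Longrightarrow> indecomposable (graph_cstar (\<Gamma> i))"
    and "n \<ge> 2 \<Longrightarrow> i < n \<Longrightarrow> nonzero_alg (graph_cstar (\<Gamma> i))"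
    and "i < n \<Longrightarrow> cstar_algebra (graph_cstar (\<Gamma> i))"
proof -
  show *: "i < n \<Longrightarrow> cstar_algebra (graph_cstar (\<Gamma> i))" for i
    using assms k_graph.graph_cstar_algebra by (auto simp: subgraph_decomposition_def k_subgraph_def)
  show "decomposition CA {..<n} (\<lambda>i. graph_cstar (\<Gamma> i)) \<phi>"
    using assms * C.cstar_algebra_axioms by (auto simp: subgraph_decomposition_def decomposition_def)
qed (use assms in \<open>auto simp: subgraph_decomposition_def\<close>)

text \<open>An arbitrary decomposition yields a family of atoms, and such a family is realised by
  subgraphs; so decompositions into abstract C*-algebras and into algebras of subgraphs exist for
  the same n.\<close>

lemma n_decomposable_atomic_family:
  assumes n: "n \<ge> 1" shows "n_decomposable CA n \<longleftrightarrow> (\<exists>A. atomic_family n A)"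
proof
  assume "n_decomposable CA n"
  then obtain B :: "nat \<Rightarrow> (nat \<Rightarrow> 'a falg) set star_alg" and \<phi> where B: "\<forall>i<n. cstar_algebra (B i)
    \<and> indecomposable (B i) \<and> (n \<ge> 2 \<longrightarrow> nonzero_alg (B i))"
    and \<phi>: "star_iso \<phi> CA (direct_sum {..<n} B)"
    unfolding n_decomposable_def star_isomorphic_def by blast
  have "decomposition CA {..<n} B \<phi>" using B \<phi> C.cstar_algebra_axioms by (simp add: decomposition_def)
  from decomposition_atomic_family[OF this] B show "\<exists>A. atomic_family n A" by blast
next
  assume "\<exists>A. atomic_family n A"
  then obtain A \<phi> where A: "subgraph_decomposition \<Lambda> n (\<lambda>i. quotient_graph \<Lambda> (cpl (A i))) \<phi>"
    using atomic_family_decomposition by blast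
  show "n_decomposable CA n"
    unfolding n_decomposable_def star_isomorphic_def
    by (intro conjI exI[of _ "\<lambda>i. graph_cstar (quotient_graph \<Lambda> (cpl (A i)))"] exI[of _ \<phi>] allI impI n
        subgraph_decompositionD[OF A] decomposition.iso[OF subgraph_decompositionD(1)[OF A]])
qed

text \<open>Supports determine central projections, so the summands agree as ideals of C*(\<Lambda>)
  and not only up to isomorphism; the algebras of the subgraphs are compared through the common
  corner.\<close>

theorem decomposition_unique:
  assumes n: "n \<ge> 1" and G: "subgraph_decomposition \<Lambda> n \<Gamma> \<phi>" and G': "subgraph_decomposition \<Lambda> n \<Gamma>' \<phi>'"
  shows "\<exists>\<sigma>. \<sigma> permutes {..<n} \<and>
    (\<forall>i<n. summand CA {..<n} (\<lambda>j. graph_cstar (\<Gamma>' j)) \<phi>' i = summand CA {..<n} (\<lambda>j. graph_cstar (\<Gamma> j)) \<phi> (\<sigma> i) \<and>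
      star_isomorphic (graph_cstar (\<Gamma>' i)) (graph_cstar (\<Gamma> (\<sigma> i))))"
proof -
  interpret D: decomposition CA "{..<n}" "\<lambda>j. graph_cstar (\<Gamma> j)" \<phi> by (rule subgraph_decompositionD(1)[OF G])
  interpret D': decomposition CA "{..<n}" "\<lambda>j. graph_cstar (\<Gamma>' j)" \<phi>'
    by (rule subgraph_decompositionD(1)[OF G'])
  have "atomic_family n (\<lambda>i. support (D.coord_proj i))"
    by (rule decomposition_atomic_family[OF subgraph_decompositionD(1-3)[OF G]])
  moreover have "atomic_family n (\<lambda>i. support (D'.coord_proj i))"
    by (rule decomposition_atomic_family[OF subgraph_decompositionD(1-3)[OF G']])
  ultimately obtain \<sigma> where \<sigma>: "\<sigma> permutes {..<n}"
    and eq: "\<And>i. i < n \<Longrightarrow> support (D'.coord_proj i) = support (D.coord_proj (\<sigma> i))"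
    using atomic_family_unique[OF _ _ n] by meson
  have "summand CA {..<n} (\<lambda>j. graph_cstar (\<Gamma>' j)) \<phi>' i = summand CA {..<n} (\<lambda>j. graph_cstar (\<Gamma> j)) \<phi> (\<sigma> i) \<and>
      star_isomorphic (graph_cstar (\<Gamma>' i)) (graph_cstar (\<Gamma> (\<sigma> i)))" if "i < n" for i
  proof -
    have i: "i \<in> {..<n}" "\<sigma> i \<in> {..<n}" using that permutes_in_image[OF \<sigma>] by auto
    have im: "D'.coord_proj i ` carr CA = D.coord_proj (\<sigma> i) ` carr CA"
      using support_eq[OF D'.coord_proj_central[OF i(1)] D.coord_proj_central[OF i(2)] eq[OF that]]
        by (rule image_cong[OF refl])
    have co: "corner CA (D'.coord_proj i) = corner CA (D.coord_proj (\<sigma> i))" using im by (simp add: corner_def)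
    have "star_isomorphic (corner CA (D'.coord_proj i)) (graph_cstar (\<Gamma>' i))"
      using D'.corner_iso[OF i(1)] by (auto simp: star_isomorphic_def)
    then have "star_isomorphic (graph_cstar (\<Gamma>' i)) (corner CA (D'.coord_proj i))"
      by (rule star_isomorphic_sym[OF C.corner_star_algebra[OF D'.coord_proj_central[OF i(1)]]])
    moreover have "star_isomorphic (corner CA (D.coord_proj (\<sigma> i))) (graph_cstar (\<Gamma> (\<sigma> i)))"
      using D.corner_iso[OF i(2)] by (auto simp: star_isomorphic_def)
    ultimately show ?thesis unfolding co D.summand_eq[OF i(2)] D'.summand_eq[OF i(1)] im
      by (blast intro: star_isomorphic_trans)
  qed
  then show ?thesis using \<sigma> by blast
qed

end

theorem theorem7p4:
  fixes \<Lambda> :: "('a, 'k::finite) kgraph" and n :: nat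
  assumes "k_graph \<Lambda>" and "row_finite \<Lambda>" and "locally_convex \<Lambda>" and "n \<ge> 1"
  shows "(n_decomposable (graph_cstar \<Lambda>) n \<longleftrightarrow>
            enat n \<in> chain_lengths \<Lambda> \<and> (\<forall>l \<in> chain_lengths \<Lambda>. l \<le> enat n)) \<and>
    (n_decomposable (graph_cstar \<Lambda>) n \<longrightarrow>
       (\<exists>\<Gamma> \<phi>. subgraph_decomposition \<Lambda> n \<Gamma> \<phi> \<and>
          (\<forall>\<Gamma>' \<phi>'. subgraph_decomposition \<Lambda> n \<Gamma>' \<phi>' \<longrightarrow>
             (\<exists>\<sigma>. \<sigma> permutes {..<n} \<and>
                (\<forall>i<n. summand (graph_cstar \<Lambda>) {..<n} (\<lambda>j. graph_cstar (\<Gamma>' j)) \<phi>' i =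
                         summand (graph_cstar \<Lambda>) {..<n} (\<lambda>j. graph_cstar (\<Gamma> j)) \<phi> (\<sigma> i) \<and>
                       star_isomorphic (graph_cstar (\<Gamma>' i)) (graph_cstar (\<Gamma> (\<sigma> i))))))))"
proof -
  interpret graph_algebra \<Lambda>
    using assms by (simp add: graph_algebra_def lc_kgraph_def lc_kgraph_axioms_def)
  have "(\<exists>A. atomic_family n A) \<longleftrightarrow> enat n \<in> chain_lengths \<Lambda> \<and> (\<forall>l\<in>chain_lengths \<Lambda>. l \<le> enat n)"
    using max_chain_atomic_family[OF assms(4)] atomic_family_chain_length[OF _ assms(4)]
      atomic_family_chain_bound[OF _ assms(4)] by blast
  moreover have "\<exists>\<Gamma> \<phi>. subgraph_decomposition \<Lambda> n \<Gamma> \<phi>" if "atomic_family n A" for A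
    using atomic_family_decomposition[OF that] by blast
  ultimately show ?thesis
    unfolding n_decomposable_atomic_family[OF assms(4)] using decomposition_unique[OF assms(4)] by meson
qed

end
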